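(* Assume (A$_1$) and (A$_2$), and consider the BSDE $$Y_t+\int_{(t,T]}\int_E Z(s,x)\,\mu(ds,dx)=\xi+\int_{(t,T]}\int_E f\bigl(\cdot,s,x,Y_{s-},Z_s(\cdot)\bigr)\,\nu(ds,dx),\qquad t\in[0,T].\quad(\ast)$$ (a) If $$\mathbb{E}\bigl(e^{\beta A_T}\alpha^{N_T}|\xi|\bigr)<\infty,\qquad \mathbb{E}\Bigl(\int_0^T\!\int_E\alpha^{N_s}e^{\beta A_s}|f(s,x,0,0)|\,\nu(ds,dx)\Bigr)<\infty\quad(\ast\ast)$$ for some $\alpha>L$ and $\beta>1+\alpha+L'$ (with $L,L'$ the Lipschitz constants of $f$), then $(\ast)$ admits one and only one (up to null sets) solution $(Y,Z)$ belonging to $\mathcal{L}^1_{\alpha,\beta}$. (b) When moreover the variable $A_T$ is bounded, the conditions $$\mathbb{E}\bigl(|\xi|^{1+\varepsilon}\bigr)<\infty,\qquad \mathbb{E}\Bigl(\Bigl(\int_0^T\!\int_E|f(s,x,0,0)|\,\nu(ds,dx)\Bigr)^{1+\varepsilon}\Bigr)<\infty$$ for some $\varepsilon>0$ imply $(\ast\ast)$ for all $\beta\ge0$ and $\alpha>0$; hence $(\ast)$ admits one and only one (up to null sets) solution $(Y,Z)$ belonging to $\bigcup_{\alpha>L,\ \beta>1+\alpha+L'}\mathcal{L}^1_{\alpha,\beta}$, and this solution also belongs to $\bigcap_{\alpha>0,\ \beta\ge0}\mathcal{L}^1_{\alpha,\beta}$.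
   Context: Point process. $(\Omega,\mathcal{F},\mathbb{P})$ is a probability space, $T\in(0,\infty)$ is fixed, $(E,\mathcal{E})$ is a Lusin space with its Borel $\sigma$-field, $\Delta\in E$ a distinguished point. $(S_n,X_n)_{n\ge1}$ is a nonexplosive multivariate point process: $S_n$ takes values in $(0,T]\cup\{\infty\}$, $X_n$ in $E$, $S_n\le S_{n+1}$ everywhere, $S_n<S_{n+1}$ if $S_n\le T$, $X_n=\Delta$ if $S_n=\infty$, and $\Omega=\bigcup_n\{S_n>T\}$; put $S_0=0$. The associated random measure is $\mu(dt,dx)=\sum_{n\ge1:\,S_n\le T}\varepsilon_{(S_n,X_n)}(dt,dx)$ ($\varepsilon$ = Dirac measure), and $N_t=\mu([0,t]\times E)$. $(\mathcal{F}_t)_{t\ge0}$ is the filtration generated by the point process (the smallest one for which each $S_n$ is a stopping time and $X_n$ is $\mathcal{F}_{S_n}$-measurable). A function on $\Omega\times[0,T]\times G$, with $(G,\mathcal{G})$ measurable, is called predictable if it is measurable with respect to $\mathcal{P}\otimes\mathcal{G}$, $\mathcal{P}$ being the predictable $\sigma$-field on $\Omega\times[0,T]$. $\nu$ is the predictable compensator of $\mu$, disintegrated as $\nu(\omega,dt,dx)=dA_t(\omega)\,\phi_{\omega,t}(dx)$, where $\phi$ is a transition probability from $(\Omega\times[0,T],\mathcal{P})$ into $(E,\mathcal{E})$ and $A$ is increasing, c\`adl\`ag, predictable, $A_0=0$ ($A$ is the compensator of $N$). Assumptions: (A$_1$) the process $A$ is continuous (equivalently, the jump times $S_n$ are totally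 inaccessible); (A$_2$) $\mathbb{P}(S_{n+1}>T\mid\mathcal{F}_{S_n})>0$ for all $n\ge0$. BSDE. The terminal condition $\xi$ is an $\mathcal{F}_T$-measurable real random variable. $\mathcal{B}(E)$ is the set of Borel real functions on $E$; for a function $Z$ on $\Omega\times[0,T]\times E$ write $Z_{\omega,t}(x)=Z(\omega,t,x)$, $Z_t(\cdot)=Z_{\omega,t}\in\mathcal{B}(E)$. The generator $f$ is a real function on $\Omega\times[0,T]\times E\times\mathbb{R}\times\mathcal{B}(E)$ such that $f(\omega,t,x,y,Z_{\omega,t}(\cdot))$ is predictable for every predictable $Z$ on $\Omega\times[0,T]\times E$, and for some constants $L,L'\ge0$: $|f(\omega,t,x,y',\zeta)-f(\omega,t,x,y,\zeta)|\le L'|y'-y|$; $\int_E|f(\omega,t,x,y,\zeta)-f(\omega,t,x,y,\zeta')|\,\phi_{\omega,t}(dx)\le L\int_E|\zeta'(x)-\zeta(x)|\,\phi_{\omega,t}(dx)$; and $\int_0^T\int_E|f(t,x,0,0)|\,\nu(dt,dx)<\infty$ a.s. (the last $0$ being the zero function of $\mathcal{B}(E)$). A solution is a pair $(Y,Z)$ with $Y$ adapted c\`adl\`ag and $Z$ predictable on $\Omega\times[0,T]\times E$ with $\int_0^T\int_E|Z(t,x)|\,\nu(dt,dx)<\infty$ a.s., such that the equation holds for all $t\in[0,T]$ outside a $\mathbb{P}$-null set. Uniqueness up to null sets means: any two solutions $(Y,Z),(Y',Z')$ in the stated class satisfy $Y_t=Y'_t$ for all $t\in[0,T]$ outside a $\mathbb{P}$-null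 set ($Z$ is determined by $Y$ up to a $\mathbb{P}(d\omega)\nu(\omega,dt,dx)$-null set). For $\alpha>0$, $\beta\ge0$, $\mathcal{L}^1_{\alpha,\beta}$ is the set of all pairs $(Y,Z)$ with $Y$ c\`adl\`ag adapted and $Z$ predictable such that $$\|(Y,Z)\|_{\alpha,\beta}:=\mathbb{E}\Bigl(\int_0^T\!\int_E\bigl(|Y_t|+|Z(t,x)|\bigr)e^{\beta A_t}\alpha^{N_t}\,\nu(dt,dx)\Bigr)<\infty.$$ *)

theory Defs
  imports "HOL-Probability.Probability"
begin

text \<open>
  Lusin spaces in the general (Bourbaki) sense: Hausdorff spaces that are the image of a Polish
  space under a continuous bijection, i.e. whose topology is coarser than some Polish topology
  on the same set. Lusin spaces in the narrower metrizable sense are included.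
\<close>

definition lusin_space :: "'e::t2_space itself \<Rightarrow> bool" where
  "lusin_space _ \<longleftrightarrow> (\<exists>P :: 'e topology. topspace P = UNIV \<and> completely_metrizable_space P \<and>
     second_countable P \<and> (\<forall>U. open U \<longrightarrow> openin P U))"

text \<open>
  Times \<open>S n\<close> are extended nonnegative reals; \<open>S 0 = 0\<close>, and the marks are \<open>X n\<close> for
  \<open>n \<ge> 1\<close> (\<open>X 0\<close> plays no role).
\<close>

definition multivariate_point_process ::
  "'w measure \<Rightarrow> real \<Rightarrow> 'e::t2_space \<Rightarrow> (nat \<Rightarrow> 'w \<Rightarrow> ennreal) \<Rightarrow> (nat \<Rightarrow> 'w \<Rightarrow> 'e) \<Rightarrow> bool" where
  "multivariate_point_process M T \<Delta> S X \<longleftrightarrow>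
     (\<forall>n\<ge>1. S n \<in> borel_measurable M \<and> X n \<in> borel_measurable M) \<and>
     (\<forall>\<omega>\<in>space M.
        S 0 \<omega> = 0 \<and>
        (\<forall>n\<ge>1. (0 < S n \<omega> \<and> S n \<omega> \<le> ennreal T) \<or> S n \<omega> = \<infinity>) \<and>
        (\<forall>n\<ge>1. S n \<omega> \<le> S (Suc n) \<omega>) \<and>
        (\<forall>n\<ge>1. S n \<omega> \<le> ennreal T \<longrightarrow> S n \<omega> < S (Suc n) \<omega>) \<and>
        (\<forall>n\<ge>1. S n \<omega> = \<infinity> \<longrightarrow> X n \<omega> = \<Delta>) \<and>
        (\<exists>n\<ge>1. S n \<omega> > ennreal T))"

text \<open>The sum of the Dirac masses at \<open>(S n, X n)\<close>, as the image of a counting measure.\<close>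

definition jump_measure ::
  "real \<Rightarrow> (nat \<Rightarrow> 'w \<Rightarrow> ennreal) \<Rightarrow> (nat \<Rightarrow> 'w \<Rightarrow> 'e::t2_space) \<Rightarrow> 'w \<Rightarrow> (real \<times> 'e) measure" where
  "jump_measure T S X \<omega> =
     distr (count_space {n. 1 \<le> n \<and> S n \<omega> \<le> ennreal T}) (borel \<Otimes>\<^sub>M borel)
       (\<lambda>n. (enn2real (S n \<omega>), X n \<omega>))"

definition counting_process ::
  "real \<Rightarrow> (nat \<Rightarrow> 'w \<Rightarrow> ennreal) \<Rightarrow> (nat \<Rightarrow> 'w \<Rightarrow> 'e::t2_space) \<Rightarrow> 'w \<Rightarrow> real \<Rightarrow> real" where
  "counting_process T S X \<omega> t = measure (jump_measure T S X \<omega>) ({0..t} \<times> UNIV)"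

text \<open>
  Filtrations are indexed by \<open>[0,\<infinity>]\<close>, so that the possibly infinite times \<open>S n\<close> are stopping
  times in the sense of the library. All \<open>S n\<close> lie in \<open>[0,T] \<union> {\<infinity>}\<close>, hence the index \<open>\<infinity>\<close>
  adds no information to the generated filtration.
\<close>

definition point_process_filtration ::
  "'w measure \<Rightarrow> (nat \<Rightarrow> 'w \<Rightarrow> ennreal) \<Rightarrow> (nat \<Rightarrow> 'w \<Rightarrow> 'e::t2_space) \<Rightarrow> (ennreal \<Rightarrow> 'w measure) \<Rightarrow> bool" where
  "point_process_filtration M S X G \<longleftrightarrow>
     filtration (space M) G \<and>
     (\<forall>n\<ge>1. stopping_time G (S n) \<and>
        X n \<in> borel_measurable (filtration.pre_sigma (space M) G (S n)))"

definition generated_filtration ::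
  "'w measure \<Rightarrow> (nat \<Rightarrow> 'w \<Rightarrow> ennreal) \<Rightarrow> (nat \<Rightarrow> 'w \<Rightarrow> 'e::t2_space) \<Rightarrow> (ennreal \<Rightarrow> 'w measure) \<Rightarrow> bool" where
  "generated_filtration M S X F \<longleftrightarrow>
     point_process_filtration M S X F \<and>
     (\<forall>G. point_process_filtration M S X G \<longrightarrow> (\<forall>t. sets (F t) \<subseteq> sets (G t)))"

definition predictable_sigma ::
  "'w measure \<Rightarrow> real \<Rightarrow> (ennreal \<Rightarrow> 'w measure) \<Rightarrow> ('w \<times> real) measure" where
  "predictable_sigma M T F = sigma (space M \<times> {0..T})
     ({B \<times> {0} | B. B \<in> sets (F 0)} \<union>
      {B \<times> {s<..t} | B s t. 0 \<le> s \<and> s \<le> t \<and> t \<le> T \<and> B \<in> sets (F (ennreal s))})"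

definition predictable ::
  "'w measure \<Rightarrow> real \<Rightarrow> (ennreal \<Rightarrow> 'w measure) \<Rightarrow> 'g measure \<Rightarrow>
     ('w \<Rightarrow> real \<Rightarrow> 'g \<Rightarrow> 'b::topological_space) \<Rightarrow> bool" where
  "predictable M T F G h \<longleftrightarrow>
     (\<lambda>((\<omega>, t), x). h \<omega> t x) \<in> borel_measurable (predictable_sigma M T F \<Otimes>\<^sub>M G)"

definition cadlag_on :: "real \<Rightarrow> (real \<Rightarrow> real) \<Rightarrow> bool" where
  "cadlag_on T y \<longleftrightarrow>
     (\<forall>t. 0 \<le> t \<and> t < T \<longrightarrow> (y \<longlongrightarrow> y t) (at_right t)) \<and>
     (\<forall>t. 0 < t \<and> t \<le> T \<longrightarrow> (\<exists>l. (y \<longlongrightarrow> l) (at_left t)))"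

definition adapted_cadlag ::
  "'w measure \<Rightarrow> real \<Rightarrow> (ennreal \<Rightarrow> 'w measure) \<Rightarrow> ('w \<Rightarrow> real \<Rightarrow> real) \<Rightarrow> bool" where
  "adapted_cadlag M T F Y \<longleftrightarrow>
     (\<forall>t\<in>{0..T}. (\<lambda>\<omega>. Y \<omega> t) \<in> borel_measurable (F (ennreal t))) \<and>
     (\<forall>\<omega>\<in>space M. cadlag_on T (Y \<omega>))"

text \<open>
  The Stieltjes measure of an increasing right-continuous function on \<open>[0,T]\<close>, extended by
  constants outside that interval; it is carried by \<open>(0,T]\<close>.
\<close>

definition stieltjes :: "real \<Rightarrow> (real \<Rightarrow> real) \<Rightarrow> real measure" where
  "stieltjes T a = interval_measure (\<lambda>t. a (max 0 (min T t)))"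

definition disintegrated_measure ::
  "real \<Rightarrow> ('w \<Rightarrow> real \<Rightarrow> real) \<Rightarrow> ('w \<Rightarrow> real \<Rightarrow> 'e::t2_space measure) \<Rightarrow> 'w \<Rightarrow> (real \<times> 'e) measure" where
  "disintegrated_measure T A \<phi> \<omega> =
     measure_of (space (borel \<Otimes>\<^sub>M borel)) (sets (borel \<Otimes>\<^sub>M borel))
       (\<lambda>B. \<integral>\<^sup>+t\<in>{0..T}. emeasure (\<phi> \<omega> t) {x. (t, x) \<in> B} \<partial>stieltjes T (A \<omega>))"

text \<open>
  Integrals of functions of time and mark. Functions on \<open>[0,T] \<times> E\<close> have unspecified values
  (and measurability) at other times, so the domain of integration is always explicit.
\<close>

definition nn_integral_upto ::
  "real \<Rightarrow> (real \<times> 'e) measure \<Rightarrow> (real \<Rightarrow> 'e \<Rightarrow> ennreal) \<Rightarrow> ennreal" where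
  "nn_integral_upto T m g = (\<integral>\<^sup>+z\<in>({0..T} \<times> UNIV). g (fst z) (snd z) \<partial>m)"

definition integral_Ioc ::
  "real \<Rightarrow> real \<Rightarrow> (real \<times> 'e) measure \<Rightarrow> (real \<Rightarrow> 'e \<Rightarrow> real) \<Rightarrow> real" where
  "integral_Ioc t T m g = (LINT z:({t<..T} \<times> UNIV)|m. g (fst z) (snd z))"

text \<open>
  \<open>A\<close> and \<open>\<phi>\<close> disintegrate the predictable compensator of the random measure \<open>\<mu>\<close>. The identity
  for all nonnegative predictable integrands characterises the compensator among the
  predictable random measures.
\<close>

definition compensator ::
  "'w measure \<Rightarrow> real \<Rightarrow> (ennreal \<Rightarrow> 'w measure) \<Rightarrow> ('w \<Rightarrow> (real \<times> 'e::t2_space) measure) \<Rightarrow>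
     ('w \<Rightarrow> real \<Rightarrow> real) \<Rightarrow> ('w \<Rightarrow> real \<Rightarrow> 'e measure) \<Rightarrow> bool" where
  "compensator M T F \<mu> A \<phi> \<longleftrightarrow>
     (\<lambda>(\<omega>, t). A \<omega> t) \<in> borel_measurable (predictable_sigma M T F) \<and>
     (\<forall>\<omega>\<in>space M. A \<omega> 0 = 0 \<and> mono_on {0..T} (A \<omega>) \<and> cadlag_on T (A \<omega>)) \<and>
     (\<lambda>(\<omega>, t). \<phi> \<omega> t) \<in> predictable_sigma M T F \<rightarrow>\<^sub>M prob_algebra borel \<and>
     (\<forall>H :: 'w \<Rightarrow> real \<Rightarrow> 'e \<Rightarrow> ennreal. predictable M T F borel H \<longrightarrow>
        (\<integral>\<^sup>+\<omega>. nn_integral_upto T (\<mu> \<omega>) (H \<omega>) \<partial>M) =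
        (\<integral>\<^sup>+\<omega>. nn_integral_upto T (disintegrated_measure T A \<phi> \<omega>) (H \<omega>) \<partial>M))"

definition continuous_compensator :: "'w measure \<Rightarrow> real \<Rightarrow> ('w \<Rightarrow> real \<Rightarrow> real) \<Rightarrow> bool" where
  "continuous_compensator M T A \<longleftrightarrow> (AE \<omega> in M. continuous_on {0..T} (A \<omega>))"

definition no_more_jumps_possible ::
  "'w measure \<Rightarrow> real \<Rightarrow> (nat \<Rightarrow> 'w \<Rightarrow> ennreal) \<Rightarrow> (ennreal \<Rightarrow> 'w measure) \<Rightarrow> bool" where
  "no_more_jumps_possible M T S F \<longleftrightarrow>
     (\<forall>n. AE \<omega> in M.
        0 < real_cond_exp M (filtration.pre_sigma (space M) F (S n))
              (indicator {\<omega>\<in>space M. S (Suc n) \<omega> > ennreal T}) \<omega>)"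

text \<open>
  In the second Lipschitz condition the right-hand side may be infinite, so both sides are
  integrals in \<open>[0,\<infinity>]\<close>.
\<close>

definition bsde_generator ::
  "'w measure \<Rightarrow> real \<Rightarrow> (ennreal \<Rightarrow> 'w measure) \<Rightarrow>
     ('w \<Rightarrow> real \<Rightarrow> real) \<Rightarrow> ('w \<Rightarrow> real \<Rightarrow> 'e::t2_space measure) \<Rightarrow>
     ('w \<Rightarrow> real \<Rightarrow> 'e \<Rightarrow> real \<Rightarrow> ('e \<Rightarrow> real) \<Rightarrow> real) \<Rightarrow> real \<Rightarrow> real \<Rightarrow> bool" where
  "bsde_generator M T F A \<phi> f L L' \<longleftrightarrow>
     0 \<le> L \<and> 0 \<le> L' \<and>
     (\<forall>Z :: 'w \<Rightarrow> real \<Rightarrow> 'e \<Rightarrow> real. predictable M T F borel Z \<longrightarrow>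
        predictable M T F (borel \<Otimes>\<^sub>M borel) (\<lambda>\<omega> t (x, y). f \<omega> t x y (Z \<omega> t))) \<and>
     (\<forall>\<omega>\<in>space M. \<forall>t\<in>{0..T}. \<forall>x y y'. \<forall>\<zeta>\<in>borel_measurable borel.
        \<bar>f \<omega> t x y' \<zeta> - f \<omega> t x y \<zeta>\<bar> \<le> L' * \<bar>y' - y\<bar>) \<and>
     (\<forall>\<omega>\<in>space M. \<forall>t\<in>{0..T}. \<forall>y. \<forall>\<zeta>\<in>borel_measurable borel. \<forall>\<zeta>'\<in>borel_measurable borel.
        (\<integral>\<^sup>+x. ennreal \<bar>f \<omega> t x y \<zeta> - f \<omega> t x y \<zeta>'\<bar> \<partial>\<phi> \<omega> t)
          \<le> ennreal L * (\<integral>\<^sup>+x. ennreal \<bar>\<zeta>' x - \<zeta> x\<bar> \<partial>\<phi> \<omega> t)) \<and>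
     (AE \<omega> in M. nn_integral_upto T (disintegrated_measure T A \<phi> \<omega>)
        (\<lambda>t x. ennreal \<bar>f \<omega> t x 0 (\<lambda>_. 0)\<bar>) < \<infinity>)"

definition bsde_solution ::
  "'w measure \<Rightarrow> real \<Rightarrow> (ennreal \<Rightarrow> 'w measure) \<Rightarrow>
     ('w \<Rightarrow> (real \<times> 'e::t2_space) measure) \<Rightarrow> ('w \<Rightarrow> (real \<times> 'e) measure) \<Rightarrow> ('w \<Rightarrow> real) \<Rightarrow>
     ('w \<Rightarrow> real \<Rightarrow> 'e \<Rightarrow> real \<Rightarrow> ('e \<Rightarrow> real) \<Rightarrow> real) \<Rightarrow>
     (('w \<Rightarrow> real \<Rightarrow> real) \<times> ('w \<Rightarrow> real \<Rightarrow> 'e \<Rightarrow> real)) set" where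
  "bsde_solution M T F \<mu> \<nu> \<xi> f = {(Y, Z).
     adapted_cadlag M T F Y \<and> predictable M T F borel Z \<and>
     (AE \<omega> in M. nn_integral_upto T (\<nu> \<omega>) (\<lambda>t x. ennreal \<bar>Z \<omega> t x\<bar>) < \<infinity>) \<and>
     (AE \<omega> in M. \<forall>t\<in>{0..T}.
        Y \<omega> t + integral_Ioc t T (\<mu> \<omega>) (Z \<omega>) =
        \<xi> \<omega> + integral_Ioc t T (\<nu> \<omega>) (\<lambda>s x. f \<omega> s x (Lim (at_left s) (Y \<omega>)) (Z \<omega> s)))}"

definition L1_space ::
  "'w measure \<Rightarrow> real \<Rightarrow> (ennreal \<Rightarrow> 'w measure) \<Rightarrow> ('w \<Rightarrow> (real \<times> 'e::t2_space) measure) \<Rightarrow>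
     ('w \<Rightarrow> real \<Rightarrow> real) \<Rightarrow> ('w \<Rightarrow> real \<Rightarrow> real) \<Rightarrow> real \<Rightarrow> real \<Rightarrow>
     (('w \<Rightarrow> real \<Rightarrow> real) \<times> ('w \<Rightarrow> real \<Rightarrow> 'e \<Rightarrow> real)) set" where
  "L1_space M T F \<nu> A N \<alpha> \<beta> = {(Y, Z).
     adapted_cadlag M T F Y \<and> predictable M T F borel Z \<and>
     (\<integral>\<^sup>+\<omega>. nn_integral_upto T (\<nu> \<omega>)
        (\<lambda>t x. ennreal ((\<bar>Y \<omega> t\<bar> + \<bar>Z \<omega> t x\<bar>) * exp (\<beta> * A \<omega> t) * \<alpha> powr N \<omega> t)) \<partial>M) < \<infinity>}"

definition weighted_integrable_data ::
  "'w measure \<Rightarrow> real \<Rightarrow> ('w \<Rightarrow> (real \<times> 'e::t2_space) measure) \<Rightarrow>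
     ('w \<Rightarrow> real \<Rightarrow> real) \<Rightarrow> ('w \<Rightarrow> real \<Rightarrow> real) \<Rightarrow> ('w \<Rightarrow> real) \<Rightarrow>
     ('w \<Rightarrow> real \<Rightarrow> 'e \<Rightarrow> real \<Rightarrow> ('e \<Rightarrow> real) \<Rightarrow> real) \<Rightarrow> real \<Rightarrow> real \<Rightarrow> bool" where
  "weighted_integrable_data M T \<nu> A N \<xi> f \<alpha> \<beta> \<longleftrightarrow>
     (\<integral>\<^sup>+\<omega>. ennreal (exp (\<beta> * A \<omega> T) * \<alpha> powr N \<omega> T * \<bar>\<xi> \<omega>\<bar>) \<partial>M) < \<infinity> \<and>
     (\<integral>\<^sup>+\<omega>. nn_integral_upto T (\<nu> \<omega>)
        (\<lambda>s x. ennreal (\<alpha> powr N \<omega> s * exp (\<beta> * A \<omega> s) * \<bar>f \<omega> s x 0 (\<lambda>_. 0)\<bar>)) \<partial>M) < \<infinity>"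

text \<open>
  Equality of two pairs \<open>(Y, Z)\<close> up to null sets: the paths of \<open>Y\<close> agree almost surely, and \<open>Z\<close>
  agrees almost everywhere for \<open>P(d\<omega>) \<nu>(\<omega>, dt, dx)\<close>.
\<close>

definition same_up_to_null ::
  "'w measure \<Rightarrow> real \<Rightarrow> ('w \<Rightarrow> (real \<times> 'e::t2_space) measure) \<Rightarrow>
     ('w \<Rightarrow> real \<Rightarrow> real) \<times> ('w \<Rightarrow> real \<Rightarrow> 'e \<Rightarrow> real) \<Rightarrow>
     ('w \<Rightarrow> real \<Rightarrow> real) \<times> ('w \<Rightarrow> real \<Rightarrow> 'e \<Rightarrow> real) \<Rightarrow> bool" where
  "same_up_to_null M T \<nu> = (\<lambda>(Y, Z) (Y', Z').
     (AE \<omega> in M. \<forall>t\<in>{0..T}. Y \<omega> t = Y' \<omega> t) \<and>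
     (AE \<omega> in M. AE z in \<nu> \<omega>. Z \<omega> (fst z) (snd z) = Z' \<omega> (fst z) (snd z)))"

definition exists_unique_up_to_null ::
  "'w measure \<Rightarrow> real \<Rightarrow> ('w \<Rightarrow> (real \<times> 'e::t2_space) measure) \<Rightarrow>
     (('w \<Rightarrow> real \<Rightarrow> real) \<times> ('w \<Rightarrow> real \<Rightarrow> 'e \<Rightarrow> real)) set \<Rightarrow> bool" where
  "exists_unique_up_to_null M T \<nu> C \<longleftrightarrow>
     C \<noteq> {} \<and> (\<forall>p\<in>C. \<forall>q\<in>C. same_up_to_null M T \<nu> p q)"

end

theory Submission
  imports Defs
begin

text \<open>
  The driver is first frozen: for a given predictable \<open>g\<close>, solve
  \<open>Y t + (sum of Z at the jumps in (t,T]) = \<xi> + (integral of g over (t,T] against \<nu>)\<close>.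
  Between two jumps, \<open>Y t + (integral of g over (0,t])\<close> has to be constant, and at a jump this
  constant changes by the value of \<open>Z\<close>. For a filtration generated by a point process, every
  variable that is known at time \<open>T\<close> coincides on \<open>{S (n + 1) > T}\<close> with a function of the first
  \<open>n\<close> jumps. Applied to \<open>\<xi> + (integral of g over (0,T])\<close>, this gives the constants: the one after
  the \<open>n\<close>-th jump, \<open>c n\<close>, is the function of the first \<open>n\<close> jumps that is correct if no further jump
  occurs before \<open>T\<close>. As \<open>c (n + 1)\<close> is a function of the first \<open>n\<close> jumps and of the time and mark
  of the next one, \<open>c (n + 1) - c n\<close> is the value of a predictable \<open>Z\<close> at the next jump. The linear
  equation is thus solved explicitly (\<open>linear_solution_exists\<close>), with no need for a martingale
  representation theorem. The positive conditional probability that no further jump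
  occurs is what transfers properties from paths without a further jump to all paths
  (\<open>AE_survival\<close>). It bounds the integral of \<open>|g|\<close> and the process \<open>A\<close> up to the next jump by
  finite functions of the past jumps (\<open>dominated_until_next_jump\<close>).

  The estimate (\<open>energy_estimate\<close>) is proved one interval at a time. As \<open>A\<close> is continuous, a
  change of variables and Tonelli's theorem bound, on each path, the value of \<open>exp (\<beta> A) |Y|\<close>
  after the \<open>n\<close>-th jump plus \<open>\<beta>\<close> times the integral of \<open>exp (\<beta> A) |Y|\<close> against \<open>A\<close> over the interval
  by the value at the end of the interval plus the integral of \<open>exp (\<beta> A) |g|\<close>. If the interval
  ends with a jump, then the end value is evaluated at the left limit \<open>Y_-\<close>, and by the definition
  of the compensator its expectation is that of the integral of \<open>exp (\<beta> A) |Y_-|\<close> against \<open>A\<close>: it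
  is absorbed on the left, where \<open>\<beta>\<close> becomes \<open>\<beta> - 1\<close>. The value after the jump is
  \<open>Y_- + Z\<close>, again a predictable function at a jump time. Multiplying by \<open>\<alpha> ^ n\<close>, summing over \<open>n\<close>
  and using the triangle inequality yields, in the norms weighted by \<open>exp (\<beta> A) \<alpha> ^ N\<close>,
  \<open>\<alpha> \<parallel>Z\<parallel> + (\<beta> - 1 - \<alpha>) \<parallel>Y_-\<parallel> \<le> \<parallel>\<xi>\<parallel> + \<parallel>g\<parallel>\<close>.

  For the difference of two linear solutions with the same terminal value only \<open>\<parallel>g - g'\<parallel>\<close>
  remains on the right (\<open>difference_estimate\<close>). With the Lipschitz conditions, the map from
  \<open>g\<close> to the generator evaluated along the solution for \<open>g\<close> is a contraction of a weighted
  \<open>L1\<close> space with constant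
  \<open>max (L / \<alpha>) (L' / (\<beta> - 1 - \<alpha>)) < 1\<close>. This gives \<open>existence\<close>, and the same inequality gives
  \<open>uniqueness\<close>.

  For bounded \<open>A T\<close>, the weight \<open>exp (\<beta> A)\<close> is irrelevant. The bound
  \<open>E (\<gamma> ^ N exp (- (\<gamma> - 1) A)) \<le> 1\<close> at time \<open>T\<close> (\<open>exponential_moment\<close>) shows that all powers
  \<open>\<gamma> ^ N\<close> are integrable, so by Young's inequality \<open>1 + \<epsilon>\<close> moments of the data suffice for every
  \<open>\<alpha>\<close>. The spaces decrease in \<open>\<alpha>\<close>, so the solutions for different parameters are compared in the
  larger of two spaces, where uniqueness shows that they agree.
\<close>

section \<open>Measurability through a map\<close>

text \<open>
  Complements and countable unions can be formed on the side of \<open>N\<close>, so only generating sets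
  have to be treated. Asking for the equivalence on \<open>D\<close> only lets an event be replaced by one
  that uses less information but is correct on \<open>D\<close>.
\<close>

lemma sigma_sets_factor:
  assumes "B \<in> sigma_sets \<Omega> G" and D: "D \<subseteq> \<Omega>" "\<And>\<omega>. \<omega> \<in> D \<Longrightarrow> \<theta> \<omega> \<in> space N"
    and gen: "\<And>B. B \<in> G \<Longrightarrow> \<exists>B'\<in>sets N. \<forall>\<omega>\<in>D. \<omega> \<in> B \<longleftrightarrow> \<theta> \<omega> \<in> B'"
  shows "\<exists>B'\<in>sets N. \<forall>\<omega>\<in>D. \<omega> \<in> B \<longleftrightarrow> \<theta> \<omega> \<in> B'"
  using assms(1)
proof induction
  case (Basic a)
  then show ?case by (rule gen)
next
  case Empty
  show ?case by (intro bexI[of _ "{}"]) auto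
next
  case (Compl a)
  then obtain B' where "B' \<in> sets N" "\<forall>\<omega>\<in>D. \<omega> \<in> a \<longleftrightarrow> \<theta> \<omega> \<in> B'" by auto
  then show ?case using D by (intro bexI[of _ "space N - B'"]) auto
next
  case (Union a)
  then obtain B' where "\<And>i. B' i \<in> sets N" "\<And>i. \<forall>\<omega>\<in>D. \<omega> \<in> a i \<longleftrightarrow> \<theta> \<omega> \<in> B' i" by metis
  then show ?case by (intro bexI[of _ "\<Union>i::nat. B' i"]) auto
qed

text \<open>
  A version of the Doob-Dynkin lemma relative to a set, by approximation with simple functions.
\<close>

lemma borel_measurable_factor_ennreal:
  fixes u :: "'a \<Rightarrow> ennreal"
  assumes "u \<in> borel_measurable M" and D: "D \<subseteq> space M"
    and fac: "\<And>B. B \<in> sets M \<Longrightarrow> \<exists>B'\<in>sets N. \<forall>\<omega>\<in>D. \<omega> \<in> B \<longleftrightarrow> \<theta> \<omega> \<in> B'"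
  shows "\<exists>v\<in>borel_measurable N. \<forall>\<omega>\<in>D. u \<omega> = v (\<theta> \<omega>)"
  using assms(1)
proof (induction rule: borel_measurable_induct)
  case (cong f g)
  then show ?case using D by (metis subsetD)
next
  case (set A)
  obtain B' where "B' \<in> sets N" "\<forall>\<omega>\<in>D. \<omega> \<in> A \<longleftrightarrow> \<theta> \<omega> \<in> B'" using fac[OF set] by auto
  then show ?case by (intro bexI[of _ "indicator B'"]) (auto simp: indicator_def)
next
  case (mult u c)
  from mult.IH obtain v where "v \<in> borel_measurable N" "\<forall>\<omega>\<in>D. u \<omega> = v (\<theta> \<omega>)" by blast
  then show ?case by (intro bexI[of _ "\<lambda>x. c * v x"]) auto
next
  case (add u v)
  from add.IH obtain u' v' where "u' \<in> borel_measurable N" "\<forall>\<omega>\<in>D. u \<omega> = u' (\<theta> \<omega>)"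
    "v' \<in> borel_measurable N" "\<forall>\<omega>\<in>D. v \<omega> = v' (\<theta> \<omega>)" by blast
  then show ?case by (intro bexI[of _ "\<lambda>x. v' x + u' x"]) auto
next
  case (seq U)
  have "\<forall>i. \<exists>v. v \<in> borel_measurable N \<and> (\<forall>\<omega>\<in>D. U i \<omega> = v (\<theta> \<omega>))" using seq.IH by blast
  then obtain v where v: "\<And>i. v i \<in> borel_measurable N" "\<And>i. \<forall>\<omega>\<in>D. U i \<omega> = v i (\<theta> \<omega>)" by metis
  show ?case
  proof (intro bexI ballI)
    fix \<omega> assume "\<omega> \<in> D"
    then have "(SUP i. U i \<omega>) = (SUP i. v i (\<theta> \<omega>))" using v(2) by (intro SUP_cong) blast+
    then show "(SUP i. U i) \<omega> = (SUP i. v i (\<theta> \<omega>))" by (simp add: image_comp)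
  qed (use v(1) in measurable)
qed

lemma borel_measurable_factor_real:
  fixes u :: "'a \<Rightarrow> real"
  assumes [measurable]: "u \<in> borel_measurable M" and D: "D \<subseteq> space M"
    and fac: "\<And>B. B \<in> sets M \<Longrightarrow> \<exists>B'\<in>sets N. \<forall>\<omega>\<in>D. \<omega> \<in> B \<longleftrightarrow> \<theta> \<omega> \<in> B'"
  shows "\<exists>v\<in>borel_measurable N. \<forall>\<omega>\<in>D. u \<omega> = v (\<theta> \<omega>)"
proof -
  obtain p where p: "p \<in> borel_measurable N" "\<forall>\<omega>\<in>D. ennreal (u \<omega>) = p (\<theta> \<omega>)"
    using borel_measurable_factor_ennreal[OF _ D fac, of "\<lambda>x. ennreal (u x)"] by auto
  obtain m where m: "m \<in> borel_measurable N" "\<forall>\<omega>\<in>D. ennreal (- u \<omega>) = m (\<theta> \<omega>)"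
    using borel_measurable_factor_ennreal[OF _ D fac, of "\<lambda>x. ennreal (- u x)"] by auto
  have "u \<omega> = enn2real (p (\<theta> \<omega>)) - enn2real (m (\<theta> \<omega>))" if "\<omega> \<in> D" for \<omega>
    using p(2) m(2) that by (cases "u \<omega> \<ge> 0") (auto simp flip: p(2) m(2) simp: ennreal_neg)
  then show ?thesis using p(1) m(1)
    by (intro bexI[of _ "\<lambda>x. enn2real (p x) - enn2real (m x)"]) auto
qed

section \<open>Stieltjes integrals of continuous increasing functions\<close>

text \<open>
  These are the properties that make \<open>a\<close>, frozen outside \<open>{0..T}\<close>, the distribution function of
  an interval measure on the whole line.
\<close>

lemma stieltjes_cutoff:
  assumes T: "0 \<le> T" and mono: "mono_on {0..T} a" and cad: "cadlag_on T a"
  shows "x \<le> y \<Longrightarrow> a (max 0 (min T x)) \<le> a (max 0 (min T y))"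
    and "continuous (at_right x) (\<lambda>t. a (max 0 (min T t)))"
proof -
  show "x \<le> y \<Longrightarrow> a (max 0 (min T x)) \<le> a (max 0 (min T y))"
    using T by (intro mono_onD[OF mono]) (simp_all add: min_def max_def)
  show "continuous (at_right x) (\<lambda>t. a (max 0 (min T t)))"
  proof -
    consider "x < 0" | "0 \<le> x" "x < T" | "x \<ge> T" by linarith
    then show ?thesis
    proof cases
      case 1
      have "\<forall>\<^sub>F t in at_right x. a (max 0 (min T x)) = a (max 0 (min T t))"
        unfolding eventually_at_right_field using 1 T by (intro exI[of _ 0]) auto
      then show ?thesis unfolding continuous_within
        by (rule Lim_transform_eventually[OF tendsto_const])
    next
      case 2
      have "(a \<longlongrightarrow> a x) (at_right x)" using cad 2 by (auto simp: cadlag_on_def)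
      moreover have "\<forall>\<^sub>F t in at_right x. a t = a (max 0 (min T t))"
        unfolding eventually_at_right_field using 2 by (intro exI[of _ T]) auto
      ultimately show ?thesis unfolding continuous_within using 2
        by (auto intro: Lim_transform_eventually)
    next
      case 3
      have "\<forall>\<^sub>F t in at_right x. a (max 0 (min T x)) = a (max 0 (min T t))"
        unfolding eventually_at_right_field using 3 by (intro exI[of _ "x+1"]) auto
      then show ?thesis unfolding continuous_within
        by (rule Lim_transform_eventually[OF tendsto_const])
    qed
  qed
qed

lemma sets_stieltjes[simp, measurable_cong]: "sets (stieltjes T a) = sets borel"
  by (simp add: stieltjes_def)

lemma space_stieltjes[simp]: "space (stieltjes T a) = UNIV"
  by (simp add: stieltjes_def)

lemma emeasure_stieltjes_Ioc:
  assumes "0 \<le> T" "mono_on {0..T} a" "cadlag_on T a" "x \<le> y"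
  shows "emeasure (stieltjes T a) {x<..y} = ennreal (a (max 0 (min T y)) - a (max 0 (min T x)))"
  unfolding stieltjes_def
  by (intro emeasure_interval_measure_Ioc assms stieltjes_cutoff[OF assms(1-3)])

lemma emeasure_stieltjes_null:
  assumes "0 \<le> T" "mono_on {0..T} a" "cadlag_on T a"
  shows "emeasure (stieltjes T a) {..0} = 0" "emeasure (stieltjes T a) {T<..} = 0"
proof -
  have "{..0::real} = (\<Union>n::nat. {-real n<..0})"
    by (auto, metis reals_Archimedean2 minus_less_iff)
  also have "emeasure (stieltjes T a) \<dots> = 0"
    using assms by (intro emeasure_UN_eq_0) (auto simp: emeasure_stieltjes_Ioc[OF assms])
  finally show "emeasure (stieltjes T a) {..0} = 0" .
  have "{T<..} = (\<Union>n::nat. {T<..T + real n})"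
    by (auto, metis add.commute diff_less_eq less_imp_le reals_Archimedean2)
  also have "emeasure (stieltjes T a) \<dots> = 0"
    using assms by (intro emeasure_UN_eq_0) (auto simp: emeasure_stieltjes_Ioc[OF assms])
  finally show "emeasure (stieltjes T a) {T<..} = 0" .
qed

lemma emeasure_stieltjes_space:
  assumes "0 \<le> T" "mono_on {0..T} a" "cadlag_on T a"
  shows "emeasure (stieltjes T a) UNIV = ennreal (a T - a 0)"
proof -
  have eq: "UNIV = {..0} \<union> {0<..T} \<union> {T<..}" by auto
  have "emeasure (stieltjes T a) UNIV \<le> emeasure (stieltjes T a) ({..0} \<union> {0<..T}) + emeasure (stieltjes T a) {T<..}"
    by (subst eq, intro emeasure_subadditive) auto
  also have "\<dots> \<le> emeasure (stieltjes T a) {..0} + emeasure (stieltjes T a) {0<..T} + emeasure (stieltjes T a) {T<..}"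
    by (intro add_mono emeasure_subadditive) auto
  finally have "emeasure (stieltjes T a) UNIV \<le> ennreal (a T - a 0)"
    using emeasure_stieltjes_null[OF assms] emeasure_stieltjes_Ioc[OF assms, of 0 T] assms by (simp add: min_def)
  moreover have "ennreal (a T - a 0) \<le> emeasure (stieltjes T a) UNIV"
    using emeasure_stieltjes_Ioc[OF assms, of 0 T] assms emeasure_mono[of "{0<..T}" UNIV "stieltjes T a"]
    by (simp add: min_def)
  ultimately show ?thesis by simp
qed

lemma AE_stieltjes_in_Ioc:
  assumes "0 \<le> T" "mono_on {0..T} a" "cadlag_on T a"
  shows "AE t in stieltjes T a. 0 < t \<and> t \<le> T"
proof -
  have "AE t in stieltjes T a. t \<notin> {..0}" "AE t in stieltjes T a. t \<notin> {T<..}"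
    using emeasure_stieltjes_null[OF assms] by (intro AE_not_in; simp add: null_sets_def)+
  then show ?thesis by eventually_elim auto
qed

lemma stieltjes_no_atoms:
  assumes "0 \<le> T" "mono_on {0..T} a" "cadlag_on T a" and cont: "continuous_on {0..T} a"
  shows "emeasure (stieltjes T a) {x} = 0"
proof (cases "0 < x \<and> x \<le> T")
  case True
  have "((\<lambda>y. ennreal (a x - a y)) \<longlongrightarrow> ennreal (a x - a x)) (at_left x)"
  proof (intro tendsto_ennrealI tendsto_diff tendsto_const)
    have "(a \<longlongrightarrow> a x) (at x within {0..T})" using cont True by (auto simp: continuous_on_def)
    moreover have "at x within {0..x} = at_left x" using True by (simp add: at_within_Icc_at_left)
    ultimately show "(a \<longlongrightarrow> a x) (at_left x)" using True tendsto_within_subset[of a _ x "{0..T}" "{0..x}"] by auto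
  qed
  moreover have "\<forall>\<^sub>F y in at_left x. emeasure (stieltjes T a) {x} \<le> ennreal (a x - a y)"
  proof -
    have "\<forall>\<^sub>F y in at_left x. y \<in> {0<..<x}" using True by (intro eventually_at_leftI[of 0]) auto
    then show ?thesis
    proof eventually_elim
      case (elim y)
      then show ?case using emeasure_mono[of "{x}" "{y<..x}" "stieltjes T a"]
        emeasure_stieltjes_Ioc[OF assms(1-3), of y x] True by auto
    qed
  qed
  ultimately have "emeasure (stieltjes T a) {x} \<le> ennreal (a x - a x)"
    by (intro tendsto_lowerbound) auto
  then show ?thesis by simp
next
  case False
  then have "{x} \<subseteq> {..0} \<or> {x} \<subseteq> {T<..}" by auto
  moreover have "emeasure (stieltjes T a) {x} \<le> emeasure (stieltjes T a) B" if "{x} \<subseteq> B" "B \<in> sets borel" for B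
    using that by (intro emeasure_mono) auto
  ultimately show ?thesis using emeasure_stieltjes_null[OF assms(1-3)] by (metis atMost_borel greaterThan_borel le_zero_eq)
qed

text \<open>
  Continuity enters through the intermediate value theorem. The part of \<open>{p<..q}\<close> on which \<open>a\<close>
  exceeds a level \<open>x\<close> is an interval \<open>{t<..q}\<close> with \<open>a t = x\<close>, so the image of the measure under
  \<open>a\<close> gives half-lines their Lebesgue measure.
\<close>

lemma stieltjes_change_of_variables:
  fixes h :: "real \<Rightarrow> ennreal"
  assumes a: "0 \<le> T" "mono_on {0..T} a" "cadlag_on T a" and cont: "continuous_on {0..T} a"
    and pq: "0 \<le> p" "p \<le> q" "q \<le> T" and [measurable]: "h \<in> borel_measurable borel"
  shows "(\<integral>\<^sup>+s\<in>{p<..q}. h (a s) \<partial>stieltjes T a) = (\<integral>\<^sup>+u\<in>{a p<..a q}. h u \<partial>lborel)"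
proof -
  define b where "b = (\<lambda>t. a (max 0 (min T t)))"
  have b: "mono b" unfolding b_def mono_def using stieltjes_cutoff(1)[OF a] by auto
  have [measurable]: "b \<in> borel_measurable borel" by (rule borel_measurable_mono[OF b])
  define \<sigma> where "\<sigma> = density (stieltjes T a) (indicator {p<..q})"
  have ab: "a p \<le> a q" using a pq by (auto intro: mono_onD[OF a(2)])
  have "distr \<sigma> borel b = density lborel (indicator {a p<..a q})"
  proof (rule measure_eqI_lessThan)
    fix x
    have L: "emeasure (distr \<sigma> borel b) {x<..} = emeasure (stieltjes T a) {s\<in>{p<..q}. x < a s}"
    proof -
      have *: "b -` {x<..} \<in> sets borel"
        using measurable_sets[of b borel borel "{x<..}"] by simp
      have "emeasure (distr \<sigma> borel b) {x<..} = emeasure \<sigma> (b -` {x<..})"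
        by (subst emeasure_distr) (auto simp: \<sigma>_def)
      also have "\<dots> = (\<integral>\<^sup>+s. indicator {p<..q} s * indicator (b -` {x<..}) s \<partial>stieltjes T a)"
        unfolding \<sigma>_def using * by (subst emeasure_density) auto
      also have "\<dots> = (\<integral>\<^sup>+s. indicator ({p<..q} \<inter> b -` {x<..}) s \<partial>stieltjes T a)"
        by (intro nn_integral_cong) (auto simp: indicator_def)
      also have "\<dots> = emeasure (stieltjes T a) ({p<..q} \<inter> b -` {x<..})"
        using * by (intro nn_integral_indicator) auto
      also have "{p<..q} \<inter> b -` {x<..} = {s\<in>{p<..q}. x < a s}" using pq by (auto simp: b_def)
      finally show ?thesis .
    qed
    have "emeasure (density lborel (indicator {a p<..a q})) {x<..}
        = (\<integral>\<^sup>+s. indicator {max x (a p)<..a q} s \<partial>lborel)"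
      by (subst emeasure_density) (auto intro!: nn_integral_cong simp del: nn_integral_indicator simp: indicator_def)
    also have "\<dots> = ennreal (a q - max x (a p))"
      by (cases "max x (a p) \<le> a q") (auto simp: ennreal_neg simp del: max.bounded_iff max_less_iff_conj)
    finally have R: "emeasure (density lborel (indicator {a p<..a q})) {x<..} = ennreal (a q - max x (a p))" .
    have "emeasure (stieltjes T a) {s\<in>{p<..q}. x < a s} = ennreal (a q - max x (a p))"
    proof -
      consider "x < a p" | "a p \<le> x" "x < a q" | "a q \<le> x" by linarith
      then show ?thesis
      proof cases
        case 1
        have "{s\<in>{p<..q}. x < a s} = {p<..q}"
        proof (intro set_eqI iffI)
          fix s assume "s \<in> {p<..q}"
          then show "s \<in> {s\<in>{p<..q}. x < a s}" using 1 mono_onD[OF a(2), of p s] pq by simp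
        qed simp
        then show ?thesis using 1 pq emeasure_stieltjes_Ioc[OF a pq(2)] by simp
      next
        case 2
        have c: "continuous_on {p..q} a" using cont pq by (auto intro: continuous_on_subset)
        have "closed ({p..q} \<inter> a -` {..x})" using c by (intro continuous_closed_preimage) auto
        then have "compact ({p..q} \<inter> a -` {..x})"
          by (metis bounded_Int bounded_closed_interval compact_eq_bounded_closed)
        moreover have "p \<in> {p..q} \<inter> a -` {..x}" using 2 pq by auto
        \<comment> \<open>the last time in \<open>{p..q}\<close> at which \<open>a\<close> is at most \<open>x\<close>\<close>
        ultimately obtain t where t: "t \<in> {p..q}" "a t \<le> x" "\<And>s. s \<in> {p..q} \<Longrightarrow> a s \<le> x \<Longrightarrow> s \<le> t"
          using compact_attains_sup[of "{p..q} \<inter> a -` {..x}"] by (metis IntE IntI atMost_iff empty_iff vimage_eq)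
        obtain s where s: "p \<le> s" "s \<le> q" "a s = x"
          using IVT'[of a p x q] 2 pq c by auto
        have "x \<le> a t" using t(3)[of s] s mono_onD[OF a(2), of s t] t(1) pq by auto
        then have at_eq: "a t = x" using t by auto
        have "{s\<in>{p<..q}. x < a s} = {t<..q}"
        proof (intro set_eqI iffI)
          fix s assume s: "s \<in> {s\<in>{p<..q}. x < a s}"
          have "\<not> s \<le> t" using s at_eq mono_onD[OF a(2), of s t] t(1) pq by auto
          then show "s \<in> {t<..q}" using s by auto
        next
          fix s assume s: "s \<in> {t<..q}"
          then have "\<not> a s \<le> x" using t(1) t(3)[of s] by auto
          then show "s \<in> {s\<in>{p<..q}. x < a s}" using s t(1) by auto
        qed
        then show ?thesis using 2 pq t(1) at_eq emeasure_stieltjes_Ioc[OF a, of t q] by auto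
      next
        case 3
        have "a s \<le> x" if "s \<in> {p<..q}" for s
          using that 3 mono_onD[OF a(2), of s q] pq by simp
        then have "{s\<in>{p<..q}. x < a s} = {}" by (auto simp: not_less[symmetric])
        then have "emeasure (stieltjes T a) {s\<in>{p<..q}. x < a s} = 0" by (simp only: emeasure_empty)
        then show ?thesis using 3 by (simp add: ennreal_neg)
      qed
    qed
    then show "emeasure (distr \<sigma> borel b) {x<..} = emeasure (density lborel (indicator {a p<..a q})) {x<..}"
      using L R by simp
    show "emeasure (distr \<sigma> borel b) {x<..} < \<infinity>"
      using L R \<open>emeasure (stieltjes T a) {s\<in>{p<..q}. x < a s} = ennreal (a q - max x (a p))\<close> by simp
  qed simp_all
  then have "(\<integral>\<^sup>+u. h u \<partial>distr \<sigma> borel b) = (\<integral>\<^sup>+u. h u \<partial>density lborel (indicator {a p<..a q}))" by simp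
  also have "(\<integral>\<^sup>+u. h u \<partial>distr \<sigma> borel b) = (\<integral>\<^sup>+s. h (b s) \<partial>\<sigma>)"
    by (subst nn_integral_distr) (auto simp: \<sigma>_def)
  also have "\<dots> = (\<integral>\<^sup>+s. indicator {p<..q} s * h (b s) \<partial>stieltjes T a)"
    unfolding \<sigma>_def by (subst nn_integral_density) auto
  also have "\<dots> = (\<integral>\<^sup>+s\<in>{p<..q}. h (a s) \<partial>stieltjes T a)"
    using pq by (intro nn_integral_cong) (auto simp: indicator_def b_def)
  finally show ?thesis by (subst (asm) nn_integral_density) (auto simp: mult.commute)
qed

lemma stieltjes_FTC:
  fixes g G :: "real \<Rightarrow> real"
  assumes a: "0 \<le> T" "mono_on {0..T} a" "cadlag_on T a" and cont: "continuous_on {0..T} a"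
    and pq: "0 \<le> p" "p \<le> q" "q \<le> T" and g[measurable]: "g \<in> borel_measurable borel"
    and G: "\<And>x. (G has_real_derivative g x) (at x)" "\<And>x. 0 \<le> g x"
  shows "(\<integral>\<^sup>+s\<in>{p<..q}. ennreal (g (a s)) \<partial>stieltjes T a) = ennreal (G (a q) - G (a p))"
proof -
  have ab: "a p \<le> a q" using a pq by (auto intro: mono_onD[OF a(2)])
  have "(\<integral>\<^sup>+s\<in>{p<..q}. ennreal (g (a s)) \<partial>stieltjes T a) = (\<integral>\<^sup>+u\<in>{a p<..a q}. ennreal (g u) \<partial>lborel)"
    by (rule stieltjes_change_of_variables[OF a cont pq]) simp
  also have "\<dots> = (\<integral>\<^sup>+u\<in>{a p..a q}. ennreal (g u) \<partial>lborel)"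
    using AE_lborel_singleton[of "a p"] by (intro nn_integral_cong_AE) (auto elim!: eventually_mono simp: indicator_def)
  also have "\<dots> = ennreal (G (a q) - G (a p))"
    using G ab by (intro nn_integral_FTC_Icc) auto
  finally show ?thesis .
qed

text \<open>
  A backward Gronwall argument in integrated form. Inserting the bound for \<open>\<bar>y s\<bar>\<close> and
  exchanging the integrals, a point \<open>z\<close> of \<open>\<gamma>\<close> receives the weight
  \<open>exp (\<beta> * a (fst z)) - exp (\<beta> * a p)\<close>, which is the integral of \<open>\<beta> * exp (\<beta> * a)\<close> up to
  \<open>fst z\<close>. The subtracted term is made up for by the bound at \<open>p\<close> itself.
\<close>

lemma stieltjes_backward_exp_bound:
  fixes G :: "real \<times> 'e \<Rightarrow> ennreal" and \<gamma> :: "(real \<times> 'e) measure"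
  assumes a: "0 \<le> T" "mono_on {0..T} a" "cadlag_on T a" and cont: "continuous_on {0..T} a"
    and pq: "0 \<le> p" "p \<le> q" "q \<le> T" and \<beta>: "0 \<le> \<beta>"
    and \<gamma>: "sigma_finite_measure \<gamma>" and fst[measurable]: "fst \<in> borel_measurable \<gamma>"
    and G[measurable]: "G \<in> borel_measurable \<gamma>"
    and y: "\<And>s. p \<le> s \<Longrightarrow> s \<le> q \<Longrightarrow> ennreal \<bar>y s\<bar> \<le> ennreal \<bar>y q\<bar> + (\<integral>\<^sup>+z. G z * indicator {s<..q} (fst z) \<partial>\<gamma>)"
  shows "ennreal (exp (\<beta> * a p) * \<bar>y p\<bar>) + (\<integral>\<^sup>+s\<in>{p<..q}. ennreal (\<beta> * exp (\<beta> * a s) * \<bar>y s\<bar>) \<partial>stieltjes T a)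
     \<le> ennreal (exp (\<beta> * a q) * \<bar>y q\<bar>) + (\<integral>\<^sup>+z. ennreal (exp (\<beta> * a (fst z))) * G z * indicator {p<..q} (fst z) \<partial>\<gamma>)"
proof -
  interpret \<gamma>: sigma_finite_measure \<gamma> by fact
  interpret \<sigma>: finite_measure "stieltjes T a"
    by (intro finite_measureI) (simp add: emeasure_stieltjes_space[OF a])
  interpret P: pair_sigma_finite "stieltjes T a" \<gamma> by unfold_locales
  define b where "b = (\<lambda>t. a (max 0 (min T t)))"
  have b: "mono b" unfolding b_def mono_def using stieltjes_cutoff(1)[OF a] by auto
  have bm[measurable]: "b \<in> borel_measurable borel" by (rule borel_measurable_mono[OF b])
  have ba: "b t = a t" if "0 \<le> t" "t \<le> T" for t using that by (simp add: b_def)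
  have ft: "(\<integral>\<^sup>+s\<in>{p<..r}. ennreal (\<beta> * exp (\<beta> * b s)) \<partial>stieltjes T a) = ennreal (exp (\<beta> * a r) - exp (\<beta> * a p))"
    if "p \<le> r" "r \<le> q" for r
  proof -
    have "(\<integral>\<^sup>+s\<in>{p<..r}. ennreal (\<beta> * exp (\<beta> * a s)) \<partial>stieltjes T a) = ennreal (exp (\<beta> * a r) - exp (\<beta> * a p))"
      using \<beta> that pq by (intro stieltjes_FTC[OF a cont]) (auto intro!: derivative_eq_intros)
    moreover have "(\<integral>\<^sup>+s\<in>{p<..r}. ennreal (\<beta> * exp (\<beta> * b s)) \<partial>stieltjes T a)
       = (\<integral>\<^sup>+s\<in>{p<..r}. ennreal (\<beta> * exp (\<beta> * a s)) \<partial>stieltjes T a)"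
      using pq that by (intro nn_integral_cong) (auto simp: indicator_def ba)
    ultimately show ?thesis by simp
  qed
  have exp_mono: "exp (\<beta> * a s) \<le> exp (\<beta> * a t)" if "p \<le> s" "s \<le> t" "t \<le> q" for s t
    using \<beta> that pq a by (auto intro!: mult_left_mono mono_onD[OF a(2)])
  let ?Y = "ennreal \<bar>y q\<bar>"
  let ?I = "\<integral>\<^sup>+z. G z * indicator {p<..q} (fst z) \<partial>\<gamma>"
  \<comment> \<open>\<open>k\<close> is the density of \<open>d (exp (\<beta> * a))\<close> on \<open>{p<..q}\<close>\<close>
  define k where "k s = ennreal (\<beta> * exp (\<beta> * b s)) * indicator {p<..q} s" for s
  have [measurable]: "k \<in> borel_measurable borel" unfolding k_def by measurable
  have ind[measurable]: "(\<lambda>z. indicator {s<..q} (fst z) :: ennreal) \<in> borel_measurable \<gamma>" for s by measurable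
  have m2: "(\<lambda>(s, z). k s * (G z * indicator {s<..q} (fst z))) \<in> borel_measurable (stieltjes T a \<Otimes>\<^sub>M \<gamma>)"
    unfolding indicator_def greaterThanAtMost_iff by measurable
  have k0: "(\<integral>\<^sup>+s. k s \<partial>stieltjes T a) = ennreal (exp (\<beta> * a q) - exp (\<beta> * a p))"
    unfolding k_def using ft[of q] pq by simp
  have A1: "ennreal (exp (\<beta> * a p) * \<bar>y p\<bar>) \<le> ennreal (exp (\<beta> * a p)) * (?Y + ?I)"
    using y[of p] pq by (simp add: ennreal_mult mult_left_mono)
  have "(\<integral>\<^sup>+s\<in>{p<..q}. ennreal (\<beta> * exp (\<beta> * a s) * \<bar>y s\<bar>) \<partial>stieltjes T a)
     \<le> (\<integral>\<^sup>+s. k s * ?Y + (\<integral>\<^sup>+z. k s * (G z * indicator {s<..q} (fst z)) \<partial>\<gamma>) \<partial>stieltjes T a)"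
  proof (rule nn_integral_mono)
    fix s
    have "ennreal (\<beta> * exp (\<beta> * a s) * \<bar>y s\<bar>) * indicator {p<..q} s
       \<le> k s * (?Y + (\<integral>\<^sup>+z. G z * indicator {s<..q} (fst z) \<partial>\<gamma>))"
      using y[of s] pq \<beta> by (auto simp: indicator_def k_def ba ennreal_mult mult_left_mono)
    also have "\<dots> = k s * ?Y + (\<integral>\<^sup>+z. k s * (G z * indicator {s<..q} (fst z)) \<partial>\<gamma>)"
      by (simp add: distrib_left nn_integral_cmult)
    finally show "ennreal (\<beta> * exp (\<beta> * a s) * \<bar>y s\<bar>) * indicator {p<..q} s \<le> \<dots>" .
  qed
  also have "\<dots> = (\<integral>\<^sup>+s. k s * ?Y \<partial>stieltjes T a) +
      (\<integral>\<^sup>+s. (\<integral>\<^sup>+z. k s * (G z * indicator {s<..q} (fst z)) \<partial>\<gamma>) \<partial>stieltjes T a)"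
    using \<gamma>.borel_measurable_nn_integral[OF m2] by (intro nn_integral_add) auto
  also have "(\<integral>\<^sup>+s. k s * ?Y \<partial>stieltjes T a) = ennreal (exp (\<beta> * a q) - exp (\<beta> * a p)) * ?Y"
    by (simp add: nn_integral_multc k0)
  also have "(\<integral>\<^sup>+s. (\<integral>\<^sup>+z. k s * (G z * indicator {s<..q} (fst z)) \<partial>\<gamma>) \<partial>stieltjes T a)
     = (\<integral>\<^sup>+z. (\<integral>\<^sup>+s. k s * (G z * indicator {s<..q} (fst z)) \<partial>stieltjes T a) \<partial>\<gamma>)"
    using P.Fubini'[OF m2] by simp
  also have "\<dots> \<le> (\<integral>\<^sup>+z. ennreal (exp (\<beta> * a (fst z)) - exp (\<beta> * a p)) * (G z * indicator {p<..q} (fst z)) \<partial>\<gamma>)"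
  proof (rule nn_integral_mono)
    fix z
    show "(\<integral>\<^sup>+s. k s * (G z * indicator {s<..q} (fst z)) \<partial>stieltjes T a)
       \<le> ennreal (exp (\<beta> * a (fst z)) - exp (\<beta> * a p)) * (G z * indicator {p<..q} (fst z))"
    proof (cases "fst z \<in> {p<..q}")
      case True
      have "(\<integral>\<^sup>+s. k s * (G z * indicator {s<..q} (fst z)) \<partial>stieltjes T a)
        \<le> (\<integral>\<^sup>+s. (ennreal (\<beta> * exp (\<beta> * b s)) * indicator {p<..fst z} s) * G z \<partial>stieltjes T a)"
        using True by (intro nn_integral_mono) (auto simp: k_def indicator_def)
      also have "\<dots> = ennreal (exp (\<beta> * a (fst z)) - exp (\<beta> * a p)) * G z"
        using True ft[of "fst z"] by (subst nn_integral_multc) auto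
      finally show ?thesis using True by simp
    next
      case False
      have "(\<integral>\<^sup>+s. k s * (G z * indicator {s<..q} (fst z)) \<partial>stieltjes T a) = (\<integral>\<^sup>+s. 0 \<partial>stieltjes T a)"
        using False by (intro nn_integral_cong) (auto simp: k_def indicator_def)
      then show ?thesis by simp
    qed
  qed
  finally have A2: "(\<integral>\<^sup>+s\<in>{p<..q}. ennreal (\<beta> * exp (\<beta> * a s) * \<bar>y s\<bar>) \<partial>stieltjes T a)
    \<le> ennreal (exp (\<beta> * a q) - exp (\<beta> * a p)) * ?Y
     + (\<integral>\<^sup>+z. ennreal (exp (\<beta> * a (fst z)) - exp (\<beta> * a p)) * (G z * indicator {p<..q} (fst z)) \<partial>\<gamma>)"
    by (simp add: add_left_mono)
  have A3: "ennreal (exp (\<beta> * a p)) * ?Y + ennreal (exp (\<beta> * a q) - exp (\<beta> * a p)) * ?Y = ennreal (exp (\<beta> * a q) * \<bar>y q\<bar>)"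
    using exp_mono[of p q] pq by (simp flip: distrib_right ennreal_plus ennreal_mult)
  have A4: "ennreal (exp (\<beta> * a p)) * ?I
     + (\<integral>\<^sup>+z. ennreal (exp (\<beta> * a (fst z)) - exp (\<beta> * a p)) * (G z * indicator {p<..q} (fst z)) \<partial>\<gamma>)
     = (\<integral>\<^sup>+z. ennreal (exp (\<beta> * a (fst z))) * G z * indicator {p<..q} (fst z) \<partial>\<gamma>)"
  proof -
    have m3: "(\<lambda>z. ennreal (exp (\<beta> * b (fst z)) - exp (\<beta> * a p)) * (G z * indicator {p<..q} (fst z))) \<in> borel_measurable \<gamma>"
      by measurable
    have eq: "(\<integral>\<^sup>+z. ennreal (exp (\<beta> * a (fst z)) - exp (\<beta> * a p)) * (G z * indicator {p<..q} (fst z)) \<partial>\<gamma>)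
       = (\<integral>\<^sup>+z. ennreal (exp (\<beta> * b (fst z)) - exp (\<beta> * a p)) * (G z * indicator {p<..q} (fst z)) \<partial>\<gamma>)"
      using pq by (intro nn_integral_cong) (auto simp: indicator_def ba)
    have "ennreal (exp (\<beta> * a p)) * ?I + (\<integral>\<^sup>+z. ennreal (exp (\<beta> * b (fst z)) - exp (\<beta> * a p)) * (G z * indicator {p<..q} (fst z)) \<partial>\<gamma>)
      = (\<integral>\<^sup>+z. ennreal (exp (\<beta> * a p)) * (G z * indicator {p<..q} (fst z)) +
           ennreal (exp (\<beta> * b (fst z)) - exp (\<beta> * a p)) * (G z * indicator {p<..q} (fst z)) \<partial>\<gamma>)"
      by (subst nn_integral_cmult[symmetric], simp, subst nn_integral_add) (use m3 in auto)
    also have "\<dots> = (\<integral>\<^sup>+z. ennreal (exp (\<beta> * a (fst z))) * G z * indicator {p<..q} (fst z) \<partial>\<gamma>)"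
    proof (intro nn_integral_cong)
      fix z
      show "ennreal (exp (\<beta> * a p)) * (G z * indicator {p<..q} (fst z)) +
           ennreal (exp (\<beta> * b (fst z)) - exp (\<beta> * a p)) * (G z * indicator {p<..q} (fst z))
         = ennreal (exp (\<beta> * a (fst z))) * G z * indicator {p<..q} (fst z)"
        using pq exp_mono[of p "fst z"]
        by (auto simp: indicator_def ba simp flip: distrib_right ennreal_plus)
    qed
    finally show ?thesis unfolding eq .
  qed
  have "ennreal (exp (\<beta> * a p) * \<bar>y p\<bar>) + (\<integral>\<^sup>+s\<in>{p<..q}. ennreal (\<beta> * exp (\<beta> * a s) * \<bar>y s\<bar>) \<partial>stieltjes T a)
    \<le> ennreal (exp (\<beta> * a p)) * (?Y + ?I) + (ennreal (exp (\<beta> * a q) - exp (\<beta> * a p)) * ?Y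
     + (\<integral>\<^sup>+z. ennreal (exp (\<beta> * a (fst z)) - exp (\<beta> * a p)) * (G z * indicator {p<..q} (fst z)) \<partial>\<gamma>))"
    by (intro add_mono A1 A2)
  also have "\<dots> = (ennreal (exp (\<beta> * a p)) * ?Y + ennreal (exp (\<beta> * a q) - exp (\<beta> * a p)) * ?Y)
    + (ennreal (exp (\<beta> * a p)) * ?I
     + (\<integral>\<^sup>+z. ennreal (exp (\<beta> * a (fst z)) - exp (\<beta> * a p)) * (G z * indicator {p<..q} (fst z)) \<partial>\<gamma>))"
    by (simp add: distrib_left ac_simps)
  finally show ?thesis unfolding A3 A4 .
qed

section \<open>Contractions of L1 and an inequality of Young type\<close>

text \<open>
  The contraction principle for functions rather than equivalence classes, so that a fixed point
  is a measurable function. The increments of the iteration are summable in mean, hence almost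
  everywhere, and the pointwise limit is also the limit in mean.
\<close>

lemma L1_contraction_fixpoint:
  fixes Q :: "'a measure" and \<Phi> :: "('a \<Rightarrow> real) \<Rightarrow> 'a \<Rightarrow> real" and \<kappa> :: real
  defines "I \<equiv> {g \<in> borel_measurable Q. (\<integral>\<^sup>+x. ennreal \<bar>g x\<bar> \<partial>Q) < \<infinity>}"
  assumes \<kappa>: "0 \<le> \<kappa>" "\<kappa> < 1"
    and meas: "\<And>g. g \<in> I \<Longrightarrow> \<Phi> g \<in> borel_measurable Q"
    and contr: "\<And>g h. g \<in> I \<Longrightarrow> h \<in> I \<Longrightarrow>
      (\<integral>\<^sup>+x. ennreal \<bar>\<Phi> g x - \<Phi> h x\<bar> \<partial>Q) \<le> ennreal \<kappa> * (\<integral>\<^sup>+x. ennreal \<bar>g x - h x\<bar> \<partial>Q)"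
    and zero: "(\<integral>\<^sup>+x. ennreal \<bar>\<Phi> (\<lambda>_. 0) x\<bar> \<partial>Q) < \<infinity>"
  shows "\<exists>g\<in>I. AE x in Q. \<Phi> g x = g x"
proof -
  have diff_le: "(\<integral>\<^sup>+x. ennreal \<bar>u x\<bar> \<partial>Q) \<le> (\<integral>\<^sup>+x. ennreal \<bar>u x - v x\<bar> \<partial>Q) + (\<integral>\<^sup>+x. ennreal \<bar>v x\<bar> \<partial>Q)"
    if [measurable]: "u \<in> borel_measurable Q" "v \<in> borel_measurable Q" for u v :: "'a \<Rightarrow> real"
    by (subst nn_integral_add[symmetric]) (auto intro!: nn_integral_mono simp flip: ennreal_plus)
  have I0: "(\<lambda>_. 0) \<in> I" by (simp add: I_def)
  have I\<Phi>: "\<Phi> g \<in> I" if "g \<in> I" for g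
  proof -
    have "(\<integral>\<^sup>+x. ennreal \<bar>\<Phi> g x - \<Phi> (\<lambda>_. 0) x\<bar> \<partial>Q) \<le> ennreal \<kappa> * (\<integral>\<^sup>+x. ennreal \<bar>g x\<bar> \<partial>Q)"
      using contr[OF that I0] by simp
    also have "\<dots> < \<infinity>" using that by (auto simp: I_def ennreal_mult_less_top)
    finally show ?thesis using diff_le[OF meas[OF that] meas[OF I0]] zero meas[OF that]
      by (auto simp: I_def intro: le_less_trans)
  qed
  define G where "G k = (\<Phi> ^^ k) (\<lambda>_. 0)" for k
  have GI: "G k \<in> I" for k by (induction k) (auto simp: G_def I0 I\<Phi>)
  have GSuc: "G (Suc k) = \<Phi> (G k)" for k by (simp add: G_def)
  have [measurable]: "G k \<in> borel_measurable Q" for k using GI[of k] by (simp add: I_def)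
  define d where "d = (\<integral>\<^sup>+x. ennreal \<bar>\<Phi> (\<lambda>_. 0) x\<bar> \<partial>Q)"
  have dk: "(\<integral>\<^sup>+x. ennreal \<bar>G (Suc k) x - G k x\<bar> \<partial>Q) \<le> ennreal (\<kappa> ^ k) * d" for k
  proof (induction k)
    case 0
    show ?case by (simp add: G_def d_def)
  next
    case (Suc k)
    have "(\<integral>\<^sup>+x. ennreal \<bar>G (Suc (Suc k)) x - G (Suc k) x\<bar> \<partial>Q) \<le> ennreal \<kappa> * (ennreal (\<kappa> ^ k) * d)"
      using order_trans[OF contr[OF GI[of "Suc k"] GI[of k]] mult_left_mono[OF Suc]]
      by (simp add: GSuc[symmetric])
    then show ?case using \<kappa> by (simp add: ennreal_mult mult.assoc)
  qed
  \<comment> \<open>\<open>R k\<close> dominates the distance between the \<open>k\<close>-th iterate and the limit\<close>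
  define R where "R k x = (\<Sum>j. ennreal \<bar>G (Suc (j + k)) x - G (j + k) x\<bar>)" for k x
  have [measurable]: "R k \<in> borel_measurable Q" for k unfolding R_def by measurable
  have Rk: "(\<integral>\<^sup>+x. R k x \<partial>Q) \<le> ennreal (\<kappa> ^ k) * (ennreal (1 / (1 - \<kappa>)) * d)" for k
  proof -
    have "(\<integral>\<^sup>+x. R k x \<partial>Q) = (\<Sum>j. \<integral>\<^sup>+x. ennreal \<bar>G (Suc (j + k)) x - G (j + k) x\<bar> \<partial>Q)"
      unfolding R_def by (rule nn_integral_suminf) measurable
    also have "\<dots> \<le> (\<Sum>j. ennreal (\<kappa> ^ j) * (ennreal (\<kappa> ^ k) * d))"
    proof (intro suminf_le summableI)
      show "(\<integral>\<^sup>+x. ennreal \<bar>G (Suc (j + k)) x - G (j + k) x\<bar> \<partial>Q) \<le> ennreal (\<kappa> ^ j) * (ennreal (\<kappa> ^ k) * d)" for j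
        using dk[of "j + k"] \<kappa> by (simp add: power_add ennreal_mult mult.assoc)
    qed
    also have "\<dots> = (\<Sum>j. ennreal (\<kappa> ^ j)) * (ennreal (\<kappa> ^ k) * d)" by (rule ennreal_suminf_multc)
    also have "(\<Sum>j. ennreal (\<kappa> ^ j)) = ennreal (1 / (1 - \<kappa>))"
      using \<kappa> by (subst suminf_ennreal2) (auto simp: suminf_geometric summable_geometric)
    finally show ?thesis by (simp add: ac_simps)
  qed
  have dfin: "ennreal (1 / (1 - \<kappa>)) * d < \<infinity>" using zero by (simp add: d_def ennreal_mult_less_top)
  define g where "g x = lim (\<lambda>k. G k x)" for x
  have gm[measurable]: "g \<in> borel_measurable Q" unfolding g_def by measurable
  have "(\<integral>\<^sup>+x. R 0 x \<partial>Q) < \<infinity>" using Rk[of 0] dfin by (simp add: le_less_trans)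
  then have "AE x in Q. R 0 x \<noteq> \<infinity>" by (intro nn_integral_noteq_infinite) auto
  then have close: "AE x in Q. \<forall>k. ennreal \<bar>g x - G k x\<bar> \<le> R k x"
  proof eventually_elim
    case (elim x)
    let ?e = "\<lambda>j. \<bar>G (Suc j) x - G j x\<bar>"
    have s: "summable ?e"
      using elim by (intro summable_suminf_not_top) (auto simp: R_def)
    have sd: "summable (\<lambda>j. G (Suc j) x - G j x)" using s by (rule summable_rabs_cancel)
    have "convergent (\<lambda>k. G k x)"
    proof -
      have "(\<lambda>n. \<Sum>j<n. G (Suc j) x - G j x) = (\<lambda>n. G n x - G 0 x)"
        using sum_lessThan_telescope[of "\<lambda>n. G n x"] by (intro ext)
      then have "convergent (\<lambda>n. G n x - G 0 x)" using sd by (simp add: summable_iff_convergent)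
      then have "convergent (\<lambda>n. (G n x - G 0 x) + G 0 x)" by (intro convergent_add convergent_const)
      then show ?thesis by simp
    qed
    then have lim: "(\<lambda>k. G k x) \<longlonglongrightarrow> g x" by (simp add: g_def convergent_LIMSEQ_iff)
    show ?case
    proof
      fix k
      have s': "summable (\<lambda>j. ?e (j + k))" using summable_iff_shift[of ?e k] s by simp
      have "\<bar>G (n + k) x - G k x\<bar> \<le> (\<Sum>j. ?e (j + k))" for n
      proof -
        have "G (n + k) x - G k x = (\<Sum>j<n. G (Suc (j + k)) x - G (j + k) x)"
          by (induction n) auto
        also have "\<bar>\<dots>\<bar> \<le> (\<Sum>j<n. ?e (j + k))" by (rule sum_abs)
        also have "\<dots> \<le> (\<Sum>j. ?e (j + k))" using s' by (intro sum_le_suminf) auto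
        finally show ?thesis .
      qed
      moreover have "(\<lambda>n. \<bar>G (n + k) x - G k x\<bar>) \<longlonglongrightarrow> \<bar>g x - G k x\<bar>"
        using lim by (intro tendsto_intros LIMSEQ_ignore_initial_segment)
      ultimately have "\<bar>g x - G k x\<bar> \<le> (\<Sum>j. ?e (j + k))" by (intro LIMSEQ_le_const2) auto
      then show "ennreal \<bar>g x - G k x\<bar> \<le> R k x"
        unfolding R_def using s' by (subst suminf_ennreal2) (auto intro: ennreal_leI)
    qed
  qed
  have gk: "(\<integral>\<^sup>+x. ennreal \<bar>g x - G k x\<bar> \<partial>Q) \<le> ennreal (\<kappa> ^ k) * (ennreal (1 / (1 - \<kappa>)) * d)" for k
    using close by (intro order_trans[OF nn_integral_mono_AE Rk]) (auto elim: eventually_mono)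
  have gI: "g \<in> I"
    using gk[of 0] dfin by (auto simp: I_def G_def intro: le_less_trans)
  have "(\<integral>\<^sup>+x. ennreal \<bar>\<Phi> g x - g x\<bar> \<partial>Q) \<le> ennreal (\<kappa> ^ Suc k) * (2 * (ennreal (1 / (1 - \<kappa>)) * d))" for k
  proof -
    have [measurable]: "\<Phi> g \<in> borel_measurable Q" by (rule meas[OF gI])
    have "(\<integral>\<^sup>+x. ennreal \<bar>\<Phi> g x - g x\<bar> \<partial>Q)
       \<le> (\<integral>\<^sup>+x. ennreal \<bar>\<Phi> g x - \<Phi> (G k) x\<bar> + ennreal \<bar>g x - G (Suc k) x\<bar> \<partial>Q)"
      by (intro nn_integral_mono) (auto simp: GSuc simp flip: ennreal_plus)
    also have "\<dots> = (\<integral>\<^sup>+x. ennreal \<bar>\<Phi> g x - \<Phi> (G k) x\<bar> \<partial>Q) + (\<integral>\<^sup>+x. ennreal \<bar>g x - G (Suc k) x\<bar> \<partial>Q)"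
      by (rule nn_integral_add) (auto simp: GSuc[symmetric])
    also have "\<dots> \<le> ennreal \<kappa> * (ennreal (\<kappa> ^ k) * (ennreal (1 / (1 - \<kappa>)) * d)) + ennreal (\<kappa> ^ Suc k) * (ennreal (1 / (1 - \<kappa>)) * d)"
      by (intro add_mono gk order_trans[OF contr[OF gI GI]] mult_left_mono) auto
    also have "\<dots> = ennreal (\<kappa> ^ Suc k) * (2 * (ennreal (1 / (1 - \<kappa>)) * d))"
      using \<kappa> by (simp add: ennreal_mult mult.assoc mult_2 distrib_left)
    finally show ?thesis .
  qed
  then have "(\<integral>\<^sup>+x. ennreal \<bar>\<Phi> g x - g x\<bar> \<partial>Q) \<le> (2 * (ennreal (1 / (1 - \<kappa>)) * d)) * ennreal (\<kappa> ^ Suc k)" for k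
    by (simp only: mult.commute)
  moreover have "(\<lambda>k. (2 * (ennreal (1 / (1 - \<kappa>)) * d)) * ennreal (\<kappa> ^ Suc k)) \<longlonglongrightarrow> (2 * (ennreal (1 / (1 - \<kappa>)) * d)) * ennreal 0"
  proof (intro ennreal_tendsto_cmult tendsto_ennrealI LIMSEQ_Suc LIMSEQ_power_zero)
    show "2 * (ennreal (1 / (1 - \<kappa>)) * d) < top" using dfin by (simp add: ennreal_mult_less_top)
  qed (use \<kappa> in simp)
  ultimately have "(\<integral>\<^sup>+x. ennreal \<bar>\<Phi> g x - g x\<bar> \<partial>Q) \<le> (2 * (ennreal (1 / (1 - \<kappa>)) * d)) * ennreal 0"
    by (intro LIMSEQ_le_const) auto
  then have "(\<integral>\<^sup>+x. ennreal \<bar>\<Phi> g x - g x\<bar> \<partial>Q) = 0" by simp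
  then have "AE x in Q. ennreal \<bar>\<Phi> g x - g x\<bar> = 0"
    using meas[OF gI] by (subst (asm) nn_integral_0_iff_AE) auto
  then show ?thesis using gI by (intro bexI[of _ g]) auto
qed

text \<open>
  Young's inequality without its constants: if \<open>u \<le> v powr e\<close>, replace \<open>u\<close>, otherwise replace
  \<open>v\<close>.
\<close>

lemma mult_le_powr_add_powr:
  fixes u v :: real
  assumes "0 \<le> u" "0 \<le> v" "0 < e"
  shows "u * v \<le> u powr (1 + 1 / e) + v powr (1 + e)"
proof (cases "u \<le> v powr e")
  case True
  then have "u * v \<le> v powr e * v" using assms by (intro mult_right_mono) auto
  also have "\<dots> = v powr (1 + e)" using assms by (cases "v = 0") (auto simp: powr_add)
  finally show ?thesis using powr_ge_zero[of u] by (simp add: add_increasing)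
next
  case False
  then have u: "0 < u" using assms powr_ge_zero[of v e] by linarith
  have "v = (v powr e) powr (1 / e)" using assms by (simp add: powr_powr)
  also have "\<dots> \<le> u powr (1 / e)" using False assms by (intro powr_mono2) auto
  finally have "u * v \<le> u * u powr (1 / e)" using assms by (intro mult_left_mono) auto
  also have "\<dots> = u powr (1 + 1 / e)" using u by (simp add: powr_add)
  finally show ?thesis by (simp add: add_increasing2)
qed

section \<open>The point process and the information carried by its first jumps\<close>

locale marked_point_process =
  fixes M :: "'w measure" and T :: real and \<Delta> :: "'e::t2_space"
    and S :: "nat \<Rightarrow> 'w \<Rightarrow> ennreal" and X :: "nat \<Rightarrow> 'w \<Rightarrow> 'e"
    and F :: "ennreal \<Rightarrow> 'w measure"
    and A :: "'w \<Rightarrow> real \<Rightarrow> real" and \<phi> :: "'w \<Rightarrow> real \<Rightarrow> 'e measure"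
  assumes prob: "prob_space M" and T_pos: "0 < T"
    and mpp: "multivariate_point_process M T \<Delta> S X"
    and gen: "generated_filtration M S X F"
    and comp: "compensator M T F (jump_measure T S X) A \<phi>"
    and cont: "continuous_compensator M T A"
    and survival: "no_more_jumps_possible M T S F"
begin

sublocale prob_space M by (rule prob)

abbreviation "Pr \<equiv> predictable_sigma M T F"
abbreviation "\<nu> \<equiv> disintegrated_measure T A \<phi>"
abbreviation "\<mu> \<equiv> jump_measure T S X"

text \<open>
  The sigma-field of the past at \<open>S n\<close>. It is given by generators, which is what all inductions
  over its sets rely on.
\<close>

definition hist :: "nat \<Rightarrow> 'w measure" where
  "hist n = sigma (space M) {{\<omega>\<in>space M. S k \<omega> \<le> u \<and> X k \<omega> \<in> C} | k u C. 1 \<le> k \<and> k \<le> n \<and> C \<in> sets borel}"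

text \<open>
  An explicit form of the filtration, which by itself is only characterized by its minimality;
  see \<open>sets_F\<close>.
\<close>

definition jumps_until :: "ennreal \<Rightarrow> 'w measure" where
  "jumps_until t = sigma (space M) {{\<omega>\<in>space M. S k \<omega> \<le> u \<and> X k \<omega> \<in> C} | k u C. 1 \<le> k \<and> u \<le> t \<and> C \<in> sets borel}"

lemma S_0: "\<omega> \<in> space M \<Longrightarrow> S 0 \<omega> = 0"
  using mpp by (auto simp: multivariate_point_process_def)

lemma S_cases: "\<omega> \<in> space M \<Longrightarrow> 1 \<le> n \<Longrightarrow> (0 < S n \<omega> \<and> S n \<omega> \<le> ennreal T) \<or> S n \<omega> = \<infinity>"
  using mpp by (auto simp: multivariate_point_process_def)

lemma S_pos: "\<omega> \<in> space M \<Longrightarrow> 1 \<le> n \<Longrightarrow> 0 < S n \<omega>"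
  using S_cases[of \<omega> n] by auto

lemma S_le_Suc: "\<omega> \<in> space M \<Longrightarrow> S n \<omega> \<le> S (Suc n) \<omega>"
  using mpp S_0 by (cases "n = 0") (auto simp: multivariate_point_process_def)

lemma S_mono: "\<omega> \<in> space M \<Longrightarrow> m \<le> n \<Longrightarrow> S m \<omega> \<le> S n \<omega>"
  by (rule lift_Suc_mono_le[of "\<lambda>n. S n \<omega>"]) (auto intro: S_le_Suc)

lemma S_less_Suc: "\<omega> \<in> space M \<Longrightarrow> S n \<omega> \<le> ennreal T \<Longrightarrow> S n \<omega> < S (Suc n) \<omega>"
  using mpp S_0 S_pos[of \<omega> 1] by (cases "n = 0") (auto simp: multivariate_point_process_def)

lemma S_less: "\<omega> \<in> space M \<Longrightarrow> S m \<omega> \<le> ennreal T \<Longrightarrow> m < n \<Longrightarrow> S m \<omega> < S n \<omega>"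
  using S_less_Suc[of \<omega> m] S_mono[of \<omega> "Suc m" n] by auto

lemma ex_S_gt: "\<omega> \<in> space M \<Longrightarrow> \<exists>n. S n \<omega> > ennreal T"
  using mpp by (auto simp: multivariate_point_process_def)

lemma S_measurable[measurable]: "S n \<in> borel_measurable M"
proof (cases "n = 0")
  case True
  then show ?thesis using S_0 by (subst measurable_cong[of _ _ "\<lambda>_. 0"]) auto
qed (use mpp in \<open>auto simp: multivariate_point_process_def\<close>)

lemma X_measurable[measurable]: "1 \<le> n \<Longrightarrow> X n \<in> borel_measurable M"
  using mpp by (auto simp: multivariate_point_process_def)

lemma space_hist[simp]: "space (hist n) = space M"
  unfolding hist_def by (rule space_measure_of) auto

lemma sets_hist: "sets (hist n) =
    sigma_sets (space M) {{\<omega>\<in>space M. S k \<omega> \<le> u \<and> X k \<omega> \<in> C} | k u C. 1 \<le> k \<and> k \<le> n \<and> C \<in> sets borel}"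
  unfolding hist_def by (rule sets_measure_of) auto

lemma space_jumps_until[simp]: "space (jumps_until t) = space M"
  unfolding jumps_until_def by (rule space_measure_of) auto

lemma sets_jumps_until: "sets (jumps_until t) =
    sigma_sets (space M) {{\<omega>\<in>space M. S k \<omega> \<le> u \<and> X k \<omega> \<in> C} | k u C. 1 \<le> k \<and> u \<le> t \<and> C \<in> sets borel}"
  unfolding jumps_until_def by (rule sets_measure_of) auto

lemma jump_event_hist:
  "1 \<le> k \<Longrightarrow> k \<le> n \<Longrightarrow> C \<in> sets borel \<Longrightarrow> {\<omega>\<in>space M. S k \<omega> \<le> u \<and> X k \<omega> \<in> C} \<in> sets (hist n)"
  unfolding sets_hist by (rule sigma_sets.Basic, rule CollectI, intro exI conjI, rule refl) assumption+

lemma jump_event_jumps_until: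
  "1 \<le> k \<Longrightarrow> u \<le> t \<Longrightarrow> C \<in> sets borel \<Longrightarrow> {\<omega>\<in>space M. S k \<omega> \<le> u \<and> X k \<omega> \<in> C} \<in> sets (jumps_until t)"
  unfolding sets_jumps_until by (rule sigma_sets.Basic, rule CollectI, intro exI conjI, rule refl) assumption+

lemma point_process_filtration_F: "point_process_filtration M S X F"
  using gen by (simp add: generated_filtration_def)

lemma F_minimal: "point_process_filtration M S X G \<Longrightarrow> sets (F t) \<subseteq> sets (G t)"
  using gen by (simp add: generated_filtration_def)

lemma filtration_F: "filtration (space M) F"
  using point_process_filtration_F by (simp add: point_process_filtration_def)

sublocale filtration "space M" F by (rule filtration_F)

declare space_F[simp]

lemma stopping_S: "stopping_time F (S n)"
proof (cases "n = 0")
  case True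
  have "stopping_time F (S 0) = stopping_time F (\<lambda>_. 0)"
    by (rule stopping_time_cong) (auto simp: S_0)
  then show ?thesis using True by (simp add: stopping_time_const)
next
  case False
  then show ?thesis
    using point_process_filtration_F by (simp add: point_process_filtration_def)
qed

lemma jump_event_F:
  assumes "1 \<le> k" "u \<le> t" "C \<in> sets borel"
  shows "{\<omega>\<in>space M. S k \<omega> \<le> u \<and> X k \<omega> \<in> C} \<in> sets (F t)"
proof -
  have "X k \<in> borel_measurable (pre_sigma (S k))"
    using point_process_filtration_F assms by (simp add: point_process_filtration_def)
  then have "X k -` C \<inter> space M \<in> sets (pre_sigma (S k))"
    using measurable_sets[of "X k" "pre_sigma (S k)" borel C] assms by (simp add: space_pre_sigma)
  then have "{\<omega>\<in>X k -` C \<inter> space M. S k \<omega> \<le> u} \<in> sets (F u)"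
    by (rule sets_pre_sigmaD[OF stopping_S])
  also have "{\<omega>\<in>X k -` C \<inter> space M. S k \<omega> \<le> u} = {\<omega>\<in>space M. S k \<omega> \<le> u \<and> X k \<omega> \<in> C}" by auto
  finally show ?thesis using sets_F_mono[OF assms(2)] by auto
qed

text \<open>
  One inclusion holds since every generating event is visible at time \<open>t\<close>. For the other, the
  sigma-fields \<open>jumps_until t\<close> form themselves a filtration to which the point process is
  adapted, and \<open>F\<close> is the smallest one.
\<close>

lemma sets_F: "sets (F t) = sets (jumps_until t)"
proof
  show "sets (jumps_until t) \<subseteq> sets (F t)"
  proof -
    have "sigma_sets (space (F t)) {{\<omega>\<in>space M. S k \<omega> \<le> u \<and> X k \<omega> \<in> C} | k u C. 1 \<le> k \<and> u \<le> t \<and> C \<in> sets borel} \<subseteq> sets (F t)"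
    proof (rule sets.sigma_sets_subset, safe)
      fix k :: nat and u and C :: "'e set" assume "1 \<le> k" "u \<le> t" "C \<in> sets borel"
      then show "{\<omega>\<in>space M. S k \<omega> \<le> u \<and> X k \<omega> \<in> C} \<in> sets (F t)" by (rule jump_event_F)
    qed
    then show ?thesis by (simp only: sets_jumps_until space_F)
  qed
  have fj: "filtration (space M) jumps_until"
  proof
    show "sets (jumps_until i) \<subseteq> sets (jumps_until j)" if "i \<le> j" for i j
      unfolding sets_jumps_until using that by (intro sigma_sets_mono') (blast intro: order_trans)
  qed simp
  interpret J: filtration "space M" jumps_until by (rule fj)
  have st: "stopping_time jumps_until (S n)" if "1 \<le> n" for n
  proof
    fix u
    have "{\<omega>\<in>space M. S n \<omega> \<le> u \<and> X n \<omega> \<in> UNIV} \<in> sets (jumps_until u)"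
      using that by (intro jump_event_jumps_until) auto
    then show "Measurable.pred (jumps_until u) (\<lambda>x. S n x \<le> u)" by (simp add: pred_def)
  qed
  have "point_process_filtration M S X jumps_until"
    unfolding point_process_filtration_def
  proof (intro conjI allI impI fj st)
    fix n :: nat assume n: "1 \<le> n"
    show "X n \<in> borel_measurable (J.pre_sigma (S n))"
    proof (rule measurableI)
      fix C :: "'e set" assume C: "C \<in> sets borel"
      show "X n -` C \<inter> space (J.pre_sigma (S n)) \<in> sets (J.pre_sigma (S n))"
      proof (rule J.sets_pre_sigmaI[OF st[OF n]])
        fix u
        have "{\<omega>\<in>space M. S n \<omega> \<le> u \<and> X n \<omega> \<in> C} \<in> sets (jumps_until u)"
          using n C by (intro jump_event_jumps_until) auto
        also have "{\<omega>\<in>space M. S n \<omega> \<le> u \<and> X n \<omega> \<in> C} = {\<omega> \<in> X n -` C \<inter> space (J.pre_sigma (S n)). S n \<omega> \<le> u}"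
          by (auto simp: J.space_pre_sigma)
        finally show "{\<omega> \<in> X n -` C \<inter> space (J.pre_sigma (S n)). S n \<omega> \<le> u} \<in> sets (jumps_until u)" .
      qed
    qed simp
  qed
  then show "sets (F t) \<subseteq> sets (jumps_until t)"
    by (rule F_minimal)
qed

lemma jump_event_M: "1 \<le> k \<Longrightarrow> C \<in> sets borel \<Longrightarrow> {\<omega>\<in>space M. S k \<omega> \<le> u \<and> X k \<omega> \<in> C} \<in> sets M"
proof -
  assume [measurable]: "1 \<le> k" "C \<in> sets borel"
  have [measurable]: "X k \<in> borel_measurable M" by (rule X_measurable) fact
  show ?thesis by measurable
qed

lemma sets_F_M: "sets (F t) \<subseteq> sets M"
  unfolding sets_F sets_jumps_until using jump_event_M by (intro sets.sigma_sets_subset) blast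

lemma sets_hist_M: "sets (hist n) \<subseteq> sets M"
  unfolding sets_hist using jump_event_M by (intro sets.sigma_sets_subset) blast

lemma measurable_F_M: "Y \<in> measurable (F t) N \<Longrightarrow> Y \<in> measurable M N"
  using sets_F_M[of t] by (auto simp: measurable_def)

lemma measurable_F_mono: "Y \<in> measurable (F s) N \<Longrightarrow> s \<le> t \<Longrightarrow> Y \<in> measurable (F t) N"
  using sets_F_mono[of s t] by (auto simp: measurable_def)

text \<open>On \<open>{S n \<le> t}\<close> the first \<open>n\<close> jumps have been seen by time \<open>t\<close>.\<close>

lemma hist_before:
  assumes "B \<in> sets (hist n)"
  shows "{\<omega>\<in>B. S n \<omega> \<le> t} \<in> sets (F t)"
  using assms unfolding sets_hist
proof induction
  case (Basic a)
  then obtain k u C where k: "a = {\<omega>\<in>space M. S k \<omega> \<le> u \<and> X k \<omega> \<in> C}" "1 \<le> k" "k \<le> n" "C \<in> sets borel" by blast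
  have n: "{\<omega>\<in>space M. S n \<omega> \<le> t} \<in> sets (F t)"
    using stopping_timeD[OF stopping_S[of n], of t] by (simp add: pred_def)
  have "{\<omega>\<in>a. S n \<omega> \<le> t} = {\<omega>\<in>space M. S k \<omega> \<le> min u t \<and> X k \<omega> \<in> C} \<inter> {\<omega>\<in>space M. S n \<omega> \<le> t}"
    using k(1) S_mono[OF _ k(3)] by (auto intro: order_trans)
  also have "\<dots> \<in> sets (F t)" using k by (intro sets.Int n jump_event_F) auto
  finally show ?case .
next
  case (Compl a)
  have n: "{\<omega>\<in>space M. S n \<omega> \<le> t} \<in> sets (F t)"
    using stopping_timeD[OF stopping_S[of n], of t] by (simp add: pred_def)
  have "{\<omega>\<in>space M - a. S n \<omega> \<le> t} = {\<omega>\<in>space M. S n \<omega> \<le> t} - {\<omega>\<in>a. S n \<omega> \<le> t}" by auto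
  then show ?case using Compl n by auto
next
  case (Union a)
  have "{\<omega>\<in>\<Union> (range a). S n \<omega> \<le> t} = (\<Union>i. {\<omega>\<in>a i. S n \<omega> \<le> t})" by auto
  then show ?case using Union by auto
qed auto

text \<open>
  As long as the next jump has not occurred, an event about the first \<open>n\<close> jumps is known from
  the past, and an event about a later jump has not happened.
\<close>

lemma F_trace_hist:
  assumes "B \<in> sets (F t)"
  shows "\<exists>B'\<in>sets (hist n). \<forall>\<omega>\<in>{\<omega>\<in>space M. t < S (Suc n) \<omega>}. \<omega> \<in> B \<longleftrightarrow> \<omega> \<in> B'"
proof (rule sigma_sets_factor[where \<theta>="\<lambda>\<omega>. \<omega>"])
  show "B \<in> sigma_sets (space M) {{\<omega>\<in>space M. S k \<omega> \<le> u \<and> X k \<omega> \<in> C} | k u C. 1 \<le> k \<and> u \<le> t \<and> C \<in> sets borel}"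
    using assms by (simp add: sets_F sets_jumps_until)
  fix B assume "B \<in> {{\<omega>\<in>space M. S k \<omega> \<le> u \<and> X k \<omega> \<in> C} | k u C. 1 \<le> k \<and> u \<le> t \<and> C \<in> sets borel}"
  then obtain k u C where k: "B = {\<omega>\<in>space M. S k \<omega> \<le> u \<and> X k \<omega> \<in> C}" "1 \<le> k" "u \<le> t" "C \<in> sets borel" by blast
  show "\<exists>B'\<in>sets (hist n). \<forall>\<omega>\<in>{\<omega>\<in>space M. t < S (Suc n) \<omega>}. \<omega> \<in> B \<longleftrightarrow> \<omega> \<in> B'"
  proof (cases "k \<le> n")
    case True
    then have "B \<in> sets (hist n)" unfolding k(1) using k by (intro jump_event_hist) auto
    then show ?thesis by blast
  next
    case False
    have "\<omega> \<notin> B" if "\<omega> \<in> space M" "t < S (Suc n) \<omega>" for \<omega>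
      using S_mono[of \<omega> "Suc n" k] False that k by (auto dest: order_trans less_le_trans leD)
    then show ?thesis by (intro bexI[of _ "{}"]) auto
  qed
qed auto

text \<open>All that the next jump reveals is its time and its mark.\<close>

lemma hist_Suc_factor:
  assumes "B \<in> sets (hist (Suc n))"
  shows "\<exists>B'\<in>sets (hist n \<Otimes>\<^sub>M (borel \<Otimes>\<^sub>M borel)). \<forall>\<omega>\<in>space M. \<omega> \<in> B \<longleftrightarrow> (\<omega>, S (Suc n) \<omega>, X (Suc n) \<omega>) \<in> B'"
proof (rule sigma_sets_factor[where \<theta>="\<lambda>\<omega>. (\<omega>, S (Suc n) \<omega>, X (Suc n) \<omega>)"])
  show "B \<in> sigma_sets (space M) {{\<omega>\<in>space M. S k \<omega> \<le> u \<and> X k \<omega> \<in> C} | k u C. 1 \<le> k \<and> k \<le> Suc n \<and> C \<in> sets borel}"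
    using assms by (simp add: sets_hist)
  fix B assume "B \<in> {{\<omega>\<in>space M. S k \<omega> \<le> u \<and> X k \<omega> \<in> C} | k u C. 1 \<le> k \<and> k \<le> Suc n \<and> C \<in> sets borel}"
  then obtain k u C where k: "B = {\<omega>\<in>space M. S k \<omega> \<le> u \<and> X k \<omega> \<in> C}" "1 \<le> k" "k \<le> Suc n" "C \<in> sets borel" by blast
  show "\<exists>B'\<in>sets (hist n \<Otimes>\<^sub>M (borel \<Otimes>\<^sub>M borel)). \<forall>\<omega>\<in>space M. \<omega> \<in> B \<longleftrightarrow> (\<omega>, S (Suc n) \<omega>, X (Suc n) \<omega>) \<in> B'"
  proof (cases "k = Suc n")
    case True
    have "space M \<times> ({..u} \<times> C) \<in> sets (hist n \<Otimes>\<^sub>M (borel \<Otimes>\<^sub>M borel))"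
      using k(4) sets.top[of "hist n"] by (intro pair_measureI) auto
    then show ?thesis using k(1) True by (intro bexI[of _ "space M \<times> ({..u} \<times> C)"]) auto
  next
    case False
    then have "B \<in> sets (hist n)" unfolding k(1) using k by (intro jump_event_hist) auto
    then have "B \<times> (UNIV :: (ennreal \<times> 'e) set) \<in> sets (hist n \<Otimes>\<^sub>M (borel \<Otimes>\<^sub>M borel))"
      using sets.top[of "borel \<Otimes>\<^sub>M borel :: (ennreal \<times> 'e) measure"]
      by (intro pair_measureI) (simp_all add: space_pair_measure)
    then show ?thesis by (intro bexI[of _ "B \<times> UNIV"]) auto
  qed
qed (auto simp: space_pair_measure)

text \<open>
  The structural fact behind the explicit solution of the linear equation. For \<open>t = T\<close> it lets
  the terminal value be computed from the first \<open>n\<close> jumps on the paths that have no other ones.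
\<close>

lemma version_before_next_jump:
  fixes Y :: "'w \<Rightarrow> ennreal"
  assumes "Y \<in> borel_measurable (F t)"
  shows "\<exists>Y'\<in>borel_measurable (hist n). \<forall>\<omega>\<in>space M. t < S (Suc n) \<omega> \<longrightarrow> Y \<omega> = Y' \<omega>"
  using borel_measurable_factor_ennreal[OF assms, where D="{\<omega>\<in>space M. t < S (Suc n) \<omega>}" and N="hist n" and \<theta>="\<lambda>\<omega>. \<omega>"]
    F_trace_hist[of _ t n] by auto

lemma version_before_next_jump_real:
  fixes Y :: "'w \<Rightarrow> real"
  assumes "Y \<in> borel_measurable (F t)"
  shows "\<exists>Y'\<in>borel_measurable (hist n). \<forall>\<omega>\<in>space M. t < S (Suc n) \<omega> \<longrightarrow> Y \<omega> = Y' \<omega>"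
  using borel_measurable_factor_real[OF assms, where D="{\<omega>\<in>space M. t < S (Suc n) \<omega>}" and N="hist n" and \<theta>="\<lambda>\<omega>. \<omega>"]
    F_trace_hist[of _ t n] by auto

lemma hist_Suc_function_of_next_jump:
  fixes Y :: "'w \<Rightarrow> real"
  assumes "Y \<in> borel_measurable (hist (Suc n))"
  shows "\<exists>h\<in>borel_measurable (hist n \<Otimes>\<^sub>M (borel \<Otimes>\<^sub>M borel)).
    \<forall>\<omega>\<in>space M. Y \<omega> = h (\<omega>, S (Suc n) \<omega>, X (Suc n) \<omega>)"
  using borel_measurable_factor_real[OF assms, where D="space M" and N="hist n \<Otimes>\<^sub>M (borel \<Otimes>\<^sub>M borel)"
      and \<theta>="\<lambda>\<omega>. (\<omega>, S (Suc n) \<omega>, X (Suc n) \<omega>)"] hist_Suc_factor[of _ n] by auto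

text \<open>
  The exceptional event \<open>C\<close> is known at the \<open>n\<close>-th jump, and on it the path almost surely has a
  further jump. So the conditional probability of having no further jump, which is positive,
  integrates to \<open>0\<close> over \<open>C\<close>.
\<close>

lemma AE_survival:
  assumes B: "B \<in> sets (hist n)"
    and AE: "AE \<omega> in M. S n \<omega> \<le> ennreal T \<longrightarrow> ennreal T < S (Suc n) \<omega> \<longrightarrow> \<omega> \<in> B"
  shows "AE \<omega> in M. S n \<omega> \<le> ennreal T \<longrightarrow> \<omega> \<in> B"
proof -
  let ?G = "pre_sigma (S n)"
  let ?U = "{\<omega>\<in>space M. S (Suc n) \<omega> > ennreal T}"
  define C where "C = {\<omega>\<in>space M - B. S n \<omega> \<le> ennreal T}"
  have nB: "space M - B \<in> sets (hist n)" using B sets.compl_sets[of B "hist n"] by simp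
  have CG: "C \<in> sets ?G"
  proof (rule sets_pre_sigmaI[OF stopping_S])
    fix t
    have "{\<omega>\<in>C. S n \<omega> \<le> t} = {\<omega>\<in>space M - B. S n \<omega> \<le> min t (ennreal T)}" by (auto simp: C_def)
    also have "\<dots> \<in> sets (F (min t (ennreal T)))" by (rule hist_before[OF nB])
    finally show "{\<omega>\<in>C. S n \<omega> \<le> t} \<in> sets (F t)" using sets_F_mono[of "min t (ennreal T)" t] by auto
  qed
  have sub: "subalgebra M ?G"
    unfolding subalgebra_def
  proof
    show "sets ?G \<subseteq> sets M"
    proof
      fix D assume D: "D \<in> sets ?G"
      then have "{\<omega>\<in>D. S n \<omega> \<le> \<infinity>} \<in> sets (F \<infinity>)" by (rule sets_pre_sigmaD[OF stopping_S])
      then show "D \<in> sets M" using sets_F_M[of \<infinity>] by auto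
    qed
  qed (simp add: space_pre_sigma)
  interpret C: finite_measure_subalgebra M ?G by unfold_locales (rule sub)
  have U: "?U \<in> sets M" by measurable
  have CM: "C \<in> sets M" using CG sub by (auto simp: subalgebra_def)
  have int: "integrable M (indicator ?U :: 'w \<Rightarrow> real)"
    using U by (intro integrable_real_indicator) (auto simp: emeasure_eq_measure)
  have "(\<integral>\<omega>\<in>C. indicator ?U \<omega> \<partial>M) = (\<integral>\<omega>\<in>C. real_cond_exp M ?G (indicator ?U) \<omega> \<partial>M)"
    using C.real_cond_exp_intA[OF int CG] by simp
  moreover have "(\<integral>\<omega>\<in>C. indicator ?U \<omega> \<partial>M) = (0::real)"
    unfolding set_lebesgue_integral_def
    using AE by (intro integral_eq_zero_AE) (auto elim!: eventually_mono simp: C_def indicator_def)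
  ultimately have z: "(\<integral>\<omega>. indicator C \<omega> * real_cond_exp M ?G (indicator ?U) \<omega> \<partial>M) = 0"
    by (simp add: set_lebesgue_integral_def)
  have pos: "AE \<omega> in M. 0 < real_cond_exp M ?G (indicator ?U) \<omega>"
    using survival by (simp add: no_more_jumps_possible_def)
  have "integrable M (\<lambda>\<omega>. indicator C \<omega> * real_cond_exp M ?G (indicator ?U) \<omega>)"
    using integrable_mult_indicator[OF CM C.real_cond_exp_int(1)[OF int]] by simp
  then have "AE \<omega> in M. indicator C \<omega> * real_cond_exp M ?G (indicator ?U) \<omega> = 0"
    using z pos by (subst (asm) integral_nonneg_eq_0_iff_AE) (auto elim!: eventually_mono)
  with pos AE_space show ?thesis
    by eventually_elim (auto simp: C_def indicator_def split: if_splits)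
qed

end

section \<open>Predictable functions and integrals against A\<close>

text \<open>
  Both \<open>\<nu>\<close> and the measure \<open>Q\<close> on the predictable sigma-field are iterated integrals. Linearity
  and monotone convergence of the iterated integral are inherited by the measure and its
  integral, which are thereby identified once and for all.
\<close>

lemma measure_of_functional:
  fixes K :: "'a measure" and \<Lambda> :: "('a \<Rightarrow> ennreal) \<Rightarrow> ennreal"
  defines "m \<equiv> measure_of (space K) (sets K) (\<lambda>B. \<Lambda> (indicator B))"
  assumes cong: "\<And>f g. (\<And>x. x \<in> space K \<Longrightarrow> f x = g x) \<Longrightarrow> \<Lambda> f = \<Lambda> g"
    and cmult: "\<And>f c. f \<in> borel_measurable K \<Longrightarrow> \<Lambda> (\<lambda>x. c * f x) = c * \<Lambda> f"
    and add: "\<And>f g. f \<in> borel_measurable K \<Longrightarrow> g \<in> borel_measurable K \<Longrightarrow> \<Lambda> (\<lambda>x. f x + g x) = \<Lambda> f + \<Lambda> g"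
    and SUP: "\<And>f :: nat \<Rightarrow> 'a \<Rightarrow> ennreal. (\<And>i. f i \<in> borel_measurable K) \<Longrightarrow> incseq f \<Longrightarrow> \<Lambda> (\<lambda>x. SUP i. f i x) = (SUP i. \<Lambda> (f i))"
  shows "sets m = sets K" "space m = space K"
    and "\<And>B. B \<in> sets K \<Longrightarrow> emeasure m B = \<Lambda> (indicator B)"
    and "\<And>f. f \<in> borel_measurable K \<Longrightarrow> (\<integral>\<^sup>+x. f x \<partial>m) = \<Lambda> f"
proof -
  have z: "\<Lambda> (\<lambda>_. 0) = 0" using cmult[of "\<lambda>_. 0" 0] by simp
  show sets: "sets m = sets K" and "space m = space K" by (simp_all add: m_def)
  have fin: "\<Lambda> (\<lambda>x. \<Sum>i<n. f i x) = (\<Sum>i<n. \<Lambda> (f i))" if "\<And>i. f i \<in> borel_measurable K" for f and n :: nat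
    using that by (induction n) (auto simp: z add)
  have suminf: "\<Lambda> (\<lambda>x. \<Sum>i. f i x) = (\<Sum>i. \<Lambda> (f i))" if f: "\<And>i. f i \<in> borel_measurable K" for f
  proof -
    have "\<Lambda> (\<lambda>x. \<Sum>i. f i x) = \<Lambda> (\<lambda>x. SUP n. \<Sum>i<n. f i x)" by (simp add: suminf_eq_SUP)
    also have "\<dots> = (SUP n. \<Lambda> (\<lambda>x. \<Sum>i<n. f i x))"
      using f by (intro SUP) (auto intro!: incseq_SucI le_funI)
    finally show ?thesis by (simp add: fin[OF f] suminf_eq_SUP)
  qed
  show em: "emeasure m B = \<Lambda> (indicator B)" if "B \<in> sets K" for B
  proof (rule emeasure_measure_of[OF m_def[THEN meta_eq_to_obj_eq]])
    show "sets K \<subseteq> Pow (space K)" by (rule sets.space_closed)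
    show "B \<in> sets m" using that sets by simp
    show "positive (sets m) (\<lambda>B. \<Lambda> (indicator B))"
    proof -
      have "indicator {} = (\<lambda>_::'a. 0::ennreal)" by (auto simp: fun_eq_iff)
      then show ?thesis using z by (simp add: positive_def)
    qed
    show "countably_additive (sets m) (\<lambda>B. \<Lambda> (indicator B))"
      unfolding countably_additive_def sets
    proof safe
      fix B :: "nat \<Rightarrow> 'a set" assume B: "range B \<subseteq> sets K" "disjoint_family B"
      have "(\<Sum>i. \<Lambda> (indicator (B i))) = \<Lambda> (\<lambda>x. \<Sum>i. indicator (B i) x)"
        using B by (intro suminf[symmetric]) auto
      also have "\<dots> = \<Lambda> (indicator (\<Union> (range B)))"
        using B(2) by (intro cong) (simp add: suminf_indicator)
      finally show "(\<Sum>i. \<Lambda> (indicator (B i))) = \<Lambda> (indicator (\<Union> (range B)))" .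
    qed
  qed
  show "(\<integral>\<^sup>+x. f x \<partial>m) = \<Lambda> f" if f: "f \<in> borel_measurable K" for f
    using f
  proof (induction rule: borel_measurable_induct)
    case (cong f g)
    have "(\<integral>\<^sup>+x. f x \<partial>m) = (\<integral>\<^sup>+x. g x \<partial>m)" using cong(3) by (intro nn_integral_cong) (simp add: m_def)
    also have "\<dots> = \<Lambda> f" using cong assms(2)[of f g] by simp
    finally show ?case .
  next
    case (set B)
    then show ?case by (simp add: sets em)
  next
    case (mult u c)
    have "u \<in> borel_measurable m" using mult.hyps measurable_cong_sets[OF sets refl] by blast
    then show ?case using mult.IH mult.hyps by (simp add: nn_integral_cmult cmult)
  next
    case (add u v)
    have "u \<in> borel_measurable m" "v \<in> borel_measurable m"
      using add.hyps measurable_cong_sets[OF sets refl] by blast+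
    then show ?case using add.IH add.hyps by (simp add: nn_integral_add assms(4))
  next
    case (seq U)
    have U: "U i \<in> borel_measurable m" for i using seq.hyps measurable_cong_sets[OF sets refl] by blast
    have "(\<integral>\<^sup>+x. (SUP i. U i) x \<partial>m) = (\<integral>\<^sup>+x. (SUP i. U i x) \<partial>m)" by (simp add: image_comp)
    also have "\<dots> = (SUP i. \<integral>\<^sup>+x. U i x \<partial>m)" using seq.hyps U by (intro nn_integral_monotone_convergence_SUP) auto
    also have "\<dots> = (SUP i. \<Lambda> (U i))" using seq.IH by simp
    also have "\<dots> = \<Lambda> (\<lambda>x. SUP i. U i x)" using seq.hyps by (intro SUP[symmetric]) auto
    also have "(\<lambda>x. SUP i. U i x) = (SUP i. U i)" by (auto simp: image_comp)
    finally show ?case .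
  qed
qed

text \<open>
  Predictable functions and kernels are only controlled for times in \<open>{0..T}\<close>. Composition with
  \<open>clip\<close> extends them measurably to the real line.
\<close>

abbreviation clip :: "real \<Rightarrow> real \<Rightarrow> real" where "clip t s \<equiv> max 0 (min t s)"

context marked_point_process
begin

lemma A_predictable[measurable]: "(\<lambda>p. A (fst p) (snd p)) \<in> borel_measurable Pr"
  using comp by (simp add: compensator_def split_beta')

lemma A_path: "\<omega> \<in> space M \<Longrightarrow> A \<omega> 0 = 0" "\<omega> \<in> space M \<Longrightarrow> mono_on {0..T} (A \<omega>)" "\<omega> \<in> space M \<Longrightarrow> cadlag_on T (A \<omega>)"
  using comp by (auto simp: compensator_def)

lemma A_mono: "\<omega> \<in> space M \<Longrightarrow> 0 \<le> s \<Longrightarrow> s \<le> t \<Longrightarrow> t \<le> T \<Longrightarrow> A \<omega> s \<le> A \<omega> t"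
  using mono_onD[OF A_path(2)] by auto

lemma A_nonneg: "\<omega> \<in> space M \<Longrightarrow> 0 \<le> t \<Longrightarrow> t \<le> T \<Longrightarrow> 0 \<le> A \<omega> t"
  using A_mono[of \<omega> 0 t] A_path(1)[of \<omega>] by simp

lemma \<phi>_kernel: "(\<lambda>p. \<phi> (fst p) (snd p)) \<in> Pr \<rightarrow>\<^sub>M prob_algebra borel"
  using comp by (simp add: compensator_def split_beta')

lemma \<phi>_subkernel[measurable]: "(\<lambda>p. \<phi> (fst p) (snd p)) \<in> Pr \<rightarrow>\<^sub>M subprob_algebra borel"
  by (rule measurable_prob_algebraD[OF \<phi>_kernel])

lemma compensator_identity:
  "predictable M T F borel H \<Longrightarrow>
    (\<integral>\<^sup>+\<omega>. nn_integral_upto T (\<mu> \<omega>) (H \<omega>) \<partial>M) = (\<integral>\<^sup>+\<omega>. nn_integral_upto T (\<nu> \<omega>) (H \<omega>) \<partial>M)"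
  for H :: "'w \<Rightarrow> real \<Rightarrow> 'e \<Rightarrow> ennreal"
  using comp by (simp add: compensator_def)

lemma AE_continuous: "AE \<omega> in M. continuous_on {0..T} (A \<omega>)"
  using cont by (simp add: continuous_compensator_def)

lemma predictable_iff:
  "predictable M T F K H \<longleftrightarrow> (\<lambda>p. H (fst (fst p)) (snd (fst p)) (snd p)) \<in> borel_measurable (Pr \<Otimes>\<^sub>M K)"
  by (simp add: predictable_def split_beta')

lemma Pr_gen_subset:
  "{B \<times> {0} | B. B \<in> sets (F 0)} \<union> {B \<times> {s<..t} | B s t. 0 \<le> s \<and> s \<le> t \<and> t \<le> T \<and> B \<in> sets (F (ennreal s))}
    \<subseteq> Pow (space M \<times> {0..T})"
  using sets.sets_into_space[of _ "F _"] T_pos by fastforce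

lemma space_Pr[simp]: "space Pr = space M \<times> {0..T}"
  unfolding predictable_sigma_def using Pr_gen_subset by (rule space_measure_of)

lemma sets_Pr: "sets Pr = sigma_sets (space M \<times> {0..T})
  ({B \<times> {0} | B. B \<in> sets (F 0)} \<union> {B \<times> {s<..t} | B s t. 0 \<le> s \<and> s \<le> t \<and> t \<le> T \<and> B \<in> sets (F (ennreal s))})"
  unfolding predictable_sigma_def using Pr_gen_subset by (rule sets_measure_of)

lemma Pr_Ioc: "0 \<le> s \<Longrightarrow> t \<le> T \<Longrightarrow> B \<in> sets (F (ennreal s)) \<Longrightarrow> B \<times> {s<..t} \<in> sets Pr"
proof (cases "s \<le> t")
  assume *: "0 \<le> s" "t \<le> T" "B \<in> sets (F (ennreal s))" and "s \<le> t"
  then show ?thesis unfolding sets_Pr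
    by (intro sigma_sets.Basic UnI2 CollectI exI[of _ B] exI[of _ s] exI[of _ t]) auto
qed auto

lemma Pr_0: "space M \<times> {0} \<in> sets Pr"
proof -
  have "space M \<in> sets (F 0)" using sets.top[of "F 0"] by simp
  then show ?thesis unfolding sets_Pr by (intro sigma_sets.Basic UnI1 CollectI exI[of _ "space M"]) auto
qed

lemma snd_Pr[measurable]: "snd \<in> borel_measurable Pr"
proof (rule borel_measurableI_le)
  fix c :: real
  have top: "space M \<in> sets (F (ennreal 0))" using sets.top[of "F (ennreal 0)"] by simp
  have "{p\<in>space Pr. snd p \<le> c} = (if c < 0 then {} else (space M \<times> {0}) \<union> (space M \<times> {0<..min c T}))"
    using T_pos by (auto simp: less_le)
  also have "\<dots> \<in> sets Pr" using Pr_0 Pr_Ioc[OF _ _ top, of "min c T"] by auto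
  finally show "{p\<in>space Pr. snd p \<le> c} \<in> sets Pr" .
qed

lemma fst_measurable_restrict_Pr:
  assumes D: "D \<in> sets Pr" and sp: "space K = space M"
    and B: "\<And>B. B \<in> sets K \<Longrightarrow> {p\<in>D. fst p \<in> B} \<in> sets Pr"
  shows "fst \<in> measurable (restrict_space Pr D) K"
proof (rule measurableI)
  have D': "D \<subseteq> space M \<times> {0..T}" using sets.sets_into_space[OF D] by simp
  show "fst x \<in> space K" if "x \<in> space (restrict_space Pr D)" for x
    using that D' by (auto simp: space_restrict_space sp)
  fix B assume "B \<in> sets K"
  then have "{p\<in>D. fst p \<in> B} \<in> sets Pr" by (rule B)
  moreover have "fst -` B \<inter> space (restrict_space Pr D) = {p\<in>D. fst p \<in> B}"
    using D' by (auto simp: space_restrict_space)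
  ultimately show "fst -` B \<inter> space (restrict_space Pr D) \<in> sets (restrict_space Pr D)"
    using D by (simp add: sets_restrict_space_iff sets.Int_space_eq2 del: space_Pr)
qed

text \<open>
  Predictable functions arise from three sources: a variable known at time \<open>s\<close> may be used
  strictly after \<open>s\<close>, a variable known at \<open>S n\<close> strictly after \<open>S n\<close>, and in the latter the
  current time and mark may stand in for those of the next jump.
\<close>

lemma measurable_after_time:
  assumes Y: "Y \<in> measurable (F (ennreal s)) N" and s: "0 \<le> s" and c: "c \<in> space N"
  shows "(\<lambda>p. if s < snd p then Y (fst p) else c) \<in> measurable Pr N"
proof -
  have top: "space M \<in> sets (F (ennreal s))" using sets.top[of "F (ennreal s)"] by simp
  have D: "space M \<times> {s<..T} \<in> sets Pr" by (rule Pr_Ioc[OF s order_refl top])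
  have "fst \<in> measurable (restrict_space Pr (space M \<times> {s<..T})) (F (ennreal s))"
  proof (rule fst_measurable_restrict_Pr[OF D space_F])
    fix B assume B: "B \<in> sets (F (ennreal s))"
    have "{p\<in>space M \<times> {s<..T}. fst p \<in> B} = B \<times> {s<..T}" using sets.sets_into_space[OF B] by auto
    then show "{p\<in>space M \<times> {s<..T}. fst p \<in> B} \<in> sets Pr" using Pr_Ioc[OF s order_refl B] by simp
  qed
  then have "(\<lambda>p. Y (fst p)) \<in> measurable (restrict_space Pr (space M \<times> {s<..T})) N"
    by (rule measurable_compose[OF _ Y])
  then have "(\<lambda>p. if p \<in> space M \<times> {s<..T} then Y (fst p) else c) \<in> measurable Pr N"
    using D c sets.Int_space_eq2[OF D] by (subst (asm) measurable_restrict_space_iff) (auto simp: Int_commute)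
  then show ?thesis by (rule measurable_cong[THEN iffD1, rotated]) auto
qed

text \<open>
  If \<open>S n\<close> lies strictly before the present, then there is a rational time \<open>q\<close> in between, and
  at \<open>q\<close> it is known both that the \<open>n\<close>-th jump has occurred and whether the path belongs to \<open>B\<close>.
\<close>

lemma after_jump_Pr:
  assumes B: "B \<in> sets (hist n)"
  shows "{p\<in>space Pr. fst p \<in> B \<and> S n (fst p) < ennreal (snd p)} \<in> sets Pr"
proof -
  have "{p\<in>space Pr. fst p \<in> B \<and> S n (fst p) < ennreal (snd p)}
      = (\<Union>q\<in>\<rat> \<inter> {0..}. {\<omega>\<in>B. S n \<omega> \<le> ennreal q} \<times> {q<..T})" (is "?L = ?R")
  proof (intro set_eqI iffI)
    fix p assume p: "p \<in> ?L"
    then have fin: "S n (fst p) < top" using top.not_eq_extremum by fastforce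
    have "enn2real (S n (fst p)) < snd p"
      using p fin by (cases "S n (fst p)") (auto simp: ennreal_less_iff)
    then obtain q where q: "q \<in> \<rat>" "enn2real (S n (fst p)) < q" "q < snd p" using Rats_dense_in_real by blast
    have "S n (fst p) \<le> ennreal q" using q fin by (cases "S n (fst p)") (auto intro: ennreal_leI)
    moreover have "0 \<le> q" using q(2) enn2real_nonneg[of "S n (fst p)"] by linarith
    ultimately show "p \<in> ?R" using q p by (auto simp: mem_Times_iff)
  next
    fix p assume "p \<in> ?R"
    then obtain q where q: "0 \<le> q" "fst p \<in> B" "S n (fst p) \<le> ennreal q" "q < snd p" "snd p \<le> T" by auto
    have "ennreal q < ennreal (snd p)" using q by (simp add: ennreal_less_iff)
    then show "p \<in> ?L" using q sets.sets_into_space[OF B] by (auto simp: mem_Times_iff intro: le_less_trans)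
  qed
  also have "?R \<in> sets Pr"
  proof (rule sets.countable_UN'')
    show "countable (\<rat> \<inter> {0::real..})" by (intro countable_Int1 countable_rat)
    show "{\<omega>\<in>B. S n \<omega> \<le> ennreal q} \<times> {q<..T} \<in> sets Pr" if "q \<in> \<rat> \<inter> {0..}" for q
      using that by (intro Pr_Ioc hist_before[OF B]) auto
  qed
  finally show ?thesis .
qed

lemma after_S_Pr: "{p\<in>space Pr. S n (fst p) < ennreal (snd p)} \<in> sets Pr"
proof -
  have "space M \<in> sets (hist n)" using sets.top[of "hist n"] by simp
  from after_jump_Pr[OF this] show ?thesis by (rule back_subst[of "\<lambda>A. A \<in> sets Pr"]) auto
qed

lemma after_S_pred[measurable]: "Measurable.pred Pr (\<lambda>p. S n (fst p) < ennreal (snd p))"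
  using after_S_Pr by (simp add: pred_def)

text \<open>
  The stochastic interval from the \<open>n\<close>-th jump, excluded, to the next one, included: with these
  end points it is predictable.
\<close>

definition J :: "nat \<Rightarrow> ('w \<times> real) set" where
  "J n = {p\<in>space M \<times> {0..T}. S n (fst p) < ennreal (snd p) \<and> ennreal (snd p) \<le> S (Suc n) (fst p)}"

lemma J_Pr[measurable]: "J n \<in> sets Pr"
proof -
  have "J n = {p\<in>space Pr. S n (fst p) < ennreal (snd p) \<and> \<not> (S (Suc n) (fst p) < ennreal (snd p))}"
    by (auto simp: J_def not_less)
  also have "\<dots> \<in> sets Pr" by measurable
  finally show ?thesis .
qed

lemma fst_measurable_after_S:
  "fst \<in> measurable (restrict_space Pr {p\<in>space Pr. S n (fst p) < ennreal (snd p)}) (hist n)"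
proof (rule fst_measurable_restrict_Pr[OF after_S_Pr space_hist])
  fix B assume "B \<in> sets (hist n)"
  from after_jump_Pr[OF this] show "{p\<in>{p\<in>space Pr. S n (fst p) < ennreal (snd p)}. fst p \<in> B} \<in> sets Pr"
    by (rule back_subst[of "\<lambda>A. A \<in> sets Pr"]) auto
qed

lemma measurable_after_S:
  assumes Y: "Y \<in> measurable (hist n) N" and c: "c \<in> space N"
  shows "(\<lambda>p. if S n (fst p) < ennreal (snd p) then Y (fst p) else c) \<in> measurable Pr N"
proof -
  let ?D = "{p\<in>space Pr. S n (fst p) < ennreal (snd p)}"
  have "(\<lambda>p. Y (fst p)) \<in> measurable (restrict_space Pr ?D) N"
    by (rule measurable_compose[OF fst_measurable_after_S Y])
  then have "(\<lambda>p. if p \<in> ?D then Y (fst p) else c) \<in> measurable Pr N"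
    using after_S_Pr[of n] c sets.Int_space_eq2[OF after_S_Pr[of n]]
    by (subst (asm) measurable_restrict_space_iff) (simp_all only:)
  then show ?thesis by (rule measurable_cong[THEN iffD1, rotated]) auto
qed

lemma measurable_after_S_mark:
  assumes h: "h \<in> measurable (hist n \<Otimes>\<^sub>M (borel \<Otimes>\<^sub>M borel)) N" and c: "c \<in> space N"
  shows "(\<lambda>p. if S n (fst (fst p)) < ennreal (snd (fst p)) then h (fst (fst p), ennreal (snd (fst p)), snd p) else c)
    \<in> measurable (Pr \<Otimes>\<^sub>M (borel :: 'e measure)) N"
proof -
  let ?D = "{p\<in>space Pr. S n (fst p) < ennreal (snd p)}"
  let ?D2 = "{p\<in>space (Pr \<Otimes>\<^sub>M (borel :: 'e measure)). S n (fst (fst p)) < ennreal (snd (fst p))}"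
  let ?R = "restrict_space (Pr \<Otimes>\<^sub>M (borel :: 'e measure)) ?D2"
  have D2: "?D2 \<in> sets (Pr \<Otimes>\<^sub>M (borel :: 'e measure))" by measurable
  have "fst \<in> measurable ?R (restrict_space Pr ?D)"
    by (rule measurable_restrict_space3) (auto simp: space_pair_measure)
  then have 1: "(\<lambda>p. fst (fst p)) \<in> measurable ?R (hist n)"
    by (rule measurable_compose[OF _ fst_measurable_after_S])
  have 2: "(\<lambda>p. ennreal (snd (fst p))) \<in> borel_measurable ?R"
    by (rule measurable_restrict_space1) measurable
  have 3: "snd \<in> borel_measurable ?R" by (rule measurable_restrict_space1) measurable
  have "(\<lambda>p. h (fst (fst p), ennreal (snd (fst p)), snd p)) \<in> measurable ?R N"
    by (rule measurable_compose[OF _ h]) (intro measurable_Pair 1 2 3)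
  then have "(\<lambda>p. if p \<in> ?D2 then h (fst (fst p), ennreal (snd (fst p)), snd p) else c) \<in> measurable (Pr \<Otimes>\<^sub>M borel) N"
    using D2 c sets.Int_space_eq2[OF D2] by (subst (asm) measurable_restrict_space_iff) (simp_all only:)
  then show ?thesis by (rule measurable_cong[THEN iffD1, rotated]) auto
qed

text \<open>
  Predictable processes are progressively measurable: stopped at \<open>t\<close>, a generating rectangle is
  either empty or a rectangle with a base in \<open>F t\<close>.
\<close>

lemma measurable_clip:
  assumes t: "0 \<le> t" "t \<le> T"
  shows "(\<lambda>p. (fst p, clip t (snd p))) \<in> measurable (F (ennreal t) \<Otimes>\<^sub>M borel) Pr"
  unfolding predictable_sigma_def
proof (rule measurable_measure_of[OF Pr_gen_subset])
  show "(\<lambda>p. (fst p, clip t (snd p))) \<in> space (F (ennreal t) \<Otimes>\<^sub>M borel) \<rightarrow> space M \<times> {0..T}"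
    using t by (auto simp: space_pair_measure)
  fix y assume "y \<in> {B \<times> {0} | B. B \<in> sets (F 0)} \<union> {B \<times> {s<..t} | B s t. 0 \<le> s \<and> s \<le> t \<and> t \<le> T \<and> B \<in> sets (F (ennreal s))}"
  then consider B where "y = B \<times> {0}" "B \<in> sets (F 0)"
    | B u v where "y = B \<times> {u<..v}" "0 \<le> u" "u \<le> v" "v \<le> T" "B \<in> sets (F (ennreal u))" by blast
  then show "(\<lambda>p. (fst p, clip t (snd p))) -` y \<inter> space (F (ennreal t) \<Otimes>\<^sub>M borel) \<in> sets (F (ennreal t) \<Otimes>\<^sub>M borel)"
  proof cases
    case 1
    have "B \<in> sets (F (ennreal t))" using 1 sets_F_mono[of 0 "ennreal t"] by auto
    moreover have "{s\<in>space borel. clip t s = 0} \<in> sets borel" by measurable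
    ultimately have "B \<times> {s. clip t s = 0} \<in> sets (F (ennreal t) \<Otimes>\<^sub>M borel)" by (intro pair_measureI) auto
    moreover have "(\<lambda>p. (fst p, clip t (snd p))) -` y \<inter> space (F (ennreal t) \<Otimes>\<^sub>M borel) = B \<times> {s. clip t s = 0}"
      using 1 sets.sets_into_space[OF 1(2)] by (auto simp: space_pair_measure)
    ultimately show ?thesis by simp
  next
    case 2
    show ?thesis
    proof (cases "u \<le> t")
      case True
      have "B \<in> sets (F (ennreal t))" using 2 sets_F_mono[of "ennreal u" "ennreal t"] True by (auto simp: ennreal_leI)
      moreover have "{s\<in>space borel. u < clip t s \<and> clip t s \<le> v} \<in> sets borel" by measurable
      ultimately have "B \<times> {s. u < clip t s \<and> clip t s \<le> v} \<in> sets (F (ennreal t) \<Otimes>\<^sub>M borel)"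
        by (intro pair_measureI) simp_all
      moreover have "(\<lambda>p. (fst p, clip t (snd p))) -` y \<inter> space (F (ennreal t) \<Otimes>\<^sub>M borel) = B \<times> {s. u < clip t s \<and> clip t s \<le> v}"
        using 2 sets.sets_into_space[OF 2(5)] by (auto simp: space_pair_measure)
      ultimately show ?thesis by simp
    next
      case False
      then have "(\<lambda>p. (fst p, clip t (snd p))) -` y \<inter> space (F (ennreal t) \<Otimes>\<^sub>M borel) = {}"
        using 2 t by auto
      then show ?thesis by simp
    qed
  qed
qed

lemma measurable_clip_path: "\<omega> \<in> space M \<Longrightarrow> (\<lambda>s. (\<omega>, clip T s)) \<in> measurable borel Pr"
  using measurable_compose[OF measurable_Pair1' measurable_clip[of T], of \<omega>] T_pos by simp

lemma measurable_at_time: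
  assumes t: "0 \<le> t" "t \<le> T" and H: "H \<in> measurable Pr N"
  shows "(\<lambda>\<omega>. H (\<omega>, t)) \<in> measurable (F (ennreal t)) N"
proof -
  have "(\<lambda>\<omega>. (\<omega>, t)) \<in> measurable (F (ennreal t)) (F (ennreal t) \<Otimes>\<^sub>M borel)" by measurable
  from measurable_compose[OF measurable_compose[OF this measurable_clip[OF t]] H] show ?thesis
    using t by (simp add: max_absorb2)
qed

lemma A_adapted: "0 \<le> t \<Longrightarrow> t \<le> T \<Longrightarrow> (\<lambda>\<omega>. A \<omega> t) \<in> borel_measurable (F (ennreal t))"
  using measurable_at_time[OF _ _ A_predictable] by simp

abbreviation dA :: "'w \<Rightarrow> real measure" where "dA \<omega> \<equiv> stieltjes T (A \<omega>)"

lemma finite_dA: "\<omega> \<in> space M \<Longrightarrow> finite_measure (dA \<omega>)"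
  using T_pos A_path by (intro finite_measureI) (simp add: emeasure_stieltjes_space)

text \<open>
  Divided by \<open>1 + A \<omega> t\<close>, a quantity known at time \<open>t\<close>, the Stieltjes measures on \<open>{0<..t}\<close> form
  a subprobability kernel, determined by the values of \<open>A\<close> up to \<open>t\<close>.
\<close>

lemma nn_integral_dA_measurable:
  assumes t: "0 \<le> t" "t \<le> T" and h: "h \<in> borel_measurable (F (ennreal t) \<Otimes>\<^sub>M borel)"
  shows "(\<lambda>\<omega>. \<integral>\<^sup>+s\<in>{0<..t}. h (\<omega>, s) \<partial>dA \<omega>) \<in> borel_measurable (F (ennreal t))"
proof -
  define \<kappa> where "\<kappa> \<omega> = scale_measure (ennreal (1 / (1 + A \<omega> t))) (density (dA \<omega>) (indicator {0<..t}))" for \<omega>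
  have k: "emeasure (\<kappa> \<omega>) B = ennreal (1 / (1 + A \<omega> t)) * emeasure (dA \<omega>) ({0<..t} \<inter> B)" if "B \<in> sets borel" for B \<omega>
  proof -
    have "emeasure (density (dA \<omega>) (indicator {0<..t})) B = (\<integral>\<^sup>+s. indicator ({0<..t} \<inter> B) s \<partial>dA \<omega>)"
      using that by (subst emeasure_density) (auto intro!: nn_integral_cong simp del: nn_integral_indicator simp: indicator_def)
    then show ?thesis using that by (simp add: \<kappa>_def)
  qed
  have At: "(\<lambda>\<omega>. A \<omega> t) \<in> borel_measurable (F (ennreal t))" by (rule A_adapted[OF t])
  have Ioc: "emeasure (dA \<omega>) ({0<..t} \<inter> {..x}) = ennreal (A \<omega> (clip t x))" if "\<omega> \<in> space M" for \<omega> x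
  proof -
    have "{0<..t} \<inter> {..x} = {0<..clip t x}" using t by auto
    then show ?thesis
      using that emeasure_stieltjes_Ioc[OF less_imp_le[OF T_pos] A_path(2,3), of \<omega> 0 "clip t x"] t A_path(1)[OF that]
      by (simp add: min_absorb2 max_absorb2)
  qed
  have "\<kappa> \<in> measurable (F (ennreal t)) (subprob_algebra borel)"
  \<comment> \<open>half-lines generate the Borel sets and have the measure given by \<open>A\<close>\<close>
  proof (rule measurable_subprob_algebra_generated[where G="range (\<lambda>x::real. {..x})" and \<Omega>=UNIV])
    show "sets (borel :: real measure) = sigma_sets UNIV (range atMost)"
      by (subst borel_eq_atMost) simp
    show "Int_stable (range (\<lambda>x::real. {..x}))" by (auto simp: Int_stable_def)
    have tot: "emeasure (\<kappa> \<omega>) UNIV = ennreal (1 / (1 + A \<omega> t)) * ennreal (A \<omega> t)" if "\<omega> \<in> space M" for \<omega>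
    proof -
      have "{0<..t} \<inter> {..t} = {0<..t}" by auto
      then show ?thesis using k[of UNIV \<omega>] Ioc[OF that, of t] t by (simp add: max_absorb2)
    qed
    show "subprob_space (\<kappa> \<omega>)" if "\<omega> \<in> space (F (ennreal t))" for \<omega>
    proof (rule subprob_spaceI)
      have "0 \<le> A \<omega> t" using that t by (simp add: A_nonneg)
      then show "emeasure (\<kappa> \<omega>) (space (\<kappa> \<omega>)) \<le> 1" using tot[of \<omega>] that
        by (simp add: \<kappa>_def space_scale_measure flip: ennreal_mult)
    qed (simp add: \<kappa>_def space_scale_measure)
    show "sets (\<kappa> \<omega>) = sets borel" for \<omega> by (simp add: \<kappa>_def)
    show "(\<lambda>\<omega>. emeasure (\<kappa> \<omega>) UNIV) \<in> borel_measurable (F (ennreal t))"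
      using At tot by (subst measurable_cong[OF tot]) auto
    fix B assume "B \<in> range (\<lambda>x::real. {..x})"
    then obtain x where B: "B = {..x}" by auto
    have Ax: "(\<lambda>\<omega>. A \<omega> (clip t x)) \<in> borel_measurable (F (ennreal t))"
      using t by (intro measurable_F_mono[OF A_adapted]) (auto intro: ennreal_leI)
    have "emeasure (\<kappa> \<omega>) B = ennreal (1 / (1 + A \<omega> t)) * ennreal (A \<omega> (clip t x))" if "\<omega> \<in> space (F (ennreal t))" for \<omega>
      using k[of B \<omega>] Ioc[of \<omega> x] that B by simp
    then show "(\<lambda>\<omega>. emeasure (\<kappa> \<omega>) B) \<in> borel_measurable (F (ennreal t))"
      using At Ax by (subst measurable_cong) auto
  qed auto
  then have "(\<lambda>\<omega>. \<integral>\<^sup>+s. h (\<omega>, s) \<partial>\<kappa> \<omega>) \<in> borel_measurable (F (ennreal t))"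
    using h by (intro nn_integral_measurable_subprob_algebra2[where N=borel]) (auto simp: split_beta')
  then have "(\<lambda>\<omega>. ennreal (1 + A \<omega> t) * (\<integral>\<^sup>+s. h (\<omega>, s) \<partial>\<kappa> \<omega>)) \<in> borel_measurable (F (ennreal t))"
    using At by measurable
  moreover have "ennreal (1 + A \<omega> t) * (\<integral>\<^sup>+s. h (\<omega>, s) \<partial>\<kappa> \<omega>) = (\<integral>\<^sup>+s\<in>{0<..t}. h (\<omega>, s) \<partial>dA \<omega>)"
    if "\<omega> \<in> space M" for \<omega>
  proof -
    have [measurable]: "(\<lambda>s. h (\<omega>, s)) \<in> borel_measurable borel"
      using measurable_compose[OF measurable_Pair1' h] that by simp
    have "(\<integral>\<^sup>+s. h (\<omega>, s) \<partial>\<kappa> \<omega>) = ennreal (1 / (1 + A \<omega> t)) * (\<integral>\<^sup>+s. h (\<omega>, s) \<partial>density (dA \<omega>) (indicator {0<..t}))"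
      unfolding \<kappa>_def by (rule nn_integral_scale_measure) simp
    also have "(\<integral>\<^sup>+s. h (\<omega>, s) \<partial>density (dA \<omega>) (indicator {0<..t})) = (\<integral>\<^sup>+s\<in>{0<..t}. h (\<omega>, s) \<partial>dA \<omega>)"
      by (subst nn_integral_density) (auto simp: mult.commute)
    also have "ennreal (1 + A \<omega> t) * (ennreal (1 / (1 + A \<omega> t)) * (\<integral>\<^sup>+s\<in>{0<..t}. h (\<omega>, s) \<partial>dA \<omega>))
       = (ennreal (1 + A \<omega> t) * ennreal (1 / (1 + A \<omega> t))) * (\<integral>\<^sup>+s\<in>{0<..t}. h (\<omega>, s) \<partial>dA \<omega>)"
      by (simp add: mult.assoc)
    also have "ennreal (1 + A \<omega> t) * ennreal (1 / (1 + A \<omega> t)) = 1"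
      using A_nonneg[OF that t] by (subst ennreal_mult[symmetric]) simp_all
    finally show ?thesis by simp
  qed
  ultimately show ?thesis by (subst measurable_cong[symmetric]) auto
qed

lemma prob_space_\<phi>: "\<omega> \<in> space M \<Longrightarrow> 0 \<le> t \<Longrightarrow> t \<le> T \<Longrightarrow> prob_space (\<phi> \<omega> t)"
  and sets_\<phi>: "\<omega> \<in> space M \<Longrightarrow> 0 \<le> t \<Longrightarrow> t \<le> T \<Longrightarrow> sets (\<phi> \<omega> t) = sets borel"
  using measurable_space[OF \<phi>_kernel, of "(\<omega>, t)"] by (auto simp: space_prob_algebra)

lemma nn_integral_\<phi>_measurable[measurable]:
  assumes [measurable]: "H \<in> borel_measurable (Pr \<Otimes>\<^sub>M borel)"
  shows "(\<lambda>p. \<integral>\<^sup>+x. H (p, x) \<partial>\<phi> (fst p) (snd p)) \<in> borel_measurable Pr"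
  by (rule nn_integral_measurable_subprob_algebra2[where N=borel]) measurable

lemma \<phi>_path_kernel: "\<omega> \<in> space M \<Longrightarrow> (\<lambda>s. \<phi> \<omega> (clip T s)) \<in> measurable borel (subprob_algebra borel)"
  using measurable_compose[OF measurable_clip_path \<phi>_subkernel] by simp

lemma
  assumes \<omega>: "\<omega> \<in> space M"
  shows sets_\<nu>[simp]: "sets (\<nu> \<omega>) = sets (borel \<Otimes>\<^sub>M borel)" and space_\<nu>[simp]: "space (\<nu> \<omega>) = UNIV"
    and nn_integral_\<nu>: "\<And>G. G \<in> borel_measurable (borel \<Otimes>\<^sub>M borel) \<Longrightarrow>
      (\<integral>\<^sup>+z. G z \<partial>\<nu> \<omega>) = (\<integral>\<^sup>+t\<in>{0..T}. (\<integral>\<^sup>+x. G (t, x) \<partial>\<phi> \<omega> t) \<partial>dA \<omega>)"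
proof -
  define \<Lambda> where "\<Lambda> G = (\<integral>\<^sup>+t\<in>{0..T}. (\<integral>\<^sup>+x. G (t, x) \<partial>\<phi> \<omega> t) \<partial>dA \<omega>)" for G :: "real \<times> 'e \<Rightarrow> ennreal"
  let ?K = "borel \<Otimes>\<^sub>M borel :: (real \<times> 'e) measure"
  have spK: "space ?K = UNIV" by (simp add: space_pair_measure)
  have mx: "(\<lambda>x. G (t, x)) \<in> borel_measurable (\<phi> \<omega> t)" if "G \<in> borel_measurable ?K" "t \<in> {0..T}" for G t
    using measurable_compose[OF measurable_Pair1' that(1), of t] that(2) measurable_cong_sets[OF sets_\<phi>[OF \<omega>, of t] refl] by auto
  have mt: "(\<lambda>t. (\<integral>\<^sup>+x. G (t, x) \<partial>\<phi> \<omega> t) * indicator {0..T} t) \<in> borel_measurable (dA \<omega>)" if G: "G \<in> borel_measurable ?K" for G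
  proof -
    have "(\<lambda>t. \<integral>\<^sup>+x. G (t, x) \<partial>\<phi> \<omega> (clip T t)) \<in> borel_measurable borel"
      using G by (intro nn_integral_measurable_subprob_algebra2[where N=borel] \<phi>_path_kernel[OF \<omega>]) (simp add: split_beta')
    then have "(\<lambda>t. (\<integral>\<^sup>+x. G (t, x) \<partial>\<phi> \<omega> (clip T t)) * indicator {0..T} t) \<in> borel_measurable (dA \<omega>)" by simp
    then show ?thesis by (rule measurable_cong[THEN iffD1, rotated]) (auto simp: indicator_def)
  qed
  have cong: "\<Lambda> f = \<Lambda> g" if "\<And>x. x \<in> space ?K \<Longrightarrow> f x = g x" for f g
    using that unfolding \<Lambda>_def by (intro nn_integral_cong) (simp add: spK)
  have cmult: "\<Lambda> (\<lambda>x. c * f x) = c * \<Lambda> f" if f: "f \<in> borel_measurable ?K" for f c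
  proof -
    have "\<Lambda> (\<lambda>x. c * f x) = (\<integral>\<^sup>+t. c * ((\<integral>\<^sup>+x. f (t, x) \<partial>\<phi> \<omega> t) * indicator {0..T} t) \<partial>dA \<omega>)"
      unfolding \<Lambda>_def by (intro nn_integral_cong) (auto simp: indicator_def nn_integral_cmult[OF mx[OF f]])
    then show ?thesis by (simp add: nn_integral_cmult[OF mt[OF f]] \<Lambda>_def)
  qed
  have add: "\<Lambda> (\<lambda>x. f x + g x) = \<Lambda> f + \<Lambda> g" if f: "f \<in> borel_measurable ?K" and g: "g \<in> borel_measurable ?K" for f g
  proof -
    have "\<Lambda> (\<lambda>x. f x + g x) = (\<integral>\<^sup>+t. (\<integral>\<^sup>+x. f (t, x) \<partial>\<phi> \<omega> t) * indicator {0..T} t + (\<integral>\<^sup>+x. g (t, x) \<partial>\<phi> \<omega> t) * indicator {0..T} t \<partial>dA \<omega>)"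
      unfolding \<Lambda>_def by (intro nn_integral_cong) (auto simp: indicator_def nn_integral_add[OF mx[OF f] mx[OF g]])
    then show ?thesis by (simp add: nn_integral_add[OF mt[OF f] mt[OF g]] \<Lambda>_def)
  qed
  have SUP: "\<Lambda> (\<lambda>x. SUP i. f i x) = (SUP i. \<Lambda> (f i))" if f: "\<And>i. f i \<in> borel_measurable ?K" and inc: "incseq f" for f :: "nat \<Rightarrow> real \<times> 'e \<Rightarrow> ennreal"
  proof -
    have inc': "incseq (\<lambda>i x. f i (t, x))" for t using inc by (auto simp: incseq_def le_fun_def)
    have "\<Lambda> (\<lambda>x. SUP i. f i x) = (\<integral>\<^sup>+t. (SUP i. (\<integral>\<^sup>+x. f i (t, x) \<partial>\<phi> \<omega> t) * indicator {0..T} t) \<partial>dA \<omega>)"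
      unfolding \<Lambda>_def
    proof (intro nn_integral_cong)
      fix t
      show "(\<integral>\<^sup>+x. (SUP i. f i (t, x)) \<partial>\<phi> \<omega> t) * indicator {0..T} t = (SUP i. (\<integral>\<^sup>+x. f i (t, x) \<partial>\<phi> \<omega> t) * indicator {0..T} t)"
        using nn_integral_monotone_convergence_SUP[OF inc' mx[OF f], of t] by (cases "t \<in> {0..T}") auto
    qed
    also have "\<dots> = (SUP i. \<Lambda> (f i))"
      unfolding \<Lambda>_def using mt[OF f] inc
      by (intro nn_integral_monotone_convergence_SUP)
        (auto simp: incseq_def le_fun_def intro!: mult_right_mono nn_integral_mono)
    finally show ?thesis .
  qed
  have eq: "\<nu> \<omega> = measure_of (space ?K) (sets ?K) (\<lambda>B. \<Lambda> (indicator B))"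
    unfolding disintegrated_measure_def
  proof (rule measure_of_eq)
    show "sets ?K \<subseteq> Pow (space ?K)" by (rule sets.space_closed)
    fix B assume "B \<in> sigma_sets (space ?K) (sets ?K)"
    then have B: "B \<in> sets ?K" by (simp only: sets.sigma_sets_eq)
    have "(\<integral>\<^sup>+x. indicator B (t, x) \<partial>\<phi> \<omega> t) = emeasure (\<phi> \<omega> t) {x. (t, x) \<in> B}" if "t \<in> {0..T}" for t
    proof -
      have "(\<integral>\<^sup>+x. indicator B (t, x) \<partial>\<phi> \<omega> t) = (\<integral>\<^sup>+x. indicator {x. (t, x) \<in> B} x \<partial>\<phi> \<omega> t)"
        by (intro nn_integral_cong) (simp add: indicator_def)
      also have "\<dots> = emeasure (\<phi> \<omega> t) {x. (t, x) \<in> B}"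
        using sets_Pair1[OF B, of t] sets_\<phi>[OF \<omega>, of t] that by (intro nn_integral_indicator) (auto simp: vimage_def)
      finally show ?thesis .
    qed
    then show "(\<integral>\<^sup>+t\<in>{0..T}. emeasure (\<phi> \<omega> t) {x. (t, x) \<in> B} \<partial>dA \<omega>) = \<Lambda> (indicator B)"
      unfolding \<Lambda>_def by (intro nn_integral_cong) (auto simp: indicator_def)
  qed
  note mof = measure_of_functional[where K="?K" and \<Lambda>=\<Lambda>]
  show "sets (\<nu> \<omega>) = sets ?K" unfolding eq by (rule mof(1)) (fact cong | fact cmult | fact add | fact SUP)+
  show "space (\<nu> \<omega>) = UNIV" unfolding eq spK[symmetric] by (rule mof(2)) (fact cong | fact cmult | fact add | fact SUP)+
  show "(\<integral>\<^sup>+z. G z \<partial>\<nu> \<omega>) = (\<integral>\<^sup>+t\<in>{0..T}. (\<integral>\<^sup>+x. G (t, x) \<partial>\<phi> \<omega> t) \<partial>dA \<omega>)" if "G \<in> borel_measurable ?K" for G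
  proof -
    have "(\<integral>\<^sup>+z. G z \<partial>\<nu> \<omega>) = \<Lambda> G"
      unfolding eq by (rule mof(4)) (fact cong | fact cmult | fact add | fact SUP | fact that)+
    then show ?thesis by (simp only: \<Lambda>_def)
  qed
qed

section \<open>The compensator as a measure on the predictable sigma-field\<close>

abbreviation PE :: "(('w \<times> real) \<times> 'e) measure" where "PE \<equiv> Pr \<Otimes>\<^sub>M borel"

text \<open>
  The point reached by the path \<open>\<omega>\<close> at the time and mark \<open>z\<close>. Clipping keeps it in the
  predictable space for all \<open>z\<close>; where \<open>\<nu>\<close> has its mass, it changes nothing.
\<close>

definition at_path :: "'w \<Rightarrow> real \<times> 'e \<Rightarrow> ('w \<times> real) \<times> 'e" where
  "at_path \<omega> z = ((\<omega>, clip T (fst z)), snd z)"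

definition comp_int :: "(('w \<times> real) \<times> 'e \<Rightarrow> ennreal) \<Rightarrow> 'w \<Rightarrow> ennreal" where
  "comp_int H \<omega> = (\<integral>\<^sup>+z. H (at_path \<omega> z) \<partial>\<nu> \<omega>)"

lemma space_PE: "space PE = (space M \<times> {0..T}) \<times> UNIV"
  by (simp add: space_pair_measure)

lemma at_path_measurable: "\<omega> \<in> space M \<Longrightarrow> at_path \<omega> \<in> measurable (borel \<Otimes>\<^sub>M borel) PE"
  unfolding at_path_def using measurable_compose[OF measurable_fst measurable_clip_path, of \<omega>]
  by (intro measurable_Pair) auto

lemma at_path_measurable_\<nu>: "\<omega> \<in> space M \<Longrightarrow> at_path \<omega> \<in> measurable (\<nu> \<omega>) PE"
  using at_path_measurable[of \<omega>] measurable_cong_sets[OF sets_\<nu> refl, of \<omega>] by blast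

lemma measurable_along_path: "H \<in> measurable PE N \<Longrightarrow> \<omega> \<in> space M \<Longrightarrow> (\<lambda>z. H (at_path \<omega> z)) \<in> measurable (\<nu> \<omega>) N"
  by (rule measurable_compose[OF at_path_measurable_\<nu>])

lemma measurable_along_path': "H \<in> measurable PE N \<Longrightarrow> \<omega> \<in> space M \<Longrightarrow> (\<lambda>z. H (at_path \<omega> z)) \<in> measurable (borel \<Otimes>\<^sub>M borel) N"
  by (rule measurable_compose[OF at_path_measurable])

lemma fst_measurable_\<nu>: "\<omega> \<in> space M \<Longrightarrow> fst \<in> borel_measurable (\<nu> \<omega>)"
  using measurable_cong_sets[OF sets_\<nu> refl, of \<omega>] by auto

lemma AE_dA_Ioc: "\<omega> \<in> space M \<Longrightarrow> AE t in dA \<omega>. 0 < t \<and> t \<le> T"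
  using T_pos A_path by (intro AE_stieltjes_in_Ioc) auto

lemma emeasure_\<nu>_UNIV: "\<omega> \<in> space M \<Longrightarrow> emeasure (\<nu> \<omega>) UNIV = ennreal (A \<omega> T)"
proof -
  assume \<omega>: "\<omega> \<in> space M"
  have "emeasure (\<nu> \<omega>) UNIV = (\<integral>\<^sup>+z. 1 \<partial>\<nu> \<omega>)" using \<omega> by simp
  also have "\<dots> = (\<integral>\<^sup>+t\<in>{0..T}. (\<integral>\<^sup>+x. 1 \<partial>\<phi> \<omega> t) \<partial>dA \<omega>)" using \<omega> by (subst nn_integral_\<nu>) auto
  also have "\<dots> = (\<integral>\<^sup>+t. 1 \<partial>dA \<omega>)"
    by (intro nn_integral_cong_AE, use AE_dA_Ioc[OF \<omega>] in eventually_elim)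
      (simp add: prob_space.emeasure_space_1[OF prob_space_\<phi>[OF \<omega>]])
  also have "\<dots> = ennreal (A \<omega> T)"
    using emeasure_stieltjes_space[OF less_imp_le[OF T_pos] A_path(2,3)[OF \<omega>]] A_path(1)[OF \<omega>] by simp
  finally show ?thesis .
qed

lemma finite_\<nu>: "\<omega> \<in> space M \<Longrightarrow> finite_measure (\<nu> \<omega>)"
  by (intro finite_measureI) (simp add: emeasure_\<nu>_UNIV)

lemma AE_\<nu>_time:
  assumes \<omega>: "\<omega> \<in> space M" and P: "AE t in dA \<omega>. P t" and m: "Measurable.pred borel P"
  shows "AE z in \<nu> \<omega>. P (fst z)"
proof (rule AE_I')
  let ?G = "\<lambda>z::real \<times> 'e. indicator {t. \<not> P t} (fst z) :: ennreal"
  have mt: "{t. \<not> P t} \<in> sets borel" using m by (simp add: pred_def) (metis Collect_neg_eq borel_comp)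
  have mG: "?G \<in> borel_measurable (borel \<Otimes>\<^sub>M borel)" using mt by measurable
  have N: "{z. \<not> P (fst z)} \<in> sets (\<nu> \<omega>)"
    using measurable_sets[OF fst_measurable_\<nu>[OF \<omega>] mt] \<omega> by (simp add: vimage_def)
  have "emeasure (\<nu> \<omega>) {z. \<not> P (fst z)} = (\<integral>\<^sup>+z. ?G z \<partial>\<nu> \<omega>)"
    unfolding nn_integral_indicator[OF N, symmetric] by (intro nn_integral_cong) (simp add: indicator_def)
  also have "\<dots> = (\<integral>\<^sup>+t\<in>{0..T}. (\<integral>\<^sup>+x. ?G (t, x) \<partial>\<phi> \<omega> t) \<partial>dA \<omega>)" by (rule nn_integral_\<nu>[OF \<omega> mG])
  also have "\<dots> = (\<integral>\<^sup>+t. 0 \<partial>dA \<omega>)"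
    by (intro nn_integral_cong_AE, use P in eventually_elim) (simp add: indicator_def)
  finally show "{z. \<not> P (fst z)} \<in> null_sets (\<nu> \<omega>)" using N by (simp add: null_sets_def)
qed auto

lemma AE_\<nu>_Ioc: "\<omega> \<in> space M \<Longrightarrow> AE z in \<nu> \<omega>. 0 < fst z \<and> fst z \<le> T"
  by (rule AE_\<nu>_time[OF _ AE_dA_Ioc]) auto

lemma comp_int_upto:
  assumes "\<omega> \<in> space M"
  shows "nn_integral_upto T (\<nu> \<omega>) (\<lambda>t x. H ((\<omega>, t), x)) = comp_int H \<omega>"
  unfolding nn_integral_upto_def comp_int_def at_path_def
  by (intro nn_integral_cong_AE, use AE_\<nu>_Ioc[OF assms] in eventually_elim) (auto simp: indicator_def)

lemma comp_int_eq:
  assumes \<omega>: "\<omega> \<in> space M" and H: "H \<in> borel_measurable PE"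
  shows "comp_int H \<omega> = (\<integral>\<^sup>+t\<in>{0..T}. (\<integral>\<^sup>+x. H ((\<omega>, t), x) \<partial>\<phi> \<omega> t) \<partial>dA \<omega>)"
  unfolding comp_int_def using nn_integral_\<nu>[OF \<omega> measurable_along_path'[OF H \<omega>]]
  by (auto simp: at_path_def intro!: nn_integral_cong simp: indicator_def)

text \<open>
  Predictable integrands are progressively measurable, and so are the integrals over the marks.
\<close>

lemma comp_int_adapted:
  assumes t: "0 \<le> t" "t \<le> T" and H[measurable]: "H \<in> borel_measurable PE"
  shows "(\<lambda>\<omega>. comp_int (\<lambda>p. H p * indicator {0<..t} (snd (fst p))) \<omega>) \<in> borel_measurable (F (ennreal t))"
proof -
  have H': "(\<lambda>p. H p * indicator {0<..t} (snd (fst p))) \<in> borel_measurable PE" by measurable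
  define h where "h p = (\<integral>\<^sup>+x. H ((fst p, clip t (snd p)), x) \<partial>\<phi> (fst p) (clip t (snd p)))" for p
  have "h \<in> borel_measurable (F (ennreal t) \<Otimes>\<^sub>M borel)"
    using measurable_compose[OF measurable_clip[OF t] nn_integral_\<phi>_measurable[OF H]] by (simp add: h_def[abs_def])
  from nn_integral_dA_measurable[OF t this]
  have "(\<lambda>\<omega>. \<integral>\<^sup>+s\<in>{0<..t}. h (\<omega>, s) \<partial>dA \<omega>) \<in> borel_measurable (F (ennreal t))" .
  moreover have "(\<integral>\<^sup>+s\<in>{0<..t}. h (\<omega>, s) \<partial>dA \<omega>) = comp_int (\<lambda>p. H p * indicator {0<..t} (snd (fst p))) \<omega>"
    if "\<omega> \<in> space M" for \<omega>
    unfolding comp_int_eq[OF that H'] using t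
    by (intro nn_integral_cong) (auto simp: indicator_def h_def)
  ultimately show ?thesis by (subst measurable_cong[symmetric]) auto
qed

lemma comp_int_measurable[measurable]:
  assumes [measurable]: "H \<in> borel_measurable PE"
  shows "comp_int H \<in> borel_measurable M"
proof -
  have "(\<lambda>\<omega>. comp_int (\<lambda>p. H p * indicator {0<..T} (snd (fst p))) \<omega>) \<in> borel_measurable M"
    using T_pos by (intro measurable_F_M[OF comp_int_adapted]) auto
  moreover have "comp_int (\<lambda>p. H p * indicator {0<..T} (snd (fst p))) \<omega> = comp_int H \<omega>" if "\<omega> \<in> space M" for \<omega>
    unfolding comp_int_def
    by (intro nn_integral_cong_AE, use AE_\<nu>_Ioc[OF that] in eventually_elim) (auto simp: at_path_def)
  ultimately show ?thesis by (subst measurable_cong[symmetric]) auto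
qed

lemma comp_int_add: "\<omega> \<in> space M \<Longrightarrow> H \<in> borel_measurable PE \<Longrightarrow> G \<in> borel_measurable PE \<Longrightarrow>
    comp_int (\<lambda>p. H p + G p) \<omega> = comp_int H \<omega> + comp_int G \<omega>"
  unfolding comp_int_def by (intro nn_integral_add measurable_along_path)

lemma comp_int_cmult: "\<omega> \<in> space M \<Longrightarrow> H \<in> borel_measurable PE \<Longrightarrow>
    comp_int (\<lambda>p. c * H p) \<omega> = c * comp_int H \<omega>"
  unfolding comp_int_def by (intro nn_integral_cmult measurable_along_path)

lemma comp_int_cmult_\<omega>: "\<omega> \<in> space M \<Longrightarrow> H \<in> borel_measurable PE \<Longrightarrow>
    comp_int (\<lambda>p. c (fst (fst p)) * H p) \<omega> = c \<omega> * comp_int H \<omega>"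
  unfolding comp_int_def using nn_integral_cmult[OF measurable_along_path, of H \<omega> "c \<omega>"] by (simp add: at_path_def)

lemma comp_int_mono:
  assumes "\<omega> \<in> space M" and "\<And>t x. 0 < t \<Longrightarrow> t \<le> T \<Longrightarrow> H ((\<omega>, t), x) \<le> G ((\<omega>, t), x)"
  shows "comp_int H \<omega> \<le> comp_int G \<omega>"
  unfolding comp_int_def
  by (intro nn_integral_mono_AE, use AE_\<nu>_Ioc[OF assms(1)] in eventually_elim) (auto simp: at_path_def intro!: assms(2))

lemma comp_int_cong:
  assumes "\<omega> \<in> space M" and "\<And>t x. 0 < t \<Longrightarrow> t \<le> T \<Longrightarrow> H ((\<omega>, t), x) = G ((\<omega>, t), x)"
  shows "comp_int H \<omega> = comp_int G \<omega>"
  by (intro antisym comp_int_mono assms) (simp_all add: assms)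

text \<open>
  The measure \<open>P(d\<omega>) \<nu>(\<omega>, dt, dx)\<close>. All weighted norms are \<open>L1\<close> norms for densities with respect
  to \<open>Q\<close>.
\<close>

definition Q :: "(('w \<times> real) \<times> 'e) measure" where
  "Q = measure_of (space PE) (sets PE) (\<lambda>B. \<integral>\<^sup>+\<omega>. comp_int (indicator B) \<omega> \<partial>M)"

lemma sets_Q[simp, measurable_cong]: "sets Q = sets PE"
  and space_Q: "space Q = space PE"
  and nn_integral_Q: "\<And>H. H \<in> borel_measurable PE \<Longrightarrow> (\<integral>\<^sup>+p. H p \<partial>Q) = (\<integral>\<^sup>+\<omega>. comp_int H \<omega> \<partial>M)"
proof -
  define \<Lambda> where "\<Lambda> H = (\<integral>\<^sup>+\<omega>. comp_int H \<omega> \<partial>M)" for H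
  have cong: "\<Lambda> f = \<Lambda> g" if "\<And>p. p \<in> space PE \<Longrightarrow> f p = g p" for f g
    unfolding \<Lambda>_def using that by (intro nn_integral_cong comp_int_cong) (auto simp: space_PE)
  have cmult: "\<Lambda> (\<lambda>p. c * f p) = c * \<Lambda> f" if f[measurable]: "f \<in> borel_measurable PE" for f c
    unfolding \<Lambda>_def by (simp add: comp_int_cmult nn_integral_cmult[symmetric] cong: nn_integral_cong)
  have add: "\<Lambda> (\<lambda>p. f p + g p) = \<Lambda> f + \<Lambda> g"
    if [measurable]: "f \<in> borel_measurable PE" "g \<in> borel_measurable PE" for f g
    unfolding \<Lambda>_def by (simp add: comp_int_add nn_integral_add[symmetric] cong: nn_integral_cong)
  have SUP: "\<Lambda> (\<lambda>p. SUP i. f i p) = (SUP i. \<Lambda> (f i))"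
    if f[measurable]: "\<And>i. f i \<in> borel_measurable PE" and inc: "incseq f" for f :: "nat \<Rightarrow> ('w \<times> real) \<times> 'e \<Rightarrow> ennreal"
  proof -
    have "\<Lambda> (\<lambda>p. SUP i. f i p) = (\<integral>\<^sup>+\<omega>. (SUP i. comp_int (f i) \<omega>) \<partial>M)"
      unfolding \<Lambda>_def
    proof (rule nn_integral_cong)
      fix \<omega> assume "\<omega> \<in> space M"
      then show "comp_int (\<lambda>p. SUP i. f i p) \<omega> = (SUP i. comp_int (f i) \<omega>)"
        unfolding comp_int_def
      proof (intro nn_integral_monotone_convergence_SUP measurable_along_path f)
        show "incseq (\<lambda>i z. f i (at_path \<omega> z))"
          using inc unfolding incseq_def by (blast intro: le_funI dest: le_funD)
      qed
    qed
    also have "\<dots> = (SUP i. \<Lambda> (f i))"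
      unfolding \<Lambda>_def
    proof (intro nn_integral_monotone_convergence_SUP)
      have "comp_int (f m) \<omega> \<le> comp_int (f n) \<omega>" if "m \<le> n" for m n \<omega>
        unfolding comp_int_def using inc that by (intro nn_integral_mono) (blast dest: incseqD le_funD)
      then show "incseq (\<lambda>i. comp_int (f i))" by (auto simp: incseq_def le_fun_def)
    qed measurable
    finally show ?thesis .
  qed
  note mof = measure_of_functional[where K=PE and \<Lambda>=\<Lambda>]
  have eq: "Q = measure_of (space PE) (sets PE) (\<lambda>B. \<Lambda> (indicator B))" by (simp add: Q_def \<Lambda>_def)
  show "sets Q = sets PE" unfolding eq by (rule mof(1)) (fact cong | fact cmult | fact add | fact SUP)+
  show "space Q = space PE" unfolding eq by (rule mof(2)) (fact cong | fact cmult | fact add | fact SUP)+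
  show "(\<integral>\<^sup>+p. H p \<partial>Q) = (\<integral>\<^sup>+\<omega>. comp_int H \<omega> \<partial>M)" if "H \<in> borel_measurable PE" for H
  proof -
    have "(\<integral>\<^sup>+p. H p \<partial>Q) = \<Lambda> H"
      unfolding eq by (rule mof(4)) (fact cong | fact cmult | fact add | fact SUP | fact that)+
    then show ?thesis by (simp only: \<Lambda>_def)
  qed
qed

lemma AE_Q_path:
  assumes "AE p in Q. P p"
  shows "AE \<omega> in M. AE z in \<nu> \<omega>. P (at_path \<omega> z)"
proof -
  obtain N where N: "{p\<in>space Q. \<not> P p} \<subseteq> N" "emeasure Q N = 0" "N \<in> sets Q" using assms by (rule AE_E)
  then have [measurable]: "N \<in> sets PE" by simp
  have "(\<integral>\<^sup>+\<omega>. comp_int (indicator N) \<omega> \<partial>M) = 0"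
    using N nn_integral_Q[of "indicator N"] by simp
  then have "AE \<omega> in M. comp_int (indicator N) \<omega> = 0" by (subst (asm) nn_integral_0_iff_AE) auto
  with AE_space show ?thesis
  proof eventually_elim
    case (elim \<omega>)
    have "AE z in \<nu> \<omega>. (indicator N (at_path \<omega> z) :: ennreal) = 0"
      using elim(2) nn_integral_0_iff_AE[OF measurable_along_path[of "indicator N" borel \<omega>]] elim(1)
      by (simp add: comp_int_def)
    with AE_space show ?case
    proof eventually_elim
      case (elim z)
      have "at_path \<omega> z \<in> space Q" using \<open>\<omega> \<in> space M\<close> T_pos by (auto simp: space_Q space_PE at_path_def)
      then show ?case using elim N(1) by (auto simp: indicator_def split: if_splits)
    qed
  qed
qed

section \<open>The jumps of a path\<close>

text \<open>
  The number of jumps up to \<open>T\<close>, which is finite because the point process does not explode.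
\<close>

definition njumps :: "'w \<Rightarrow> nat" where "njumps \<omega> = (LEAST n. S (Suc n) \<omega> > ennreal T)"

definition jtime :: "nat \<Rightarrow> 'w \<Rightarrow> real" where "jtime n \<omega> = enn2real (S n \<omega>)"

lemma S_le_iff: "\<omega> \<in> space M \<Longrightarrow> S n \<omega> \<le> ennreal T \<longleftrightarrow> n \<le> njumps \<omega>"
proof -
  assume \<omega>: "\<omega> \<in> space M"
  obtain m where m: "S m \<omega> > ennreal T" using ex_S_gt[OF \<omega>] by auto
  then obtain k where "m = Suc k" using S_0[OF \<omega>] by (cases m) auto
  then have ex: "S (Suc (njumps \<omega>)) \<omega> > ennreal T" unfolding njumps_def using m by (metis (mono_tags) LeastI)
  show ?thesis
  proof
    assume le: "S n \<omega> \<le> ennreal T"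
    show "n \<le> njumps \<omega>"
    proof (rule ccontr)
      assume "\<not> n \<le> njumps \<omega>"
      then have "S (Suc (njumps \<omega>)) \<omega> \<le> S n \<omega>" by (intro S_mono[OF \<omega>]) simp
      then show False using ex le by simp
    qed
  next
    assume le: "n \<le> njumps \<omega>"
    show "S n \<omega> \<le> ennreal T"
    proof (cases n)
      case 0
      then show ?thesis using S_0[OF \<omega>] by simp
    next
      case (Suc k)
      then have "k < njumps \<omega>" using le by simp
      then have "\<not> S (Suc k) \<omega> > ennreal T" unfolding njumps_def by (rule not_less_Least)
      then show ?thesis using Suc by (simp add: not_less)
    qed
  qed
qed

lemma jtime_0: "\<omega> \<in> space M \<Longrightarrow> jtime 0 \<omega> = 0" by (simp add: jtime_def S_0)

lemma jtime:
  assumes "\<omega> \<in> space M" "n \<le> njumps \<omega>"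
  shows "S n \<omega> = ennreal (jtime n \<omega>)" "0 \<le> jtime n \<omega>" "jtime n \<omega> \<le> T"
proof -
  have le: "S n \<omega> \<le> ennreal T" using S_le_iff assms by simp
  then have "S n \<omega> < top" using le_less_trans by fastforce
  then show *: "S n \<omega> = ennreal (jtime n \<omega>)" by (simp add: jtime_def)
  show "0 \<le> jtime n \<omega>" by (simp add: jtime_def)
  then show "jtime n \<omega> \<le> T" using le T_pos unfolding * by simp
qed

lemma jtime_less: "\<omega> \<in> space M \<Longrightarrow> m < n \<Longrightarrow> n \<le> njumps \<omega> \<Longrightarrow> jtime m \<omega> < jtime n \<omega>"
  using S_less[of \<omega> m n] S_le_iff[of \<omega> m] jtime[of \<omega> m] jtime[of \<omega> n] by (simp add: ennreal_less_iff)

text \<open>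
  The end of the interval that starts at the \<open>n\<close>-th jump, where \<open>T\<close> takes the place of a next
  jump that does not come in time.
\<close>

definition jnext :: "nat \<Rightarrow> 'w \<Rightarrow> real" where
  "jnext n \<omega> = (if n < njumps \<omega> then jtime (Suc n) \<omega> else T)"

lemma jnext:
  assumes "\<omega> \<in> space M" "n \<le> njumps \<omega>"
  shows "jtime n \<omega> \<le> jnext n \<omega>" "jnext n \<omega> \<le> T"
  using assms jtime[of \<omega>] jtime_less[of \<omega> n "Suc n"] by (auto simp: jnext_def)

lemma less_S_Suc_iff:
  assumes "\<omega> \<in> space M" "n \<le> njumps \<omega>" "0 \<le> t" "t \<le> T"
  shows "ennreal t < S (Suc n) \<omega> \<longleftrightarrow> (n < njumps \<omega> \<longrightarrow> t < jtime (Suc n) \<omega>)"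
proof (cases "n < njumps \<omega>")
  case True
  then show ?thesis using assms jtime[of \<omega> "Suc n"] by (simp add: ennreal_less_iff)
next
  case False
  then have "ennreal T < S (Suc n) \<omega>" using S_le_iff[OF assms(1), of "Suc n"] assms(2) by (simp add: not_le)
  moreover have "ennreal t \<le> ennreal T" using assms by (simp add: ennreal_leI)
  ultimately show ?thesis using False by auto
qed

lemma le_S_Suc_iff:
  assumes "\<omega> \<in> space M" "n \<le> njumps \<omega>" "0 \<le> t" "t \<le> T"
  shows "ennreal t \<le> S (Suc n) \<omega> \<longleftrightarrow> t \<le> jnext n \<omega>"
proof (cases "n < njumps \<omega>")
  case True
  then show ?thesis using assms jtime[of \<omega> "Suc n"] by (simp add: jnext_def)
next
  case False
  then have "ennreal T < S (Suc n) \<omega>" using S_le_iff[OF assms(1), of "Suc n"] assms(2) by (simp add: not_le)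
  moreover have "ennreal t \<le> ennreal T" using assms by (simp add: ennreal_leI)
  ultimately have "ennreal t \<le> S (Suc n) \<omega>" by order
  then show ?thesis using False assms by (simp add: jnext_def)
qed

lemma J_iff:
  assumes "\<omega> \<in> space M" "0 \<le> t" "t \<le> T"
  shows "(\<omega>, t) \<in> J n \<longleftrightarrow> n \<le> njumps \<omega> \<and> jtime n \<omega> < t \<and> t \<le> jnext n \<omega>"
proof (cases "n \<le> njumps \<omega>")
  case True
  then show ?thesis using assms jtime[OF assms(1) True] le_S_Suc_iff[OF assms(1) True assms(2,3)]
    by (simp add: J_def ennreal_less_iff)
next
  case False
  then have "ennreal T < S n \<omega>" using S_le_iff[OF assms(1), of n] by (simp add: not_le)
  moreover have "ennreal t \<le> ennreal T" using assms by (simp add: ennreal_leI)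
  ultimately show ?thesis using False by (auto simp: J_def)
qed

lemma ex_J:
  assumes \<omega>: "\<omega> \<in> space M" and t: "0 < t" "t \<le> T"
  shows "\<exists>n. (\<omega>, t) \<in> J n"
proof -
  define n where "n = (LEAST n. t \<le> jnext n \<omega>)"
  have ex: "t \<le> jnext (njumps \<omega>) \<omega>" using t by (simp add: jnext_def)
  then have n: "t \<le> jnext n \<omega>" unfolding n_def by (rule LeastI)
  have le: "n \<le> njumps \<omega>" unfolding n_def using ex by (rule Least_le)
  have "jtime n \<omega> < t"
  proof (cases n)
    case 0
    then show ?thesis using jtime_0[OF \<omega>] t by simp
  next
    case (Suc m)
    then have "\<not> t \<le> jnext m \<omega>" unfolding n_def by (intro not_less_Least) simp
    then show ?thesis using Suc le by (simp add: jnext_def)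
  qed
  then show ?thesis using J_iff[of \<omega> t n] \<omega> t n le by auto
qed

lemma J_disjoint: "p \<in> J m \<Longrightarrow> p \<in> J n \<Longrightarrow> m = n"
proof -
  have "False" if "p \<in> J m" "p \<in> J n" "m < n" for m n
  proof -
    have "ennreal (snd p) \<le> S (Suc m) (fst p)" "S n (fst p) < ennreal (snd p)" "fst p \<in> space M" using that by (auto simp: J_def)
    then show False using S_mono[of "fst p" "Suc m" n] that(3) by (meson Suc_leI leD order_trans)
  qed
  then show "p \<in> J m \<Longrightarrow> p \<in> J n \<Longrightarrow> m = n" by (meson linorder_neqE_nat)
qed

lemma suminf_J:
  assumes "\<omega> \<in> space M" "0 < t" "t \<le> T"
  shows "(\<Sum>n. indicator (J n) (\<omega>, t)) = (1::ennreal)"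
proof -
  obtain n where "(\<omega>, t) \<in> J n" using ex_J[OF assms] by auto
  then have "(\<lambda>m. indicator (J m) (\<omega>, t)) = (\<lambda>m. if m = n then 1 else 0 :: ennreal)"
    using J_disjoint by (auto simp: indicator_def fun_eq_iff)
  then show ?thesis using sums_unique[OF sums_single[of n "\<lambda>_. 1::ennreal"]] by simp
qed

lemma comp_int_split_J:
  assumes \<omega>: "\<omega> \<in> space M" and H[measurable]: "H \<in> borel_measurable PE"
  shows "comp_int H \<omega> = (\<Sum>n. comp_int (\<lambda>p. H p * indicator (J n) (fst p)) \<omega>)"
proof -
  have "comp_int H \<omega> = comp_int (\<lambda>p. \<Sum>n. H p * indicator (J n) (fst p)) \<omega>"
  proof (rule comp_int_cong[OF \<omega>])
    fix t :: real and x :: 'e assume t: "0 < t" "t \<le> T"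
    have "(\<Sum>n. H ((\<omega>, t), x) * indicator (J n) (\<omega>, t)) = H ((\<omega>, t), x) * 1"
      unfolding suminf_J[OF \<omega> t, symmetric] by (rule ennreal_suminf_cmult)
    then show "H ((\<omega>, t), x) = (\<Sum>n. H ((\<omega>, t), x) * indicator (J n) (fst ((\<omega>, t), x)))" by simp
  qed
  also have "\<dots> = (\<Sum>n. comp_int (\<lambda>p. H p * indicator (J n) (fst p)) \<omega>)"
    unfolding comp_int_def by (intro nn_integral_suminf measurable_along_path[OF _ \<omega>]) measurable
  finally show ?thesis .
qed

lemma nn_integral_Q_split_J:
  assumes H[measurable]: "H \<in> borel_measurable PE"
  shows "(\<integral>\<^sup>+p. H p \<partial>Q) = (\<Sum>n. \<integral>\<^sup>+p. H p * indicator (J n) (fst p) \<partial>Q)"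
proof -
  have "(\<integral>\<^sup>+p. H p \<partial>Q) = (\<integral>\<^sup>+\<omega>. (\<Sum>n. comp_int (\<lambda>p. H p * indicator (J n) (fst p)) \<omega>) \<partial>M)"
    unfolding nn_integral_Q[OF H] by (intro nn_integral_cong comp_int_split_J H)
  also have "\<dots> = (\<Sum>n. \<integral>\<^sup>+\<omega>. comp_int (\<lambda>p. H p * indicator (J n) (fst p)) \<omega> \<partial>M)"
    by (intro nn_integral_suminf) measurable
  also have "\<dots> = (\<Sum>n. \<integral>\<^sup>+p. H p * indicator (J n) (fst p) \<partial>Q)"
    by (subst nn_integral_Q) auto
  finally show ?thesis .
qed

lemma space_\<mu>[simp]: "space (\<mu> \<omega>) = UNIV" and sets_\<mu>[simp]: "sets (\<mu> \<omega>) = sets (borel \<Otimes>\<^sub>M borel)"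
  by (simp_all add: jump_measure_def space_pair_measure)

lemma jumps_set: "\<omega> \<in> space M \<Longrightarrow> {n. 1 \<le> n \<and> S n \<omega> \<le> ennreal T} = {1..njumps \<omega>}"
  using S_le_iff by auto

lemma nn_integral_\<mu>:
  assumes \<omega>: "\<omega> \<in> space M" and G: "G \<in> borel_measurable (borel \<Otimes>\<^sub>M borel)"
  shows "(\<integral>\<^sup>+z. G z \<partial>\<mu> \<omega>) = (\<Sum>n=1..njumps \<omega>. G (jtime n \<omega>, X n \<omega>))"
  unfolding jump_measure_def jumps_set[OF \<omega>] using G
  by (subst nn_integral_distr) (auto simp: space_pair_measure nn_integral_count_space_finite jtime_def)

text \<open>
  The defining identity of the compensator, for a predictable integrand restricted to \<open>J n\<close>. The
  only jump in this interval is the next one.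
\<close>

lemma next_jump_identity:
  assumes H[measurable]: "H \<in> borel_measurable PE"
  shows "(\<integral>\<^sup>+p. H p * indicator (J n) (fst p) \<partial>Q)
    = (\<integral>\<^sup>+\<omega>. (if S (Suc n) \<omega> \<le> ennreal T then H ((\<omega>, jtime (Suc n) \<omega>), X (Suc n) \<omega>) else 0) \<partial>M)"
proof -
  define G where "G p = H p * indicator (J n) (fst p)" for p
  have [measurable]: "G \<in> borel_measurable PE" unfolding G_def by measurable
  have "predictable M T F borel (\<lambda>\<omega> t x. G ((\<omega>, t), x))" by (simp add: predictable_iff)
  from compensator_identity[OF this]
  have "(\<integral>\<^sup>+p. G p \<partial>Q) = (\<integral>\<^sup>+\<omega>. nn_integral_upto T (\<mu> \<omega>) (\<lambda>t x. G ((\<omega>, t), x)) \<partial>M)"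
    by (simp add: nn_integral_Q comp_int_upto cong: nn_integral_cong)
  also have "\<dots> = (\<integral>\<^sup>+\<omega>. (if S (Suc n) \<omega> \<le> ennreal T then H ((\<omega>, jtime (Suc n) \<omega>), X (Suc n) \<omega>) else 0) \<partial>M)"
  proof (rule nn_integral_cong)
    fix \<omega> assume \<omega>: "\<omega> \<in> space M"
    have mG: "(\<lambda>z. G (at_path \<omega> z) * indicator ({0..T} \<times> UNIV) z) \<in> borel_measurable (borel \<Otimes>\<^sub>M borel)"
      using measurable_along_path'[of G borel \<omega>] \<omega> by measurable
    have "nn_integral_upto T (\<mu> \<omega>) (\<lambda>t x. G ((\<omega>, t), x)) = (\<integral>\<^sup>+z. G (at_path \<omega> z) * indicator ({0..T} \<times> UNIV) z \<partial>\<mu> \<omega>)"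
      unfolding nn_integral_upto_def by (intro nn_integral_cong) (auto simp: at_path_def indicator_def)
    also have "\<dots> = (\<Sum>k=1..njumps \<omega>. G ((\<omega>, jtime k \<omega>), X k \<omega>))"
      unfolding nn_integral_\<mu>[OF \<omega> mG] using jtime[OF \<omega>] by (intro sum.cong) (auto simp: at_path_def)
    also have "\<dots> = (\<Sum>k=1..njumps \<omega>. if k = Suc n then H ((\<omega>, jtime k \<omega>), X k \<omega>) else 0)"
    proof (intro sum.cong refl)
      fix k assume k: "k \<in> {1..njumps \<omega>}"
      have "(\<omega>, jtime k \<omega>) \<in> J n \<longleftrightarrow> k = Suc n"
      proof
        assume "(\<omega>, jtime k \<omega>) \<in> J n"
        then have J: "n \<le> njumps \<omega>" "jtime n \<omega> < jtime k \<omega>" "jtime k \<omega> \<le> jnext n \<omega>"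
          using J_iff[OF \<omega>, of "jtime k \<omega>" n] jtime[OF \<omega>, of k] k by auto
        have "\<not> k \<le> n" using J jtime_less[OF \<omega>, of k n] by (cases "k = n") auto
        moreover have "\<not> Suc n < k" using J(3) jtime_less[OF \<omega>, of "Suc n" k] k by (auto simp: jnext_def)
        ultimately show "k = Suc n" by simp
      next
        assume "k = Suc n"
        then show "(\<omega>, jtime k \<omega>) \<in> J n"
          using J_iff[OF \<omega>, of "jtime k \<omega>" n] jtime[OF \<omega>, of k] k jtime_less[OF \<omega>, of n k] by (auto simp: jnext_def)
      qed
      then show "G ((\<omega>, jtime k \<omega>), X k \<omega>) = (if k = Suc n then H ((\<omega>, jtime k \<omega>), X k \<omega>) else 0)"
        by (auto simp: G_def)
    qed
    also have "\<dots> = (if S (Suc n) \<omega> \<le> ennreal T then H ((\<omega>, jtime (Suc n) \<omega>), X (Suc n) \<omega>) else 0)"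
      using S_le_iff[OF \<omega>, of "Suc n"] by (simp add: sum.delta)
    finally show "nn_integral_upto T (\<mu> \<omega>) (\<lambda>t x. G ((\<omega>, t), x)) = \<dots>" .
  qed
  finally show ?thesis unfolding G_def .
qed

lemma integral_\<mu>_Ioc:
  assumes \<omega>: "\<omega> \<in> space M" and Z: "predictable M T F borel Z" and t: "0 \<le> t"
  shows "integral_Ioc t T (\<mu> \<omega>) (Z \<omega>) = (\<Sum>k\<in>{k\<in>{1..njumps \<omega>}. t < jtime k \<omega>}. Z \<omega> (jtime k \<omega>) (X k \<omega>))"
proof -
  let ?Z = "\<lambda>p. Z (fst (fst p)) (snd (fst p)) (snd p)"
  have "?Z \<in> borel_measurable PE" using Z by (simp add: predictable_iff)
  from measurable_along_path'[OF this \<omega>]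
  have m: "(\<lambda>z. indicator ({t<..T} \<times> UNIV) z *\<^sub>R ?Z (at_path \<omega> z)) \<in> borel_measurable (borel \<Otimes>\<^sub>M borel)" by measurable
  have "integral_Ioc t T (\<mu> \<omega>) (Z \<omega>) = (\<integral>z. indicator ({t<..T} \<times> UNIV) z *\<^sub>R ?Z (at_path \<omega> z) \<partial>\<mu> \<omega>)"
    unfolding integral_Ioc_def set_lebesgue_integral_def using t
    by (intro Bochner_Integration.integral_cong) (auto simp: at_path_def indicator_def)
  also have "\<dots> = (\<Sum>k=1..njumps \<omega>. indicator ({t<..T} \<times> UNIV) (jtime k \<omega>, X k \<omega>) *\<^sub>R ?Z (at_path \<omega> (jtime k \<omega>, X k \<omega>)))"
    unfolding jump_measure_def jumps_set[OF \<omega>] using m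
    by (subst integral_distr) (auto simp: space_pair_measure lebesgue_integral_count_space_finite jtime_def)
  also have "\<dots> = (\<Sum>k=1..njumps \<omega>. if t < jtime k \<omega> then Z \<omega> (jtime k \<omega>) (X k \<omega>) else 0)"
    using jtime[OF \<omega>] by (intro sum.cong) (auto simp: at_path_def indicator_def)
  also have "\<dots> = (\<Sum>k\<in>{k\<in>{1..njumps \<omega>}. t < jtime k \<omega>}. Z \<omega> (jtime k \<omega>) (X k \<omega>))"
    by (rule sum.inter_filter[symmetric]) simp
  finally show ?thesis .
qed

lemma counting_process_eq:
  assumes \<omega>: "\<omega> \<in> space M" and t: "0 \<le> t" "t \<le> T" and n: "n \<le> njumps \<omega>" "jtime n \<omega> \<le> t" "n < njumps \<omega> \<Longrightarrow> t < jtime (Suc n) \<omega>"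
  shows "counting_process T S X \<omega> t = real n"
proof -
  have "emeasure (\<mu> \<omega>) ({0..t} \<times> UNIV) = (\<integral>\<^sup>+z. indicator ({0..t} \<times> UNIV) z \<partial>\<mu> \<omega>)"
    by (intro nn_integral_indicator[symmetric]) simp
  also have "\<dots> = (\<Sum>k=1..njumps \<omega>. indicator ({0..t} \<times> UNIV) (jtime k \<omega>, X k \<omega>))"
    by (rule nn_integral_\<mu>[OF \<omega>]) measurable
  also have "\<dots> = (\<Sum>k=1..njumps \<omega>. if k \<in> {1..n} then 1 else 0)"
  proof (intro sum.cong refl)
    fix k assume k: "k \<in> {1..njumps \<omega>}"
    have "jtime k \<omega> \<le> t \<longleftrightarrow> k \<le> n"
    proof
      assume kt: "jtime k \<omega> \<le> t"
      show "k \<le> n"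
      proof (rule ccontr)
        assume "\<not> k \<le> n"
        then have "Suc n \<le> k" "n < njumps \<omega>" using k by auto
        then have "jtime (Suc n) \<omega> \<le> jtime k \<omega>" using jtime_less[OF \<omega>, of "Suc n" k] k by (cases "Suc n = k") auto
        then show False using n(3) \<open>n < njumps \<omega>\<close> kt by simp
      qed
    next
      assume "k \<le> n"
      then show "jtime k \<omega> \<le> t" using jtime_less[OF \<omega>, of k n] n by (cases "k = n") auto
    qed
    then show "indicator ({0..t} \<times> UNIV) (jtime k \<omega>, X k \<omega>) = (if k \<in> {1..n} then 1 else 0 :: ennreal)"
      using k jtime[OF \<omega>, of k] by (auto simp: indicator_def)
  qed
  also have "\<dots> = (\<Sum>k\<in>{1..n}. 1)" using n(1) by (intro sum.mono_neutral_cong_right) auto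
  also have "\<dots> = ennreal (real n)" by (simp add: ennreal_of_nat_eq_real_of_nat)
  finally show ?thesis by (simp add: counting_process_def measure_def)
qed

section \<open>Left limits and path integrals\<close>

text \<open>The value at time \<open>0\<close> is a convention; \<open>\<nu>\<close> does not charge that time.\<close>

definition left_lim :: "('w \<Rightarrow> real \<Rightarrow> real) \<Rightarrow> 'w \<times> real \<Rightarrow> real" where
  "left_lim Y p = (if snd p = 0 then 0 else Lim (at_left (snd p)) (Y (fst p)))"

lemma left_lim_eqI: "0 < t \<Longrightarrow> (Y \<omega> \<longlongrightarrow> l) (at_left t) \<Longrightarrow> left_lim Y (\<omega>, t) = l"
  by (auto simp: left_lim_def intro!: tendsto_Lim)

text \<open>
  On a grid of mesh \<open>1 / (k + 1)\<close>, use the value of \<open>Y\<close> at the last grid point strictly before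
  \<open>t\<close>. These step processes only use the past, and they converge to the left limit.
\<close>

lemma left_lim_predictable:
  assumes Y: "adapted_cadlag M T F Y"
  shows "left_lim Y \<in> borel_measurable Pr"
proof (rule borel_measurable_LIMSEQ_real)
  \<comment> \<open>\<open>i k t / (k + 1)\<close> is the last grid point strictly before \<open>t\<close>\<close>
  define i where "i k t = nat (\<lceil>real (Suc k) * t\<rceil> - 1)" for k t
  define f where "f k p = (if real (i k (snd p)) / real (Suc k) < snd p then Y (fst p) (real (i k (snd p)) / real (Suc k)) else 0)" for k p
  show "f k \<in> borel_measurable Pr" for k
  proof -
    define g where "g j p = (if real j / real (Suc k) < snd p then Y (fst p) (real j / real (Suc k)) else 0)" for j :: nat and p
    have "g j \<in> borel_measurable Pr" for j
    proof (cases "real j / real (Suc k) \<le> T")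
      case True
      then have "(\<lambda>\<omega>. Y \<omega> (real j / real (Suc k))) \<in> borel_measurable (F (ennreal (real j / real (Suc k))))"
        using Y by (simp add: adapted_cadlag_def)
      from measurable_after_time[OF this, of 0] show ?thesis by (simp add: g_def[abs_def])
    next
      case False
      then have "g j p = 0" if "p \<in> space Pr" for p using that by (auto simp: g_def)
      then show ?thesis by (subst measurable_cong[of _ _ "\<lambda>_. 0"]) auto
    qed
    moreover have "(\<lambda>p. i k (snd p)) \<in> measurable Pr (count_space UNIV)" unfolding i_def by measurable
    ultimately have "(\<lambda>p. g (i k (snd p)) p) \<in> borel_measurable Pr" by (rule measurable_compose_countable)
    then show ?thesis by (simp add: f_def[abs_def] g_def)
  qed
  fix p assume p: "p \<in> space Pr"
  obtain \<omega> t where pt: "p = (\<omega>, t)" by (cases p)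
  have \<omega>: "\<omega> \<in> space M" and t: "0 \<le> t" "t \<le> T" using p pt by auto
  show "(\<lambda>k. f k p) \<longlonglongrightarrow> left_lim Y p"
  proof (cases "t = 0")
    case True
    have "\<not> real (i k t) / real (Suc k) < 0" for k by (simp add: not_less)
    then have "f k p = 0" for k using True by (simp only: f_def pt fst_conv snd_conv if_False)
    then show ?thesis using True by (simp add: left_lim_def pt)
  next
    case False
    then have t0: "0 < t" using t by simp
    have "cadlag_on T (Y \<omega>)" using Y \<omega> by (simp add: adapted_cadlag_def)
    then obtain l where l: "(Y \<omega> \<longlongrightarrow> l) (at_left t)" using t0 t by (auto simp: cadlag_on_def)
    define s where "s k = real (i k t) / real (Suc k)" for k
    have s1: "s k < t" and s2: "t - 1 / real (Suc k) \<le> s k" for k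
    proof -
      have pos: "0 < real (Suc k) * t" using t0 by simp
      then have c: "1 \<le> \<lceil>real (Suc k) * t\<rceil>" by linarith
      have ri: "real (i k t) = of_int \<lceil>real (Suc k) * t\<rceil> - 1" using c by (simp add: i_def of_nat_nat)
      have "real (i k t) < real (Suc k) * t" "real (Suc k) * t - 1 \<le> real (i k t)"
        unfolding ri by linarith+
      moreover have "j / c < t \<and> t - 1 / c \<le> j / c" if "0 < c" "j < c * t" "c * t - 1 \<le> j" for c j :: real
      proof
        show "j / c < t" using that by (simp add: divide_less_eq mult.commute)
        have "t - 1 / c = (c * t - 1) / c" using that by (simp add: diff_divide_distrib)
        then show "t - 1 / c \<le> j / c" using that by (simp add: divide_right_mono)
      qed
      ultimately show "s k < t" "t - 1 / real (Suc k) \<le> s k"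
        unfolding s_def by (metis of_nat_0_less_iff zero_less_Suc)+
    qed
    have "s \<longlonglongrightarrow> t"
    proof (rule tendsto_sandwich[of "\<lambda>k. t - 1 / real (Suc k)" _ _ "\<lambda>_. t"])
      have "(\<lambda>k. t - 1 / real (Suc k)) \<longlonglongrightarrow> t - 0"
        by (intro tendsto_diff tendsto_const LIMSEQ_Suc lim_1_over_n)
      then show "(\<lambda>k. t - 1 / real (Suc k)) \<longlonglongrightarrow> t" by simp
    qed (use s1 s2 in \<open>auto intro!: always_eventually less_imp_le\<close>)
    then have "filterlim s (at_left t) sequentially"
      using s1 by (auto simp: filterlim_at intro!: always_eventually less_imp_neq)
    then have "(\<lambda>k. Y \<omega> (s k)) \<longlonglongrightarrow> l" by (rule filterlim_compose[OF l])
    moreover have "f k p = Y \<omega> (s k)" for k using s1[of k] by (simp add: f_def pt s_def)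
    moreover have "left_lim Y p = l" unfolding pt by (rule left_lim_eqI[where Y=Y and \<omega>=\<omega>, OF t0 l])
    ultimately show ?thesis by simp
  qed
qed

definition path_integrable :: "(('w \<times> real) \<times> 'e \<Rightarrow> real) \<Rightarrow> 'w \<Rightarrow> bool" where
  "path_integrable g \<omega> \<longleftrightarrow> comp_int (\<lambda>p. ennreal \<bar>g p\<bar>) \<omega> < \<infinity>"

definition path_int :: "(('w \<times> real) \<times> 'e \<Rightarrow> real) \<Rightarrow> 'w \<Rightarrow> real \<Rightarrow> real" where
  "path_int g \<omega> t = (\<integral>z. indicator ({0<..t} \<times> UNIV) z *\<^sub>R g (at_path \<omega> z) \<partial>\<nu> \<omega>)"

lemma Ioc_times_sets: "\<omega> \<in> space M \<Longrightarrow> B \<in> sets borel \<Longrightarrow> B \<times> UNIV \<in> sets (\<nu> \<omega>)"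
  using sets_\<nu>[of \<omega>] sets.top[of "borel :: 'e measure"] by (auto intro!: pair_measureI)

lemma path_integrableD:
  assumes "\<omega> \<in> space M" "g \<in> borel_measurable PE" "path_integrable g \<omega>"
  shows "integrable (\<nu> \<omega>) (\<lambda>z. g (at_path \<omega> z))"
    and "\<And>B. B \<in> sets (\<nu> \<omega>) \<Longrightarrow> integrable (\<nu> \<omega>) (\<lambda>z. indicator B z *\<^sub>R g (at_path \<omega> z))"
proof -
  show "integrable (\<nu> \<omega>) (\<lambda>z. g (at_path \<omega> z))"
    using assms(3) measurable_along_path[OF assms(2,1)] by (simp add: integrable_iff_bounded path_integrable_def comp_int_def)
  then show "\<And>B. B \<in> sets (\<nu> \<omega>) \<Longrightarrow> integrable (\<nu> \<omega>) (\<lambda>z. indicator B z *\<^sub>R g (at_path \<omega> z))"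
    by (intro integrable_mult_indicator)
qed

lemma integral_\<nu>_Ioc:
  assumes \<omega>: "\<omega> \<in> space M" and g: "g \<in> borel_measurable PE" "path_integrable g \<omega>" and t: "0 \<le> t" "t \<le> T"
    and h: "\<And>s x. 0 < s \<Longrightarrow> s \<le> T \<Longrightarrow> h s x = g ((\<omega>, s), x)"
  shows "integral_Ioc t T (\<nu> \<omega>) h = path_int g \<omega> T - path_int g \<omega> t"
proof -
  have "path_int g \<omega> T - path_int g \<omega> t
     = (\<integral>z. indicator ({0<..T} \<times> UNIV) z *\<^sub>R g (at_path \<omega> z) - indicator ({0<..t} \<times> UNIV) z *\<^sub>R g (at_path \<omega> z) \<partial>\<nu> \<omega>)"
    unfolding path_int_def
    by (intro Bochner_Integration.integral_diff[symmetric] path_integrableD(2)[OF \<omega> g] Ioc_times_sets \<omega>) auto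
  also have "\<dots> = integral_Ioc t T (\<nu> \<omega>) h"
    unfolding integral_Ioc_def set_lebesgue_integral_def using t
    by (intro Bochner_Integration.integral_cong) (auto simp: indicator_def at_path_def h)
  finally show ?thesis ..
qed

lemma path_int_diff_bound:
  assumes \<omega>: "\<omega> \<in> space M" and g: "g \<in> borel_measurable PE" "path_integrable g \<omega>" and st: "0 \<le> s" "s \<le> t" "t \<le> T"
  shows "ennreal \<bar>path_int g \<omega> t - path_int g \<omega> s\<bar> \<le> (\<integral>\<^sup>+z. ennreal \<bar>g (at_path \<omega> z)\<bar> * indicator {s<..t} (fst z) \<partial>\<nu> \<omega>)"
proof -
  have "path_int g \<omega> t - path_int g \<omega> s
     = (\<integral>z. indicator ({0<..t} \<times> UNIV) z *\<^sub>R g (at_path \<omega> z) - indicator ({0<..s} \<times> UNIV) z *\<^sub>R g (at_path \<omega> z) \<partial>\<nu> \<omega>)"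
    unfolding path_int_def
    by (intro Bochner_Integration.integral_diff[symmetric] path_integrableD(2)[OF \<omega> g] Ioc_times_sets \<omega>) auto
  also have "\<dots> = (\<integral>z. indicator ({s<..t} \<times> UNIV) z *\<^sub>R g (at_path \<omega> z) \<partial>\<nu> \<omega>)"
    using st by (intro Bochner_Integration.integral_cong) (auto simp: indicator_def)
  finally have "ennreal \<bar>path_int g \<omega> t - path_int g \<omega> s\<bar>
     \<le> (\<integral>\<^sup>+z. ennreal (norm (indicator ({s<..t} \<times> UNIV) z *\<^sub>R g (at_path \<omega> z))) \<partial>\<nu> \<omega>)"
    using integral_norm_bound_ennreal[OF path_integrableD(2)[OF \<omega> g Ioc_times_sets[OF \<omega>, of "{s<..t}"]]] by simp
  also have "\<dots> = (\<integral>\<^sup>+z. ennreal \<bar>g (at_path \<omega> z)\<bar> * indicator {s<..t} (fst z) \<partial>\<nu> \<omega>)"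
    by (intro nn_integral_cong) (auto simp: indicator_def)
  finally show ?thesis .
qed

lemma path_int_0: "path_int g \<omega> 0 = 0" by (simp add: path_int_def)

lemma path_int_tendsto_right:
  assumes \<omega>: "\<omega> \<in> space M" and g: "g \<in> borel_measurable PE" "path_integrable g \<omega>"
  shows "(path_int g \<omega> \<longlongrightarrow> path_int g \<omega> t) (at_right t)"
proof (rule tendsto_at_right_sequentially[of t "t + 1"])
  fix S' :: "nat \<Rightarrow> real" assume S: "\<And>n. t < S' n" "S' \<longlonglongrightarrow> t"
  show "(\<lambda>n. path_int g \<omega> (S' n)) \<longlonglongrightarrow> path_int g \<omega> t"
    unfolding path_int_def
  proof (rule integral_dominated_convergence[where w="\<lambda>z. \<bar>g (at_path \<omega> z)\<bar>"])
    show "AE z in \<nu> \<omega>. (\<lambda>n. indicator ({0<..S' n} \<times> UNIV) z *\<^sub>R g (at_path \<omega> z)) \<longlonglongrightarrow> indicator ({0<..t} \<times> UNIV) z *\<^sub>R g (at_path \<omega> z)"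
    proof (rule AE_I2)
      fix z :: "real \<times> 'e"
      have "\<forall>\<^sub>F n in sequentially. indicator ({0<..t} \<times> UNIV) z *\<^sub>R g (at_path \<omega> z) = indicator ({0<..S' n} \<times> UNIV) z *\<^sub>R g (at_path \<omega> z)"
      proof (cases "fst z \<le> t")
        case True
        then show ?thesis using S(1) by (auto intro!: always_eventually simp: indicator_def mem_Times_iff intro: less_imp_le order_trans)
      next
        case False
        then have "\<forall>\<^sub>F n in sequentially. S' n < fst z" using S(2) by (intro order_tendstoD(2)) auto
        then show ?thesis by eventually_elim (use False in \<open>auto simp: indicator_def mem_Times_iff\<close>)
      qed
      then show "(\<lambda>n. indicator ({0<..S' n} \<times> UNIV) z *\<^sub>R g (at_path \<omega> z)) \<longlonglongrightarrow> indicator ({0<..t} \<times> UNIV) z *\<^sub>R g (at_path \<omega> z)"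
        by (rule Lim_transform_eventually[OF tendsto_const])
    qed
    show "(\<lambda>z. indicator ({0<..t} \<times> UNIV) z *\<^sub>R g (at_path \<omega> z)) \<in> borel_measurable (\<nu> \<omega>)"
      "\<And>n. (\<lambda>z. indicator ({0<..S' n} \<times> UNIV) z *\<^sub>R g (at_path \<omega> z)) \<in> borel_measurable (\<nu> \<omega>)"
      by (intro borel_measurable_integrable path_integrableD(2)[OF \<omega> g] Ioc_times_sets[OF \<omega>]; simp)+
    show "integrable (\<nu> \<omega>) (\<lambda>z. \<bar>g (at_path \<omega> z)\<bar>)" using path_integrableD(1)[OF \<omega> g] by simp
  qed (auto simp: indicator_def)
qed simp

text \<open>
  Dominated convergence gives the integral over the open interval, since for a general \<open>A\<close> there
  may be an atom at \<open>t\<close>.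
\<close>

lemma path_int_tendsto_left:
  assumes \<omega>: "\<omega> \<in> space M" and g: "g \<in> borel_measurable PE" "path_integrable g \<omega>"
  shows "(path_int g \<omega> \<longlongrightarrow> (\<integral>z. indicator ({0<..<t} \<times> UNIV) z *\<^sub>R g (at_path \<omega> z) \<partial>\<nu> \<omega>)) (at_left t)"
proof (rule tendsto_at_left_sequentially[of "t - 1"])
  fix S' :: "nat \<Rightarrow> real" assume S: "\<And>n. S' n < t" "S' \<longlonglongrightarrow> t"
  show "(\<lambda>n. path_int g \<omega> (S' n)) \<longlonglongrightarrow> (\<integral>z. indicator ({0<..<t} \<times> UNIV) z *\<^sub>R g (at_path \<omega> z) \<partial>\<nu> \<omega>)"
    unfolding path_int_def
  proof (rule integral_dominated_convergence[where w="\<lambda>z. \<bar>g (at_path \<omega> z)\<bar>"])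
    show "AE z in \<nu> \<omega>. (\<lambda>n. indicator ({0<..S' n} \<times> UNIV) z *\<^sub>R g (at_path \<omega> z)) \<longlonglongrightarrow> indicator ({0<..<t} \<times> UNIV) z *\<^sub>R g (at_path \<omega> z)"
    proof (rule AE_I2)
      fix z :: "real \<times> 'e"
      have "\<forall>\<^sub>F n in sequentially. indicator ({0<..<t} \<times> UNIV) z *\<^sub>R g (at_path \<omega> z) = indicator ({0<..S' n} \<times> UNIV) z *\<^sub>R g (at_path \<omega> z)"
      proof (cases "fst z < t")
        case True
        then have "\<forall>\<^sub>F n in sequentially. fst z < S' n" using S(2) by (intro order_tendstoD(1)) auto
        then show ?thesis by eventually_elim (use True in \<open>auto simp: indicator_def mem_Times_iff\<close>)
      next
        case False
        have "\<not> fst z \<le> S' n" for n using False S(1)[of n] by simp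
        then show ?thesis using False by (auto intro!: always_eventually simp: indicator_def mem_Times_iff)
      qed
      then show "(\<lambda>n. indicator ({0<..S' n} \<times> UNIV) z *\<^sub>R g (at_path \<omega> z)) \<longlonglongrightarrow> indicator ({0<..<t} \<times> UNIV) z *\<^sub>R g (at_path \<omega> z)"
        by (rule Lim_transform_eventually[OF tendsto_const])
    qed
    show "(\<lambda>z. indicator ({0<..<t} \<times> UNIV) z *\<^sub>R g (at_path \<omega> z)) \<in> borel_measurable (\<nu> \<omega>)"
      "\<And>n. (\<lambda>z. indicator ({0<..S' n} \<times> UNIV) z *\<^sub>R g (at_path \<omega> z)) \<in> borel_measurable (\<nu> \<omega>)"
      by (intro borel_measurable_integrable path_integrableD(2)[OF \<omega> g] Ioc_times_sets[OF \<omega>]; simp)+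
    show "integrable (\<nu> \<omega>) (\<lambda>z. \<bar>g (at_path \<omega> z)\<bar>)" using path_integrableD(1)[OF \<omega> g] by simp
  qed (auto simp: indicator_def)
qed simp

lemma AE_\<nu>_no_atom:
  assumes \<omega>: "\<omega> \<in> space M" and c: "continuous_on {0..T} (A \<omega>)"
  shows "AE z in \<nu> \<omega>. fst z \<noteq> t"
proof (rule AE_\<nu>_time[OF \<omega>])
  show "AE s in dA \<omega>. s \<noteq> t"
    using stieltjes_no_atoms[OF less_imp_le[OF T_pos] A_path(2,3)[OF \<omega>] c, of t]
    by (intro AE_not_in[where N="{t}", simplified]) (simp add: null_sets_def)
qed measurable

lemma path_int_continuous_left:
  assumes \<omega>: "\<omega> \<in> space M" and g: "g \<in> borel_measurable PE" "path_integrable g \<omega>" and c: "continuous_on {0..T} (A \<omega>)"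
  shows "(path_int g \<omega> \<longlongrightarrow> path_int g \<omega> t) (at_left t)"
proof -
  have "(\<integral>z. indicator ({0<..<t} \<times> UNIV) z *\<^sub>R g (at_path \<omega> z) \<partial>\<nu> \<omega>) = path_int g \<omega> t"
    unfolding path_int_def
  proof (rule integral_cong_AE)
    show "AE z in \<nu> \<omega>. indicator ({0<..<t} \<times> UNIV) z *\<^sub>R g (at_path \<omega> z) = indicator ({0<..t} \<times> UNIV) z *\<^sub>R g (at_path \<omega> z)"
      using AE_\<nu>_no_atom[OF \<omega> c, of t] by eventually_elim (auto simp: indicator_def)
  qed (intro borel_measurable_integrable path_integrableD(2)[OF \<omega> g] Ioc_times_sets[OF \<omega>]; simp)+
  then show ?thesis using path_int_tendsto_left[OF \<omega> g, of t] by simp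
qed

lemma path_int_adapted:
  assumes g[measurable]: "g \<in> borel_measurable PE" and int: "\<And>\<omega>. \<omega> \<in> space M \<Longrightarrow> path_integrable g \<omega>" and t: "0 \<le> t" "t \<le> T"
  shows "(\<lambda>\<omega>. path_int g \<omega> t) \<in> borel_measurable (F (ennreal t))"
proof -
  have [measurable]: "(\<lambda>\<omega>. comp_int (\<lambda>p. ennreal (g p) * indicator {0<..t} (snd (fst p))) \<omega>) \<in> borel_measurable (F (ennreal t))"
    "(\<lambda>\<omega>. comp_int (\<lambda>p. ennreal (- g p) * indicator {0<..t} (snd (fst p))) \<omega>) \<in> borel_measurable (F (ennreal t))"
    by (intro comp_int_adapted t; measurable)+
  have "path_int g \<omega> t = enn2real (comp_int (\<lambda>p. ennreal (g p) * indicator {0<..t} (snd (fst p))) \<omega>)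
     - enn2real (comp_int (\<lambda>p. ennreal (- g p) * indicator {0<..t} (snd (fst p))) \<omega>)" if \<omega>: "\<omega> \<in> space M" for \<omega>
  proof -
    have "path_int g \<omega> t = enn2real (\<integral>\<^sup>+z. ennreal (indicator ({0<..t} \<times> UNIV) z *\<^sub>R g (at_path \<omega> z)) \<partial>\<nu> \<omega>)
      - enn2real (\<integral>\<^sup>+z. ennreal (- (indicator ({0<..t} \<times> UNIV) z *\<^sub>R g (at_path \<omega> z))) \<partial>\<nu> \<omega>)"
      unfolding path_int_def by (intro real_lebesgue_integral_def path_integrableD(2)[OF \<omega> g int[OF \<omega>]] Ioc_times_sets[OF \<omega>]) simp
    also have "(\<integral>\<^sup>+z. ennreal (indicator ({0<..t} \<times> UNIV) z *\<^sub>R g (at_path \<omega> z)) \<partial>\<nu> \<omega>)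
       = comp_int (\<lambda>p. ennreal (g p) * indicator {0<..t} (snd (fst p))) \<omega>"
      unfolding comp_int_def
      by (intro nn_integral_cong_AE, use AE_\<nu>_Ioc[OF \<omega>] in eventually_elim) (auto simp: indicator_def at_path_def)
    also have "(\<integral>\<^sup>+z. ennreal (- (indicator ({0<..t} \<times> UNIV) z *\<^sub>R g (at_path \<omega> z))) \<partial>\<nu> \<omega>)
       = comp_int (\<lambda>p. ennreal (- g p) * indicator {0<..t} (snd (fst p))) \<omega>"
      unfolding comp_int_def
      by (intro nn_integral_cong_AE, use AE_\<nu>_Ioc[OF \<omega>] in eventually_elim) (auto simp: indicator_def at_path_def)
    finally show ?thesis .
  qed
  then show ?thesis by (subst measurable_cong) auto
qed

definition uncurried :: "('w \<Rightarrow> real \<Rightarrow> 'e \<Rightarrow> real) \<Rightarrow> ('w \<times> real) \<times> 'e \<Rightarrow> real" where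
  "uncurried Z p = Z (fst (fst p)) (snd (fst p)) (snd p)"

lemma predictable_unc: "predictable M T F borel Z \<longleftrightarrow> uncurried Z \<in> borel_measurable PE"
  by (simp add: predictable_iff uncurried_def[abs_def])

text \<open>
  The \<open>n\<close>-th jump as a point of the predictable space. On paths with fewer jumps its time is
  \<open>0\<close>; clipping only makes it immediate that the point lies in the space.
\<close>

definition jump_at :: "nat \<Rightarrow> 'w \<Rightarrow> ('w \<times> real) \<times> 'e" where
  "jump_at n \<omega> = ((\<omega>, clip T (jtime n \<omega>)), X n \<omega>)"

lemma jtime_measurable[measurable]: "jtime n \<in> borel_measurable M"
  unfolding jtime_def[abs_def] by measurable

lemma jump_at_measurable[measurable]: "jump_at (Suc n) \<in> measurable M PE"
proof -
  have "(\<lambda>\<omega>. (\<omega>, jtime (Suc n) \<omega>)) \<in> measurable M (F (ennreal T) \<Otimes>\<^sub>M borel)"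
    by (intro measurable_Pair measurable_F_M[of _ "ennreal T"] measurable_ident_sets[OF refl] jtime_measurable)
  from measurable_compose[OF this measurable_clip[of T]] T_pos
  have [measurable]: "(\<lambda>\<omega>. (\<omega>, clip T (jtime (Suc n) \<omega>))) \<in> measurable M Pr" by simp
  show ?thesis unfolding jump_at_def[abs_def] by measurable
qed

lemma jump_at_eq: "\<omega> \<in> space M \<Longrightarrow> n \<le> njumps \<omega> \<Longrightarrow> jump_at n \<omega> = ((\<omega>, jtime n \<omega>), X n \<omega>)"
  using jtime[of \<omega> n] by (simp add: jump_at_def min_absorb2 max_absorb2)

text \<open>
  The indicator of an event known at the \<open>n\<close>-th jump is predictable after that jump, so it may
  be carried into the integrand.
\<close>

lemma next_jump_identity_hist:
  assumes B: "B \<in> sets (hist n)" and H[measurable]: "H \<in> borel_measurable PE"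
  shows "(\<integral>\<^sup>+\<omega>. indicator B \<omega> * comp_int (\<lambda>p. H p * indicator (J n) (fst p)) \<omega> \<partial>M)
    = (\<integral>\<^sup>+\<omega>. indicator B \<omega> * (if S (Suc n) \<omega> \<le> ennreal T then H (jump_at (Suc n) \<omega>) else 0) \<partial>M)"
proof -
  define G where "G p = (if S n (fst (fst p)) < ennreal (snd (fst p)) then indicator B (fst (fst p)) else 0) * H p" for p
  have "(\<lambda>p. if S n (fst p) < ennreal (snd p) then indicator B (fst p) else 0 :: ennreal) \<in> borel_measurable Pr"
    using B by (intro measurable_after_S) auto
  from measurable_compose[OF measurable_fst this]
  have [measurable]: "G \<in> borel_measurable PE" unfolding G_def[abs_def] by measurable
  have "(\<integral>\<^sup>+\<omega>. indicator B \<omega> * comp_int (\<lambda>p. H p * indicator (J n) (fst p)) \<omega> \<partial>M)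
    = (\<integral>\<^sup>+\<omega>. comp_int (\<lambda>p. G p * indicator (J n) (fst p)) \<omega> \<partial>M)"
  proof (rule nn_integral_cong)
    fix \<omega> assume \<omega>: "\<omega> \<in> space M"
    have "indicator B \<omega> * comp_int (\<lambda>p. H p * indicator (J n) (fst p)) \<omega>
       = comp_int (\<lambda>p. indicator B (fst (fst p)) * (H p * indicator (J n) (fst p))) \<omega>"
      by (intro comp_int_cmult_\<omega>[OF \<omega>, symmetric]) measurable
    also have "\<dots> = comp_int (\<lambda>p. G p * indicator (J n) (fst p)) \<omega>"
      by (intro comp_int_cong[OF \<omega>]) (auto simp: G_def J_def indicator_def)
    finally show "indicator B \<omega> * comp_int (\<lambda>p. H p * indicator (J n) (fst p)) \<omega> = \<dots>" .
  qed
  also have "\<dots> = (\<integral>\<^sup>+p. G p * indicator (J n) (fst p) \<partial>Q)" by (intro nn_integral_Q[symmetric]) measurable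
  also have "\<dots> = (\<integral>\<^sup>+\<omega>. (if S (Suc n) \<omega> \<le> ennreal T then G ((\<omega>, jtime (Suc n) \<omega>), X (Suc n) \<omega>) else 0) \<partial>M)"
    by (rule next_jump_identity) measurable
  also have "\<dots> = (\<integral>\<^sup>+\<omega>. indicator B \<omega> * (if S (Suc n) \<omega> \<le> ennreal T then H (jump_at (Suc n) \<omega>) else 0) \<partial>M)"
  proof (rule nn_integral_cong)
    fix \<omega> assume \<omega>: "\<omega> \<in> space M"
    show "(if S (Suc n) \<omega> \<le> ennreal T then G ((\<omega>, jtime (Suc n) \<omega>), X (Suc n) \<omega>) else 0)
      = indicator B \<omega> * (if S (Suc n) \<omega> \<le> ennreal T then H (jump_at (Suc n) \<omega>) else 0)"
    proof (cases "S (Suc n) \<omega> \<le> ennreal T")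
      case True
      then have n: "Suc n \<le> njumps \<omega>" using S_le_iff[OF \<omega>] by simp
      have "S n \<omega> < ennreal (jtime (Suc n) \<omega>)"
        using jtime(1)[OF \<omega> n] S_less[OF \<omega>, of n "Suc n"] S_le_iff[OF \<omega>, of n] n by simp
      then show ?thesis using True jump_at_eq[OF \<omega> n] by (simp add: G_def)
    qed simp
  qed
  finally show ?thesis .
qed

section \<open>The equation with a prescribed driver\<close>

text \<open>The backward equation whose driver \<open>g\<close> is prescribed and does not depend on the solution.\<close>

definition linear_solution ::
  "('w \<Rightarrow> real) \<Rightarrow> (('w \<times> real) \<times> 'e \<Rightarrow> real) \<Rightarrow> ('w \<Rightarrow> real \<Rightarrow> real) \<Rightarrow> ('w \<Rightarrow> real \<Rightarrow> 'e \<Rightarrow> real) \<Rightarrow> bool" where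
  "linear_solution \<eta> g Y Z \<longleftrightarrow>
     adapted_cadlag M T F Y \<and> uncurried Z \<in> borel_measurable PE \<and> g \<in> borel_measurable PE \<and>
     (AE \<omega> in M. path_integrable g \<omega>) \<and>
     (AE \<omega> in M. \<forall>t\<in>{0..T}. Y \<omega> t + integral_Ioc t T (\<mu> \<omega>) (Z \<omega>) = \<eta> \<omega> + (path_int g \<omega> T - path_int g \<omega> t))"

text \<open>
  The constant value of \<open>Y t + path_int g \<omega> t\<close> on the interval from the \<open>n\<close>-th jump to the next
  one, as dictated by the equation.
\<close>

definition level :: "('w \<Rightarrow> real) \<Rightarrow> (('w \<times> real) \<times> 'e \<Rightarrow> real) \<Rightarrow> ('w \<Rightarrow> real \<Rightarrow> 'e \<Rightarrow> real) \<Rightarrow> nat \<Rightarrow> 'w \<Rightarrow> real" where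
  "level \<eta> g Z n \<omega> = \<eta> \<omega> + path_int g \<omega> T - (\<Sum>k\<in>{n<..njumps \<omega>}. Z \<omega> (jtime k \<omega>) (X k \<omega>))"

lemma ex_interval:
  assumes \<omega>: "\<omega> \<in> space M" and t: "0 \<le> t" "t \<le> T"
  shows "\<exists>n\<le>njumps \<omega>. jtime n \<omega> \<le> t \<and> (n < njumps \<omega> \<longrightarrow> t < jtime (Suc n) \<omega>)"
proof -
  define n where "n = (GREATEST n. n \<le> njumps \<omega> \<and> jtime n \<omega> \<le> t)"
  have "n \<le> njumps \<omega> \<and> jtime n \<omega> \<le> t"
    unfolding n_def by (rule GreatestI_nat[of _ 0 "njumps \<omega>"]) (auto simp: jtime_0[OF \<omega>] t)
  moreover have "t < jtime (Suc n) \<omega>" if "n < njumps \<omega>"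
  proof (rule ccontr)
    assume "\<not> t < jtime (Suc n) \<omega>"
    then have "Suc n \<le> n" unfolding n_def using that unfolding n_def
      by (intro Greatest_le_nat[of _ _ "njumps \<omega>"]) auto
    then show False by simp
  qed
  ultimately show ?thesis by auto
qed

lemma jumps_after:
  assumes \<omega>: "\<omega> \<in> space M" and n: "n \<le> njumps \<omega>" "jtime n \<omega> \<le> t" "n < njumps \<omega> \<Longrightarrow> t < jtime (Suc n) \<omega>"
  shows "{k\<in>{1..njumps \<omega>}. t < jtime k \<omega>} = {n<..njumps \<omega>}"
proof (intro set_eqI iffI)
  fix k assume k: "k \<in> {k\<in>{1..njumps \<omega>}. t < jtime k \<omega>}"
  have "\<not> k \<le> n" using k n jtime_less[OF \<omega>, of k n] by (cases "k = n") auto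
  then show "k \<in> {n<..njumps \<omega>}" using k by auto
next
  fix k assume k: "k \<in> {n<..njumps \<omega>}"
  then have "t < jtime (Suc n) \<omega>" using n by auto
  also have "\<dots> \<le> jtime k \<omega>" using jtime_less[OF \<omega>, of "Suc n" k] k by (cases "k = Suc n") auto
  finally show "k \<in> {k\<in>{1..njumps \<omega>}. t < jtime k \<omega>}" using k by auto
qed

lemma equation_iff_level:
  assumes \<omega>: "\<omega> \<in> space M" and Z: "uncurried Z \<in> borel_measurable PE"
    and t: "0 \<le> t" "t \<le> T" and n: "n \<le> njumps \<omega>" "jtime n \<omega> \<le> t" "n < njumps \<omega> \<Longrightarrow> t < jtime (Suc n) \<omega>"
  shows "Y \<omega> t + integral_Ioc t T (\<mu> \<omega>) (Z \<omega>) = \<eta> \<omega> + (path_int g \<omega> T - path_int g \<omega> t)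
    \<longleftrightarrow> Y \<omega> t = level \<eta> g Z n \<omega> - path_int g \<omega> t"
  using integral_\<mu>_Ioc[OF \<omega> Z[folded predictable_unc] t(1)] jumps_after[OF \<omega> n] by (auto simp: level_def)

lemma level_Suc:
  assumes "n < njumps \<omega>"
  shows "level \<eta> g Z (Suc n) \<omega> = level \<eta> g Z n \<omega> + Z \<omega> (jtime (Suc n) \<omega>) (X (Suc n) \<omega>)"
proof -
  have "{n<..njumps \<omega>} = insert (Suc n) {Suc n<..njumps \<omega>}" using assms by auto
  then show ?thesis by (simp add: level_def)
qed

lemma level_njumps: "level \<eta> g Z (njumps \<omega>) \<omega> = \<eta> \<omega> + path_int g \<omega> T"
  by (simp add: level_def)

lemma level_unique:
  assumes "\<And>n. n < njumps \<omega> \<Longrightarrow> c (Suc n) = c n + Z \<omega> (jtime (Suc n) \<omega>) (X (Suc n) \<omega>)"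
    and "c (njumps \<omega>) = \<eta> \<omega> + path_int g \<omega> T" and "n \<le> njumps \<omega>"
  shows "level \<eta> g Z n \<omega> = c n"
  using assms(3)
proof (induction rule: inc_induct)
  case base
  then show ?case using assms(2) by (simp add: level_njumps)
next
  case (step n)
  then show ?case using level_Suc[of n \<omega> \<eta> g Z] assms(1)[of n] by simp
qed

text \<open>
  The properties of almost every path of a solution that the pathwise arguments use, with the
  equation in the resolved form of \<open>equation_iff_level\<close>.
\<close>

definition regular_path :: "('w \<Rightarrow> real) \<Rightarrow> (('w \<times> real) \<times> 'e \<Rightarrow> real) \<Rightarrow> ('w \<Rightarrow> real \<Rightarrow> real) \<Rightarrow> ('w \<Rightarrow> real \<Rightarrow> 'e \<Rightarrow> real) \<Rightarrow> 'w \<Rightarrow> bool" where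
  "regular_path \<eta> g Y Z \<omega> \<longleftrightarrow> \<omega> \<in> space M \<and> continuous_on {0..T} (A \<omega>) \<and> path_integrable g \<omega> \<and>
    (\<forall>n\<le>njumps \<omega>. \<forall>t\<in>{0..T}. jtime n \<omega> \<le> t \<longrightarrow> (n < njumps \<omega> \<longrightarrow> t < jtime (Suc n) \<omega>) \<longrightarrow>
       Y \<omega> t = level \<eta> g Z n \<omega> - path_int g \<omega> t)"

lemma AE_regular_path:
  assumes "linear_solution \<eta> g Y Z"
  shows "AE \<omega> in M. regular_path \<eta> g Y Z \<omega>"
proof -
  have Z: "uncurried Z \<in> borel_measurable PE" using assms by (simp add: linear_solution_def)
  have 1: "AE \<omega> in M. path_integrable g \<omega>" using assms by (simp add: linear_solution_def)
  have 2: "AE \<omega> in M. \<forall>t\<in>{0..T}. Y \<omega> t + integral_Ioc t T (\<mu> \<omega>) (Z \<omega>) = \<eta> \<omega> + (path_int g \<omega> T - path_int g \<omega> t)"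
    using assms by (simp add: linear_solution_def)
  show ?thesis
    using AE_space AE_continuous 1 2
  proof eventually_elim
    case (elim \<omega>)
    show ?case unfolding regular_path_def
    proof (intro conjI allI impI ballI elim(1,2,3))
      fix n t assume n: "n \<le> njumps \<omega>" "t \<in> {0..T}" "jtime n \<omega> \<le> t" "n < njumps \<omega> \<longrightarrow> t < jtime (Suc n) \<omega>"
      then show "Y \<omega> t = level \<eta> g Z n \<omega> - path_int g \<omega> t"
        using equation_iff_level[OF elim(1) Z, of t n Y \<eta> g] elim(4) by auto
    qed
  qed
qed

lemma regular_path_left_lim:
  assumes reg: "regular_path \<eta> g Y Z \<omega>" and g: "g \<in> borel_measurable PE"
    and n: "n \<le> njumps \<omega>" and t: "jtime n \<omega> < t" "t \<le> jnext n \<omega>"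
  shows "left_lim Y (\<omega>, t) = level \<eta> g Z n \<omega> - path_int g \<omega> t"
proof (rule left_lim_eqI)
  have \<omega>: "\<omega> \<in> space M" and c: "continuous_on {0..T} (A \<omega>)" and i: "path_integrable g \<omega>"
    using reg by (auto simp: regular_path_def)
  have tT: "t \<le> T" using jnext[OF \<omega> n] t by simp
  have j0: "0 \<le> jtime n \<omega>" using jtime[OF \<omega> n] by simp
  show "0 < t" using t j0 by simp
  have "((\<lambda>s. level \<eta> g Z n \<omega> - path_int g \<omega> s) \<longlongrightarrow> level \<eta> g Z n \<omega> - path_int g \<omega> t) (at_left t)"
    by (intro tendsto_intros path_int_continuous_left[OF \<omega> g i c])
  moreover have "\<forall>\<^sub>F s in at_left t. level \<eta> g Z n \<omega> - path_int g \<omega> s = Y \<omega> s"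
  proof -
    have "\<forall>\<^sub>F s in at_left t. s \<in> {jtime n \<omega><..<t}" by (intro eventually_at_leftI[OF _ t(1)]) auto
    then show ?thesis
    proof eventually_elim
      case (elim s)
      then have "Y \<omega> s = level \<eta> g Z n \<omega> - path_int g \<omega> s"
      proof -
        have "s \<in> {0..T}" "jtime n \<omega> \<le> s" "n < njumps \<omega> \<longrightarrow> s < jtime (Suc n) \<omega>"
          using elim t j0 tT by (auto simp: jnext_def)
        then show ?thesis using reg n unfolding regular_path_def by blast
      qed
      then show ?case by simp
    qed
  qed
  ultimately show "(Y \<omega> \<longlongrightarrow> level \<eta> g Z n \<omega> - path_int g \<omega> t) (at_left t)"
    by (rule Lim_transform_eventually)
qed

lemma regular_path_at_jump:
  assumes reg: "regular_path \<eta> g Y Z \<omega>" and n: "n \<le> njumps \<omega>"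
  shows "Y \<omega> (jtime n \<omega>) = level \<eta> g Z n \<omega> - path_int g \<omega> (jtime n \<omega>)"
proof -
  have \<omega>: "\<omega> \<in> space M" using reg by (simp add: regular_path_def)
  show ?thesis
    using reg n jtime[OF \<omega> n] jtime_less[OF \<omega>, of n "Suc n"] by (auto simp: regular_path_def)
qed

lemma regular_path_jump:
  assumes reg: "regular_path \<eta> g Y Z \<omega>" and g: "g \<in> borel_measurable PE" and n: "n < njumps \<omega>"
  shows "Y \<omega> (jtime (Suc n) \<omega>) = left_lim Y (\<omega>, jtime (Suc n) \<omega>) + Z \<omega> (jtime (Suc n) \<omega>) (X (Suc n) \<omega>)"
proof -
  have \<omega>: "\<omega> \<in> space M" using reg by (simp add: regular_path_def)
  have "left_lim Y (\<omega>, jtime (Suc n) \<omega>) = level \<eta> g Z n \<omega> - path_int g \<omega> (jtime (Suc n) \<omega>)"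
    using n jtime_less[OF \<omega>, of n "Suc n"] by (intro regular_path_left_lim[OF reg g]) (auto simp: jnext_def)
  then show ?thesis using regular_path_at_jump[OF reg, of "Suc n"] level_Suc[OF n, of \<eta> g Z] n by simp
qed

lemma comp_int_time:
  assumes \<omega>: "\<omega> \<in> space M" and h: "h \<in> borel_measurable Pr"
  shows "comp_int (\<lambda>p. h (fst p)) \<omega> = (\<integral>\<^sup>+t\<in>{0..T}. h (\<omega>, t) \<partial>dA \<omega>)"
proof -
  have "comp_int (\<lambda>p. h (fst p)) \<omega> = (\<integral>\<^sup>+t\<in>{0..T}. (\<integral>\<^sup>+x. h (\<omega>, t) \<partial>\<phi> \<omega> t) \<partial>dA \<omega>)"
    using comp_int_eq[OF \<omega>, of "\<lambda>p. h (fst p)"] h by simp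
  also have "\<dots> = (\<integral>\<^sup>+t\<in>{0..T}. h (\<omega>, t) \<partial>dA \<omega>)"
    using prob_space.emeasure_space_1[OF prob_space_\<phi>[OF \<omega>]]
    by (intro nn_integral_cong) (auto simp: indicator_def)
  finally show ?thesis .
qed

definition expA :: "real \<Rightarrow> 'w \<times> real \<Rightarrow> real" where "expA \<beta> p = exp (\<beta> * A (fst p) (snd p))"

lemma expA_measurable[measurable]: "expA \<beta> \<in> borel_measurable Pr"
  unfolding expA_def[abs_def] by measurable

lemma expA_pos: "0 < expA \<beta> p" by (simp add: expA_def)

text \<open>
  Up to the next jump, \<open>Y\<close> is the continuous function \<open>level - path_int\<close>, whose increments are
  bounded by integrals of \<open>\<bar>g\<bar>\<close>. So the backward exponential bound applies, with \<open>\<nu> \<omega>\<close> as \<open>\<gamma>\<close>.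
\<close>

lemma regular_path_energy:
  assumes reg: "regular_path \<eta> g Y Z \<omega>" and g[measurable]: "g \<in> borel_measurable PE" and Y: "adapted_cadlag M T F Y"
    and n: "n \<le> njumps \<omega>" and \<beta>: "0 \<le> \<beta>"
  shows "ennreal (expA \<beta> (\<omega>, jtime n \<omega>) * \<bar>Y \<omega> (jtime n \<omega>)\<bar>)
      + ennreal \<beta> * comp_int (\<lambda>p. ennreal (expA \<beta> (fst p) * \<bar>left_lim Y (fst p)\<bar>) * indicator (J n) (fst p)) \<omega>
    \<le> ennreal (expA \<beta> (\<omega>, jnext n \<omega>) * \<bar>level \<eta> g Z n \<omega> - path_int g \<omega> (jnext n \<omega>)\<bar>)
      + comp_int (\<lambda>p. ennreal (expA \<beta> (fst p) * \<bar>g p\<bar>) * indicator (J n) (fst p)) \<omega>"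
proof -
  have \<omega>: "\<omega> \<in> space M" and c: "continuous_on {0..T} (A \<omega>)" and i: "path_integrable g \<omega>"
    using reg by (auto simp: regular_path_def)
  note [measurable] = left_lim_predictable[OF Y]
  let ?p = "jtime n \<omega>" and ?q = "jnext n \<omega>"
  have pq: "0 \<le> ?p" "?p \<le> ?q" "?q \<le> T" using jtime[OF \<omega> n] jnext[OF \<omega> n] by auto
  define y where "y s = level \<eta> g Z n \<omega> - path_int g \<omega> s" for s
  have main: "ennreal (exp (\<beta> * A \<omega> ?p) * \<bar>y ?p\<bar>) + (\<integral>\<^sup>+s\<in>{?p<..?q}. ennreal (\<beta> * exp (\<beta> * A \<omega> s) * \<bar>y s\<bar>) \<partial>dA \<omega>)
     \<le> ennreal (exp (\<beta> * A \<omega> ?q) * \<bar>y ?q\<bar>) + (\<integral>\<^sup>+z. ennreal (exp (\<beta> * A \<omega> (fst z))) * ennreal \<bar>g (at_path \<omega> z)\<bar> * indicator {?p<..?q} (fst z) \<partial>\<nu> \<omega>)"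
  proof (rule stieltjes_backward_exp_bound[OF less_imp_le[OF T_pos] A_path(2,3)[OF \<omega>] c pq \<beta>])
    show "sigma_finite_measure (\<nu> \<omega>)" using finite_\<nu>[OF \<omega>] by (rule finite_measure.sigma_finite_measure)
    show "fst \<in> borel_measurable (\<nu> \<omega>)" by (rule fst_measurable_\<nu>[OF \<omega>])
    show "(\<lambda>z. ennreal \<bar>g (at_path \<omega> z)\<bar>) \<in> borel_measurable (\<nu> \<omega>)"
      by (rule measurable_along_path[OF _ \<omega>, of "\<lambda>p. ennreal \<bar>g p\<bar>"]) measurable
    fix s assume s: "?p \<le> s" "s \<le> ?q"
    have "ennreal \<bar>y s\<bar> \<le> ennreal (\<bar>y ?q\<bar> + \<bar>path_int g \<omega> ?q - path_int g \<omega> s\<bar>)"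
      by (intro ennreal_leI) (simp add: y_def)
    also have "\<dots> = ennreal \<bar>y ?q\<bar> + ennreal \<bar>path_int g \<omega> ?q - path_int g \<omega> s\<bar>" by simp
    also have "\<dots> \<le> ennreal \<bar>y ?q\<bar> + (\<integral>\<^sup>+z. ennreal \<bar>g (at_path \<omega> z)\<bar> * indicator {s<..?q} (fst z) \<partial>\<nu> \<omega>)"
      using s pq by (intro add_left_mono path_int_diff_bound[OF \<omega> g i]) auto
    finally show "ennreal \<bar>y s\<bar> \<le> \<dots>" .
  qed
  have e1: "ennreal \<beta> * comp_int (\<lambda>p. ennreal (expA \<beta> (fst p) * \<bar>left_lim Y (fst p)\<bar>) * indicator (J n) (fst p)) \<omega>
      = (\<integral>\<^sup>+s\<in>{?p<..?q}. ennreal (\<beta> * exp (\<beta> * A \<omega> s) * \<bar>y s\<bar>) \<partial>dA \<omega>)"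
  proof -
    have "ennreal \<beta> * comp_int (\<lambda>p. ennreal (expA \<beta> (fst p) * \<bar>left_lim Y (fst p)\<bar>) * indicator (J n) (fst p)) \<omega>
      = comp_int (\<lambda>p. ennreal \<beta> * (ennreal (expA \<beta> (fst p) * \<bar>left_lim Y (fst p)\<bar>) * indicator (J n) (fst p))) \<omega>"
      by (intro comp_int_cmult[symmetric] \<omega>) measurable
    also have "\<dots> = (\<integral>\<^sup>+t\<in>{0..T}. ennreal \<beta> * (ennreal (expA \<beta> (\<omega>, t) * \<bar>left_lim Y (\<omega>, t)\<bar>) * indicator (J n) (\<omega>, t)) \<partial>dA \<omega>)"
      by (rule comp_int_time[OF \<omega>, of "\<lambda>p. ennreal \<beta> * (ennreal (expA \<beta> p * \<bar>left_lim Y p\<bar>) * indicator (J n) p)"]) measurable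
    also have "\<dots> = (\<integral>\<^sup>+s\<in>{?p<..?q}. ennreal (\<beta> * exp (\<beta> * A \<omega> s) * \<bar>y s\<bar>) \<partial>dA \<omega>)"
    proof (rule nn_integral_cong)
      fix t
      show "ennreal \<beta> * (ennreal (expA \<beta> (\<omega>, t) * \<bar>left_lim Y (\<omega>, t)\<bar>) * indicator (J n) (\<omega>, t)) * indicator {0..T} t
        = ennreal (\<beta> * exp (\<beta> * A \<omega> t) * \<bar>y t\<bar>) * indicator {?p<..?q} t"
      proof (cases "t \<in> {?p<..?q}")
        case True
        then have "(\<omega>, t) \<in> J n" "t \<in> {0..T}" using J_iff[OF \<omega>, of t n] n pq by auto
        then show ?thesis using True regular_path_left_lim[OF reg g n, of t] \<beta>
          by (simp add: y_def expA_def ennreal_mult mult.assoc)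
      next
        case False
        then have "(\<omega>, t) \<notin> J n" if "t \<in> {0..T}" using J_iff[OF \<omega>, of t n] that by auto
        then show ?thesis using False by (auto simp: indicator_def)
      qed
    qed
    finally show ?thesis .
  qed
  have e2: "comp_int (\<lambda>p. ennreal (expA \<beta> (fst p) * \<bar>g p\<bar>) * indicator (J n) (fst p)) \<omega>
    = (\<integral>\<^sup>+z. ennreal (exp (\<beta> * A \<omega> (fst z))) * ennreal \<bar>g (at_path \<omega> z)\<bar> * indicator {?p<..?q} (fst z) \<partial>\<nu> \<omega>)"
    unfolding comp_int_def
  proof (intro nn_integral_cong_AE, use AE_\<nu>_Ioc[OF \<omega>] in eventually_elim)
    fix z :: "real \<times> 'e" assume z: "0 < fst z \<and> fst z \<le> T"
    then show "ennreal (expA \<beta> (fst (at_path \<omega> z)) * \<bar>g (at_path \<omega> z)\<bar>) * indicator (J n) (fst (at_path \<omega> z))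
      = ennreal (exp (\<beta> * A \<omega> (fst z))) * ennreal \<bar>g (at_path \<omega> z)\<bar> * indicator {?p<..?q} (fst z)"
      using J_iff[OF \<omega>, of "fst z" n] n by (auto simp: at_path_def expA_def ennreal_mult indicator_def)
  qed
  show ?thesis
    using main regular_path_at_jump[OF reg n] unfolding e1 e2 by (simp add: y_def expA_def)
qed

section \<open>The energy estimate on one interval\<close>

definition jump_value :: "real \<Rightarrow> ('w \<Rightarrow> real \<Rightarrow> real) \<Rightarrow> ('w \<Rightarrow> real \<Rightarrow> 'e \<Rightarrow> real) \<Rightarrow> ('w \<times> real) \<times> 'e \<Rightarrow> ennreal" where
  "jump_value \<beta> Y Z p = ennreal (expA \<beta> (fst p) * \<bar>left_lim Y (fst p) + uncurried Z p\<bar>)"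

text \<open>
  At a jump the value of \<open>Y\<close> is written as left limit plus \<open>Z\<close>, because this is a predictable
  function evaluated at the jump. At time \<open>0\<close> there is no jump.
\<close>

definition start_value :: "real \<Rightarrow> ('w \<Rightarrow> real \<Rightarrow> real) \<Rightarrow> ('w \<Rightarrow> real \<Rightarrow> 'e \<Rightarrow> real) \<Rightarrow> nat \<Rightarrow> 'w \<Rightarrow> ennreal" where
  "start_value \<beta> Y Z n \<omega> = (if n = 0 then ennreal \<bar>Y \<omega> 0\<bar>
     else if S n \<omega> \<le> ennreal T then jump_value \<beta> Y Z (jump_at n \<omega>) else 0)"

text \<open>Only the paths with exactly \<open>n\<close> jumps reach \<open>T\<close> in the \<open>n\<close>-th interval.\<close>

definition end_value :: "real \<Rightarrow> ('w \<Rightarrow> real) \<Rightarrow> nat \<Rightarrow> 'w \<Rightarrow> ennreal" where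
  "end_value \<beta> \<eta> n \<omega> = (if S n \<omega> \<le> ennreal T \<and> ennreal T < S (Suc n) \<omega> then ennreal (expA \<beta> (\<omega>, T) * \<bar>\<eta> \<omega>\<bar>) else 0)"

definition Y_int :: "real \<Rightarrow> ('w \<Rightarrow> real \<Rightarrow> real) \<Rightarrow> nat \<Rightarrow> 'w \<Rightarrow> ennreal" where
  "Y_int \<beta> Y n = comp_int (\<lambda>p. ennreal (expA \<beta> (fst p) * \<bar>left_lim Y (fst p)\<bar>) * indicator (J n) (fst p))"

definition g_int :: "real \<Rightarrow> (('w \<times> real) \<times> 'e \<Rightarrow> real) \<Rightarrow> nat \<Rightarrow> 'w \<Rightarrow> ennreal" where
  "g_int \<beta> g n = comp_int (\<lambda>p. ennreal (expA \<beta> (fst p) * \<bar>g p\<bar>) * indicator (J n) (fst p))"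

lemma linear_solutionD:
  assumes "linear_solution \<eta> g Y Z"
  shows "adapted_cadlag M T F Y" "uncurried Z \<in> borel_measurable PE" "g \<in> borel_measurable PE"
    "left_lim Y \<in> borel_measurable Pr" "AE \<omega> in M. path_integrable g \<omega>"
  using assms left_lim_predictable by (auto simp: linear_solution_def)

lemma start_value_measurable:
  assumes Y: "adapted_cadlag M T F Y" and Z[measurable]: "uncurried Z \<in> borel_measurable PE"
  shows "start_value \<beta> Y Z n \<in> borel_measurable M"
proof (cases n)
  case 0
  have "(\<lambda>\<omega>. Y \<omega> 0) \<in> borel_measurable (F (ennreal 0))" using Y T_pos unfolding adapted_cadlag_def by (auto dest: bspec[of _ _ 0])
  then have [measurable]: "(\<lambda>\<omega>. Y \<omega> 0) \<in> borel_measurable M" by (rule measurable_F_M)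
  show ?thesis unfolding start_value_def[abs_def] using 0 by simp
next
  case (Suc m)
  note [measurable] = left_lim_predictable[OF Y]
  have [measurable]: "jump_value \<beta> Y Z \<in> borel_measurable PE" unfolding jump_value_def[abs_def] by measurable
  have "(\<lambda>\<omega>. if S (Suc m) \<omega> \<le> ennreal T then jump_value \<beta> Y Z (jump_at (Suc m) \<omega>) else 0) \<in> borel_measurable M"
    by measurable
  then show ?thesis unfolding start_value_def[abs_def] Suc by simp
qed

lemma end_value_measurable: "\<eta> \<in> borel_measurable M \<Longrightarrow> end_value \<beta> \<eta> n \<in> borel_measurable M"
proof -
  assume [measurable]: "\<eta> \<in> borel_measurable M"
  have [measurable]: "(\<lambda>\<omega>. expA \<beta> (\<omega>, T)) \<in> borel_measurable M"
    using T_pos by (intro measurable_F_M[OF measurable_at_time]) auto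
  show ?thesis unfolding end_value_def[abs_def] by measurable
qed

lemma J_empty_after_last:
  assumes "\<omega> \<in> space M" "njumps \<omega> < n"
  shows "comp_int (\<lambda>p. H p * indicator (J n) (fst p)) \<omega> = 0"
proof -
  have "comp_int (\<lambda>p. H p * indicator (J n) (fst p)) \<omega> = comp_int (\<lambda>p. 0) \<omega>"
    using assms J_iff[OF assms(1), of _ n] by (intro comp_int_cong) (auto simp: indicator_def)
  then show ?thesis by (simp add: comp_int_def)
qed

text \<open>
  The interval ends at the next jump, where the left limit of \<open>Y\<close> counts, or at \<open>T\<close>, where \<open>Y\<close>
  is the terminal value.
\<close>

lemma energy_pathwise:
  assumes sol: "linear_solution \<eta> g Y Z" and \<beta>: "0 \<le> \<beta>"
  shows "AE \<omega> in M. start_value \<beta> Y Z n \<omega> + ennreal \<beta> * Y_int \<beta> Y n \<omega>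
    \<le> (if S (Suc n) \<omega> \<le> ennreal T then ennreal (expA \<beta> (fst (jump_at (Suc n) \<omega>)) * \<bar>left_lim Y (fst (jump_at (Suc n) \<omega>))\<bar>) else 0)
      + (end_value \<beta> \<eta> n \<omega> + g_int \<beta> g n \<omega>)"
  using AE_regular_path[OF sol]
proof eventually_elim
  case (elim \<omega>)
  note reg = elim
  have \<omega>: "\<omega> \<in> space M" using reg by (simp add: regular_path_def)
  note d = linear_solutionD[OF sol]
  show ?case
  proof (cases "n \<le> njumps \<omega>")
    case False
    then have "start_value \<beta> Y Z n \<omega> = 0" using S_le_iff[OF \<omega>, of n] by (auto simp: start_value_def)
    moreover have "Y_int \<beta> Y n \<omega> = 0" unfolding Y_int_def using False by (intro J_empty_after_last[OF \<omega>]) simp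
    ultimately show ?thesis by simp
  next
    case True
    have sv: "start_value \<beta> Y Z n \<omega> = ennreal (expA \<beta> (\<omega>, jtime n \<omega>) * \<bar>Y \<omega> (jtime n \<omega>)\<bar>)"
    proof (cases n)
      case 0
      then show ?thesis using jtime_0[OF \<omega>] A_path(1)[OF \<omega>] by (simp add: start_value_def expA_def)
    next
      case (Suc m)
      then have "m < njumps \<omega>" using True by simp
      then show ?thesis using regular_path_jump[OF reg d(3), of m] True S_le_iff[OF \<omega>, of n] jump_at_eq[OF \<omega> True] Suc
        by (simp add: start_value_def jump_value_def uncurried_def)
    qed
    have ev: "ennreal (expA \<beta> (\<omega>, jnext n \<omega>) * \<bar>level \<eta> g Z n \<omega> - path_int g \<omega> (jnext n \<omega>)\<bar>)
      \<le> (if S (Suc n) \<omega> \<le> ennreal T then ennreal (expA \<beta> (fst (jump_at (Suc n) \<omega>)) * \<bar>left_lim Y (fst (jump_at (Suc n) \<omega>))\<bar>) else 0)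
        + end_value \<beta> \<eta> n \<omega>"
    proof (cases "n < njumps \<omega>")
      case n: True
      then have "left_lim Y (\<omega>, jtime (Suc n) \<omega>) = level \<eta> g Z n \<omega> - path_int g \<omega> (jtime (Suc n) \<omega>)"
        using jtime_less[OF \<omega>, of n "Suc n"] by (intro regular_path_left_lim[OF reg d(3)]) (auto simp: jnext_def)
      then show ?thesis using n S_le_iff[OF \<omega>, of "Suc n"] jump_at_eq[OF \<omega>, of "Suc n"] by (simp add: jnext_def)
    next
      case False
      then have n: "n = njumps \<omega>" using True by simp
      then have "level \<eta> g Z n \<omega> - path_int g \<omega> (jnext n \<omega>) = \<eta> \<omega>"
        using level_njumps[of \<eta> g Z \<omega>] by (simp add: jnext_def)
      then show ?thesis using n S_le_iff[OF \<omega>, of n] S_le_iff[OF \<omega>, of "Suc n"]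
        by (auto simp: end_value_def jnext_def not_le)
    qed
    show ?thesis
      using regular_path_energy[OF reg d(3) d(1) True \<beta>] ev unfolding sv Y_int_def[symmetric] g_int_def[symmetric]
      by (subst add.assoc[symmetric]) (rule order_trans[OF _ add_right_mono])
  qed
qed

text \<open>
  In expectation, the left limit at the next jump equals the integral of
  \<open>exp (\<beta> * A) * \<bar>left_lim Y\<bar>\<close> over the interval, by the compensator identity. Cancelling it
  turns \<open>\<beta>\<close> into \<open>\<beta> - 1\<close>, but it has to be finite for that; hence the event \<open>B\<close>.
\<close>

lemma energy_localized:
  assumes sol: "linear_solution \<eta> g Y Z" and \<beta>: "1 \<le> \<beta>" and \<eta>[measurable]: "\<eta> \<in> borel_measurable M"
    and B: "B \<in> sets (hist n)" and fin: "(\<integral>\<^sup>+\<omega>. indicator B \<omega> * Y_int \<beta> Y n \<omega> \<partial>M) < \<infinity>"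
  shows "(\<integral>\<^sup>+\<omega>. indicator B \<omega> * start_value \<beta> Y Z n \<omega> \<partial>M) + ennreal (\<beta> - 1) * (\<integral>\<^sup>+\<omega>. indicator B \<omega> * Y_int \<beta> Y n \<omega> \<partial>M)
    \<le> (\<integral>\<^sup>+\<omega>. end_value \<beta> \<eta> n \<omega> \<partial>M) + (\<integral>\<^sup>+\<omega>. g_int \<beta> g n \<omega> \<partial>M)"
proof -
  note d[measurable] = linear_solutionD(2,3,4)[OF sol]
  note [measurable] = start_value_measurable[OF linear_solutionD(1,2)[OF sol]] end_value_measurable[OF \<eta>]
  have [measurable]: "Y_int \<beta> Y n \<in> borel_measurable M" "g_int \<beta> g n \<in> borel_measurable M"
    unfolding Y_int_def g_int_def by measurable
  have [measurable]: "B \<in> sets M" using B sets_hist_M by auto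
  define H where "H p = ennreal (expA \<beta> (fst p) * \<bar>left_lim Y (fst p)\<bar>)" for p :: "('w \<times> real) \<times> 'e"
  have [measurable]: "H \<in> borel_measurable PE" unfolding H_def by measurable
  define u where "u \<omega> = (if S (Suc n) \<omega> \<le> ennreal T then H (jump_at (Suc n) \<omega>) else 0)" for \<omega>
  have [measurable]: "u \<in> borel_measurable M" unfolding u_def by measurable
  let ?a = "\<integral>\<^sup>+\<omega>. indicator B \<omega> * Y_int \<beta> Y n \<omega> \<partial>M"
  let ?v = "\<integral>\<^sup>+\<omega>. indicator B \<omega> * start_value \<beta> Y Z n \<omega> \<partial>M"
  \<comment> \<open>the end values at the next jump have the same expectation as \<open>Y_int\<close>\<close>
  have a: "?a = (\<integral>\<^sup>+\<omega>. indicator B \<omega> * u \<omega> \<partial>M)"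
    using next_jump_identity_hist[OF B, of H] by (simp add: Y_int_def H_def u_def)
  have "?v + ennreal \<beta> * ?a = (\<integral>\<^sup>+\<omega>. indicator B \<omega> * (start_value \<beta> Y Z n \<omega> + ennreal \<beta> * Y_int \<beta> Y n \<omega>) \<partial>M)"
  proof -
    have "ennreal \<beta> * ?a = (\<integral>\<^sup>+\<omega>. ennreal \<beta> * (indicator B \<omega> * Y_int \<beta> Y n \<omega>) \<partial>M)"
      by (rule nn_integral_cmult[symmetric]) measurable
    then have "?v + ennreal \<beta> * ?a = (\<integral>\<^sup>+\<omega>. indicator B \<omega> * start_value \<beta> Y Z n \<omega> + ennreal \<beta> * (indicator B \<omega> * Y_int \<beta> Y n \<omega>) \<partial>M)"
      by (simp only:) (rule nn_integral_add[symmetric]; measurable)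
    then show ?thesis by (simp add: distrib_left mult.left_commute)
  qed
  also have "\<dots> \<le> (\<integral>\<^sup>+\<omega>. indicator B \<omega> * u \<omega> + (end_value \<beta> \<eta> n \<omega> + g_int \<beta> g n \<omega>) \<partial>M)"
  proof (rule nn_integral_mono_AE)
    show "AE \<omega> in M. indicator B \<omega> * (start_value \<beta> Y Z n \<omega> + ennreal \<beta> * Y_int \<beta> Y n \<omega>)
        \<le> indicator B \<omega> * u \<omega> + (end_value \<beta> \<eta> n \<omega> + g_int \<beta> g n \<omega>)"
      using energy_pathwise[OF sol, of \<beta> n] \<beta> by (auto elim!: eventually_mono simp: indicator_def u_def H_def)
  qed
  also have "\<dots> = ?a + ((\<integral>\<^sup>+\<omega>. end_value \<beta> \<eta> n \<omega> \<partial>M) + (\<integral>\<^sup>+\<omega>. g_int \<beta> g n \<omega> \<partial>M))"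
    unfolding a by (simp add: nn_integral_add)
  finally have "?a + (?v + ennreal (\<beta> - 1) * ?a) \<le> ?a + ((\<integral>\<^sup>+\<omega>. end_value \<beta> \<eta> n \<omega> \<partial>M) + (\<integral>\<^sup>+\<omega>. g_int \<beta> g n \<omega> \<partial>M))"
  proof -
    assume le: "?v + ennreal \<beta> * ?a \<le> ?a + ((\<integral>\<^sup>+\<omega>. end_value \<beta> \<eta> n \<omega> \<partial>M) + (\<integral>\<^sup>+\<omega>. g_int \<beta> g n \<omega> \<partial>M))"
    have "ennreal \<beta> = 1 + ennreal (\<beta> - 1)" using \<beta> by (simp flip: ennreal_1 ennreal_plus)
    then have "?v + ennreal \<beta> * ?a = ?a + (?v + ennreal (\<beta> - 1) * ?a)" by (simp add: distrib_right ac_simps)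
    with le show ?thesis by simp
  qed
  then show ?thesis using fin by (auto simp: ennreal_add_left_cancel_le)
qed

text \<open>
  The integrability needed for the cancellation, localized by events known at the \<open>n\<close>-th jump.
  No more is known about the explicit solution of a linear equation before its norm has been
  estimated.
\<close>

definition locally_finite :: "real \<Rightarrow> ('w \<Rightarrow> real \<Rightarrow> real) \<Rightarrow> nat \<Rightarrow> bool" where
  "locally_finite \<beta> Y n \<longleftrightarrow> (\<exists>B::nat \<Rightarrow> 'w set. range B \<subseteq> sets (hist n) \<and> incseq B \<and>
     (AE \<omega> in M. S n \<omega> \<le> ennreal T \<longrightarrow> (\<exists>k. \<omega> \<in> B k)) \<and>
     (\<forall>k. (\<integral>\<^sup>+\<omega>. indicator (B k) \<omega> * Y_int \<beta> Y n \<omega> \<partial>M) < \<infinity>))"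

lemma energy_interval:
  assumes sol: "linear_solution \<eta> g Y Z" and \<beta>: "1 \<le> \<beta>" and \<eta>[measurable]: "\<eta> \<in> borel_measurable M"
    and loc: "locally_finite \<beta> Y n"
  shows "(\<integral>\<^sup>+\<omega>. start_value \<beta> Y Z n \<omega> \<partial>M) + ennreal (\<beta> - 1) * (\<integral>\<^sup>+\<omega>. Y_int \<beta> Y n \<omega> \<partial>M)
    \<le> (\<integral>\<^sup>+\<omega>. end_value \<beta> \<eta> n \<omega> \<partial>M) + (\<integral>\<^sup>+\<omega>. g_int \<beta> g n \<omega> \<partial>M)"
proof -
  obtain B where B: "\<And>k. B k \<in> sets (hist n)" "incseq B" "AE \<omega> in M. S n \<omega> \<le> ennreal T \<longrightarrow> (\<exists>k. \<omega> \<in> B k)"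
    "\<And>k. (\<integral>\<^sup>+\<omega>. indicator (B k) \<omega> * Y_int \<beta> Y n \<omega> \<partial>M) < \<infinity>"
    using loc by (auto simp: locally_finite_def)
  note d[measurable] = linear_solutionD(2,3,4)[OF sol]
  note [measurable] = start_value_measurable[OF linear_solutionD(1,2)[OF sol]] end_value_measurable[OF \<eta>]
  have [measurable]: "Y_int \<beta> Y n \<in> borel_measurable M" unfolding Y_int_def by measurable
  have BM[measurable]: "B k \<in> sets M" for k using B(1)[of k] sets_hist_M by auto
  have conv: "(\<lambda>k. \<integral>\<^sup>+\<omega>. indicator (B k) \<omega> * h \<omega> \<partial>M) \<longlonglongrightarrow> (\<integral>\<^sup>+\<omega>. h \<omega> \<partial>M)"
    if [measurable]: "h \<in> borel_measurable M" and z: "\<And>\<omega>. \<omega> \<in> space M \<Longrightarrow> ennreal T < S n \<omega> \<Longrightarrow> h \<omega> = 0" for h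
  proof -
    have mono: "indicator (B i) \<omega> \<le> (indicator (B j) \<omega> :: ennreal)" if "i \<le> j" for i j \<omega>
      using incseqD[OF B(2) that] by (auto simp: indicator_def)
    have inc: "incseq (\<lambda>k \<omega>. indicator (B k) \<omega> * h \<omega>)"
      by (auto simp: incseq_def le_fun_def intro!: mult_right_mono mono)
    have "(\<integral>\<^sup>+\<omega>. h \<omega> \<partial>M) = (\<integral>\<^sup>+\<omega>. (SUP k. indicator (B k) \<omega> * h \<omega>) \<partial>M)"
    proof (rule nn_integral_cong_AE)
      show "AE \<omega> in M. h \<omega> = (SUP k. indicator (B k) \<omega> * h \<omega>)"
        using B(3) AE_space
      proof eventually_elim
        case (elim \<omega>)
        show ?case
        proof (cases "S n \<omega> \<le> ennreal T")
          case True
          then obtain k where k: "\<omega> \<in> B k" using elim by auto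
          show ?thesis
          proof (rule antisym)
            show "h \<omega> \<le> (SUP k. indicator (B k) \<omega> * h \<omega>)" using k by (intro SUP_upper2[of k]) auto
            show "(SUP k. indicator (B k) \<omega> * h \<omega>) \<le> h \<omega>" by (intro SUP_least) (auto simp: indicator_def)
          qed
        next
          case False
          then show ?thesis using z[OF elim(2)] by (simp add: not_le)
        qed
      qed
    qed
    also have "\<dots> = (SUP k. \<integral>\<^sup>+\<omega>. indicator (B k) \<omega> * h \<omega> \<partial>M)"
      by (intro nn_integral_monotone_convergence_SUP inc) measurable
    finally show ?thesis
      using inc by (auto intro!: LIMSEQ_SUP simp: incseq_def le_fun_def intro!: nn_integral_mono mult_right_mono mono)
  qed
  have z1: "start_value \<beta> Y Z n \<omega> = 0" if "\<omega> \<in> space M" "ennreal T < S n \<omega>" for \<omega>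
    using that S_0 by (auto simp: start_value_def)
  have z2: "Y_int \<beta> Y n \<omega> = 0" if "\<omega> \<in> space M" "ennreal T < S n \<omega>" for \<omega>
    unfolding Y_int_def using that S_le_iff[of \<omega> n] by (intro J_empty_after_last) (auto simp: not_le[symmetric])
  have "(\<lambda>k. (\<integral>\<^sup>+\<omega>. indicator (B k) \<omega> * start_value \<beta> Y Z n \<omega> \<partial>M) + ennreal (\<beta> - 1) * (\<integral>\<^sup>+\<omega>. indicator (B k) \<omega> * Y_int \<beta> Y n \<omega> \<partial>M))
    \<longlonglongrightarrow> (\<integral>\<^sup>+\<omega>. start_value \<beta> Y Z n \<omega> \<partial>M) + ennreal (\<beta> - 1) * (\<integral>\<^sup>+\<omega>. Y_int \<beta> Y n \<omega> \<partial>M)"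
    by (intro tendsto_add ennreal_tendsto_cmult conv z1 z2) simp_all
  then show ?thesis
    by (rule LIMSEQ_le_const2) (use energy_localized[OF sol \<beta> \<eta> B(1) B(4)] in blast)
qed

section \<open>Weighted norms and the energy estimate\<close>

text \<open>
  The number of jumps strictly before the given time, a predictable substitute for the counting
  process. The two differ at jump times only.
\<close>

definition jump_index :: "'w \<times> real \<Rightarrow> nat" where
  "jump_index p = (LEAST n. \<not> S (Suc n) (fst p) < ennreal (snd p))"

lemma jump_index_measurable[measurable]: "jump_index \<in> measurable Pr (count_space UNIV)"
  unfolding jump_index_def[abs_def] by measurable

lemma jump_index_J: "p \<in> J n \<Longrightarrow> jump_index p = n"
  unfolding jump_index_def
proof (rule Least_equality)
  assume p: "p \<in> J n"
  then show "\<not> S (Suc n) (fst p) < ennreal (snd p)" by (auto simp: J_def not_less)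
  fix m assume "\<not> S (Suc m) (fst p) < ennreal (snd p)"
  then have "ennreal (snd p) \<le> S (Suc m) (fst p)" by simp
  moreover have "S n (fst p) < ennreal (snd p)" "fst p \<in> space M" using p by (auto simp: J_def)
  ultimately show "n \<le> m" using S_mono[of "fst p" "Suc m" n] by (meson leD le_less_trans not_less_eq_eq order_trans)
qed

definition weight :: "real \<Rightarrow> real \<Rightarrow> 'w \<times> real \<Rightarrow> real" where
  "weight \<alpha> \<beta> p = \<alpha> ^ jump_index p * expA \<beta> p"

lemma weight_measurable[measurable]: "weight \<alpha> \<beta> \<in> borel_measurable Pr"
proof -
  have "(\<lambda>p. \<alpha> ^ jump_index p) \<in> borel_measurable Pr"
    by (rule measurable_compose[OF jump_index_measurable]) simp
  then show ?thesis unfolding weight_def[abs_def] by measurable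
qed

lemma weight_pos: "0 < \<alpha> \<Longrightarrow> 0 < weight \<alpha> \<beta> p" by (simp add: weight_def expA_pos)

lemma weight_J: "p \<in> J n \<Longrightarrow> weight \<alpha> \<beta> p = \<alpha> ^ n * expA \<beta> p" by (simp add: weight_def jump_index_J)

lemma nn_integral_weight_split:
  assumes \<alpha>: "0 < \<alpha>" and h[measurable]: "h \<in> borel_measurable PE" and h0: "\<And>p. 0 \<le> h p"
  shows "(\<integral>\<^sup>+p. ennreal (weight \<alpha> \<beta> (fst p) * h p) \<partial>Q)
    = (\<Sum>n. ennreal (\<alpha> ^ n) * (\<integral>\<^sup>+\<omega>. comp_int (\<lambda>p. ennreal (expA \<beta> (fst p) * h p) * indicator (J n) (fst p)) \<omega> \<partial>M))"
proof -
  have "(\<integral>\<^sup>+p. ennreal (weight \<alpha> \<beta> (fst p) * h p) * indicator (J n) (fst p) \<partial>Q)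
    = ennreal (\<alpha> ^ n) * (\<integral>\<^sup>+\<omega>. comp_int (\<lambda>p. ennreal (expA \<beta> (fst p) * h p) * indicator (J n) (fst p)) \<omega> \<partial>M)" for n
  proof -
    have "(\<integral>\<^sup>+p. ennreal (weight \<alpha> \<beta> (fst p) * h p) * indicator (J n) (fst p) \<partial>Q)
      = (\<integral>\<^sup>+p. ennreal (\<alpha> ^ n) * (ennreal (expA \<beta> (fst p) * h p) * indicator (J n) (fst p)) \<partial>Q)"
    proof (rule nn_integral_cong)
      fix p
      show "ennreal (weight \<alpha> \<beta> (fst p) * h p) * indicator (J n) (fst p)
        = ennreal (\<alpha> ^ n) * (ennreal (expA \<beta> (fst p) * h p) * indicator (J n) (fst p))"
        using \<alpha> h0[of p] expA_pos[of \<beta> "fst p"]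
        by (cases "fst p \<in> J n") (simp_all add: weight_J mult.assoc ennreal_mult[symmetric])
    qed
    also have "\<dots> = ennreal (\<alpha> ^ n) * (\<integral>\<^sup>+p. ennreal (expA \<beta> (fst p) * h p) * indicator (J n) (fst p) \<partial>Q)"
      by (intro nn_integral_cmult) measurable
    also have "(\<integral>\<^sup>+p. ennreal (expA \<beta> (fst p) * h p) * indicator (J n) (fst p) \<partial>Q)
      = (\<integral>\<^sup>+\<omega>. comp_int (\<lambda>p. ennreal (expA \<beta> (fst p) * h p) * indicator (J n) (fst p)) \<omega> \<partial>M)"
      by (intro nn_integral_Q) measurable
    finally show ?thesis .
  qed
  then show ?thesis by (subst nn_integral_Q_split_J) auto
qed

definition terminal_norm :: "real \<Rightarrow> real \<Rightarrow> ('w \<Rightarrow> real) \<Rightarrow> ennreal" where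
  "terminal_norm \<alpha> \<beta> \<eta> = (\<integral>\<^sup>+\<omega>. ennreal (\<alpha> ^ njumps \<omega> * exp (\<beta> * A \<omega> T) * \<bar>\<eta> \<omega>\<bar>) \<partial>M)"

abbreviation wnorm :: "real \<Rightarrow> real \<Rightarrow> (('w \<times> real) \<times> 'e \<Rightarrow> real) \<Rightarrow> ennreal" where
  "wnorm \<alpha> \<beta> h \<equiv> (\<integral>\<^sup>+p. ennreal (weight \<alpha> \<beta> (fst p) * \<bar>h p\<bar>) \<partial>Q)"

lemma sum_end_value:
  assumes \<alpha>: "0 < \<alpha>" and \<eta>: "\<eta> \<in> borel_measurable M"
  shows "(\<Sum>n. ennreal (\<alpha> ^ n) * (\<integral>\<^sup>+\<omega>. end_value \<beta> \<eta> n \<omega> \<partial>M)) = terminal_norm \<alpha> \<beta> \<eta>"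
proof -
  note [measurable] = end_value_measurable[OF \<eta>]
  have "(\<Sum>n. ennreal (\<alpha> ^ n) * (\<integral>\<^sup>+\<omega>. end_value \<beta> \<eta> n \<omega> \<partial>M)) = (\<Sum>n. \<integral>\<^sup>+\<omega>. ennreal (\<alpha> ^ n) * end_value \<beta> \<eta> n \<omega> \<partial>M)"
    by (simp add: nn_integral_cmult)
  also have "\<dots> = (\<integral>\<^sup>+\<omega>. (\<Sum>n. ennreal (\<alpha> ^ n) * end_value \<beta> \<eta> n \<omega>) \<partial>M)"
    by (intro nn_integral_suminf[symmetric]) measurable
  also have "\<dots> = terminal_norm \<alpha> \<beta> \<eta>"
    unfolding terminal_norm_def
  proof (rule nn_integral_cong)
    fix \<omega> assume \<omega>: "\<omega> \<in> space M"
    have "(\<lambda>n. ennreal (\<alpha> ^ n) * end_value \<beta> \<eta> n \<omega>)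
      = (\<lambda>n. if n = njumps \<omega> then ennreal (\<alpha> ^ n) * ennreal (expA \<beta> (\<omega>, T) * \<bar>\<eta> \<omega>\<bar>) else 0)"
      using S_le_iff[OF \<omega>] by (auto simp: fun_eq_iff end_value_def not_le[symmetric])
    then have "(\<Sum>n. ennreal (\<alpha> ^ n) * end_value \<beta> \<eta> n \<omega>) = ennreal (\<alpha> ^ njumps \<omega>) * ennreal (expA \<beta> (\<omega>, T) * \<bar>\<eta> \<omega>\<bar>)"
      using sums_unique[OF sums_single[of "njumps \<omega>" "\<lambda>n. ennreal (\<alpha> ^ n) * ennreal (expA \<beta> (\<omega>, T) * \<bar>\<eta> \<omega>\<bar>)"]] by simp
    also have "\<dots> = ennreal (\<alpha> ^ njumps \<omega> * exp (\<beta> * A \<omega> T) * \<bar>\<eta> \<omega>\<bar>)"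
      using \<alpha> by (simp add: expA_def ennreal_mult[symmetric] mult.assoc)
    finally show "(\<Sum>n. ennreal (\<alpha> ^ n) * end_value \<beta> \<eta> n \<omega>) = \<dots>" .
  qed
  finally show ?thesis .
qed

lemma suminf_Suc_le: "(\<Sum>n. f (Suc n)) \<le> (\<Sum>n. f n)" for f :: "nat \<Rightarrow> ennreal"
  unfolding suminf_eq_SUP[of "\<lambda>n. f (Suc n)"]
proof (rule SUP_least)
  fix n
  have "(\<Sum>i<n. f (Suc i)) \<le> (\<Sum>i<Suc n. f i)" by (subst sum.lessThan_Suc_shift) simp
  also have "\<dots> \<le> (\<Sum>n. f n)" by (intro sum_le_suminf) auto
  finally show "(\<Sum>i<n. f (Suc i)) \<le> (\<Sum>n. f n)" .
qed

text \<open>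
  The \<open>n\<close>-th interval gets the weight \<open>\<alpha> ^ n\<close>. A start value at the jump that opens interval
  \<open>n + 1\<close> is the function \<open>Y_- + Z\<close> at the jump that closes interval \<open>n\<close>, so the start values
  add up to at least \<open>\<alpha>\<close> times the norm of \<open>Y_- + Z\<close>. Passing from \<open>Y_- + Z\<close> to \<open>Z\<close> costs \<open>\<alpha>\<close>
  times the norm of \<open>Y_-\<close>, which is available since \<open>\<beta> - 1 > \<alpha>\<close>.
\<close>

theorem energy_estimate:
  assumes sol: "linear_solution \<eta> g Y Z" and \<eta>[measurable]: "\<eta> \<in> borel_measurable M"
    and \<alpha>: "0 < \<alpha>" and \<beta>: "1 + \<alpha> < \<beta>" and loc: "\<And>n. locally_finite \<beta> Y n"
  shows "ennreal \<alpha> * wnorm \<alpha> \<beta> (uncurried Z) + ennreal (\<beta> - 1 - \<alpha>) * wnorm \<alpha> \<beta> (\<lambda>p. left_lim Y (fst p))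
    \<le> terminal_norm \<alpha> \<beta> \<eta> + wnorm \<alpha> \<beta> g"
proof -
  note d[measurable] = linear_solutionD(2,3,4)[OF sol]
  let ?a = "wnorm \<alpha> \<beta> (\<lambda>p. left_lim Y (fst p))"
  let ?s = "\<lambda>n. \<integral>\<^sup>+\<omega>. start_value \<beta> Y Z n \<omega> \<partial>M"
  let ?R = "terminal_norm \<alpha> \<beta> \<eta> + wnorm \<alpha> \<beta> g"
  have a: "?a = (\<Sum>n. ennreal (\<alpha> ^ n) * (\<integral>\<^sup>+\<omega>. Y_int \<beta> Y n \<omega> \<partial>M))"
    unfolding Y_int_def by (intro nn_integral_weight_split \<alpha>) auto
  have g: "wnorm \<alpha> \<beta> g = (\<Sum>n. ennreal (\<alpha> ^ n) * (\<integral>\<^sup>+\<omega>. g_int \<beta> g n \<omega> \<partial>M))"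
    unfolding g_int_def by (intro nn_integral_weight_split \<alpha>) auto
  have "(\<Sum>n. ennreal (\<alpha> ^ n) * ?s n) + ennreal (\<beta> - 1) * ?a
      = (\<Sum>n. ennreal (\<alpha> ^ n) * ?s n) + (\<Sum>n. ennreal (\<beta> - 1) * (ennreal (\<alpha> ^ n) * (\<integral>\<^sup>+\<omega>. Y_int \<beta> Y n \<omega> \<partial>M)))"
    unfolding a by (simp only: ennreal_suminf_cmult)
  also have "\<dots> = (\<Sum>n. ennreal (\<alpha> ^ n) * ?s n + ennreal (\<beta> - 1) * (ennreal (\<alpha> ^ n) * (\<integral>\<^sup>+\<omega>. Y_int \<beta> Y n \<omega> \<partial>M)))"
    by (intro suminf_add) auto
  also have "\<dots> = (\<Sum>n. ennreal (\<alpha> ^ n) * (?s n + ennreal (\<beta> - 1) * (\<integral>\<^sup>+\<omega>. Y_int \<beta> Y n \<omega> \<partial>M)))"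
    by (simp only: distrib_left mult.left_commute)
  also have "\<dots> \<le> (\<Sum>n. ennreal (\<alpha> ^ n) * ((\<integral>\<^sup>+\<omega>. end_value \<beta> \<eta> n \<omega> \<partial>M) + (\<integral>\<^sup>+\<omega>. g_int \<beta> g n \<omega> \<partial>M)))"
    using \<alpha> \<beta> by (intro suminf_le mult_left_mono energy_interval[OF sol _ \<eta> loc]) auto
  also have "\<dots> = (\<Sum>n. ennreal (\<alpha> ^ n) * (\<integral>\<^sup>+\<omega>. end_value \<beta> \<eta> n \<omega> \<partial>M) + ennreal (\<alpha> ^ n) * (\<integral>\<^sup>+\<omega>. g_int \<beta> g n \<omega> \<partial>M))"
    by (simp only: distrib_left)
  also have "\<dots> = (\<Sum>n. ennreal (\<alpha> ^ n) * (\<integral>\<^sup>+\<omega>. end_value \<beta> \<eta> n \<omega> \<partial>M)) + (\<Sum>n. ennreal (\<alpha> ^ n) * (\<integral>\<^sup>+\<omega>. g_int \<beta> g n \<omega> \<partial>M))"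
    by (intro suminf_add[symmetric]) auto
  also have "\<dots> = ?R" unfolding g by (simp add: sum_end_value[OF \<alpha> \<eta>])
  finally have main: "(\<Sum>n. ennreal (\<alpha> ^ n) * ?s n) + ennreal (\<beta> - 1) * ?a \<le> ?R" .
  \<comment> \<open>the norm of \<open>Y_- + Z\<close>, which the compensator identity extracts from the start values\<close>
  let ?b = "wnorm \<alpha> \<beta> (\<lambda>p. left_lim Y (fst p) + uncurried Z p)"
  have [measurable]: "jump_value \<beta> Y Z \<in> borel_measurable PE" unfolding jump_value_def[abs_def] by measurable
  have s: "?s (Suc n) = (\<integral>\<^sup>+\<omega>. comp_int (\<lambda>p. jump_value \<beta> Y Z p * indicator (J n) (fst p)) \<omega> \<partial>M)" for n
  proof -
    have "(\<integral>\<^sup>+\<omega>. indicator (space M) \<omega> * comp_int (\<lambda>p. jump_value \<beta> Y Z p * indicator (J n) (fst p)) \<omega> \<partial>M)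
      = (\<integral>\<^sup>+\<omega>. indicator (space M) \<omega> * (if S (Suc n) \<omega> \<le> ennreal T then jump_value \<beta> Y Z (jump_at (Suc n) \<omega>) else 0) \<partial>M)"
      using sets.top[of "hist n"] by (intro next_jump_identity_hist) auto
    then show ?thesis by (simp add: start_value_def cong: nn_integral_cong)
  qed
  have "ennreal \<alpha> * ?b = ennreal \<alpha> * (\<Sum>n. ennreal (\<alpha> ^ n) * ?s (Suc n))"
    unfolding s jump_value_def by (subst nn_integral_weight_split[OF \<alpha>]) auto
  also have "\<dots> = (\<Sum>n. ennreal \<alpha> * (ennreal (\<alpha> ^ n) * ?s (Suc n)))" by (rule ennreal_suminf_cmult[symmetric])
  also have "\<dots> = (\<Sum>n. ennreal (\<alpha> ^ Suc n) * ?s (Suc n))"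
    using \<alpha> by (simp add: ennreal_mult mult.assoc)
  also have "\<dots> \<le> (\<Sum>n. ennreal (\<alpha> ^ n) * ?s n)" by (rule suminf_Suc_le)
  finally have b: "ennreal \<alpha> * ?b + ennreal (\<beta> - 1) * ?a \<le> ?R"
    using order_trans[OF add_right_mono main] by blast
  have z: "wnorm \<alpha> \<beta> (uncurried Z) \<le> ?b + ?a"
  proof -
    have "wnorm \<alpha> \<beta> (uncurried Z) \<le> (\<integral>\<^sup>+p. ennreal (weight \<alpha> \<beta> (fst p) * \<bar>left_lim Y (fst p) + uncurried Z p\<bar>)
        + ennreal (weight \<alpha> \<beta> (fst p) * \<bar>left_lim Y (fst p)\<bar>) \<partial>Q)"
    proof (rule nn_integral_mono)
      fix p
      have "weight \<alpha> \<beta> (fst p) * \<bar>uncurried Z p\<bar> \<le> weight \<alpha> \<beta> (fst p) * (\<bar>left_lim Y (fst p) + uncurried Z p\<bar> + \<bar>left_lim Y (fst p)\<bar>)"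
        using weight_pos[OF \<alpha>, of \<beta> "fst p"] by (intro mult_left_mono) auto
      then show "ennreal (weight \<alpha> \<beta> (fst p) * \<bar>uncurried Z p\<bar>) \<le> ennreal (weight \<alpha> \<beta> (fst p) * \<bar>left_lim Y (fst p) + uncurried Z p\<bar>)
        + ennreal (weight \<alpha> \<beta> (fst p) * \<bar>left_lim Y (fst p)\<bar>)"
        using weight_pos[OF \<alpha>, of \<beta> "fst p"] by (simp add: distrib_left ennreal_leI flip: ennreal_plus)
    qed
    also have "\<dots> = ?b + ?a" by (intro nn_integral_add) measurable
    finally show ?thesis .
  qed
  have split: "ennreal (\<beta> - 1) * ?a = ennreal \<alpha> * ?a + ennreal (\<beta> - 1 - \<alpha>) * ?a"
    using \<alpha> \<beta> by (simp flip: distrib_right ennreal_plus)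
  have "ennreal \<alpha> * wnorm \<alpha> \<beta> (uncurried Z) + ennreal (\<beta> - 1 - \<alpha>) * ?a
    \<le> ennreal \<alpha> * (?b + ?a) + ennreal (\<beta> - 1 - \<alpha>) * ?a"
    using z by (intro add_right_mono mult_left_mono) auto
  also have "\<dots> = ennreal \<alpha> * ?b + ennreal (\<beta> - 1) * ?a" unfolding split by (simp only: distrib_left add.assoc)
  finally show ?thesis using b by (rule order_trans)
qed

lemma locally_finite_if_integrable:
  assumes Y: "adapted_cadlag M T F Y" and \<alpha>: "0 < \<alpha>" and fin: "wnorm \<alpha> \<beta> (\<lambda>p. left_lim Y (fst p)) < \<infinity>"
  shows "locally_finite \<beta> Y n"
proof -
  note [measurable] = left_lim_predictable[OF Y]
  have "ennreal (\<alpha> ^ n) * (\<integral>\<^sup>+\<omega>. Y_int \<beta> Y n \<omega> \<partial>M) \<le> (\<Sum>n. ennreal (\<alpha> ^ n) * (\<integral>\<^sup>+\<omega>. Y_int \<beta> Y n \<omega> \<partial>M))"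
    using sum_le_suminf[of "\<lambda>n. ennreal (\<alpha> ^ n) * (\<integral>\<^sup>+\<omega>. Y_int \<beta> Y n \<omega> \<partial>M)" "{n}"] by simp
  also have "\<dots> = wnorm \<alpha> \<beta> (\<lambda>p. left_lim Y (fst p))"
    unfolding Y_int_def by (intro nn_integral_weight_split[symmetric] \<alpha>) auto
  finally have "ennreal (\<alpha> ^ n) * (\<integral>\<^sup>+\<omega>. Y_int \<beta> Y n \<omega> \<partial>M) < \<infinity>" using fin by (rule le_less_trans)
  then have f: "(\<integral>\<^sup>+\<omega>. Y_int \<beta> Y n \<omega> \<partial>M) < \<infinity>" using \<alpha> by (auto simp: ennreal_mult_less_top)
  have top: "space M \<in> sets (hist n)" using sets.top[of "hist n"] by simp
  show ?thesis unfolding locally_finite_def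
  proof (intro exI[of _ "\<lambda>_. space M"] conjI)
    show "AE \<omega> in M. S n \<omega> \<le> ennreal T \<longrightarrow> (\<exists>k. \<omega> \<in> space M)" using AE_space by eventually_elim auto
    show "\<forall>k. (\<integral>\<^sup>+\<omega>. indicator (space M) \<omega> * Y_int \<beta> Y n \<omega> \<partial>M) < \<infinity>"
      using f by (simp cong: nn_integral_cong)
  qed (use top in auto)
qed

section \<open>Existence for a prescribed driver\<close>

text \<open>
  Before the next jump, \<open>R t\<close> is a function \<open>v t\<close> of the first \<open>n\<close> jumps. On paths without a
  further jump, \<open>v q \<le> v T < \<infinity>\<close> for all rational \<open>q\<close>, because \<open>R\<close> is increasing. This is an
  event known at the \<open>n\<close>-th jump, so by \<open>AE_survival\<close> it holds almost surely, also on paths that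
  jump again. There \<open>v T\<close> still bounds \<open>R\<close> up to the next jump, although \<open>R T\<close> may be larger.
\<close>

lemma dominated_until_next_jump:
  fixes R :: "'w \<Rightarrow> real \<Rightarrow> ennreal"
  assumes adapted: "\<And>t. 0 \<le> t \<Longrightarrow> t \<le> T \<Longrightarrow> (\<lambda>\<omega>. R \<omega> t) \<in> borel_measurable (F (ennreal t))"
    and mono: "\<And>\<omega> s t. \<omega> \<in> space M \<Longrightarrow> 0 \<le> s \<Longrightarrow> s \<le> t \<Longrightarrow> t \<le> T \<Longrightarrow> R \<omega> s \<le> R \<omega> t"
    and fin: "AE \<omega> in M. R \<omega> T < \<infinity>"
  shows "\<exists>r. (\<forall>n. r n \<in> borel_measurable (hist n)) \<and>
    (AE \<omega> in M. \<forall>n. S n \<omega> \<le> ennreal T \<longrightarrow> r n \<omega> < \<infinity> \<and>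
      (\<forall>t. 0 \<le> t \<longrightarrow> t \<le> T \<longrightarrow> ennreal t < S (Suc n) \<omega> \<longrightarrow> R \<omega> t \<le> r n \<omega>))"
proof -
  have "\<exists>r\<in>borel_measurable (hist n). AE \<omega> in M. S n \<omega> \<le> ennreal T \<longrightarrow> r \<omega> < \<infinity> \<and>
      (\<forall>t. 0 \<le> t \<longrightarrow> t \<le> T \<longrightarrow> ennreal t < S (Suc n) \<omega> \<longrightarrow> R \<omega> t \<le> r \<omega>)" for n
  proof -
    have "\<forall>t\<in>{0..T}. \<exists>v. v \<in> borel_measurable (hist n) \<and> (\<forall>\<omega>\<in>space M. ennreal t < S (Suc n) \<omega> \<longrightarrow> R \<omega> t = v \<omega>)"
    proof
      fix t assume "t \<in> {0..T}"
      then show "\<exists>v. v \<in> borel_measurable (hist n) \<and> (\<forall>\<omega>\<in>space M. ennreal t < S (Suc n) \<omega> \<longrightarrow> R \<omega> t = v \<omega>)"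
        using version_before_next_jump[OF adapted[of t], of n] unfolding Bex_def by simp
    qed
    from bchoice[OF this] obtain v where v': "\<forall>t\<in>{0..T}. v t \<in> borel_measurable (hist n) \<and>
      (\<forall>\<omega>\<in>space M. ennreal t < S (Suc n) \<omega> \<longrightarrow> R \<omega> t = v t \<omega>)" ..
    then have v: "\<And>t. t \<in> {0..T} \<Longrightarrow> v t \<in> borel_measurable (hist n)"
      "\<And>t \<omega>. t \<in> {0..T} \<Longrightarrow> \<omega> \<in> space M \<Longrightarrow> ennreal t < S (Suc n) \<omega> \<Longrightarrow> R \<omega> t = v t \<omega>" by blast+
    let ?q = "insert T (\<rat> \<inter> {0..T})"
    define B where "B = {\<omega>\<in>space (hist n). v T \<omega> < \<infinity> \<and> (\<forall>q\<in>?q. v q \<omega> \<le> v T \<omega>)}"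
    have TT: "T \<in> {0..T}" using T_pos by simp
    have B: "B \<in> sets (hist n)"
    proof -
      have c: "countable ?q" by (intro countable_insert countable_Int1 countable_rat)
      have [measurable]: "v T \<in> borel_measurable (hist n)" by (rule v(1)[OF TT])
      have "Measurable.pred (hist n) (\<lambda>\<omega>. \<forall>q\<in>?q. v q \<omega> \<le> v T \<omega>)"
      proof (rule measurable_pred_countable(1)[OF c])
        fix q assume "q \<in> ?q"
        then have [measurable]: "v q \<in> borel_measurable (hist n)" using T_pos by (intro v(1)) auto
        show "Measurable.pred (hist n) (\<lambda>\<omega>. v q \<omega> \<le> v T \<omega>)" by measurable
      qed
      then show ?thesis unfolding B_def by measurable
    qed
    have AEB: "AE \<omega> in M. S n \<omega> \<le> ennreal T \<longrightarrow> \<omega> \<in> B"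
    proof (rule AE_survival[OF B])
      show "AE \<omega> in M. S n \<omega> \<le> ennreal T \<longrightarrow> ennreal T < S (Suc n) \<omega> \<longrightarrow> \<omega> \<in> B"
        using fin AE_space
      proof eventually_elim
        case (elim \<omega>)
        have "\<omega> \<in> B" if T: "ennreal T < S (Suc n) \<omega>"
        proof -
          have eq: "v q \<omega> = R \<omega> q" if "q \<in> {0..T}" for q
          proof -
            have "ennreal q \<le> ennreal T" using that by (simp add: ennreal_leI)
            then have "ennreal q < S (Suc n) \<omega>" using T by (rule le_less_trans)
            then show ?thesis using v(2)[OF that elim(2)] by simp
          qed
          show ?thesis unfolding B_def
          proof (intro CollectI conjI ballI)
            show "v T \<omega> < \<infinity>" using elim(1) eq[OF TT] by simp
            fix q assume "q \<in> ?q"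
            then have "q \<in> {0..T}" using T_pos by auto
            then show "v q \<omega> \<le> v T \<omega>" using eq[of q] eq[OF TT] mono[OF elim(2), of q T] by simp
          qed (use elim in simp)
        qed
        then show ?case by simp
      qed
    qed
    have "AE \<omega> in M. S n \<omega> \<le> ennreal T \<longrightarrow> v T \<omega> < \<infinity> \<and>
      (\<forall>t. 0 \<le> t \<longrightarrow> t \<le> T \<longrightarrow> ennreal t < S (Suc n) \<omega> \<longrightarrow> R \<omega> t \<le> v T \<omega>)"
      using AEB AE_space
    proof eventually_elim
      case (elim \<omega>)
      show ?case
      proof (intro impI conjI allI)
        assume Sn: "S n \<omega> \<le> ennreal T"
        then have \<omega>B: "\<omega> \<in> B" using elim by simp
        then show "v T \<omega> < \<infinity>" by (simp add: B_def)
        fix t assume t: "0 \<le> t" "t \<le> T" "ennreal t < S (Suc n) \<omega>"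
        show "R \<omega> t \<le> v T \<omega>"
        proof (cases "t = T")
          case True
          then show ?thesis using v(2)[OF TT elim(2)] t by simp
        next
          case False
          have n: "n \<le> njumps \<omega>" using S_le_iff[OF elim(2)] Sn by simp
          have "\<exists>u. t < u \<and> u \<le> T \<and> (n < njumps \<omega> \<longrightarrow> u \<le> jtime (Suc n) \<omega>)"
          proof (cases "n < njumps \<omega>")
            case True
            then show ?thesis using less_S_Suc_iff[OF elim(2) n t(1,2)] t(3) jtime(3)[OF elim(2), of "Suc n"]
              by (intro exI[of _ "jtime (Suc n) \<omega>"]) simp
          next
            case F: False
            then show ?thesis using False t(2) by (intro exI[of _ T]) simp
          qed
          then obtain u where u: "t < u" "u \<le> T" "n < njumps \<omega> \<longrightarrow> u \<le> jtime (Suc n) \<omega>" by blast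
          obtain q where q: "q \<in> \<rat>" "t < q" "q < u" using Rats_dense_in_real[OF u(1)] by blast
          have qT: "q \<in> {0..T}" using q t u by simp
          have "ennreal q < S (Suc n) \<omega>" using less_S_Suc_iff[OF elim(2) n, of q] qT u q by auto
          then have "R \<omega> q = v q \<omega>" using v(2)[OF qT elim(2)] by simp
          also have "\<dots> \<le> v T \<omega>" using \<omega>B q qT by (auto simp: B_def)
          finally show ?thesis using mono[OF elim(2), of t q] t q qT by (simp add: order_trans)
        qed
      qed
    qed
    then show ?thesis using v(1)[OF TT] by blast
  qed
  then have "\<forall>n. \<exists>r. r \<in> borel_measurable (hist n) \<and> (AE \<omega> in M. S n \<omega> \<le> ennreal T \<longrightarrow> r \<omega> < \<infinity> \<and>
      (\<forall>t. 0 \<le> t \<longrightarrow> t \<le> T \<longrightarrow> ennreal t < S (Suc n) \<omega> \<longrightarrow> R \<omega> t \<le> r \<omega>))" by (simp add: Bex_def)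
  from choice[OF this] obtain r where "\<And>n. r n \<in> borel_measurable (hist n)"
    "\<And>n. AE \<omega> in M. S n \<omega> \<le> ennreal T \<longrightarrow> r n \<omega> < \<infinity> \<and>
      (\<forall>t. 0 \<le> t \<longrightarrow> t \<le> T \<longrightarrow> ennreal t < S (Suc n) \<omega> \<longrightarrow> R \<omega> t \<le> r n \<omega>)" by blast
  then show ?thesis by (intro exI[of _ r]) (simp add: AE_all_countable)
qed

definition var_upto :: "(('w \<times> real) \<times> 'e \<Rightarrow> real) \<Rightarrow> 'w \<Rightarrow> real \<Rightarrow> ennreal" where
  "var_upto g \<omega> t = comp_int (\<lambda>p. ennreal \<bar>g p\<bar> * indicator {0<..t} (snd (fst p))) \<omega>"

lemma var_upto_mono: "s \<le> t \<Longrightarrow> var_upto g \<omega> s \<le> var_upto g \<omega> t"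
  unfolding var_upto_def comp_int_def by (intro nn_integral_mono mult_left_mono) (auto simp: indicator_def)

lemma var_upto_adapted: "g \<in> borel_measurable PE \<Longrightarrow> 0 \<le> t \<Longrightarrow> t \<le> T \<Longrightarrow> (\<lambda>\<omega>. var_upto g \<omega> t) \<in> borel_measurable (F (ennreal t))"
  unfolding var_upto_def by (intro comp_int_adapted) auto

lemma var_upto_T: "\<omega> \<in> space M \<Longrightarrow> var_upto g \<omega> T = comp_int (\<lambda>p. ennreal \<bar>g p\<bar>) \<omega>"
  unfolding var_upto_def by (intro comp_int_cong) auto

lemma path_int_le_var_upto:
  assumes \<omega>: "\<omega> \<in> space M" and g: "g \<in> borel_measurable PE" "path_integrable g \<omega>" and t: "0 \<le> t" "t \<le> T"
  shows "ennreal \<bar>path_int g \<omega> t\<bar> \<le> var_upto g \<omega> t"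
proof -
  have "ennreal \<bar>path_int g \<omega> t - path_int g \<omega> 0\<bar> \<le> (\<integral>\<^sup>+z. ennreal \<bar>g (at_path \<omega> z)\<bar> * indicator {0<..t} (fst z) \<partial>\<nu> \<omega>)"
    by (rule path_int_diff_bound[OF \<omega> g]) (use t in auto)
  also have "\<dots> = var_upto g \<omega> t"
    unfolding var_upto_def comp_int_def
    by (intro nn_integral_cong_AE, use AE_\<nu>_Ioc[OF \<omega>] in eventually_elim) (auto simp: at_path_def)
  finally show ?thesis by (simp add: path_int_0)
qed

text \<open>
  The paths along which \<open>g\<close> is not integrable form a null set that need not be known at any time
  before \<open>T\<close>, so removing them would destroy predictability. Instead, \<open>g\<close> is kept on the \<open>n\<close>-th
  interval only as long as the integral of \<open>\<bar>g\<bar>\<close> has not exceeded the bound \<open>r n\<close> of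
  \<open>dominated_until_next_jump\<close>, and where its integral over the marks is finite. These conditions
  are predictable and hold almost everywhere. On every path they keep the integral finite, since
  before the supremum of the kept times it is at most \<open>r n\<close>.
\<close>

lemma everywhere_integrable_version:
  assumes g[measurable]: "g \<in> borel_measurable PE" and int: "AE \<omega> in M. path_integrable g \<omega>"
  shows "\<exists>g'\<in>borel_measurable PE. (\<forall>\<omega>\<in>space M. path_integrable g' \<omega>) \<and>
    (AE \<omega> in M. AE z in \<nu> \<omega>. g' (at_path \<omega> z) = g (at_path \<omega> z))"
proof -
  have fin: "AE \<omega> in M. var_upto g \<omega> T < \<infinity>"
    using int AE_space by eventually_elim (simp add: var_upto_T path_integrable_def)
  obtain r where r: "\<And>n. r n \<in> borel_measurable (hist n)"
    "AE \<omega> in M. \<forall>n. S n \<omega> \<le> ennreal T \<longrightarrow> r n \<omega> < \<infinity> \<and>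
      (\<forall>t. 0 \<le> t \<longrightarrow> t \<le> T \<longrightarrow> ennreal t < S (Suc n) \<omega> \<longrightarrow> var_upto g \<omega> t \<le> r n \<omega>)"
    using dominated_until_next_jump[of "var_upto g", OF var_upto_adapted[OF g] var_upto_mono fin] by auto
  define h where "h p = (\<integral>\<^sup>+x. ennreal \<bar>g (p, x)\<bar> \<partial>\<phi> (fst p) (snd p))" for p
  have h[measurable]: "h \<in> borel_measurable Pr"
    unfolding h_def using nn_integral_\<phi>_measurable[of "\<lambda>p. ennreal \<bar>g p\<bar>"] by simp
  define rr where "rr n p = (if S n (fst p) < ennreal (snd p) then r n (fst p) else 0)" for n p
  have [measurable]: "rr n \<in> borel_measurable Pr" for n
    unfolding rr_def[abs_def] using r(1) by (intro measurable_after_S) auto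
  define RR where "RR q p = (if q < snd p then var_upto g (fst p) q else 0)" for q p
  let ?q = "\<rat> \<inter> {0..T}"
  \<comment> \<open>the part of the \<open>n\<close>-th interval on which \<open>g\<close> is kept\<close>
  define \<Gamma> where "\<Gamma> n = {p\<in>space Pr. p \<in> J n \<and> rr n p < \<infinity> \<and> (\<forall>q\<in>?q. RR q p \<le> rr n p) \<and> h p < \<infinity>}" for n
  have \<Gamma>: "\<Gamma> n \<in> sets Pr" for n
  proof -
    have c: "countable ?q" by (intro countable_Int1 countable_rat)
    have "Measurable.pred Pr (\<lambda>p. \<forall>q\<in>?q. RR q p \<le> rr n p)"
    proof (rule measurable_pred_countable(1)[OF c])
      fix q assume "q \<in> ?q"
      then have [measurable]: "RR q \<in> borel_measurable Pr"
        unfolding RR_def[abs_def] by (intro measurable_after_time var_upto_adapted[OF g]) auto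
      show "Measurable.pred Pr (\<lambda>p. RR q p \<le> rr n p)" by measurable
    qed
    then show ?thesis unfolding \<Gamma>_def by measurable
  qed
  define G where "G = (\<Union>n. \<Gamma> n)"
  have G[measurable]: "G \<in> sets Pr" unfolding G_def using \<Gamma> by auto
  define g' where "g' p = indicator G (fst p) * g p" for p
  have g'[measurable]: "g' \<in> borel_measurable PE" unfolding g'_def[abs_def] by measurable
  have "path_integrable g' \<omega>" if \<omega>: "\<omega> \<in> space M" for \<omega>
  proof -
    let ?c = "\<lambda>n. comp_int (\<lambda>p. ennreal \<bar>g' p\<bar> * indicator (J n) (fst p)) \<omega>"
    have "comp_int (\<lambda>p. ennreal \<bar>g' p\<bar>) \<omega> = (\<Sum>n. ?c n)" by (rule comp_int_split_J[OF \<omega>]) measurable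
    also have "\<dots> = (\<Sum>n\<in>{..njumps \<omega>}. ?c n)"
      using J_empty_after_last[OF \<omega>] by (intro suminf_finite) auto
    also have "\<dots> < \<infinity>"
    proof -
      have "?c n < \<infinity>" for n
      proof (cases "\<exists>t. (\<omega>, t) \<in> \<Gamma> n")
        case False
        have "g' ((\<omega>, t), x) = 0" if "(\<omega>, t) \<in> J n" for t x
        proof -
          have "(\<omega>, t) \<notin> \<Gamma> m" for m using J_disjoint[of "(\<omega>, t)" m n] that False by (auto simp: \<Gamma>_def)
          then show ?thesis by (simp add: g'_def G_def)
        qed
        then have "?c n = comp_int (\<lambda>p. 0) \<omega>" by (intro comp_int_cong[OF \<omega>]) (auto simp: indicator_def)
        then show ?thesis by (simp add: comp_int_def)
      next
        case True
        then have rfin: "r n \<omega> < \<infinity>" by (auto simp: \<Gamma>_def rr_def J_def)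
        define U where "U = {t. (\<omega>, t) \<in> \<Gamma> n}"
        define b where "b = Sup U"
        have UT: "U \<subseteq> {0..T}" by (auto simp: U_def \<Gamma>_def)
        have Ubdd: "bdd_above U" using UT by (meson atLeastAtMost_iff bdd_aboveI subsetD)
        have Une: "U \<noteq> {}" using True by (auto simp: U_def)
        have Ub: "t \<le> b" if "t \<in> U" for t unfolding b_def using that Ubdd by (rule cSup_upper)
        have below: "var_upto g \<omega> s \<le> r n \<omega>" if tU: "t \<in> U" and st: "s < t" for s t
        proof -
          have tT: "0 \<le> t" "t \<le> T" using UT tU by auto
          show ?thesis
          proof (cases "0 \<le> s")
            case True
            obtain q where q: "q \<in> \<rat>" "s < q" "q < t" using Rats_dense_in_real[OF st] by blast
            then have "RR q (\<omega>, t) \<le> rr n (\<omega>, t)" using tU True tT by (auto simp: U_def \<Gamma>_def)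
            then have "var_upto g \<omega> q \<le> r n \<omega>" using q tU by (auto simp: RR_def rr_def U_def \<Gamma>_def J_def)
            then show ?thesis using var_upto_mono[of s q g \<omega>] q by (simp add: order_trans)
          next
            case False
            have "var_upto g \<omega> s = comp_int (\<lambda>p. 0) \<omega>"
              unfolding var_upto_def using False by (intro comp_int_cong[OF \<omega>]) auto
            then show ?thesis by (simp add: comp_int_def)
          qed
        qed
        \<comment> \<open>every time before \<open>b\<close> lies before a kept time, where the integral was still at most
          \<open>r n\<close>\<close>
        have small: "comp_int (\<lambda>p. ennreal \<bar>g p\<bar> * indicator {0<..<b} (snd (fst p))) \<omega> \<le> r n \<omega>"
        proof -
          let ?f = "\<lambda>k p. ennreal \<bar>g p\<bar> * indicator {0<..b - 1 / real (Suc k)} (snd (fst p))"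
          have "comp_int (\<lambda>p. ennreal \<bar>g p\<bar> * indicator {0<..<b} (snd (fst p))) \<omega> = comp_int (\<lambda>p. SUP k. ?f k p) \<omega>"
          proof (rule comp_int_cong[OF \<omega>])
            fix t x assume t: "0 < t" "t \<le> T"
            show "ennreal \<bar>g ((\<omega>, t), x)\<bar> * indicator {0<..<b} (snd (fst ((\<omega>, t), x))) = (SUP k. ?f k ((\<omega>, t), x))"
            proof (cases "t < b")
              case True
              obtain k where k: "1 / real (Suc k) < b - t" using True reals_Archimedean[of "b - t"] by (auto simp: inverse_eq_divide)
              show ?thesis
              proof (rule antisym)
                show "ennreal \<bar>g ((\<omega>, t), x)\<bar> * indicator {0<..<b} (snd (fst ((\<omega>, t), x))) \<le> (SUP k. ?f k ((\<omega>, t), x))"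
                  using k t True by (intro SUP_upper2[of k]) (auto simp: indicator_def)
              qed (use True t in \<open>auto intro!: SUP_least simp: indicator_def\<close>)
            next
              case False
              have "\<not> t \<le> b - 1 / real (Suc k)" for k using False by (simp add: not_le) (smt (verit) divide_pos_pos of_nat_0_le_iff)
              then show ?thesis using False by (simp add: indicator_def)
            qed
          qed
          also have "\<dots> = (SUP k. comp_int (?f k) \<omega>)"
            unfolding comp_int_def
          proof (intro nn_integral_monotone_convergence_SUP)
            show "incseq (\<lambda>k z. ?f k (at_path \<omega> z))"
            proof (intro incseq_SucI le_funI mult_left_mono)
              fix k z
              have "b - 1 / real (Suc k) \<le> b - 1 / real (Suc (Suc k))" by (intro diff_left_mono divide_left_mono) auto
              then show "indicator {0<..b - 1 / real (Suc k)} (snd (fst (at_path \<omega> z)))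
                 \<le> (indicator {0<..b - 1 / real (Suc (Suc k))} (snd (fst (at_path \<omega> z))) :: ennreal)"
                by (auto simp: indicator_def)
            qed simp
            show "(\<lambda>z. ?f k (at_path \<omega> z)) \<in> borel_measurable (\<nu> \<omega>)" for k
              by (rule measurable_along_path[OF _ \<omega>, of "?f k"]) measurable
          qed
          also have "\<dots> \<le> r n \<omega>"
          proof (rule SUP_least)
            fix k
            have "b - 1 / real (Suc k) < b" by simp
            then obtain t where "t \<in> U" "b - 1 / real (Suc k) < t"
              unfolding b_def using less_cSup_iff[OF Une Ubdd] by blast
            then have "var_upto g \<omega> (b - 1 / real (Suc k)) \<le> r n \<omega>" by (rule below)
            then show "comp_int (?f k) \<omega> \<le> r n \<omega>" by (simp add: var_upto_def)
          qed
          finally show ?thesis .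
        qed
        \<comment> \<open>on an exceptional path \<open>A\<close> may jump at \<open>b\<close>; finiteness of \<open>h\<close> at kept times covers that\<close>
        have atom: "comp_int (\<lambda>p. ennreal \<bar>g' p\<bar> * indicator {b} (snd (fst p))) \<omega> < \<infinity>"
        proof -
          have b0: "b \<in> {0..T}" using UT Une Ub unfolding b_def
            by (metis atLeastAtMost_iff cSup_least equals0I order_trans subsetD)
          have "comp_int (\<lambda>p. ennreal \<bar>g' p\<bar> * indicator {b} (snd (fst p))) \<omega>
            = (\<integral>\<^sup>+t\<in>{0..T}. (\<integral>\<^sup>+x. ennreal \<bar>g' ((\<omega>, t), x)\<bar> * indicator {b} (snd (fst ((\<omega>, t), x))) \<partial>\<phi> \<omega> t) \<partial>dA \<omega>)"
            by (rule comp_int_eq[OF \<omega>]) measurable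
          also have "\<dots> \<le> (\<integral>\<^sup>+t. (if (\<omega>, b) \<in> G then h (\<omega>, b) else 0) * indicator {b} t \<partial>dA \<omega>)"
            by (intro nn_integral_mono) (auto simp: indicator_def g'_def h_def)
          also have "\<dots> = (if (\<omega>, b) \<in> G then h (\<omega>, b) else 0) * emeasure (dA \<omega>) {b}"
            by (subst nn_integral_cmult_indicator) auto
          also have "\<dots> < \<infinity>"
          proof -
            have "(if (\<omega>, b) \<in> G then h (\<omega>, b) else 0) < \<infinity>" by (auto simp: G_def \<Gamma>_def)
            moreover have "emeasure (dA \<omega>) {b} < \<infinity>"
              using finite_measure.emeasure_finite[OF finite_dA[OF \<omega>]] by (simp add: top.not_eq_extremum)
            ultimately show ?thesis by (simp add: ennreal_mult_less_top)
          qed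
          finally show ?thesis .
        qed
        have "?c n \<le> comp_int (\<lambda>p. ennreal \<bar>g p\<bar> * indicator {0<..<b} (snd (fst p)) + ennreal \<bar>g' p\<bar> * indicator {b} (snd (fst p))) \<omega>"
        proof (rule comp_int_mono[OF \<omega>])
          fix t x assume t: "0 < t" "t \<le> T"
          show "ennreal \<bar>g' ((\<omega>, t), x)\<bar> * indicator (J n) (fst ((\<omega>, t), x))
            \<le> ennreal \<bar>g ((\<omega>, t), x)\<bar> * indicator {0<..<b} (snd (fst ((\<omega>, t), x))) + ennreal \<bar>g' ((\<omega>, t), x)\<bar> * indicator {b} (snd (fst ((\<omega>, t), x)))"
          proof (cases "(\<omega>, t) \<in> J n \<and> (\<omega>, t) \<in> G")
            case True
            then obtain m where m: "(\<omega>, t) \<in> \<Gamma> m" by (auto simp: G_def)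
            then have "m = n" using J_disjoint[of "(\<omega>, t)" m n] True by (auto simp: \<Gamma>_def)
            then have "t \<le> b" using m by (intro Ub) (simp add: U_def)
            then show ?thesis using t True by (cases "t = b") (auto simp: g'_def indicator_def)
          qed (auto simp: g'_def indicator_def)
        qed
        also have "\<dots> = comp_int (\<lambda>p. ennreal \<bar>g p\<bar> * indicator {0<..<b} (snd (fst p))) \<omega> + comp_int (\<lambda>p. ennreal \<bar>g' p\<bar> * indicator {b} (snd (fst p))) \<omega>"
          by (intro comp_int_add \<omega>) measurable
        also have "\<dots> < \<infinity>" using le_less_trans[OF small rfin] atom by (simp add: ennreal_add_eq_top less_top)
        finally show ?thesis .
      qed
      then show ?thesis by (simp add: less_top[symmetric])
    qed
    finally show ?thesis by (simp add: path_integrable_def)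
  qed
  moreover have "AE \<omega> in M. AE z in \<nu> \<omega>. g' (at_path \<omega> z) = g (at_path \<omega> z)"
    using r(2) int AE_space
  proof eventually_elim
    case (elim \<omega>)
    note \<omega> = elim(3)
    have "(\<integral>\<^sup>+t\<in>{0..T}. h (\<omega>, t) \<partial>dA \<omega>) < \<infinity>"
      using elim(2) comp_int_eq[OF \<omega>, of "\<lambda>p. ennreal \<bar>g p\<bar>"] by (simp add: path_integrable_def h_def)
    moreover have hm[measurable]: "(\<lambda>t. h (\<omega>, clip T t)) \<in> borel_measurable borel"
      by (rule measurable_compose[OF measurable_clip_path[OF \<omega>] h])
    moreover have "(\<integral>\<^sup>+t\<in>{0..T}. h (\<omega>, t) \<partial>dA \<omega>) = (\<integral>\<^sup>+t. h (\<omega>, clip T t) \<partial>dA \<omega>)"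
      by (intro nn_integral_cong_AE, use AE_dA_Ioc[OF \<omega>] in eventually_elim) auto
    ultimately have "AE t in dA \<omega>. h (\<omega>, clip T t) \<noteq> \<infinity>" by (intro nn_integral_noteq_infinite) auto
    then have "AE z in \<nu> \<omega>. h (\<omega>, clip T (fst z)) \<noteq> \<infinity>"
    proof (rule AE_\<nu>_time[OF \<omega>])
      show "Measurable.pred borel (\<lambda>t. h (\<omega>, clip T t) \<noteq> \<infinity>)" by measurable
    qed
    with AE_\<nu>_Ioc[OF \<omega>] show ?case
    proof eventually_elim
      case (elim z)
      obtain n where n: "(\<omega>, fst z) \<in> J n" using ex_J[OF \<omega>, of "fst z"] elim by auto
      have nK: "n \<le> njumps \<omega>" "fst z \<le> jnext n \<omega>" "jtime n \<omega> < fst z" using J_iff[OF \<omega>, of "fst z" n] n elim by auto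
      have Sn: "S n \<omega> \<le> ennreal T" using S_le_iff[OF \<omega>] nK by simp
      have "RR q (\<omega>, fst z) \<le> r n \<omega>" if q: "q \<in> ?q" for q
      proof (cases "q < fst z")
        case True
        have "ennreal q < S (Suc n) \<omega>" using less_S_Suc_iff[OF \<omega> nK(1), of q] q True nK by (auto simp: jnext_def)
        then show ?thesis using \<open>\<forall>n. S n \<omega> \<le> ennreal T \<longrightarrow> _ n\<close> Sn q True by (auto simp: RR_def)
      qed (simp add: RR_def)
      moreover have "r n \<omega> < \<infinity>" using \<open>\<forall>n. S n \<omega> \<le> ennreal T \<longrightarrow> _ n\<close> Sn by auto
      moreover have "S n \<omega> < ennreal (fst z)" using n by (simp add: J_def)
      moreover have "h (\<omega>, fst z) < \<infinity>" using elim by (simp add: top.not_eq_extremum)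
      ultimately have "(\<omega>, fst z) \<in> \<Gamma> n" using n \<omega> elim by (auto simp: \<Gamma>_def rr_def)
      then have "(\<omega>, fst z) \<in> G" unfolding G_def by (rule UN_I[OF UNIV_I])
      then show ?case using elim by (simp add: g'_def at_path_def)
    qed
  qed
  ultimately show ?thesis using g' by blast
qed

lemma measurable_before_time:
  assumes c: "c \<in> borel_measurable (hist n)"
  shows "(\<lambda>\<omega>. if S n \<omega> \<le> t then c \<omega> else (0::real)) \<in> borel_measurable (F t)"
proof -
  let ?D = "{\<omega>\<in>space M. S n \<omega> \<le> t}"
  have D: "?D \<in> sets (F t)" using stopping_timeD[OF stopping_S[of n], of t] by (simp add: pred_def)
  have "(\<lambda>\<omega>. \<omega>) \<in> measurable (restrict_space (F t) ?D) (hist n)"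
  proof (rule measurableI)
    fix B assume B: "B \<in> sets (hist n)"
    have "(\<lambda>\<omega>. \<omega>) -` B \<inter> space (restrict_space (F t) ?D) = {\<omega>\<in>B. S n \<omega> \<le> t}"
      using sets.sets_into_space[OF B] by (auto simp: space_restrict_space)
    then show "(\<lambda>\<omega>. \<omega>) -` B \<inter> space (restrict_space (F t) ?D) \<in> sets (restrict_space (F t) ?D)"
      using hist_before[OF B, of t] D sets.sets_into_space[OF B]
      by (auto simp: sets_restrict_space_iff sets.Int_space_eq2)
  qed (auto simp: space_restrict_space)
  from measurable_compose[OF this c] have "c \<in> borel_measurable (restrict_space (F t) ?D)" .
  then have "(\<lambda>\<omega>. if \<omega> \<in> ?D then c \<omega> else 0) \<in> borel_measurable (F t)"
    using D sets.Int_space_eq2[OF D] by (subst (asm) measurable_restrict_space_iff) simp_all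
  then show ?thesis by (rule measurable_cong[THEN iffD1, rotated]) auto
qed

text \<open>
  For \<open>c n\<close> take the function of the first \<open>n\<close> jumps that equals \<open>\<xi> + path_int g \<omega> T\<close> if there
  is no further jump. This fits the terminal condition on every path, the last interval being
  the one that matters there. At the next jump \<open>c\<close> moves to \<open>c (n + 1)\<close>, a function \<open>h n\<close> of the
  past and of the time and mark of that jump, and \<open>Z\<close> is the difference.
\<close>

lemma linear_solution_exists_everywhere_integrable:
  assumes g[measurable]: "g \<in> borel_measurable PE" and int: "\<And>\<omega>. \<omega> \<in> space M \<Longrightarrow> path_integrable g \<omega>"
    and \<xi>: "\<xi> \<in> borel_measurable (F (ennreal T))"
  shows "\<exists>Y Z c. adapted_cadlag M T F Y \<and> uncurried Z \<in> borel_measurable PE \<and> (\<forall>n. c n \<in> borel_measurable (hist n)) \<and>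
    (\<forall>\<omega>\<in>space M. \<forall>n\<le>njumps \<omega>. level \<xi> g Z n \<omega> = c n \<omega> \<and>
      (\<forall>t. 0 \<le> t \<longrightarrow> t \<le> T \<longrightarrow> jtime n \<omega> \<le> t \<longrightarrow> (n < njumps \<omega> \<longrightarrow> t < jtime (Suc n) \<omega>) \<longrightarrow> Y \<omega> t = c n \<omega> - path_int g \<omega> t))"
proof -
  have "(\<lambda>\<omega>. \<xi> \<omega> + path_int g \<omega> T) \<in> borel_measurable (F (ennreal T))"
    using T_pos by (intro borel_measurable_add \<xi> path_int_adapted[OF g int]) auto
  then have "\<forall>n. \<exists>c. c \<in> borel_measurable (hist n) \<and> (\<forall>\<omega>\<in>space M. ennreal T < S (Suc n) \<omega> \<longrightarrow> \<xi> \<omega> + path_int g \<omega> T = c \<omega>)"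
    using version_before_next_jump_real unfolding Bex_def by blast
  from choice[OF this] obtain c where c: "\<And>n. c n \<in> borel_measurable (hist n)"
    "\<And>n \<omega>. \<omega> \<in> space M \<Longrightarrow> ennreal T < S (Suc n) \<omega> \<Longrightarrow> \<xi> \<omega> + path_int g \<omega> T = c n \<omega>" by blast
  have "\<forall>n. \<exists>h. h \<in> borel_measurable (hist n \<Otimes>\<^sub>M (borel \<Otimes>\<^sub>M borel)) \<and>
      (\<forall>\<omega>\<in>space M. c (Suc n) \<omega> = h (\<omega>, S (Suc n) \<omega>, X (Suc n) \<omega>))"
    using hist_Suc_function_of_next_jump[OF c(1)] unfolding Bex_def by blast
  from choice[OF this] obtain h where h: "\<And>n. h n \<in> borel_measurable (hist n \<Otimes>\<^sub>M (borel \<Otimes>\<^sub>M borel))"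
    "\<And>n \<omega>. \<omega> \<in> space M \<Longrightarrow> c (Suc n) \<omega> = h n (\<omega>, S (Suc n) \<omega>, X (Suc n) \<omega>)" by blast
  \<comment> \<open>the number of jumps up to and including \<open>t\<close>, whereas \<open>jump_index\<close> leaves out a jump at \<open>t\<close>\<close>
  define N where "N t \<omega> = (LEAST n. ennreal t < S (Suc n) \<omega>)" for t \<omega>
  have N: "N t \<omega> = n" if \<omega>: "\<omega> \<in> space M" and n: "n \<le> njumps \<omega>" "0 \<le> t" "t \<le> T" "jtime n \<omega> \<le> t" "n < njumps \<omega> \<longrightarrow> t < jtime (Suc n) \<omega>" for \<omega> t n
    unfolding N_def
  proof (rule Least_equality)
    show "ennreal t < S (Suc n) \<omega>" using less_S_Suc_iff[OF \<omega> n(1-3)] n(5) by simp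
    fix m assume m: "ennreal t < S (Suc m) \<omega>"
    show "n \<le> m"
    proof (rule ccontr)
      assume "\<not> n \<le> m"
      then have "S (Suc m) \<omega> \<le> S n \<omega>" by (intro S_mono[OF \<omega>]) simp
      also have "\<dots> \<le> ennreal t" using jtime[OF \<omega> n(1)] n by (simp add: ennreal_leI)
      finally show False using m by simp
    qed
  qed
  define Y where "Y \<omega> t = c (N t \<omega>) \<omega> - path_int g \<omega> t" for \<omega> t
  have Yeq: "Y \<omega> t = c n \<omega> - path_int g \<omega> t"
    if "\<omega> \<in> space M" "n \<le> njumps \<omega>" "0 \<le> t" "t \<le> T" "jtime n \<omega> \<le> t" "n < njumps \<omega> \<longrightarrow> t < jtime (Suc n) \<omega>" for \<omega> t n
    using N[OF that] by (simp add: Y_def)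
  define Z where "Z \<omega> t x = (if S (jump_index (\<omega>, t)) \<omega> < ennreal t
      then h (jump_index (\<omega>, t)) (\<omega>, ennreal t, x) - c (jump_index (\<omega>, t)) \<omega> else 0)" for \<omega> t x
  have Z: "uncurried Z \<in> borel_measurable PE"
  proof -
    define f where "f n p = (if S n (fst (fst p)) < ennreal (snd (fst p)) then h n (fst (fst p), ennreal (snd (fst p)), snd p) else 0)
        - (if S n (fst (fst p)) < ennreal (snd (fst p)) then c n (fst (fst p)) else 0)" for n and p :: "('w \<times> real) \<times> 'e"
    have "(\<lambda>p. if S n (fst p) < ennreal (snd p) then c n (fst p) else 0) \<in> borel_measurable Pr" for n
      by (intro measurable_after_S c) simp
    from measurable_compose[OF measurable_fst this]
    have "f n \<in> borel_measurable PE" for n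
      unfolding f_def[abs_def] by (intro borel_measurable_diff measurable_after_S_mark h) simp_all
    moreover have "(\<lambda>p. jump_index (fst p)) \<in> measurable PE (count_space UNIV)" by measurable
    ultimately have "(\<lambda>p. f (jump_index (fst p)) p) \<in> borel_measurable PE" by (rule measurable_compose_countable)
    then show ?thesis by (rule measurable_cong[THEN iffD1, rotated]) (simp add: f_def uncurried_def Z_def)
  qed
  have lev: "level \<xi> g Z n \<omega> = c n \<omega>" if \<omega>: "\<omega> \<in> space M" and n: "n \<le> njumps \<omega>" for n \<omega>
  proof (rule level_unique[where c="\<lambda>n. c n \<omega>"])
    show "c (njumps \<omega>) \<omega> = \<xi> \<omega> + path_int g \<omega> T"
      using c(2)[OF \<omega>, of "njumps \<omega>"] S_le_iff[OF \<omega>, of "Suc (njumps \<omega>)"] by (simp add: not_le)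
    fix m assume m: "m < njumps \<omega>"
    then have Jm: "(\<omega>, jtime (Suc m) \<omega>) \<in> J m"
      using jtime[OF \<omega>, of "Suc m"] jtime_less[OF \<omega>, of m "Suc m"] by (subst J_iff[OF \<omega>]) (auto simp: jnext_def)
    then have "jump_index (\<omega>, jtime (Suc m) \<omega>) = m" "S m \<omega> < ennreal (jtime (Suc m) \<omega>)"
      by (simp_all add: jump_index_J) (simp add: J_def)
    then show "c (Suc m) \<omega> = c m \<omega> + Z \<omega> (jtime (Suc m) \<omega>) (X (Suc m) \<omega>)"
      using h(2)[OF \<omega>, of m] jtime(1)[OF \<omega>, of "Suc m"] m by (simp add: Z_def)
  qed (rule n)
  have "adapted_cadlag M T F Y"
    unfolding adapted_cadlag_def
  proof (intro conjI ballI)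
    fix t assume t: "t \<in> {0..T}"
    define f where "f n \<omega> = (if S n \<omega> \<le> ennreal t then c n \<omega> else 0)" for n \<omega>
    have "f n \<in> borel_measurable (F (ennreal t))" for n
      unfolding f_def[abs_def] by (rule measurable_before_time[OF c(1)])
    moreover have "N t \<in> measurable (F (ennreal t)) (count_space UNIV)"
      unfolding N_def[abs_def] using stopping_timeD2[OF stopping_S] by measurable
    ultimately have "(\<lambda>\<omega>. f (N t \<omega>) \<omega>) \<in> borel_measurable (F (ennreal t))" by (rule measurable_compose_countable)
    then have "(\<lambda>\<omega>. f (N t \<omega>) \<omega> - path_int g \<omega> t) \<in> borel_measurable (F (ennreal t))"
      using t by (intro borel_measurable_diff path_int_adapted[OF g int]) auto
    moreover have "f (N t \<omega>) \<omega> - path_int g \<omega> t = Y \<omega> t" if \<omega>: "\<omega> \<in> space M" for \<omega>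
    proof -
      obtain n where n: "n \<le> njumps \<omega>" "jtime n \<omega> \<le> t" "n < njumps \<omega> \<longrightarrow> t < jtime (Suc n) \<omega>"
        using ex_interval[OF \<omega>, of t] t by auto
      have "N t \<omega> = n" using N[OF \<omega> n(1)] n t by simp
      moreover have "S n \<omega> \<le> ennreal t" using jtime[OF \<omega> n(1)] n by (simp add: ennreal_leI)
      ultimately show ?thesis by (simp add: f_def Y_def)
    qed
    ultimately show "(\<lambda>\<omega>. Y \<omega> t) \<in> borel_measurable (F (ennreal t))"
      by (subst measurable_cong[symmetric]) auto
  next
    fix \<omega> assume \<omega>: "\<omega> \<in> space M"
    show "cadlag_on T (Y \<omega>)"
      unfolding cadlag_on_def
    proof (intro conjI allI impI)
      fix t assume t: "0 \<le> t \<and> t < T"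
      obtain n where n: "n \<le> njumps \<omega>" "jtime n \<omega> \<le> t" "n < njumps \<omega> \<longrightarrow> t < jtime (Suc n) \<omega>"
        using ex_interval[OF \<omega>, of t] t by auto
      define u where "u = (if n < njumps \<omega> then jtime (Suc n) \<omega> else T)"
      have u: "t < u" "u \<le> T" using n t jtime(3)[OF \<omega>, of "Suc n"] by (auto simp: u_def)
      have "\<forall>\<^sub>F s in at_right t. c n \<omega> - path_int g \<omega> s = Y \<omega> s"
      proof -
        have "\<forall>\<^sub>F s in at_right t. s \<in> {t<..<u}" using u by (intro eventually_at_rightI[of _ u]) auto
        then show ?thesis
        proof eventually_elim
          case (elim s)
          have "Y \<omega> s = c n \<omega> - path_int g \<omega> s" by (rule Yeq[OF \<omega> n(1)]) (use elim n t u in \<open>auto simp: u_def split: if_splits\<close>)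
          then show ?case ..
        qed
      qed
      moreover have "((\<lambda>s. c n \<omega> - path_int g \<omega> s) \<longlongrightarrow> c n \<omega> - path_int g \<omega> t) (at_right t)"
        by (intro tendsto_intros path_int_tendsto_right[OF \<omega> g int[OF \<omega>]])
      moreover have "Y \<omega> t = c n \<omega> - path_int g \<omega> t" by (rule Yeq[OF \<omega> n(1)]) (use n t in auto)
      ultimately show "(Y \<omega> \<longlongrightarrow> Y \<omega> t) (at_right t)" by (auto intro: Lim_transform_eventually)
    next
      fix t assume t: "0 < t \<and> t \<le> T"
      obtain n where "(\<omega>, t) \<in> J n" using ex_J[OF \<omega>, of t] t by auto
      then have n: "n \<le> njumps \<omega>" "jtime n \<omega> < t" "t \<le> jnext n \<omega>" using J_iff[OF \<omega>, of t n] t by auto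
      have "\<forall>\<^sub>F s in at_left t. c n \<omega> - path_int g \<omega> s = Y \<omega> s"
      proof -
        have "\<forall>\<^sub>F s in at_left t. s \<in> {jtime n \<omega><..<t}" using n by (intro eventually_at_leftI[of "jtime n \<omega>"]) auto
        then show ?thesis
        proof eventually_elim
          case (elim s)
          have "Y \<omega> s = c n \<omega> - path_int g \<omega> s"
            by (rule Yeq[OF \<omega> n(1)]) (use elim n t jtime(2)[OF \<omega> n(1)] in \<open>auto simp: jnext_def split: if_splits\<close>)
          then show ?case ..
        qed
      qed
      moreover have "((\<lambda>s. c n \<omega> - path_int g \<omega> s) \<longlongrightarrow> c n \<omega> - (\<integral>z. indicator ({0<..<t} \<times> UNIV) z *\<^sub>R g (at_path \<omega> z) \<partial>\<nu> \<omega>)) (at_left t)"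
        by (intro tendsto_intros path_int_tendsto_left[OF \<omega> g int[OF \<omega>]])
      ultimately show "\<exists>l. (Y \<omega> \<longlongrightarrow> l) (at_left t)" by (blast intro: Lim_transform_eventually)
    qed
  qed
  then show ?thesis using Z c(1) lev Yeq by (intro exI[of _ Y] exI[of _ Z] exI[of _ c]) simp
qed

lemma path_int_cong_AE:
  assumes \<omega>: "\<omega> \<in> space M" and [measurable]: "g \<in> borel_measurable PE" "g' \<in> borel_measurable PE"
    and eq: "AE z in \<nu> \<omega>. g' (at_path \<omega> z) = g (at_path \<omega> z)"
  shows "path_int g' \<omega> t = path_int g \<omega> t"
proof -
  have m: "(\<lambda>z. indicator ({0<..t} \<times> UNIV) z *\<^sub>R u (at_path \<omega> z)) \<in> borel_measurable (\<nu> \<omega>)"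
    if "u \<in> borel_measurable PE" for u :: "_ \<Rightarrow> real"
    using Ioc_times_sets[OF \<omega>, of "{0<..t}"] measurable_along_path[OF that \<omega>]
    by (intro borel_measurable_scaleR borel_measurable_indicator) auto
  show ?thesis unfolding path_int_def
    by (intro integral_cong_AE m) (use eq in \<open>auto elim: eventually_mono\<close>)
qed

text \<open>
  Passing to an everywhere integrable version of the driver does not affect the equation almost
  surely. The localizing events require \<open>c n\<close> and the bounds for the integral of \<open>\<bar>g'\<bar>\<close> and for
  \<open>A\<close> up to the next jump to be at most \<open>k\<close>: this bounds \<open>exp (\<beta> * A) * \<bar>Y\<bar>\<close> on the interval,
  and the expected length of the interval, measured by \<open>A\<close>, is at most \<open>1\<close>.
\<close>

lemma linear_solution_exists:
  assumes g[measurable]: "g \<in> borel_measurable PE" and int: "AE \<omega> in M. path_integrable g \<omega>"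
    and \<xi>: "\<xi> \<in> borel_measurable (F (ennreal T))"
  shows "\<exists>Y Z. linear_solution \<xi> g Y Z \<and> (\<forall>\<beta>\<ge>0. \<forall>n. locally_finite \<beta> Y n)"
proof -
  obtain g' where g'[measurable]: "g' \<in> borel_measurable PE" and int': "\<And>\<omega>. \<omega> \<in> space M \<Longrightarrow> path_integrable g' \<omega>"
    and eq: "AE \<omega> in M. AE z in \<nu> \<omega>. g' (at_path \<omega> z) = g (at_path \<omega> z)"
    using everywhere_integrable_version[OF g int] by blast
  obtain Y Z c where Y: "adapted_cadlag M T F Y" and Z: "uncurried Z \<in> borel_measurable PE"
    and c: "\<And>n. c n \<in> borel_measurable (hist n)"
    and lev: "\<And>\<omega> n. \<omega> \<in> space M \<Longrightarrow> n \<le> njumps \<omega> \<Longrightarrow> level \<xi> g' Z n \<omega> = c n \<omega>"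
    and Yeq: "\<And>\<omega> n t. \<omega> \<in> space M \<Longrightarrow> n \<le> njumps \<omega> \<Longrightarrow> 0 \<le> t \<Longrightarrow> t \<le> T \<Longrightarrow> jtime n \<omega> \<le> t \<Longrightarrow>
      (n < njumps \<omega> \<longrightarrow> t < jtime (Suc n) \<omega>) \<Longrightarrow> Y \<omega> t = c n \<omega> - path_int g' \<omega> t"
    using linear_solution_exists_everywhere_integrable[OF g' int' \<xi>] by blast
  have eqn: "Y \<omega> t + integral_Ioc t T (\<mu> \<omega>) (Z \<omega>) = \<xi> \<omega> + (path_int g' \<omega> T - path_int g' \<omega> t)"
    if \<omega>: "\<omega> \<in> space M" and t: "0 \<le> t" "t \<le> T" for \<omega> t
  proof -
    obtain n where n: "n \<le> njumps \<omega>" "jtime n \<omega> \<le> t" "n < njumps \<omega> \<longrightarrow> t < jtime (Suc n) \<omega>"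
      using ex_interval[OF \<omega> t] by auto
    then show ?thesis
      using Yeq[OF \<omega> n(1) t n(2,3)] lev[OF \<omega> n(1)] by (subst equation_iff_level[OF \<omega> Z t n(1,2)]) auto
  qed
  have sol': "linear_solution \<xi> g' Y Z"
    unfolding linear_solution_def using Y Z g' int' eqn by auto
  have sol: "linear_solution \<xi> g Y Z"
    unfolding linear_solution_def
  proof (intro conjI Y Z g int)
    show "AE \<omega> in M. \<forall>t\<in>{0..T}. Y \<omega> t + integral_Ioc t T (\<mu> \<omega>) (Z \<omega>) = \<xi> \<omega> + (path_int g \<omega> T - path_int g \<omega> t)"
      using eq AE_space
    proof eventually_elim
      case (elim \<omega>)
      have "path_int g' \<omega> t = path_int g \<omega> t" for t by (rule path_int_cong_AE[OF elim(2) g g' elim(1)])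
      then show ?case using eqn[OF elim(2)] by simp
    qed
  qed
  have "locally_finite \<beta> Y n" if \<beta>: "0 \<le> \<beta>" for \<beta> n
  proof -
    note [measurable] = left_lim_predictable[OF Y]
    have "AE \<omega> in M. var_upto g' \<omega> T < \<infinity>"
      using AE_space by eventually_elim (use int' in \<open>simp add: var_upto_T path_integrable_def\<close>)
    from dominated_until_next_jump[of "var_upto g'", OF var_upto_adapted[OF g'] var_upto_mono this]
    obtain r where r[measurable]: "\<And>n. r n \<in> borel_measurable (hist n)"
      "AE \<omega> in M. \<forall>n. S n \<omega> \<le> ennreal T \<longrightarrow> r n \<omega> < \<infinity> \<and>
        (\<forall>t. 0 \<le> t \<longrightarrow> t \<le> T \<longrightarrow> ennreal t < S (Suc n) \<omega> \<longrightarrow> var_upto g' \<omega> t \<le> r n \<omega>)" by blast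
    have Am: "(\<lambda>\<omega>. ennreal (A \<omega> t)) \<in> borel_measurable (F (ennreal t))" if "0 \<le> t" "t \<le> T" for t
      using A_adapted[OF that] by simp
    have "\<exists>a. (\<forall>n. a n \<in> borel_measurable (hist n)) \<and>
      (AE \<omega> in M. \<forall>n. S n \<omega> \<le> ennreal T \<longrightarrow> a n \<omega> < \<infinity> \<and>
        (\<forall>t. 0 \<le> t \<longrightarrow> t \<le> T \<longrightarrow> ennreal t < S (Suc n) \<omega> \<longrightarrow> ennreal (A \<omega> t) \<le> a n \<omega>))"
      by (rule dominated_until_next_jump[of "\<lambda>\<omega> t. ennreal (A \<omega> t)"]) (auto intro: Am ennreal_leI A_mono)
    then obtain a where a[measurable]: "\<And>n. a n \<in> borel_measurable (hist n)"
      "AE \<omega> in M. \<forall>n. S n \<omega> \<le> ennreal T \<longrightarrow> a n \<omega> < \<infinity> \<and>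
        (\<forall>t. 0 \<le> t \<longrightarrow> t \<le> T \<longrightarrow> ennreal t < S (Suc n) \<omega> \<longrightarrow> ennreal (A \<omega> t) \<le> a n \<omega>)" by blast
    note c[measurable]
    define B where "B k = {\<omega>\<in>space (hist n). ennreal \<bar>c n \<omega>\<bar> + r n \<omega> + a n \<omega> \<le> of_nat k}" for k :: nat
    have B: "B k \<in> sets (hist n)" for k unfolding B_def by measurable
    have bound: "AE \<omega> in M. indicator (B k) \<omega> * Y_int \<beta> Y n \<omega>
        \<le> ennreal (exp (\<beta> * real k) * (2 * real k)) * comp_int (\<lambda>p. indicator (J n) (fst p)) \<omega>" for k
      using AE_regular_path[OF sol'] r(2) a(2)
    proof eventually_elim
      case (elim \<omega>)
      note reg = elim(1)
      have \<omega>: "\<omega> \<in> space M" and cA: "continuous_on {0..T} (A \<omega>)" using reg by (auto simp: regular_path_def)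
      show ?case
      proof (cases "\<omega> \<in> B k \<and> n \<le> njumps \<omega>")
        case False
        then show ?thesis using J_empty_after_last[OF \<omega>, of n] by (auto simp: indicator_def Y_int_def not_le)
      next
        case True
        then have Bk: "ennreal \<bar>c n \<omega>\<bar> + r n \<omega> + a n \<omega> \<le> of_nat k" and n: "n \<le> njumps \<omega>" by (auto simp: B_def)
        have le3: "x \<le> of_nat k \<and> y \<le> of_nat k \<and> z \<le> of_nat k" if "x + y + z \<le> of_nat k" for x y z :: ennreal
          using that by (meson add_increasing add_increasing2 order_trans order_refl zero_le)
        have Bc: "\<bar>c n \<omega>\<bar> \<le> real k" and Br: "r n \<omega> \<le> ennreal (real k)" and Ba: "a n \<omega> \<le> ennreal (real k)"
          using le3[OF Bk] by (auto simp: ennreal_of_nat_eq_real_of_nat)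
        have Sn: "S n \<omega> \<le> ennreal T" using S_le_iff[OF \<omega>] n by simp
        have key: "expA \<beta> (\<omega>, t) * \<bar>left_lim Y (\<omega>, t)\<bar> \<le> exp (\<beta> * real k) * (2 * real k)" if t: "(\<omega>, t) \<in> J n" "0 < t" "t \<le> T" for t
        proof -
          have tn: "jtime n \<omega> < t" "t \<le> jnext n \<omega>" using J_iff[OF \<omega>, of t n] t by auto
          have before: "ennreal s < S (Suc n) \<omega> \<and> 0 \<le> s \<and> s \<le> T" if "s \<in> {jtime n \<omega><..<t}" for s
            using less_S_Suc_iff[OF \<omega> n, of s] jtime(2)[OF \<omega> n] that tn t by (auto simp: jnext_def split: if_splits)
          have ev: "\<forall>\<^sub>F s in at_left t. s \<in> {jtime n \<omega><..<t}" using tn by (intro eventually_at_leftI[of "jtime n \<omega>"]) auto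
          have "\<bar>path_int g' \<omega> t\<bar> \<le> real k"
          proof (rule tendsto_upperbound)
            show "((\<lambda>s. \<bar>path_int g' \<omega> s\<bar>) \<longlongrightarrow> \<bar>path_int g' \<omega> t\<bar>) (at_left t)"
              by (intro tendsto_rabs path_int_continuous_left[OF \<omega> g' int'[OF \<omega>] cA])
            show "\<forall>\<^sub>F s in at_left t. \<bar>path_int g' \<omega> s\<bar> \<le> real k"
              using ev
            proof eventually_elim
              case (elim s)
              have "ennreal \<bar>path_int g' \<omega> s\<bar> \<le> var_upto g' \<omega> s"
                using before[OF elim] by (intro path_int_le_var_upto[OF \<omega> g' int'[OF \<omega>]]) auto
              also have "\<dots> \<le> r n \<omega>" using \<open>\<forall>n. S n \<omega> \<le> ennreal T \<longrightarrow> r n \<omega> < \<infinity> \<and> _ n\<close> Sn before[OF elim] by blast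
              also note Br
              finally show ?case by simp
            qed
          qed simp
          moreover have "left_lim Y (\<omega>, t) = c n \<omega> - path_int g' \<omega> t"
            using regular_path_left_lim[OF reg g' n tn] lev[OF \<omega> n] by simp
          ultimately have Yb: "\<bar>left_lim Y (\<omega>, t)\<bar> \<le> 2 * real k" using Bc by linarith
          have "A \<omega> t \<le> real k"
          proof (rule tendsto_upperbound)
            have "(A \<omega> \<longlongrightarrow> A \<omega> t) (at t within {0..T})" using cA t by (auto simp: continuous_on_def)
            then have "(A \<omega> \<longlongrightarrow> A \<omega> t) (at t within {0..t})" by (rule tendsto_within_subset) (use t in auto)
            then show "(A \<omega> \<longlongrightarrow> A \<omega> t) (at_left t)" using t by (simp add: at_within_Icc_at_left)
            show "\<forall>\<^sub>F s in at_left t. A \<omega> s \<le> real k"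
              using ev
            proof eventually_elim
              case (elim s)
              have "ennreal (A \<omega> s) \<le> a n \<omega>" using \<open>\<forall>n. S n \<omega> \<le> ennreal T \<longrightarrow> a n \<omega> < \<infinity> \<and> _ n\<close> Sn before[OF elim] by blast
              also note Ba
              finally show ?case by simp
            qed
          qed simp
          then have "expA \<beta> (\<omega>, t) \<le> exp (\<beta> * real k)" using \<beta> by (simp add: expA_def mult_left_mono)
          then show ?thesis using Yb by (intro mult_mono) (auto simp: expA_def)
        qed
        have "Y_int \<beta> Y n \<omega> \<le> comp_int (\<lambda>p. ennreal (exp (\<beta> * real k) * (2 * real k)) * indicator (J n) (fst p)) \<omega>"
          unfolding Y_int_def by (intro comp_int_mono[OF \<omega>]) (auto simp: indicator_def intro!: ennreal_leI key)
        also have "\<dots> = ennreal (exp (\<beta> * real k) * (2 * real k)) * comp_int (\<lambda>p. indicator (J n) (fst p)) \<omega>"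
          by (intro comp_int_cmult[OF \<omega>]) measurable
        finally show ?thesis using True by (simp add: indicator_def)
      qed
    qed
    \<comment> \<open>the expected \<open>A\<close>-length of an interval is the probability that it ends with a jump\<close>
    have one: "(\<integral>\<^sup>+\<omega>. comp_int (\<lambda>p. indicator (J n) (fst p)) \<omega> \<partial>M) \<le> 1"
    proof -
      have "(\<integral>\<^sup>+\<omega>. comp_int (\<lambda>p. indicator (J n) (fst p)) \<omega> \<partial>M) = (\<integral>\<^sup>+p. 1 * indicator (J n) (fst p) \<partial>Q)"
        by (subst nn_integral_Q) auto
      also have "\<dots> = (\<integral>\<^sup>+\<omega>. (if S (Suc n) \<omega> \<le> ennreal T then 1 else 0) \<partial>M)" by (rule next_jump_identity) simp
      also have "\<dots> \<le> (\<integral>\<^sup>+\<omega>. 1 \<partial>M)" by (intro nn_integral_mono) auto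
      finally show ?thesis by (simp add: emeasure_space_1)
    qed
    show ?thesis
      unfolding locally_finite_def
    proof (intro exI[of _ B] conjI allI)
      show "range B \<subseteq> sets (hist n)" using B by auto
      show "incseq B" unfolding incseq_def B_def by (auto intro: order_trans)
      show "AE \<omega> in M. S n \<omega> \<le> ennreal T \<longrightarrow> (\<exists>k. \<omega> \<in> B k)"
        using r(2) a(2) AE_space
      proof eventually_elim
        case (elim \<omega>)
        show ?case
        proof
          assume Sn: "S n \<omega> \<le> ennreal T"
          have "r n \<omega> < \<infinity>" "a n \<omega> < \<infinity>" using elim(1,2) Sn by blast+
          then have "ennreal \<bar>c n \<omega>\<bar> + r n \<omega> + a n \<omega> < \<infinity>" by (simp add: less_top[symmetric] ennreal_add_eq_top)
          then obtain k :: nat where "ennreal \<bar>c n \<omega>\<bar> + r n \<omega> + a n \<omega> < of_nat k"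
            using ennreal_Ex_less_of_nat[of "ennreal \<bar>c n \<omega>\<bar> + r n \<omega> + a n \<omega>"] by auto
          then have "ennreal \<bar>c n \<omega>\<bar> + r n \<omega> + a n \<omega> \<le> of_nat k" by (rule less_imp_le)
          then show "\<exists>k. \<omega> \<in> B k" using elim(3) by (auto simp: B_def)
        qed
      qed
      fix k
      have "(\<integral>\<^sup>+\<omega>. indicator (B k) \<omega> * Y_int \<beta> Y n \<omega> \<partial>M)
        \<le> (\<integral>\<^sup>+\<omega>. ennreal (exp (\<beta> * real k) * (2 * real k)) * comp_int (\<lambda>p. indicator (J n) (fst p)) \<omega> \<partial>M)"
        by (rule nn_integral_mono_AE[OF bound])
      also have "\<dots> = ennreal (exp (\<beta> * real k) * (2 * real k)) * (\<integral>\<^sup>+\<omega>. comp_int (\<lambda>p. indicator (J n) (fst p)) \<omega> \<partial>M)"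
        by (intro nn_integral_cmult) measurable
      also have "\<dots> \<le> ennreal (exp (\<beta> * real k) * (2 * real k)) * 1" by (intro mult_left_mono one) simp
      also have "\<dots> < \<infinity>" by simp
      finally show "(\<integral>\<^sup>+\<omega>. indicator (B k) \<omega> * Y_int \<beta> Y n \<omega> \<partial>M) < \<infinity>" .
    qed
  qed
  then show ?thesis using sol by blast
qed

end

section \<open>Differences of solutions\<close>

text \<open>One-sided limits give a bound near each point, and compactness does the rest.\<close>

lemma cadlag_on_bounded:
  assumes "cadlag_on T y"
  shows "\<exists>C\<ge>0. \<forall>t\<in>{0..T}. \<bar>y t\<bar> \<le> C"
proof -
  have "\<exists>e C. 0 < e \<and> (\<forall>s\<in>{0..T}. \<bar>s - t\<bar> < e \<longrightarrow> \<bar>y s\<bar> \<le> C)" if t: "t \<in> {0..T}" for t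
  proof -
    have "\<exists>e C. 0 < e \<and> (\<forall>s\<in>{0..T}. t < s \<longrightarrow> s < t + e \<longrightarrow> \<bar>y s\<bar> \<le> C)"
    proof (cases "t < T")
      case True
      then have "(y \<longlongrightarrow> y t) (at_right t)" using assms t by (auto simp: cadlag_on_def)
      then have "((\<lambda>s. \<bar>y s\<bar>) \<longlongrightarrow> \<bar>y t\<bar>) (at_right t)" by (rule tendsto_rabs)
      then have "\<forall>\<^sub>F s in at_right t. \<bar>y s\<bar> < \<bar>y t\<bar> + 1" by (rule order_tendstoD(2)) simp
      then obtain b where "t < b" "\<And>s. t < s \<Longrightarrow> s < b \<Longrightarrow> \<bar>y s\<bar> < \<bar>y t\<bar> + 1"
        unfolding eventually_at_right_field by blast
      then show ?thesis by (intro exI[of _ "b - t"] exI[of _ "\<bar>y t\<bar> + 1"]) (auto intro: less_imp_le)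
    qed (use t in \<open>auto intro!: exI[of _ 1]\<close>)
    then obtain e1 C1 where e1: "0 < e1" "\<And>s. s \<in> {0..T} \<Longrightarrow> t < s \<Longrightarrow> s < t + e1 \<Longrightarrow> \<bar>y s\<bar> \<le> C1" by blast
    have "\<exists>e C. 0 < e \<and> (\<forall>s\<in>{0..T}. s < t \<longrightarrow> t - e < s \<longrightarrow> \<bar>y s\<bar> \<le> C)"
    proof (cases "0 < t")
      case True
      then obtain l where "(y \<longlongrightarrow> l) (at_left t)" using assms t by (auto simp: cadlag_on_def)
      then have "((\<lambda>s. \<bar>y s\<bar>) \<longlongrightarrow> \<bar>l\<bar>) (at_left t)" by (rule tendsto_rabs)
      then have "\<forall>\<^sub>F s in at_left t. \<bar>y s\<bar> < \<bar>l\<bar> + 1" by (rule order_tendstoD(2)) simp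
      then obtain b where "b < t" "\<And>s. b < s \<Longrightarrow> s < t \<Longrightarrow> \<bar>y s\<bar> < \<bar>l\<bar> + 1"
        unfolding eventually_at_left_field by blast
      then show ?thesis by (intro exI[of _ "t - b"] exI[of _ "\<bar>l\<bar> + 1"]) (auto intro: less_imp_le)
    qed (use t in \<open>auto intro!: exI[of _ 1]\<close>)
    then obtain e2 C2 where e2: "0 < e2" "\<And>s. s \<in> {0..T} \<Longrightarrow> s < t \<Longrightarrow> t - e2 < s \<Longrightarrow> \<bar>y s\<bar> \<le> C2" by blast
    have "\<bar>y s\<bar> \<le> max \<bar>y t\<bar> (max C1 C2)" if s: "s \<in> {0..T}" "\<bar>s - t\<bar> < min e1 e2" for s
    proof -
      consider "s = t" | "t < s" | "s < t" by linarith
      then show ?thesis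
      proof cases
        case 2
        then have "\<bar>y s\<bar> \<le> C1" using s by (intro e1(2)) auto
        then show ?thesis by simp
      next
        case 3
        then have "\<bar>y s\<bar> \<le> C2" using s by (intro e2(2)) auto
        then show ?thesis by simp
      qed simp
    qed
    then show ?thesis using e1(1) e2(1) by (intro exI[of _ "min e1 e2"] exI[of _ "max \<bar>y t\<bar> (max C1 C2)"]) simp
  qed
  then have "\<forall>t\<in>{0..T}. \<exists>p. 0 < fst p \<and> (\<forall>s\<in>{0..T}. \<bar>s - t\<bar> < fst p \<longrightarrow> \<bar>y s\<bar> \<le> snd p)" by simp
  from bchoice[OF this] obtain p where p: "\<forall>t\<in>{0..T}. 0 < fst (p t) \<and> (\<forall>s\<in>{0..T}. \<bar>s - t\<bar> < fst (p t) \<longrightarrow> \<bar>y s\<bar> \<le> snd (p t))" ..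
  define e C where "e t = fst (p t)" and "C t = snd (p t)" for t
  have eC: "\<And>t. t \<in> {0..T} \<Longrightarrow> 0 < e t"
    "\<And>t s. t \<in> {0..T} \<Longrightarrow> s \<in> {0..T} \<Longrightarrow> \<bar>s - t\<bar> < e t \<Longrightarrow> \<bar>y s\<bar> \<le> C t"
    using p unfolding e_def C_def by blast+
  have cover: "{0..T} \<subseteq> (\<Union>t\<in>{0..T}. ball t (e t))" using eC(1) by (auto intro: centre_in_ball[THEN iffD2])
  obtain D where D: "D \<subseteq> {0..T}" "finite D" "{0..T} \<subseteq> (\<Union>t\<in>D. ball t (e t))"
    by (rule compactE_image[OF compact_Icc _ cover]) simp_all
  show ?thesis
  proof (intro exI[of _ "\<Sum>t\<in>D. \<bar>C t\<bar>"] conjI ballI)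
    fix s assume s: "s \<in> {0..T}"
    then obtain t where t: "t \<in> D" "\<bar>s - t\<bar> < e t" using D(3) by (auto simp: dist_real_def abs_minus_commute)
    then have "\<bar>y s\<bar> \<le> C t" using D(1) s by (intro eC(2)) auto
    also have "\<dots> \<le> \<bar>C t\<bar>" by simp
    also have "\<dots> \<le> (\<Sum>t\<in>D. \<bar>C t\<bar>)" using D(2) t(1) by (intro member_le_sum) auto
    finally show "\<bar>y s\<bar> \<le> (\<Sum>t\<in>D. \<bar>C t\<bar>)" .
  qed (simp add: sum_nonneg)
qed

lemma left_limit_bounded:
  assumes "cadlag_on T y" "\<And>t. t \<in> {0..T} \<Longrightarrow> \<bar>y t\<bar> \<le> C" "0 < t" "t \<le> T"
  shows "\<bar>Lim (at_left t) y\<bar> \<le> C"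
proof -
  obtain l where l: "(y \<longlongrightarrow> l) (at_left t)" using assms by (auto simp: cadlag_on_def)
  then have "Lim (at_left t) y = l" by (intro tendsto_Lim) auto
  moreover have "\<bar>l\<bar> \<le> C"
  proof (rule tendsto_upperbound)
    show "((\<lambda>s. \<bar>y s\<bar>) \<longlongrightarrow> \<bar>l\<bar>) (at_left t)" using l by (rule tendsto_rabs)
    have "\<forall>\<^sub>F s in at_left t. s \<in> {0<..<t}" using assms by (intro eventually_at_leftI[of 0]) auto
    then show "\<forall>\<^sub>F s in at_left t. \<bar>y s\<bar> \<le> C" by eventually_elim (use assms in auto)
  qed simp
  ultimately show ?thesis by simp
qed

context marked_point_process
begin

lemma adapted_cadlag_zero: "adapted_cadlag M T F (\<lambda>_ _. 0)"
  by (auto simp: adapted_cadlag_def cadlag_on_def)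

lemma left_lim_zero: "left_lim (\<lambda>_ _. 0) p = 0"
  by (auto simp: left_lim_def intro!: tendsto_Lim)

lemma adapted_cadlag_diff:
  assumes "adapted_cadlag M T F Y" "adapted_cadlag M T F Y'"
  shows "adapted_cadlag M T F (\<lambda>\<omega> t. Y \<omega> t - Y' \<omega> t)"
  unfolding adapted_cadlag_def
proof (intro conjI ballI)
  fix t assume "t \<in> {0..T}"
  then show "(\<lambda>\<omega>. Y \<omega> t - Y' \<omega> t) \<in> borel_measurable (F (ennreal t))"
    using assms by (intro borel_measurable_diff) (auto simp: adapted_cadlag_def)
next
  fix \<omega> assume "\<omega> \<in> space M"
  then have "cadlag_on T (Y \<omega>)" "cadlag_on T (Y' \<omega>)" using assms by (auto simp: adapted_cadlag_def)
  note c = this[unfolded cadlag_on_def]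
  show "cadlag_on T (\<lambda>t. Y \<omega> t - Y' \<omega> t)"
    unfolding cadlag_on_def
  proof (intro conjI allI impI)
    fix t assume t: "0 \<le> t \<and> t < T"
    show "((\<lambda>t. Y \<omega> t - Y' \<omega> t) \<longlongrightarrow> Y \<omega> t - Y' \<omega> t) (at_right t)"
      using c(1)[THEN conjunct1, rule_format, OF t] c(2)[THEN conjunct1, rule_format, OF t] by (rule tendsto_diff)
  next
    fix t assume t: "0 < t \<and> t \<le> T"
    obtain l l' where "(Y \<omega> \<longlongrightarrow> l) (at_left t)" "(Y' \<omega> \<longlongrightarrow> l') (at_left t)"
      using c(1)[THEN conjunct2, rule_format, OF t] c(2)[THEN conjunct2, rule_format, OF t] by blast
    then have "((\<lambda>t. Y \<omega> t - Y' \<omega> t) \<longlongrightarrow> l - l') (at_left t)" by (rule tendsto_diff)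
    then show "\<exists>l. ((\<lambda>t. Y \<omega> t - Y' \<omega> t) \<longlongrightarrow> l) (at_left t)" ..
  qed
qed

lemma left_lim_diff:
  assumes "adapted_cadlag M T F Y" "adapted_cadlag M T F Y'" "p \<in> space Pr"
  shows "left_lim (\<lambda>\<omega> t. Y \<omega> t - Y' \<omega> t) p = left_lim Y p - left_lim Y' p"
proof (cases "snd p = 0")
  case False
  obtain \<omega> t where p: "p = (\<omega>, t)" by (cases p)
  have t: "0 < t" "t \<le> T" and \<omega>: "\<omega> \<in> space M" using False assms(3) p by auto
  have "cadlag_on T (Y \<omega>)" "cadlag_on T (Y' \<omega>)" using assms(1,2) \<omega> by (auto simp: adapted_cadlag_def)
  note c = this[unfolded cadlag_on_def]
  obtain l l' where l: "(Y \<omega> \<longlongrightarrow> l) (at_left t)" "(Y' \<omega> \<longlongrightarrow> l') (at_left t)"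
    using c(1)[THEN conjunct2, rule_format, of t] c(2)[THEN conjunct2, rule_format, of t] t by blast
  have "left_lim (\<lambda>\<omega> t. Y \<omega> t - Y' \<omega> t) (\<omega>, t) = l - l'"
    by (rule left_lim_eqI[OF t(1)]) (rule tendsto_diff[OF l])
  then show ?thesis using left_lim_eqI[where Y=Y, OF t(1) l(1)] left_lim_eqI[where Y=Y', OF t(1) l(2)] p by simp
qed (simp add: left_lim_def)

lemma unc_diff: "uncurried (\<lambda>\<omega> t x. Z \<omega> t x - Z' \<omega> t x) p = uncurried Z p - uncurried Z' p"
  by (simp add: uncurried_def)

lemma path_integrable_diff:
  assumes \<omega>: "\<omega> \<in> space M" and m: "g \<in> borel_measurable PE" "g' \<in> borel_measurable PE"
    and i: "path_integrable g \<omega>" "path_integrable g' \<omega>"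
  shows "path_integrable (\<lambda>p. g p - g' p) \<omega>" "path_int (\<lambda>p. g p - g' p) \<omega> t = path_int g \<omega> t - path_int g' \<omega> t"
proof -
  note i1 = path_integrableD[OF \<omega> m(1) i(1)] and i2 = path_integrableD[OF \<omega> m(2) i(2)]
  have "integrable (\<nu> \<omega>) (\<lambda>z. g (at_path \<omega> z) - g' (at_path \<omega> z))" by (intro Bochner_Integration.integrable_diff i1(1) i2(1))
  then show "path_integrable (\<lambda>p. g p - g' p) \<omega>"
    by (simp add: path_integrable_def comp_int_def integrable_iff_bounded)
  have "path_int (\<lambda>p. g p - g' p) \<omega> t = (\<integral>z. indicator ({0<..t} \<times> UNIV) z *\<^sub>R g (at_path \<omega> z) - indicator ({0<..t} \<times> UNIV) z *\<^sub>R g' (at_path \<omega> z) \<partial>\<nu> \<omega>)"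
    unfolding path_int_def by (simp add: algebra_simps)
  also have "\<dots> = path_int g \<omega> t - path_int g' \<omega> t"
    unfolding path_int_def
    by (intro Bochner_Integration.integral_diff i1(2) i2(2) Ioc_times_sets[OF \<omega>]) auto
  finally show "path_int (\<lambda>p. g p - g' p) \<omega> t = path_int g \<omega> t - path_int g' \<omega> t" .
qed

lemma linear_solution_diff:
  assumes s: "linear_solution \<eta> g Y Z" and s': "linear_solution \<eta> g' Y' Z'"
  shows "linear_solution (\<lambda>_. 0) (\<lambda>p. g p - g' p) (\<lambda>\<omega> t. Y \<omega> t - Y' \<omega> t) (\<lambda>\<omega> t x. Z \<omega> t x - Z' \<omega> t x)"
proof -
  note d = linear_solutionD[OF s] and d' = linear_solutionD[OF s']
  let ?Z = "\<lambda>\<omega> t x. Z \<omega> t x - Z' \<omega> t x"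
  have Z: "uncurried ?Z \<in> borel_measurable PE"
    using borel_measurable_diff[OF d(2) d'(2)] by (simp add: uncurried_def[abs_def])
  have "AE \<omega> in M. path_integrable (\<lambda>p. g p - g' p) \<omega>"
    using d(5) d'(5) AE_space by eventually_elim (rule path_integrable_diff(1)[OF _ d(3) d'(3)])
  moreover have "AE \<omega> in M. \<forall>t\<in>{0..T}. Y \<omega> t - Y' \<omega> t + integral_Ioc t T (\<mu> \<omega>) (?Z \<omega>)
      = 0 + (path_int (\<lambda>p. g p - g' p) \<omega> T - path_int (\<lambda>p. g p - g' p) \<omega> t)"
  proof -
    have e: "AE \<omega> in M. \<forall>t\<in>{0..T}. Y \<omega> t + integral_Ioc t T (\<mu> \<omega>) (Z \<omega>) = \<eta> \<omega> + (path_int g \<omega> T - path_int g \<omega> t)"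
      "AE \<omega> in M. \<forall>t\<in>{0..T}. Y' \<omega> t + integral_Ioc t T (\<mu> \<omega>) (Z' \<omega>) = \<eta> \<omega> + (path_int g' \<omega> T - path_int g' \<omega> t)"
      using s s' by (simp_all add: linear_solution_def)
    show ?thesis
      using e d(5) d'(5) AE_space
    proof eventually_elim
      case (elim \<omega>)
      show ?case
      proof
        fix t assume t: "t \<in> {0..T}"
        then have "integral_Ioc t T (\<mu> \<omega>) (?Z \<omega>) = integral_Ioc t T (\<mu> \<omega>) (Z \<omega>) - integral_Ioc t T (\<mu> \<omega>) (Z' \<omega>)"
          using Z d(2) d'(2) elim(5) integral_\<mu>_Ioc[OF elim(5), of ?Z t]
          by (simp add: integral_\<mu>_Ioc predictable_unc sum_subtractf)
        then show "Y \<omega> t - Y' \<omega> t + integral_Ioc t T (\<mu> \<omega>) (?Z \<omega>)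
            = 0 + (path_int (\<lambda>p. g p - g' p) \<omega> T - path_int (\<lambda>p. g p - g' p) \<omega> t)"
          using bspec[OF elim(1) t] bspec[OF elim(2) t] path_integrable_diff(2)[OF elim(5) d(3) d'(3) elim(3,4)] by simp
      qed
    qed
  qed
  ultimately show ?thesis
    unfolding linear_solution_def using adapted_cadlag_diff[OF d(1) d'(1)] Z borel_measurable_diff[OF d(3) d'(3)] by simp
qed

lemma jump_index_le: "\<omega> \<in> space M \<Longrightarrow> 0 < t \<Longrightarrow> t \<le> T \<Longrightarrow> jump_index (\<omega>, t) \<le> njumps \<omega>"
  using ex_J[of \<omega> t] jump_index_J[of "(\<omega>, t)"] J_iff[of \<omega> t] by auto

text \<open>
  A path has finitely many jumps, so along it the weight is bounded away from \<open>0\<close>, also for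
  \<open>\<alpha> < 1\<close>.
\<close>

lemma wnorm_finite_path_integrable:
  assumes g[measurable]: "g \<in> borel_measurable PE" and fin: "wnorm \<alpha> \<beta> g < \<infinity>" and \<alpha>: "0 < \<alpha>" and \<beta>: "0 \<le> \<beta>"
  shows "AE \<omega> in M. path_integrable g \<omega>"
proof -
  have "(\<integral>\<^sup>+\<omega>. comp_int (\<lambda>p. ennreal (weight \<alpha> \<beta> (fst p) * \<bar>g p\<bar>)) \<omega> \<partial>M) < \<infinity>"
    using fin by (subst (asm) nn_integral_Q) auto
  then have "AE \<omega> in M. comp_int (\<lambda>p. ennreal (weight \<alpha> \<beta> (fst p) * \<bar>g p\<bar>)) \<omega> \<noteq> \<infinity>"
    by (intro nn_integral_noteq_infinite) auto
  with AE_space show ?thesis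
  proof eventually_elim
    case (elim \<omega>)
    define C where "C = 1 / (min 1 \<alpha>) ^ njumps \<omega>"
    have C: "0 < C" using \<alpha> by (simp add: C_def)
    have lower: "1 \<le> C * weight \<alpha> \<beta> (\<omega>, t)" if t: "0 < t" "t \<le> T" for t
    proof -
      have n: "jump_index (\<omega>, t) \<le> njumps \<omega>" by (rule jump_index_le[OF elim(1) t])
      have "(min 1 \<alpha>) ^ njumps \<omega> \<le> (min 1 \<alpha>) ^ jump_index (\<omega>, t)" using \<alpha> n by (intro power_decreasing) auto
      also have "\<dots> \<le> \<alpha> ^ jump_index (\<omega>, t)" using \<alpha> by (intro power_mono) auto
      also have "\<dots> \<le> \<alpha> ^ jump_index (\<omega>, t) * expA \<beta> (\<omega>, t)"
        using \<alpha> \<beta> A_nonneg[OF elim(1), of t] t by (simp add: expA_def)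
      finally show ?thesis using \<alpha> by (simp add: C_def weight_def field_simps)
    qed
    have "comp_int (\<lambda>p. ennreal \<bar>g p\<bar>) \<omega> \<le> comp_int (\<lambda>p. ennreal C * ennreal (weight \<alpha> \<beta> (fst p) * \<bar>g p\<bar>)) \<omega>"
    proof (rule comp_int_mono[OF elim(1)])
      fix t x assume t: "0 < t" "t \<le> T"
      have "1 * \<bar>g ((\<omega>, t), x)\<bar> \<le> (C * weight \<alpha> \<beta> (\<omega>, t)) * \<bar>g ((\<omega>, t), x)\<bar>" by (intro mult_right_mono lower t) simp
      then show "ennreal \<bar>g ((\<omega>, t), x)\<bar> \<le> ennreal C * ennreal (weight \<alpha> \<beta> (fst ((\<omega>, t), x)) * \<bar>g ((\<omega>, t), x)\<bar>)"
        using C weight_pos[OF \<alpha>, of \<beta> "(\<omega>, t)"] by (simp add: ennreal_mult[symmetric] ennreal_leI mult.assoc)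
    qed
    also have "\<dots> = ennreal C * comp_int (\<lambda>p. ennreal (weight \<alpha> \<beta> (fst p) * \<bar>g p\<bar>)) \<omega>"
      by (intro comp_int_cmult elim) measurable
    also have "\<dots> < \<infinity>" using elim(2) by (auto simp: ennreal_mult_less_top top.not_eq_extremum)
    finally show ?case by (simp add: path_integrable_def)
  qed
qed

lemma wnorm_triangle:
  assumes \<alpha>: "0 < \<alpha>" and [measurable]: "u \<in> borel_measurable PE" "v \<in> borel_measurable PE"
    and le: "\<And>p. p \<in> space PE \<Longrightarrow> \<bar>w p\<bar> \<le> \<bar>u p\<bar> + \<bar>v p\<bar>"
  shows "wnorm \<alpha> \<beta> w \<le> wnorm \<alpha> \<beta> u + wnorm \<alpha> \<beta> v"
proof -
  have "wnorm \<alpha> \<beta> w \<le> (\<integral>\<^sup>+p. ennreal (weight \<alpha> \<beta> (fst p) * \<bar>u p\<bar>) + ennreal (weight \<alpha> \<beta> (fst p) * \<bar>v p\<bar>) \<partial>Q)"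
  proof (rule nn_integral_mono)
    fix p assume "p \<in> space Q"
    then have "weight \<alpha> \<beta> (fst p) * \<bar>w p\<bar> \<le> weight \<alpha> \<beta> (fst p) * (\<bar>u p\<bar> + \<bar>v p\<bar>)"
      using weight_pos[OF \<alpha>, of \<beta> "fst p"] le[of p] by (intro mult_left_mono) (auto simp: space_Q)
    then show "ennreal (weight \<alpha> \<beta> (fst p) * \<bar>w p\<bar>) \<le> ennreal (weight \<alpha> \<beta> (fst p) * \<bar>u p\<bar>) + ennreal (weight \<alpha> \<beta> (fst p) * \<bar>v p\<bar>)"
      using weight_pos[OF \<alpha>, of \<beta> "fst p"] by (simp add: distrib_left ennreal_leI flip: ennreal_plus)
  qed
  also have "\<dots> = wnorm \<alpha> \<beta> u + wnorm \<alpha> \<beta> v" by (intro nn_integral_add) measurable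
  finally show ?thesis .
qed

lemma wnorm_diff_finite:
  assumes "0 < \<alpha>" "u \<in> borel_measurable PE" "v \<in> borel_measurable PE" "wnorm \<alpha> \<beta> u < \<infinity>" "wnorm \<alpha> \<beta> v < \<infinity>"
  shows "wnorm \<alpha> \<beta> (\<lambda>p. u p - v p) < \<infinity>"
proof -
  have "wnorm \<alpha> \<beta> (\<lambda>p. u p - v p) \<le> wnorm \<alpha> \<beta> u + wnorm \<alpha> \<beta> v"
    by (rule wnorm_triangle[OF assms(1-3)]) simp
  also have "\<dots> < \<infinity>" using assms(4,5) by (simp add: less_top[symmetric])
  finally show ?thesis .
qed

lemma wnorm_zero_AE:
  assumes \<alpha>: "0 < \<alpha>" and [measurable]: "u \<in> borel_measurable PE" and "wnorm \<alpha> \<beta> u = 0"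
  shows "AE p in Q. u p = 0"
proof -
  have "AE p in Q. ennreal (weight \<alpha> \<beta> (fst p) * \<bar>u p\<bar>) = 0"
    using assms by (subst (asm) nn_integral_0_iff_AE) auto
  then show ?thesis
  proof eventually_elim
    case (elim p)
    then have "weight \<alpha> \<beta> (fst p) * \<bar>u p\<bar> \<le> 0" by (simp add: ennreal_eq_0_iff)
    then show ?case using weight_pos[OF \<alpha>, of \<beta> "fst p"] by (simp add: mult_le_0_iff)
  qed
qed

text \<open>
  The common terminal value cancels, and finite norms make the local finiteness required by the
  energy estimate automatic. This is the inequality behind both existence and uniqueness.
\<close>

lemma difference_estimate:
  assumes s: "linear_solution \<eta> g Y Z" and s': "linear_solution \<eta> g' Y' Z'"
    and \<alpha>: "0 < \<alpha>" and \<beta>: "1 + \<alpha> < \<beta>"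
    and fin: "wnorm \<alpha> \<beta> (\<lambda>p. left_lim Y (fst p)) < \<infinity>" "wnorm \<alpha> \<beta> (\<lambda>p. left_lim Y' (fst p)) < \<infinity>"
  shows "ennreal \<alpha> * wnorm \<alpha> \<beta> (\<lambda>p. uncurried Z p - uncurried Z' p)
      + ennreal (\<beta> - 1 - \<alpha>) * wnorm \<alpha> \<beta> (\<lambda>p. left_lim Y (fst p) - left_lim Y' (fst p))
    \<le> wnorm \<alpha> \<beta> (\<lambda>p. g p - g' p)"
proof -
  note d = linear_solutionD[OF s] and d' = linear_solutionD[OF s']
  note [measurable] = d(2-4) d'(2-4)
  let ?Y = "\<lambda>\<omega> t. Y \<omega> t - Y' \<omega> t" and ?Z = "\<lambda>\<omega> t x. Z \<omega> t x - Z' \<omega> t x"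
  let ?a = "wnorm \<alpha> \<beta> (\<lambda>p. left_lim Y (fst p) - left_lim Y' (fst p))"
  have a: "wnorm \<alpha> \<beta> (\<lambda>p. left_lim ?Y (fst p)) = ?a"
    by (intro nn_integral_cong) (simp add: space_Q space_PE left_lim_diff[OF d(1) d'(1)] mem_Times_iff)
  have z: "wnorm \<alpha> \<beta> (uncurried ?Z) = wnorm \<alpha> \<beta> (\<lambda>p. uncurried Z p - uncurried Z' p)" by (simp add: unc_diff)
  have "?a < \<infinity>" by (rule wnorm_diff_finite[OF \<alpha> _ _ fin]) measurable
  then have "locally_finite \<beta> ?Y n" for n
    by (intro locally_finite_if_integrable[OF adapted_cadlag_diff[OF d(1) d'(1)] \<alpha>]) (simp only: a)
  then show ?thesis
    using energy_estimate[OF linear_solution_diff[OF s s'] _ \<alpha> \<beta>] by (simp add: a z terminal_norm_def)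
qed

text \<open>
  Jump times are not charged by \<open>\<nu>\<close>, so it is the compensator identity that carries \<open>Q\<close>-null
  sets to the jumps.
\<close>

lemma AE_Q_at_jumps:
  assumes [measurable]: "u \<in> borel_measurable PE" and AE: "AE p in Q. u p = (0::real)"
  shows "AE \<omega> in M. \<forall>n<njumps \<omega>. u (jump_at (Suc n) \<omega>) = 0"
proof -
  have "AE \<omega> in M. (if S (Suc n) \<omega> \<le> ennreal T then ennreal \<bar>u (jump_at (Suc n) \<omega>)\<bar> else 0) = 0" for n
  proof -
    have "(\<integral>\<^sup>+\<omega>. indicator (space M) \<omega> * (if S (Suc n) \<omega> \<le> ennreal T then ennreal \<bar>u (jump_at (Suc n) \<omega>)\<bar> else 0) \<partial>M)
      = (\<integral>\<^sup>+\<omega>. indicator (space M) \<omega> * comp_int (\<lambda>p. ennreal \<bar>u p\<bar> * indicator (J n) (fst p)) \<omega> \<partial>M)"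
      using sets.top[of "hist n"] by (intro next_jump_identity_hist[symmetric]) auto
    also have "\<dots> = (\<integral>\<^sup>+p. ennreal \<bar>u p\<bar> * indicator (J n) (fst p) \<partial>Q)"
      by (subst nn_integral_Q) (auto cong: nn_integral_cong)
    also have "\<dots> = (\<integral>\<^sup>+p. 0 \<partial>Q)" by (intro nn_integral_cong_AE) (use AE in \<open>auto elim: eventually_mono\<close>)
    finally have "(\<integral>\<^sup>+\<omega>. (if S (Suc n) \<omega> \<le> ennreal T then ennreal \<bar>u (jump_at (Suc n) \<omega>)\<bar> else 0) \<partial>M) = 0"
      by (simp cong: nn_integral_cong)
    then show ?thesis by (subst (asm) nn_integral_0_iff_AE) auto
  qed
  then have "AE \<omega> in M. \<forall>n. (if S (Suc n) \<omega> \<le> ennreal T then ennreal \<bar>u (jump_at (Suc n) \<omega>)\<bar> else 0) = 0"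
    by (simp add: AE_all_countable)
  with AE_space show ?thesis
  proof eventually_elim
    case (elim \<omega>)
    show ?case
    proof (intro allI impI)
      fix n assume "n < njumps \<omega>"
      then have "S (Suc n) \<omega> \<le> ennreal T" using S_le_iff[OF elim(1)] by simp
      then show "u (jump_at (Suc n) \<omega>) = 0" using spec[OF elim(2), of n] by simp
    qed
  qed
qed

lemma path_unique:
  assumes sol: "linear_solution (\<lambda>_. 0) g Y Z" and g: "AE p in Q. g p = 0" and Z: "AE p in Q. uncurried Z p = 0"
  shows "AE \<omega> in M. \<forall>t\<in>{0..T}. Y \<omega> t = 0"
proof -
  note d = linear_solutionD[OF sol]
  show ?thesis
    using AE_regular_path[OF sol] AE_Q_path[OF g] AE_Q_at_jumps[OF d(2) Z]
  proof eventually_elim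
    case (elim \<omega>)
    have \<omega>: "\<omega> \<in> space M" using elim(1) by (simp add: regular_path_def)
    have p0: "path_int g \<omega> t = 0" for t
    proof -
      have "path_int g \<omega> t = path_int (\<lambda>_. 0) \<omega> t"
        by (rule path_int_cong_AE[OF \<omega>]) (use d(3) elim(2) in auto)
      then show ?thesis by (simp add: path_int_def)
    qed
    have l0: "level (\<lambda>_. 0) g Z n \<omega> = 0" for n
    proof -
      have "Z \<omega> (jtime k \<omega>) (X k \<omega>) = 0" if k: "k \<in> {n<..njumps \<omega>}" for k
      proof -
        obtain m where m: "k = Suc m" using k by (cases k) auto
        then have "uncurried Z (jump_at (Suc m) \<omega>) = 0" using elim(3) k by auto
        then show ?thesis using jump_at_eq[OF \<omega>, of k] k m by (simp add: uncurried_def)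
      qed
      then show ?thesis by (simp add: level_def p0)
    qed
    show ?case
    proof
      fix t assume t: "t \<in> {0..T}"
      obtain n where "n \<le> njumps \<omega>" "jtime n \<omega> \<le> t" "n < njumps \<omega> \<longrightarrow> t < jtime (Suc n) \<omega>"
        using ex_interval[OF \<omega>, of t] t by auto
      then show "Y \<omega> t = 0" using elim(1) t l0 p0 unfolding regular_path_def by auto
    qed
  qed
qed

text \<open>
  The counting process includes a jump at \<open>t\<close> and \<open>jump_index\<close> does not, so they agree off the
  jump times.
\<close>

lemma off_jumps:
  assumes \<omega>: "\<omega> \<in> space M" and t: "0 < t" "t \<le> T" and nj: "\<And>n. t \<noteq> jtime n \<omega>"
  obtains n where "n \<le> njumps \<omega>" "jtime n \<omega> < t" "t \<le> jnext n \<omega>" "n < njumps \<omega> \<longrightarrow> t < jtime (Suc n) \<omega>"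
    "jump_index (\<omega>, t) = n" "counting_process T S X \<omega> t = real n"
proof -
  obtain n where J: "(\<omega>, t) \<in> J n" using ex_J[OF \<omega> t] by auto
  have n: "n \<le> njumps \<omega>" "jtime n \<omega> < t" "t \<le> jnext n \<omega>" using J_iff[OF \<omega>, of t n] J t by auto
  moreover have l: "n < njumps \<omega> \<longrightarrow> t < jtime (Suc n) \<omega>" using n(3) nj[of "Suc n"] by (auto simp: jnext_def)
  moreover have "counting_process T S X \<omega> t = real n" using n l t by (intro counting_process_eq[OF \<omega>]) auto
  ultimately show ?thesis using jump_index_J[OF J] that by blast
qed

lemma AE_off_jumps: "AE \<omega> in M. AE z in \<nu> \<omega>. 0 < fst z \<and> fst z \<le> T \<and> (\<forall>n. fst z \<noteq> jtime n \<omega>)"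
  using AE_space AE_continuous
proof eventually_elim
  case (elim \<omega>)
  have "AE z in \<nu> \<omega>. \<forall>n. fst z \<noteq> jtime n \<omega>"
    using AE_\<nu>_no_atom[OF elim(1,2)] by (simp add: AE_all_countable)
  with AE_\<nu>_Ioc[OF elim(1)] show ?case by eventually_elim simp
qed

text \<open>
  For continuous \<open>A\<close> the countably many jump times have \<open>\<nu>\<close>-measure \<open>0\<close>. Off them \<open>Y\<close> equals its
  left limit, and the counting process equals \<open>jump_index\<close>.
\<close>

lemma L1_norm_eq:
  assumes \<alpha>: "0 < \<alpha>" and sol: "linear_solution \<eta> g Y Z"
  shows "(\<integral>\<^sup>+\<omega>. nn_integral_upto T (\<nu> \<omega>) (\<lambda>t x. ennreal ((\<bar>Y \<omega> t\<bar> + \<bar>Z \<omega> t x\<bar>) * exp (\<beta> * A \<omega> t) * \<alpha> powr counting_process T S X \<omega> t)) \<partial>M)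
    = wnorm \<alpha> \<beta> (\<lambda>p. left_lim Y (fst p)) + wnorm \<alpha> \<beta> (uncurried Z)"
proof -
  note d[measurable] = linear_solutionD(2,3,4)[OF sol]
  let ?H = "\<lambda>p. ennreal (weight \<alpha> \<beta> (fst p) * \<bar>left_lim Y (fst p)\<bar>) + ennreal (weight \<alpha> \<beta> (fst p) * \<bar>uncurried Z p\<bar>)"
  have "(\<integral>\<^sup>+\<omega>. nn_integral_upto T (\<nu> \<omega>) (\<lambda>t x. ennreal ((\<bar>Y \<omega> t\<bar> + \<bar>Z \<omega> t x\<bar>) * exp (\<beta> * A \<omega> t) * \<alpha> powr counting_process T S X \<omega> t)) \<partial>M)
    = (\<integral>\<^sup>+\<omega>. comp_int ?H \<omega> \<partial>M)"
  proof (rule nn_integral_cong_AE)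
    show "AE \<omega> in M. nn_integral_upto T (\<nu> \<omega>) (\<lambda>t x. ennreal ((\<bar>Y \<omega> t\<bar> + \<bar>Z \<omega> t x\<bar>) * exp (\<beta> * A \<omega> t) * \<alpha> powr counting_process T S X \<omega> t))
      = comp_int ?H \<omega>"
      using AE_regular_path[OF sol] AE_off_jumps
    proof eventually_elim
      case (elim \<omega>)
      note reg = elim(1)
      have \<omega>: "\<omega> \<in> space M" using reg by (simp add: regular_path_def)
      show ?case
        unfolding nn_integral_upto_def comp_int_def
      proof (intro nn_integral_cong_AE, use elim(2) in eventually_elim)
        case (elim z)
        then have t: "0 < fst z" "fst z \<le> T" and nj: "\<And>n. fst z \<noteq> jtime n \<omega>" by auto
        obtain n where n: "n \<le> njumps \<omega>" "jtime n \<omega> < fst z" "fst z \<le> jnext n \<omega>" "n < njumps \<omega> \<longrightarrow> fst z < jtime (Suc n) \<omega>"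
          "jump_index (\<omega>, fst z) = n" "counting_process T S X \<omega> (fst z) = real n" by (rule off_jumps[OF \<omega> t nj])
        have "Y \<omega> (fst z) = level \<eta> g Z n \<omega> - path_int g \<omega> (fst z)"
          using reg n t unfolding regular_path_def by auto
        also have "\<dots> = left_lim Y (\<omega>, fst z)" by (rule regular_path_left_lim[OF reg d(2) n(1-3), symmetric])
        finally have Y: "Y \<omega> (fst z) = left_lim Y (\<omega>, fst z)" .
        have ap: "at_path \<omega> z = ((\<omega>, fst z), snd z)" using t by (simp add: at_path_def)
        have w: "exp (\<beta> * A \<omega> (fst z)) * \<alpha> powr counting_process T S X \<omega> (fst z) = weight \<alpha> \<beta> (\<omega>, fst z)"
          using n \<alpha> by (simp add: weight_def expA_def powr_realpow)
        have "(\<bar>Y \<omega> (fst z)\<bar> + \<bar>Z \<omega> (fst z) (snd z)\<bar>) * exp (\<beta> * A \<omega> (fst z)) * \<alpha> powr counting_process T S X \<omega> (fst z)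
          = weight \<alpha> \<beta> (\<omega>, fst z) * \<bar>left_lim Y (\<omega>, fst z)\<bar> + weight \<alpha> \<beta> (\<omega>, fst z) * \<bar>uncurried Z ((\<omega>, fst z), snd z)\<bar>"
          unfolding mult.assoc w Y by (simp add: uncurried_def algebra_simps)
        then show ?case
          using t weight_pos[OF \<alpha>, of \<beta> "(\<omega>, fst z)"] by (simp add: ap indicator_def mem_Times_iff ennreal_plus)
      qed
    qed
  qed
  also have "\<dots> = (\<integral>\<^sup>+p. ?H p \<partial>Q)" by (rule nn_integral_Q[symmetric]) measurable
  also have "\<dots> = wnorm \<alpha> \<beta> (\<lambda>p. left_lim Y (fst p)) + wnorm \<alpha> \<beta> (uncurried Z)" by (intro nn_integral_add) measurable
  finally show ?thesis .
qed

end

section \<open>The nonlinear equation\<close>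

locale bsde = marked_point_process M T \<Delta> S X F A \<phi>
  for M :: "'w measure" and T :: real and \<Delta> :: "'e::t2_space"
    and S :: "nat \<Rightarrow> 'w \<Rightarrow> ennreal" and X :: "nat \<Rightarrow> 'w \<Rightarrow> 'e"
    and F :: "ennreal \<Rightarrow> 'w measure"
    and A :: "'w \<Rightarrow> real \<Rightarrow> real" and \<phi> :: "'w \<Rightarrow> real \<Rightarrow> 'e measure" +
  fixes \<xi> :: "'w \<Rightarrow> real" and f :: "'w \<Rightarrow> real \<Rightarrow> 'e \<Rightarrow> real \<Rightarrow> ('e \<Rightarrow> real) \<Rightarrow> real" and L L' :: real
  assumes \<xi>: "\<xi> \<in> borel_measurable (F (ennreal T))"
    and generator: "bsde_generator M T F A \<phi> f L L'"
begin

lemma L_nonneg: "0 \<le> L" "0 \<le> L'"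
  using generator by (simp_all add: bsde_generator_def)

lemma \<xi>_measurable[measurable]: "\<xi> \<in> borel_measurable M"
  by (rule measurable_F_M[OF \<xi>])

text \<open>
  The generator along a pair \<open>(Y, Z)\<close>, a predictable function because \<open>Y\<close> enters through its
  left limit.
\<close>

definition driver :: "('w \<Rightarrow> real \<Rightarrow> real) \<Rightarrow> ('w \<Rightarrow> real \<Rightarrow> 'e \<Rightarrow> real) \<Rightarrow> ('w \<times> real) \<times> 'e \<Rightarrow> real" where
  "driver Y Z p = f (fst (fst p)) (snd (fst p)) (snd p) (left_lim Y (fst p)) (Z (fst (fst p)) (snd (fst p)))"

lemma driver_measurable:
  assumes Y: "adapted_cadlag M T F Y" and Z: "uncurried Z \<in> borel_measurable PE"
  shows "driver Y Z \<in> borel_measurable PE"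
proof -
  have "predictable M T F (borel \<Otimes>\<^sub>M borel) (\<lambda>\<omega> t (x, y). f \<omega> t x y (Z \<omega> t))"
    using generator Z by (simp add: bsde_generator_def predictable_unc)
  then have m: "(\<lambda>p. f (fst (fst p)) (snd (fst p)) (fst (snd p)) (snd (snd p)) (Z (fst (fst p)) (snd (fst p))))
      \<in> borel_measurable (Pr \<Otimes>\<^sub>M (borel \<Otimes>\<^sub>M borel))"
    by (simp add: predictable_iff split_beta')
  note [measurable] = left_lim_predictable[OF Y]
  have "(\<lambda>p. (fst p, (snd p, left_lim Y (fst p)))) \<in> measurable PE (Pr \<Otimes>\<^sub>M (borel \<Otimes>\<^sub>M borel))" by measurable
  from measurable_compose[OF this m] show ?thesis by (simp add: driver_def[abs_def])
qed

lemma unc_section: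
  assumes Z: "uncurried Z \<in> borel_measurable PE" and "\<omega> \<in> space M" "t \<in> {0..T}"
  shows "Z \<omega> t \<in> borel_measurable borel"
  using measurable_compose[OF measurable_Pair1'[of "(\<omega>, t)" Pr borel] Z] assms by (simp add: uncurried_def)

lemma f_lipschitz_y:
  "\<omega> \<in> space M \<Longrightarrow> t \<in> {0..T} \<Longrightarrow> \<zeta> \<in> borel_measurable borel \<Longrightarrow> \<bar>f \<omega> t x y' \<zeta> - f \<omega> t x y \<zeta>\<bar> \<le> L' * \<bar>y' - y\<bar>"
  using generator unfolding bsde_generator_def by blast

lemma f_lipschitz_z:
  "\<omega> \<in> space M \<Longrightarrow> t \<in> {0..T} \<Longrightarrow> \<zeta> \<in> borel_measurable borel \<Longrightarrow> \<zeta>' \<in> borel_measurable borel \<Longrightarrow>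
    (\<integral>\<^sup>+x. ennreal \<bar>f \<omega> t x y \<zeta> - f \<omega> t x y \<zeta>'\<bar> \<partial>\<phi> \<omega> t) \<le> ennreal L * (\<integral>\<^sup>+x. ennreal \<bar>\<zeta>' x - \<zeta> x\<bar> \<partial>\<phi> \<omega> t)"
  using generator unfolding bsde_generator_def by blast

lemma f_section_measurable:
  assumes Z: "uncurried Z \<in> borel_measurable PE" and \<omega>: "\<omega> \<in> space M" and t: "t \<in> {0..T}"
  shows "(\<lambda>x. f \<omega> t x y (Z \<omega> t)) \<in> borel_measurable borel"
proof -
  have "predictable M T F (borel \<Otimes>\<^sub>M borel) (\<lambda>\<omega> t (x, y). f \<omega> t x y (Z \<omega> t))"
    using generator Z by (simp add: bsde_generator_def predictable_unc)
  then have m: "(\<lambda>p. f (fst (fst p)) (snd (fst p)) (fst (snd p)) (snd (snd p)) (Z (fst (fst p)) (snd (fst p))))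
      \<in> borel_measurable (Pr \<Otimes>\<^sub>M (borel \<Otimes>\<^sub>M borel))"
    by (simp add: predictable_iff split_beta')
  have "(\<omega>, t) \<in> space Pr" using \<omega> t by simp
  then have "(\<lambda>x. ((\<omega>, t), (x, y))) \<in> measurable borel (Pr \<Otimes>\<^sub>M (borel \<Otimes>\<^sub>M borel))" by measurable
  from measurable_compose[OF this m] show ?thesis by simp
qed

text \<open>
  The Lipschitz condition in \<open>Z\<close> holds after integration over the marks at a fixed time, so the
  weight \<open>v\<close> must not depend on the mark. As \<open>\<phi>\<close> has total mass \<open>1\<close>, the part coming from \<open>Y\<close> is
  not changed by that integration.
\<close>

lemma driver_lipschitz:
  assumes Y: "adapted_cadlag M T F Y" and Z: "uncurried Z \<in> borel_measurable PE"
    and Y': "adapted_cadlag M T F Y'" and Z': "uncurried Z' \<in> borel_measurable PE"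
    and v[measurable]: "v \<in> borel_measurable Pr" and v0: "\<And>p. 0 \<le> v p" and \<omega>: "\<omega> \<in> space M"
  shows "comp_int (\<lambda>p. ennreal (v (fst p) * \<bar>driver Y Z p - driver Y' Z' p\<bar>)) \<omega>
    \<le> ennreal L' * comp_int (\<lambda>p. ennreal (v (fst p) * \<bar>left_lim Y (fst p) - left_lim Y' (fst p)\<bar>)) \<omega>
      + ennreal L * comp_int (\<lambda>p. ennreal (v (fst p) * \<bar>uncurried Z p - uncurried Z' p\<bar>)) \<omega>"
proof -
  note [measurable] = left_lim_predictable[OF Y] left_lim_predictable[OF Y'] Z Z' driver_measurable[OF Y Z] driver_measurable[OF Y' Z']
  let ?H = "\<lambda>p. ennreal (v (fst p) * \<bar>driver Y Z p - driver Y' Z' p\<bar>)"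
  let ?y = "\<lambda>p. ennreal (v (fst p) * \<bar>left_lim Y (fst p) - left_lim Y' (fst p)\<bar>)"
  let ?z = "\<lambda>p. ennreal (v (fst p) * \<bar>uncurried Z p - uncurried Z' p\<bar>)"
  let ?G = "\<lambda>p. ennreal L' * ?y p + ennreal L * ?z p"
  have "comp_int ?H \<omega> \<le> comp_int ?G \<omega>"
  proof -
    have "comp_int ?H \<omega> = (\<integral>\<^sup>+t\<in>{0..T}. (\<integral>\<^sup>+x. ?H ((\<omega>, t), x) \<partial>\<phi> \<omega> t) \<partial>dA \<omega>)" by (rule comp_int_eq[OF \<omega>]) measurable
    also have "\<dots> \<le> (\<integral>\<^sup>+t\<in>{0..T}. (\<integral>\<^sup>+x. ?G ((\<omega>, t), x) \<partial>\<phi> \<omega> t) \<partial>dA \<omega>)"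
    proof (rule nn_integral_mono)
      fix t
      show "(\<integral>\<^sup>+x. ?H ((\<omega>, t), x) \<partial>\<phi> \<omega> t) * indicator {0..T} t \<le> (\<integral>\<^sup>+x. ?G ((\<omega>, t), x) \<partial>\<phi> \<omega> t) * indicator {0..T} t"
      proof (cases "t \<in> {0..T}")
        case t: True
        have s\<phi>[measurable_cong]: "sets (\<phi> \<omega> t) = sets borel" using sets_\<phi>[OF \<omega>] t by simp
        have \<phi>1: "emeasure (\<phi> \<omega> t) (space (\<phi> \<omega> t)) = 1" using prob_space.emeasure_space_1[OF prob_space_\<phi>[OF \<omega>]] t by simp
        note [measurable] = f_section_measurable[OF Z \<omega> t] f_section_measurable[OF Z' \<omega> t] unc_section[OF Z \<omega> t] unc_section[OF Z' \<omega> t]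
        let ?v = "v (\<omega>, t)" and ?l = "left_lim Y (\<omega>, t)" and ?l' = "left_lim Y' (\<omega>, t)"
        have "(\<integral>\<^sup>+x. ?H ((\<omega>, t), x) \<partial>\<phi> \<omega> t)
          \<le> (\<integral>\<^sup>+x. ennreal L' * ennreal (?v * \<bar>?l - ?l'\<bar>) + ennreal ?v * ennreal \<bar>f \<omega> t x ?l' (Z \<omega> t) - f \<omega> t x ?l' (Z' \<omega> t)\<bar> \<partial>\<phi> \<omega> t)"
        proof (rule nn_integral_mono)
          fix x
          have "\<bar>f \<omega> t x ?l (Z \<omega> t) - f \<omega> t x ?l' (Z' \<omega> t)\<bar>
            \<le> L' * \<bar>?l - ?l'\<bar> + \<bar>f \<omega> t x ?l' (Z \<omega> t) - f \<omega> t x ?l' (Z' \<omega> t)\<bar>"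
            using f_lipschitz_y[OF \<omega> t unc_section[OF Z \<omega> t], of x ?l ?l'] by linarith
          then have "?v * \<bar>f \<omega> t x ?l (Z \<omega> t) - f \<omega> t x ?l' (Z' \<omega> t)\<bar>
            \<le> ?v * (L' * \<bar>?l - ?l'\<bar> + \<bar>f \<omega> t x ?l' (Z \<omega> t) - f \<omega> t x ?l' (Z' \<omega> t)\<bar>)"
            by (intro mult_left_mono v0)
          also have "\<dots> = L' * (?v * \<bar>?l - ?l'\<bar>) + ?v * \<bar>f \<omega> t x ?l' (Z \<omega> t) - f \<omega> t x ?l' (Z' \<omega> t)\<bar>"
            by (simp add: algebra_simps)
          finally have "ennreal (?v * \<bar>f \<omega> t x ?l (Z \<omega> t) - f \<omega> t x ?l' (Z' \<omega> t)\<bar>)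
            \<le> ennreal (L' * (?v * \<bar>?l - ?l'\<bar>) + ?v * \<bar>f \<omega> t x ?l' (Z \<omega> t) - f \<omega> t x ?l' (Z' \<omega> t)\<bar>)" by (rule ennreal_leI)
          also have "\<dots> = ennreal L' * ennreal (?v * \<bar>?l - ?l'\<bar>) + ennreal ?v * ennreal \<bar>f \<omega> t x ?l' (Z \<omega> t) - f \<omega> t x ?l' (Z' \<omega> t)\<bar>"
            using v0[of "(\<omega>, t)"] L_nonneg by (simp add: ennreal_mult[symmetric])
          finally show "?H ((\<omega>, t), x) \<le> \<dots>" by (simp add: driver_def)
        qed
        also have "\<dots> = ennreal L' * ennreal (?v * \<bar>?l - ?l'\<bar>) + ennreal ?v * (\<integral>\<^sup>+x. ennreal \<bar>f \<omega> t x ?l' (Z \<omega> t) - f \<omega> t x ?l' (Z' \<omega> t)\<bar> \<partial>\<phi> \<omega> t)"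
          by (subst nn_integral_add) (auto simp: nn_integral_cmult \<phi>1)
        also have "\<dots> \<le> ennreal L' * ennreal (?v * \<bar>?l - ?l'\<bar>) + ennreal ?v * (ennreal L * (\<integral>\<^sup>+x. ennreal \<bar>Z' \<omega> t x - Z \<omega> t x\<bar> \<partial>\<phi> \<omega> t))"
          by (intro add_left_mono mult_left_mono f_lipschitz_z[OF \<omega> t] unc_section[OF Z \<omega> t] unc_section[OF Z' \<omega> t]) simp
        also have "\<dots> = (\<integral>\<^sup>+x. ennreal L' * ennreal (?v * \<bar>?l - ?l'\<bar>) + ennreal ?v * (ennreal L * ennreal \<bar>Z' \<omega> t x - Z \<omega> t x\<bar>) \<partial>\<phi> \<omega> t)"
          by (subst nn_integral_add) (auto simp: nn_integral_cmult \<phi>1)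
        also have "\<dots> = (\<integral>\<^sup>+x. ?G ((\<omega>, t), x) \<partial>\<phi> \<omega> t)"
          using v0[of "(\<omega>, t)"] by (intro nn_integral_cong) (simp add: uncurried_def ennreal_mult abs_minus_commute mult.left_commute)
        finally show ?thesis using t by simp
      qed simp
    qed
    also have "\<dots> = comp_int ?G \<omega>" by (rule comp_int_eq[OF \<omega>, symmetric]) measurable
    finally show ?thesis .
  qed
  also have "comp_int ?G \<omega> = ennreal L' * comp_int ?y \<omega> + ennreal L * comp_int ?z \<omega>"
    using comp_int_cmult[OF \<omega>, of ?y "ennreal L'"] comp_int_cmult[OF \<omega>, of ?z "ennreal L"]
      comp_int_add[OF \<omega>, of "\<lambda>p. ennreal L' * ?y p" "\<lambda>p. ennreal L * ?z p"] by simp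
  finally show ?thesis .
qed

lemma driver_wnorm_lipschitz:
  assumes Y: "adapted_cadlag M T F Y" and Z: "uncurried Z \<in> borel_measurable PE"
    and Y': "adapted_cadlag M T F Y'" and Z': "uncurried Z' \<in> borel_measurable PE" and \<alpha>: "0 < \<alpha>"
  shows "wnorm \<alpha> \<beta> (\<lambda>p. driver Y Z p - driver Y' Z' p)
    \<le> ennreal L' * wnorm \<alpha> \<beta> (\<lambda>p. left_lim Y (fst p) - left_lim Y' (fst p)) + ennreal L * wnorm \<alpha> \<beta> (\<lambda>p. uncurried Z p - uncurried Z' p)"
proof -
  note [measurable] = left_lim_predictable[OF Y] left_lim_predictable[OF Y'] Z Z' driver_measurable[OF Y Z] driver_measurable[OF Y' Z']
  let ?y = "\<lambda>p. ennreal (weight \<alpha> \<beta> (fst p) * \<bar>left_lim Y (fst p) - left_lim Y' (fst p)\<bar>)"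
  let ?z = "\<lambda>p. ennreal (weight \<alpha> \<beta> (fst p) * \<bar>uncurried Z p - uncurried Z' p\<bar>)"
  have "wnorm \<alpha> \<beta> (\<lambda>p. driver Y Z p - driver Y' Z' p)
    = (\<integral>\<^sup>+\<omega>. comp_int (\<lambda>p. ennreal (weight \<alpha> \<beta> (fst p) * \<bar>driver Y Z p - driver Y' Z' p\<bar>)) \<omega> \<partial>M)"
    by (rule nn_integral_Q) measurable
  also have "\<dots> \<le> (\<integral>\<^sup>+\<omega>. ennreal L' * comp_int ?y \<omega> + ennreal L * comp_int ?z \<omega> \<partial>M)"
    using weight_pos[OF \<alpha>] by (intro nn_integral_mono driver_lipschitz Y Z Y' Z') (auto intro: less_imp_le)
  also have "\<dots> = ennreal L' * (\<integral>\<^sup>+\<omega>. comp_int ?y \<omega> \<partial>M) + ennreal L * (\<integral>\<^sup>+\<omega>. comp_int ?z \<omega> \<partial>M)"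
    by (subst nn_integral_add) (auto simp: nn_integral_cmult)
  also have "(\<integral>\<^sup>+\<omega>. comp_int ?y \<omega> \<partial>M) = (\<integral>\<^sup>+p. ?y p \<partial>Q)" by (rule nn_integral_Q[symmetric]) measurable
  also have "(\<integral>\<^sup>+\<omega>. comp_int ?z \<omega> \<partial>M) = (\<integral>\<^sup>+p. ?z p \<partial>Q)" by (rule nn_integral_Q[symmetric]) measurable
  finally show ?thesis .
qed

abbreviation f0 :: "('w \<times> real) \<times> 'e \<Rightarrow> real" where "f0 \<equiv> driver (\<lambda>_ _. 0) (\<lambda>_ _ _. 0)"

lemma f0_eq: "f0 ((\<omega>, t), x) = f \<omega> t x 0 (\<lambda>_. 0)"
  by (simp add: driver_def left_lim_zero)

lemma unc_zero: "uncurried (\<lambda>_ _ _. 0) = (\<lambda>_. 0)" by (auto simp: uncurried_def)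

lemma unc_zero_measurable: "uncurried (\<lambda>_ _ _. 0) \<in> borel_measurable PE" by (simp add: unc_zero)

lemma f0_measurable[measurable]: "f0 \<in> borel_measurable PE"
  by (rule driver_measurable[OF adapted_cadlag_zero unc_zero_measurable])

lemma f0_path_integrable: "AE \<omega> in M. path_integrable f0 \<omega>"
proof -
  have "AE \<omega> in M. nn_integral_upto T (\<nu> \<omega>) (\<lambda>t x. ennreal \<bar>f \<omega> t x 0 (\<lambda>_. 0)\<bar>) < \<infinity>"
    using generator by (simp add: bsde_generator_def)
  with AE_space show ?thesis
  proof eventually_elim
    case (elim \<omega>)
    then show ?case using comp_int_upto[OF elim(1), of "\<lambda>p. ennreal \<bar>f0 p\<bar>"] by (simp add: path_integrable_def f0_eq)
  qed
qed

text \<open>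
  Compare with \<open>f0\<close>. The part of the difference that is due to \<open>Y\<close> is integrable since a cadlag
  path is bounded and \<open>\<nu> \<omega>\<close> is finite.
\<close>

lemma driver_path_integrable:
  assumes Y: "adapted_cadlag M T F Y" and Z[measurable]: "uncurried Z \<in> borel_measurable PE"
    and ZI: "AE \<omega> in M. path_integrable (uncurried Z) \<omega>"
  shows "AE \<omega> in M. path_integrable (driver Y Z) \<omega>"
  using ZI f0_path_integrable AE_space
proof eventually_elim
  case (elim \<omega>)
  note \<omega> = elim(3)
  note [measurable] = left_lim_predictable[OF Y] driver_measurable[OF Y Z]
  have "cadlag_on T (Y \<omega>)" using Y \<omega> by (simp add: adapted_cadlag_def)
  then obtain C where C: "0 \<le> C" "\<And>t. t \<in> {0..T} \<Longrightarrow> \<bar>Y \<omega> t\<bar> \<le> C" using cadlag_on_bounded by blast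
  have l: "\<bar>left_lim Y (\<omega>, t)\<bar> \<le> C" if "0 < t" "t \<le> T" for t
    using left_limit_bounded[OF \<open>cadlag_on T (Y \<omega>)\<close> C(2) that] that by (simp add: left_lim_def)
  have y: "comp_int (\<lambda>p. ennreal \<bar>left_lim Y (fst p)\<bar>) \<omega> < \<infinity>"
  proof -
    have "comp_int (\<lambda>p. ennreal \<bar>left_lim Y (fst p)\<bar>) \<omega> \<le> comp_int (\<lambda>p. ennreal C) \<omega>"
      using l by (intro comp_int_mono[OF \<omega>]) (auto intro: ennreal_leI)
    also have "\<dots> = ennreal C * ennreal (A \<omega> T)" using \<omega> by (simp add: comp_int_def emeasure_\<nu>_UNIV)
    also have "\<dots> < \<infinity>" by (simp add: ennreal_mult_less_top)
    finally show ?thesis .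
  qed
  have "comp_int (\<lambda>p. ennreal \<bar>driver Y Z p\<bar>) \<omega> \<le> comp_int (\<lambda>p. ennreal \<bar>f0 p\<bar> + ennreal \<bar>driver Y Z p - f0 p\<bar>) \<omega>"
    by (intro comp_int_mono[OF \<omega>]) (simp flip: ennreal_plus)
  also have "\<dots> = comp_int (\<lambda>p. ennreal \<bar>f0 p\<bar>) \<omega> + comp_int (\<lambda>p. ennreal \<bar>driver Y Z p - f0 p\<bar>) \<omega>"
    by (intro comp_int_add \<omega>) measurable
  also have "\<dots> \<le> comp_int (\<lambda>p. ennreal \<bar>f0 p\<bar>) \<omega> + (ennreal L' * comp_int (\<lambda>p. ennreal \<bar>left_lim Y (fst p)\<bar>) \<omega>
      + ennreal L * comp_int (\<lambda>p. ennreal \<bar>uncurried Z p\<bar>) \<omega>)"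
    using driver_lipschitz[OF Y Z adapted_cadlag_zero unc_zero_measurable, of "\<lambda>_. 1" \<omega>] \<omega>
    by (intro add_left_mono) (simp add: left_lim_zero unc_zero)
  also have "\<dots> < \<infinity>"
    using y elim(1,2) by (simp add: path_integrable_def ennreal_mult_less_top less_top[symmetric] ennreal_add_eq_top ennreal_mult_eq_top_iff)
  finally show ?case by (simp add: path_integrable_def)
qed

lemma bsde_solution_iff:
  "(Y, Z) \<in> bsde_solution M T F \<mu> \<nu> \<xi> f \<longleftrightarrow>
     linear_solution \<xi> (driver Y Z) Y Z \<and> (AE \<omega> in M. path_integrable (uncurried Z) \<omega>)"
proof -
  have zi: "(AE \<omega> in M. nn_integral_upto T (\<nu> \<omega>) (\<lambda>t x. ennreal \<bar>Z \<omega> t x\<bar>) < \<infinity>) \<longleftrightarrow> (AE \<omega> in M. path_integrable (uncurried Z) \<omega>)"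
  proof (intro AE_cong)
    fix \<omega> assume "\<omega> \<in> space M"
    then show "(nn_integral_upto T (\<nu> \<omega>) (\<lambda>t x. ennreal \<bar>Z \<omega> t x\<bar>) < \<infinity>) = path_integrable (uncurried Z) \<omega>"
      using comp_int_upto[of \<omega> "\<lambda>p. ennreal \<bar>uncurried Z p\<bar>"] by (simp add: path_integrable_def uncurried_def)
  qed
  have eq: "(\<forall>t\<in>{0..T}. Y \<omega> t + integral_Ioc t T (\<mu> \<omega>) (Z \<omega>) =
        \<xi> \<omega> + integral_Ioc t T (\<nu> \<omega>) (\<lambda>s x. f \<omega> s x (Lim (at_left s) (Y \<omega>)) (Z \<omega> s)))
    \<longleftrightarrow> (\<forall>t\<in>{0..T}. Y \<omega> t + integral_Ioc t T (\<mu> \<omega>) (Z \<omega>) = \<xi> \<omega> + (path_int (driver Y Z) \<omega> T - path_int (driver Y Z) \<omega> t))"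
    if "\<omega> \<in> space M" "driver Y Z \<in> borel_measurable PE" "path_integrable (driver Y Z) \<omega>" for \<omega>
  proof (intro ball_cong refl)
    fix t assume t: "t \<in> {0..T}"
    have "integral_Ioc t T (\<nu> \<omega>) (\<lambda>s x. f \<omega> s x (Lim (at_left s) (Y \<omega>)) (Z \<omega> s)) = path_int (driver Y Z) \<omega> T - path_int (driver Y Z) \<omega> t"
      by (rule integral_\<nu>_Ioc[OF that]) (use t in \<open>auto simp: driver_def left_lim_def\<close>)
    then show "(Y \<omega> t + integral_Ioc t T (\<mu> \<omega>) (Z \<omega>) = \<xi> \<omega> + integral_Ioc t T (\<nu> \<omega>) (\<lambda>s x. f \<omega> s x (Lim (at_left s) (Y \<omega>)) (Z \<omega> s)))
      = (Y \<omega> t + integral_Ioc t T (\<mu> \<omega>) (Z \<omega>) = \<xi> \<omega> + (path_int (driver Y Z) \<omega> T - path_int (driver Y Z) \<omega> t))" by simp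
  qed
  show ?thesis
  proof
    assume "(Y, Z) \<in> bsde_solution M T F \<mu> \<nu> \<xi> f"
    then have Y: "adapted_cadlag M T F Y" and Z: "uncurried Z \<in> borel_measurable PE" and ZI: "AE \<omega> in M. path_integrable (uncurried Z) \<omega>"
      and E: "AE \<omega> in M. \<forall>t\<in>{0..T}. Y \<omega> t + integral_Ioc t T (\<mu> \<omega>) (Z \<omega>) =
        \<xi> \<omega> + integral_Ioc t T (\<nu> \<omega>) (\<lambda>s x. f \<omega> s x (Lim (at_left s) (Y \<omega>)) (Z \<omega> s))"
      using zi unfolding bsde_solution_def by (simp_all add: predictable_unc)
    note DI = driver_path_integrable[OF Y Z ZI]
    have "AE \<omega> in M. \<forall>t\<in>{0..T}. Y \<omega> t + integral_Ioc t T (\<mu> \<omega>) (Z \<omega>) = \<xi> \<omega> + (path_int (driver Y Z) \<omega> T - path_int (driver Y Z) \<omega> t)"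
      using E DI AE_space
    proof eventually_elim
      case (elim \<omega>)
      show ?case using elim(1) unfolding eq[OF elim(3) driver_measurable[OF Y Z] elim(2)] .
    qed
    then show "linear_solution \<xi> (driver Y Z) Y Z \<and> (AE \<omega> in M. path_integrable (uncurried Z) \<omega>)"
      using Y Z ZI DI driver_measurable[OF Y Z] by (simp add: linear_solution_def)
  next
    assume sol: "linear_solution \<xi> (driver Y Z) Y Z \<and> (AE \<omega> in M. path_integrable (uncurried Z) \<omega>)"
    note d = linear_solutionD[OF conjunct1[OF sol]]
    have "AE \<omega> in M. \<forall>t\<in>{0..T}. Y \<omega> t + integral_Ioc t T (\<mu> \<omega>) (Z \<omega>) = \<xi> \<omega> + (path_int (driver Y Z) \<omega> T - path_int (driver Y Z) \<omega> t)"
      using sol by (simp add: linear_solution_def)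
    then have "AE \<omega> in M. \<forall>t\<in>{0..T}. Y \<omega> t + integral_Ioc t T (\<mu> \<omega>) (Z \<omega>) =
        \<xi> \<omega> + integral_Ioc t T (\<nu> \<omega>) (\<lambda>s x. f \<omega> s x (Lim (at_left s) (Y \<omega>)) (Z \<omega> s))"
      using d(5) AE_space
    proof eventually_elim
      case (elim \<omega>)
      show ?case unfolding eq[OF elim(3) d(3) elim(2)] by (rule elim(1))
    qed
    then show "(Y, Z) \<in> bsde_solution M T F \<mu> \<nu> \<xi> f"
      unfolding bsde_solution_def using d(1,2) sol zi by (simp add: predictable_unc)
  qed
qed

abbreviation "L1 \<alpha> \<beta> \<equiv> L1_space M T F \<nu> A (counting_process T S X) \<alpha> \<beta>"
abbreviation "sols \<equiv> bsde_solution M T F \<mu> \<nu> \<xi> f"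

lemma L1_iff:
  assumes \<alpha>: "0 < \<alpha>" and sol: "(Y, Z) \<in> sols"
  shows "(Y, Z) \<in> L1 \<alpha> \<beta> \<longleftrightarrow> wnorm \<alpha> \<beta> (\<lambda>p. left_lim Y (fst p)) < \<infinity> \<and> wnorm \<alpha> \<beta> (uncurried Z) < \<infinity>"
proof -
  have s: "linear_solution \<xi> (driver Y Z) Y Z" using sol bsde_solution_iff by simp
  show ?thesis
    using L1_norm_eq[OF \<alpha> s, of \<beta>] linear_solutionD(1,2)[OF s]
    by (simp add: L1_space_def predictable_unc less_top[symmetric] ennreal_add_eq_top)
qed

text \<open>
  With \<open>z\<close> and \<open>a\<close> the norms of the differences of \<open>Z\<close> and \<open>Y_-\<close>, the difference estimate and
  the Lipschitz conditions give \<open>\<alpha> z + (\<beta> - 1 - \<alpha>) a \<le> L z + L' a\<close>. As both coefficients on the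
  left are strictly larger, \<open>z = a = 0\<close>. Then \<open>path_unique\<close> applies to the difference.
\<close>

lemma uniqueness:
  assumes \<alpha>: "L < \<alpha>" and \<beta>: "1 + \<alpha> + L' < \<beta>"
    and p: "(Y, Z) \<in> sols \<inter> L1 \<alpha> \<beta>" and q: "(Y', Z') \<in> sols \<inter> L1 \<alpha> \<beta>"
  shows "same_up_to_null M T \<nu> (Y, Z) (Y', Z')"
proof -
  have \<alpha>0: "0 < \<alpha>" using \<alpha> L_nonneg by simp
  have s: "linear_solution \<xi> (driver Y Z) Y Z" and s': "linear_solution \<xi> (driver Y' Z') Y' Z'"
    using p q bsde_solution_iff by auto
  have fin: "wnorm \<alpha> \<beta> (\<lambda>p. left_lim Y (fst p)) < \<infinity>" "wnorm \<alpha> \<beta> (uncurried Z) < \<infinity>"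
    "wnorm \<alpha> \<beta> (\<lambda>p. left_lim Y' (fst p)) < \<infinity>" "wnorm \<alpha> \<beta> (uncurried Z') < \<infinity>"
    using p q L1_iff[OF \<alpha>0] by auto
  note d = linear_solutionD[OF s] and d' = linear_solutionD[OF s']
  note [measurable] = d(2-4) d'(2-4)
  let ?Z = "\<lambda>\<omega> t x. Z \<omega> t x - Z' \<omega> t x" and ?g = "\<lambda>p. driver Y Z p - driver Y' Z' p"
  let ?a = "wnorm \<alpha> \<beta> (\<lambda>p. left_lim Y (fst p) - left_lim Y' (fst p))"
  let ?z = "wnorm \<alpha> \<beta> (\<lambda>p. uncurried Z p - uncurried Z' p)"
  have a_fin: "?a < \<infinity>" by (rule wnorm_diff_finite[OF \<alpha>0 _ _ fin(1,3)]) measurable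
  have z_fin: "?z < \<infinity>" by (rule wnorm_diff_finite[OF \<alpha>0 _ _ fin(2,4)]) measurable
  have "ennreal \<alpha> * ?z + ennreal (\<beta> - 1 - \<alpha>) * ?a \<le> wnorm \<alpha> \<beta> ?g"
    using \<beta> L_nonneg by (intro difference_estimate[OF s s' \<alpha>0 _ fin(1,3)]) simp
  also have "\<dots> \<le> ennreal L' * ?a + ennreal L * ?z"
    by (rule driver_wnorm_lipschitz[OF d(1,2) d'(1,2) \<alpha>0])
  finally have le: "ennreal \<alpha> * ?z + ennreal (\<beta> - 1 - \<alpha>) * ?a \<le> ennreal L' * ?a + ennreal L * ?z" .
  obtain a z where az: "?a = ennreal a" "?z = ennreal z" "0 \<le> a" "0 \<le> z"
    using a_fin z_fin by (cases ?a; cases ?z) auto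
  have "\<alpha> * z + (\<beta> - 1 - \<alpha>) * a \<le> L' * a + L * z"
    using le az \<alpha>0 \<beta> L_nonneg by (simp flip: ennreal_mult ennreal_plus)
  then have "(\<alpha> - L) * z + (\<beta> - 1 - \<alpha> - L') * a \<le> 0" by (simp add: algebra_simps)
  moreover have "0 \<le> (\<alpha> - L) * z" "0 \<le> (\<beta> - 1 - \<alpha> - L') * a" using az \<alpha> \<beta> by simp_all
  ultimately have "(\<alpha> - L) * z = 0" "(\<beta> - 1 - \<alpha> - L') * a = 0" by linarith+
  then have "?a = 0" "?z = 0" using az \<alpha> \<beta> by auto
  then have "wnorm \<alpha> \<beta> ?g = 0"
    using driver_wnorm_lipschitz[OF d(1,2) d'(1,2) \<alpha>0, of \<beta>] by simp
  then have g0: "AE p in Q. ?g p = 0" by (intro wnorm_zero_AE[OF \<alpha>0]) auto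
  have "AE p in Q. uncurried Z p - uncurried Z' p = 0"
    using \<open>?z = 0\<close> by (intro wnorm_zero_AE[OF \<alpha>0, of _ \<beta>]) simp_all
  then have z0: "AE p in Q. uncurried ?Z p = 0" by (simp only: unc_diff)
  have "AE \<omega> in M. \<forall>t\<in>{0..T}. Y \<omega> t - Y' \<omega> t = 0"
    by (rule path_unique[OF linear_solution_diff[OF s s'] g0 z0])
  moreover have "AE \<omega> in M. AE z in \<nu> \<omega>. Z \<omega> (fst z) (snd z) = Z' \<omega> (fst z) (snd z)"
    using AE_Q_path[OF z0] AE_space
  proof eventually_elim
    case (elim \<omega>)
    show ?case using elim(1) AE_\<nu>_Ioc[OF elim(2)] by eventually_elim (simp add: at_path_def uncurried_def)
  qed
  ultimately show ?thesis by (simp add: same_up_to_null_def)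
qed

text \<open>
  A fixed point of the map \<open>\<Phi>\<close>, which solves the linear equation for a given driver and
  evaluates the generator along the solution, is a driver that its own solution generates. The
  contraction constant \<open>\<kappa>\<close> compares \<open>L\<close> with \<open>\<alpha>\<close> and \<open>L'\<close> with \<open>\<beta> - 1 - \<alpha>\<close>.
\<close>

lemma existence:
  assumes \<alpha>: "L < \<alpha>" and \<beta>: "1 + \<alpha> + L' < \<beta>"
    and tn: "terminal_norm \<alpha> \<beta> \<xi> < \<infinity>" and fn: "wnorm \<alpha> \<beta> f0 < \<infinity>"
  shows "sols \<inter> L1 \<alpha> \<beta> \<noteq> {}"
proof -
  have \<alpha>0: "0 < \<alpha>" and \<beta>0: "0 \<le> \<beta>" and \<beta>\<alpha>: "1 + \<alpha> < \<beta>" using \<alpha> \<beta> L_nonneg by simp_all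
  \<comment> \<open>weighted norms are \<open>L1\<close> norms for the measure \<open>Q'\<close>\<close>
  define Q' where "Q' = density Q (\<lambda>p. ennreal (weight \<alpha> \<beta> (fst p)))"
  have Q'm: "borel_measurable Q' = borel_measurable PE" unfolding Q'_def by (intro measurable_cong_sets) auto
  have Q'i: "(\<integral>\<^sup>+p. ennreal \<bar>g p\<bar> \<partial>Q') = wnorm \<alpha> \<beta> g" if [measurable]: "g \<in> borel_measurable PE" for g :: "_ \<Rightarrow> real"
    unfolding Q'_def using weight_pos[OF \<alpha>0]
    by (subst nn_integral_density) (auto intro!: nn_integral_cong simp: ennreal_mult less_imp_le)
  define I where "I = {g \<in> borel_measurable PE. wnorm \<alpha> \<beta> g < \<infinity>}"
  have I_eq: "{g \<in> borel_measurable Q'. (\<integral>\<^sup>+p. ennreal \<bar>g p\<bar> \<partial>Q') < \<infinity>} = I"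
    unfolding I_def Q'm using Q'i by auto
  have "\<exists>YZ. linear_solution \<xi> g (fst YZ) (snd YZ) \<and> (\<forall>n. locally_finite \<beta> (fst YZ) n)" if g: "g \<in> I" for g
  proof -
    obtain Y Z where "linear_solution \<xi> g Y Z \<and> (\<forall>\<beta>\<ge>0. \<forall>n. locally_finite \<beta> Y n)"
      using linear_solution_exists[OF _ wnorm_finite_path_integrable[OF _ _ \<alpha>0 \<beta>0] \<xi>, of g] g unfolding I_def by blast
    then show ?thesis using \<beta>0 by (intro exI[of _ "(Y, Z)"]) simp
  qed
  then have "\<forall>g\<in>I. \<exists>YZ. linear_solution \<xi> g (fst YZ) (snd YZ) \<and> (\<forall>n. locally_finite \<beta> (fst YZ) n)" by blast
  from bchoice[OF this] obtain sol where sol: "\<And>g. g \<in> I \<Longrightarrow> linear_solution \<xi> g (fst (sol g)) (snd (sol g))"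
    "\<And>g n. g \<in> I \<Longrightarrow> locally_finite \<beta> (fst (sol g)) n" by blast
  define Yg where "Yg g = fst (sol g)" for g
  define Zg where "Zg g = snd (sol g)" for g
  have s: "linear_solution \<xi> g (Yg g) (Zg g)" if "g \<in> I" for g using sol(1)[OF that] by (simp add: Yg_def Zg_def)
  note d = linear_solutionD[OF s]
  have est: "wnorm \<alpha> \<beta> (\<lambda>p. left_lim (Yg g) (fst p)) < \<infinity>" "wnorm \<alpha> \<beta> (uncurried (Zg g)) < \<infinity>" if g: "g \<in> I" for g
  proof -
    have "ennreal \<alpha> * wnorm \<alpha> \<beta> (uncurried (Zg g)) + ennreal (\<beta> - 1 - \<alpha>) * wnorm \<alpha> \<beta> (\<lambda>p. left_lim (Yg g) (fst p))
      \<le> terminal_norm \<alpha> \<beta> \<xi> + wnorm \<alpha> \<beta> g"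
      by (rule energy_estimate[OF s[OF g] \<xi>_measurable \<alpha>0 \<beta>\<alpha>]) (use sol(2)[OF g] in \<open>simp add: Yg_def\<close>)
    also have "\<dots> < \<infinity>" using tn g by (simp add: I_def less_top[symmetric] ennreal_add_eq_top)
    finally show "wnorm \<alpha> \<beta> (\<lambda>p. left_lim (Yg g) (fst p)) < \<infinity>" "wnorm \<alpha> \<beta> (uncurried (Zg g)) < \<infinity>"
      using \<alpha>0 \<beta>\<alpha> by (auto simp: less_top[symmetric] ennreal_add_eq_top ennreal_mult_eq_top_iff)
  qed
  define \<Phi> where "\<Phi> g = driver (Yg g) (Zg g)" for g
  have \<Phi>m: "\<Phi> g \<in> borel_measurable PE" if "g \<in> I" for g
    unfolding \<Phi>_def by (rule driver_measurable[OF d(1,2)[OF that]])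
  have \<Phi>0: "wnorm \<alpha> \<beta> (\<Phi> g) < \<infinity>" if g: "g \<in> I" for g
  proof -
    note [measurable] = \<Phi>m[OF g]
    have "wnorm \<alpha> \<beta> (\<Phi> g) \<le> wnorm \<alpha> \<beta> (\<lambda>p. \<Phi> g p - f0 p) + wnorm \<alpha> \<beta> f0"
      by (intro wnorm_triangle[OF \<alpha>0]) auto
    also have "\<dots> \<le> (ennreal L' * wnorm \<alpha> \<beta> (\<lambda>p. left_lim (Yg g) (fst p)) + ennreal L * wnorm \<alpha> \<beta> (uncurried (Zg g))) + wnorm \<alpha> \<beta> f0"
      using driver_wnorm_lipschitz[OF d(1,2)[OF g] adapted_cadlag_zero unc_zero_measurable \<alpha>0, of \<beta>]
      by (intro add_right_mono) (simp add: \<Phi>_def left_lim_zero unc_zero)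
    also have "\<dots> < \<infinity>" using est[OF g] fn
      by (simp add: less_top[symmetric] ennreal_add_eq_top ennreal_mult_eq_top_iff)
    finally show ?thesis .
  qed
  define \<kappa> where "\<kappa> = max (L' / (\<beta> - 1 - \<alpha>)) (L / \<alpha>)"
  have \<kappa>: "0 \<le> \<kappa>" "\<kappa> < 1" "L' \<le> \<kappa> * (\<beta> - 1 - \<alpha>)" "L \<le> \<kappa> * \<alpha>"
  proof -
    have "L' / (\<beta> - 1 - \<alpha>) \<le> \<kappa>" "L / \<alpha> \<le> \<kappa>" by (simp_all add: \<kappa>_def)
    then show "L' \<le> \<kappa> * (\<beta> - 1 - \<alpha>)" "L \<le> \<kappa> * \<alpha>" using \<alpha>0 \<beta>\<alpha> by (simp_all add: divide_le_eq)
    show "0 \<le> \<kappa>" "\<kappa> < 1" using \<alpha>0 \<alpha> \<beta> \<beta>\<alpha> L_nonneg by (auto simp: \<kappa>_def le_max_iff_disj)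
  qed
  have contr: "wnorm \<alpha> \<beta> (\<lambda>p. \<Phi> g p - \<Phi> h p) \<le> ennreal \<kappa> * wnorm \<alpha> \<beta> (\<lambda>p. g p - h p)" if g: "g \<in> I" and h: "h \<in> I" for g h
  proof -
    note [measurable] = d(2-4)[OF g] d(2-4)[OF h]
    let ?a = "wnorm \<alpha> \<beta> (\<lambda>p. left_lim (Yg g) (fst p) - left_lim (Yg h) (fst p))"
    let ?z = "wnorm \<alpha> \<beta> (\<lambda>p. uncurried (Zg g) p - uncurried (Zg h) p)"
    have "wnorm \<alpha> \<beta> (\<lambda>p. \<Phi> g p - \<Phi> h p) \<le> ennreal L' * ?a + ennreal L * ?z"
      unfolding \<Phi>_def by (rule driver_wnorm_lipschitz[OF d(1,2)[OF g] d(1,2)[OF h] \<alpha>0])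
    also have "\<dots> \<le> ennreal (\<kappa> * (\<beta> - 1 - \<alpha>)) * ?a + ennreal (\<kappa> * \<alpha>) * ?z"
      using \<kappa> by (intro add_mono mult_right_mono ennreal_leI) auto
    also have "\<dots> = ennreal \<kappa> * (ennreal \<alpha> * ?z + ennreal (\<beta> - 1 - \<alpha>) * ?a)"
      using \<kappa> \<alpha>0 \<beta>\<alpha> by (simp add: ennreal_mult distrib_left mult.assoc add.commute)
    also have "\<dots> \<le> ennreal \<kappa> * wnorm \<alpha> \<beta> (\<lambda>p. g p - h p)"
      by (intro mult_left_mono difference_estimate[OF s[OF g] s[OF h] \<alpha>0 \<beta>\<alpha> est(1)[OF g] est(1)[OF h]]) simp
    finally show ?thesis .
  qed
  have I0: "(\<lambda>_. 0) \<in> I" by (simp add: I_def)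
  have "\<exists>g\<in>{g \<in> borel_measurable Q'. (\<integral>\<^sup>+p. ennreal \<bar>g p\<bar> \<partial>Q') < \<infinity>}. AE p in Q'. \<Phi> g p = g p"
  proof (rule L1_contraction_fixpoint[where \<kappa>=\<kappa>])
    show "0 \<le> \<kappa>" "\<kappa> < 1" by (fact \<kappa>)+
    show "(\<integral>\<^sup>+p. ennreal \<bar>\<Phi> (\<lambda>_. 0) p\<bar> \<partial>Q') < \<infinity>" using \<Phi>0[OF I0] Q'i[OF \<Phi>m[OF I0]] by simp
    fix g assume "g \<in> {g \<in> borel_measurable Q'. (\<integral>\<^sup>+p. ennreal \<bar>g p\<bar> \<partial>Q') < \<infinity>}"
    then have g: "g \<in> I" by (simp only: I_eq)
    then show "\<Phi> g \<in> borel_measurable Q'" unfolding Q'm by (rule \<Phi>m)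
    fix h assume "h \<in> {g \<in> borel_measurable Q'. (\<integral>\<^sup>+p. ennreal \<bar>g p\<bar> \<partial>Q') < \<infinity>}"
    then have h: "h \<in> I" by (simp only: I_eq)
    have m: "(\<lambda>p. \<Phi> g p - \<Phi> h p) \<in> borel_measurable PE" "(\<lambda>p. g p - h p) \<in> borel_measurable PE"
      using \<Phi>m[OF g] \<Phi>m[OF h] g h by (auto simp: I_def)
    show "(\<integral>\<^sup>+p. ennreal \<bar>\<Phi> g p - \<Phi> h p\<bar> \<partial>Q') \<le> ennreal \<kappa> * (\<integral>\<^sup>+p. ennreal \<bar>g p - h p\<bar> \<partial>Q')"
      unfolding Q'i[OF m(1)] Q'i[OF m(2)] by (rule contr[OF g h])
  qed
  then obtain g where g: "g \<in> I" and fix_Q': "AE p in Q'. \<Phi> g p = g p" unfolding I_eq by blast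
  have "AE p in Q. \<Phi> g p = g p"
    using fix_Q' weight_pos[OF \<alpha>0, of \<beta>] unfolding Q'_def by (subst (asm) AE_density) (auto simp: ennreal_eq_0_iff not_le)
  from AE_Q_path[OF this] have eq: "AE \<omega> in M. AE z in \<nu> \<omega>. \<Phi> g (at_path \<omega> z) = g (at_path \<omega> z)" .
  let ?Y = "Yg g" and ?Z = "Zg g"
  have ZI: "AE \<omega> in M. path_integrable (uncurried ?Z) \<omega>"
    by (rule wnorm_finite_path_integrable[OF d(2)[OF g] est(2)[OF g] \<alpha>0 \<beta>0])
  have "linear_solution \<xi> (driver ?Y ?Z) ?Y ?Z"
    unfolding linear_solution_def
  proof (intro conjI d(1,2)[OF g] driver_path_integrable[OF _ _ ZI] driver_measurable)
    have "AE \<omega> in M. \<forall>t\<in>{0..T}. ?Y \<omega> t + integral_Ioc t T (\<mu> \<omega>) (?Z \<omega>) = \<xi> \<omega> + (path_int g \<omega> T - path_int g \<omega> t)"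
      using s[OF g] by (simp add: linear_solution_def)
    then show "AE \<omega> in M. \<forall>t\<in>{0..T}. ?Y \<omega> t + integral_Ioc t T (\<mu> \<omega>) (?Z \<omega>) = \<xi> \<omega> + (path_int (driver ?Y ?Z) \<omega> T - path_int (driver ?Y ?Z) \<omega> t)"
      using eq AE_space
    proof eventually_elim
      case (elim \<omega>)
      have "path_int (driver ?Y ?Z) \<omega> t = path_int g \<omega> t" for t
        using path_int_cong_AE[OF elim(3) d(3)[OF g] \<Phi>m[OF g] elim(2)] by (simp add: \<Phi>_def)
      then show ?case using elim(1) by simp
    qed
  qed
  then have in_sols: "(?Y, ?Z) \<in> sols" using ZI bsde_solution_iff by simp
  moreover have "(?Y, ?Z) \<in> L1 \<alpha> \<beta>" using L1_iff[OF \<alpha>0 in_sols] est[OF g] by simp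
  ultimately show ?thesis by blast
qed

end

section \<open>Exponential moments of the number of jumps\<close>

context marked_point_process
begin

lemma njumps_measurable[measurable]: "njumps \<in> measurable M (count_space UNIV)"
  unfolding njumps_def[abs_def] by measurable

text \<open>
  The pathwise counterpart of the energy estimate for the decreasing process \<open>exp (- c * A)\<close>:
  its loss over the interval is the integral of \<open>c * exp (- c * A)\<close> against \<open>A\<close>.
\<close>

lemma AE_expA_decay:
  assumes c: "0 \<le> c"
  shows "AE \<omega> in M. (if S n \<omega> \<le> ennreal T then ennreal (expA (- c) (fst (jump_at n \<omega>))) else 0)
    = (if S (Suc n) \<omega> \<le> ennreal T then ennreal (expA (- c) (fst (jump_at (Suc n) \<omega>))) else 0)
      + (end_value (- c) (\<lambda>_. 1) n \<omega> + ennreal c * comp_int (\<lambda>p. ennreal (expA (- c) (fst p)) * indicator (J n) (fst p)) \<omega>)"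
  using AE_space AE_continuous
proof eventually_elim
  case (elim \<omega>)
  note \<omega> = elim(1)
  show ?case
  proof (cases "n \<le> njumps \<omega>")
    case False
    then have "\<not> S n \<omega> \<le> ennreal T" "\<not> S (Suc n) \<omega> \<le> ennreal T" using S_le_iff[OF \<omega>] by auto
    then show ?thesis using J_empty_after_last[OF \<omega>, of n] False by (simp add: end_value_def)
  next
    case True
    let ?p = "jtime n \<omega>" and ?q = "jnext n \<omega>"
    have pq: "0 \<le> ?p" "?p \<le> ?q" "?q \<le> T" using jtime[OF \<omega> True] jnext[OF \<omega> True] by auto
    have "ennreal c * comp_int (\<lambda>p. ennreal (expA (- c) (fst p)) * indicator (J n) (fst p)) \<omega>
      = comp_int (\<lambda>p. ennreal c * (ennreal (expA (- c) (fst p)) * indicator (J n) (fst p))) \<omega>"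
      by (intro comp_int_cmult[symmetric] \<omega>) measurable
    also have "\<dots> = (\<integral>\<^sup>+t\<in>{0..T}. ennreal c * (ennreal (expA (- c) (\<omega>, t)) * indicator (J n) (\<omega>, t)) \<partial>dA \<omega>)"
      by (rule comp_int_time[OF \<omega>, of "\<lambda>p. ennreal c * (ennreal (expA (- c) p) * indicator (J n) p)"]) measurable
    also have "\<dots> = (\<integral>\<^sup>+t\<in>{?p<..?q}. ennreal (c * exp (- c * A \<omega> t)) \<partial>dA \<omega>)"
    proof (rule nn_integral_cong)
      fix t
      show "ennreal c * (ennreal (expA (- c) (\<omega>, t)) * indicator (J n) (\<omega>, t)) * indicator {0..T} t
        = ennreal (c * exp (- c * A \<omega> t)) * indicator {?p<..?q} t"
      proof (cases "t \<in> {0..T}")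
        case t: True
        then show ?thesis using J_iff[OF \<omega>, of t n] True c by (auto simp: indicator_def expA_def ennreal_mult)
      qed (use pq in \<open>auto simp: indicator_def\<close>)
    qed
    also have "\<dots> = ennreal (- exp (- c * A \<omega> ?q) - - exp (- c * A \<omega> ?p))"
      by (rule stieltjes_FTC[OF less_imp_le[OF T_pos] A_path(2,3)[OF \<omega>] elim(2) pq, where g="\<lambda>x. c * exp (- c * x)" and G="\<lambda>x. - exp (- c * x)"])
        (use c in \<open>auto intro!: derivative_eq_intros\<close>)
    finally have int: "ennreal c * comp_int (\<lambda>p. ennreal (expA (- c) (fst p)) * indicator (J n) (fst p)) \<omega>
      = ennreal (exp (- c * A \<omega> ?p) - exp (- c * A \<omega> ?q))" by simp
    have mono: "exp (- c * A \<omega> ?q) \<le> exp (- c * A \<omega> ?p)"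
      using A_mono[OF \<omega> pq] c by (simp add: mult_left_mono)
    have start: "(if S n \<omega> \<le> ennreal T then ennreal (expA (- c) (fst (jump_at n \<omega>))) else 0) = ennreal (exp (- c * A \<omega> ?p))"
      using S_le_iff[OF \<omega>, of n] True jump_at_eq[OF \<omega> True] by (simp add: expA_def)
    have fin: "(if S (Suc n) \<omega> \<le> ennreal T then ennreal (expA (- c) (fst (jump_at (Suc n) \<omega>))) else 0) + end_value (- c) (\<lambda>_. 1) n \<omega>
      = ennreal (exp (- c * A \<omega> ?q))"
    proof (cases "n < njumps \<omega>")
      case n: True
      then show ?thesis using S_le_iff[OF \<omega>, of "Suc n"] jump_at_eq[OF \<omega>, of "Suc n"] by (simp add: end_value_def expA_def jnext_def not_less)
    next
      case False
      then have "\<not> S (Suc n) \<omega> \<le> ennreal T" "S n \<omega> \<le> ennreal T" using True S_le_iff[OF \<omega>] by auto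
      then show ?thesis using False by (simp add: end_value_def expA_def jnext_def not_le)
    qed
    show ?thesis unfolding start add.assoc[symmetric] fin int using mono by (simp flip: ennreal_plus)
  qed
qed

text \<open>
  Let \<open>e n\<close> be the expectation of \<open>\<gamma> ^ n * exp (- c * A)\<close> at the \<open>n\<close>-th jump, counted as \<open>0\<close> on
  paths without one, where \<open>c = \<gamma> - 1\<close>. By the compensator identity, the loss of \<open>exp (- c * A)\<close>
  over the interval has the expectation \<open>c\<close> times the value at the next jump. Together with that
  value itself this is the factor \<open>1 + c = \<gamma>\<close>, so \<open>e n\<close> is \<open>e (n + 1)\<close> plus the contribution of
  the paths that end in the interval, and the sum telescopes.
\<close>

lemma exponential_moment:
  assumes \<gamma>: "1 \<le> \<gamma>"
  shows "terminal_norm \<gamma> (- (\<gamma> - 1)) (\<lambda>_. 1) \<le> 1"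
proof -
  define c where "c = \<gamma> - 1"
  have c: "0 \<le> c" using \<gamma> by (simp add: c_def)
  define V where "V n \<omega> = (if S n \<omega> \<le> ennreal T then ennreal (expA (- c) (fst (jump_at n \<omega>))) else 0)" for n \<omega>
  define e where "e n = ennreal (\<gamma> ^ n) * (\<integral>\<^sup>+\<omega>. V n \<omega> \<partial>M)" for n
  define P where "P n = (\<integral>\<^sup>+\<omega>. end_value (- c) (\<lambda>_. 1) n \<omega> \<partial>M)" for n
  have [measurable]: "end_value (- c) (\<lambda>_. 1) n \<in> borel_measurable M" for n by (rule end_value_measurable) simp
  have [measurable]: "V (Suc n) \<in> borel_measurable M" for n unfolding V_def[abs_def] by measurable
  have step: "e n = e (Suc n) + ennreal (\<gamma> ^ n) * P n" for n
  proof -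
    let ?C = "\<lambda>\<omega>. comp_int (\<lambda>p. ennreal (expA (- c) (fst p)) * indicator (J n) (fst p)) \<omega>"
    have C: "(\<integral>\<^sup>+\<omega>. ?C \<omega> \<partial>M) = (\<integral>\<^sup>+\<omega>. V (Suc n) \<omega> \<partial>M)"
    proof -
      have "(\<integral>\<^sup>+\<omega>. indicator (space M) \<omega> * ?C \<omega> \<partial>M)
        = (\<integral>\<^sup>+\<omega>. indicator (space M) \<omega> * (if S (Suc n) \<omega> \<le> ennreal T then ennreal (expA (- c) (fst (jump_at (Suc n) \<omega>))) else 0) \<partial>M)"
        using sets.top[of "hist n"] by (intro next_jump_identity_hist) auto
      then show ?thesis by (simp add: V_def cong: nn_integral_cong)
    qed
    have "(\<integral>\<^sup>+\<omega>. V n \<omega> \<partial>M) = (\<integral>\<^sup>+\<omega>. V (Suc n) \<omega> + (end_value (- c) (\<lambda>_. 1) n \<omega> + ennreal c * ?C \<omega>) \<partial>M)"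
      unfolding V_def by (intro nn_integral_cong_AE AE_expA_decay c)
    also have "\<dots> = (\<integral>\<^sup>+\<omega>. V (Suc n) \<omega> \<partial>M) + (P n + ennreal c * (\<integral>\<^sup>+\<omega>. V (Suc n) \<omega> \<partial>M))"
      unfolding P_def by (simp add: nn_integral_add nn_integral_cmult C)
    also have "\<dots> = (1 + ennreal c) * (\<integral>\<^sup>+\<omega>. V (Suc n) \<omega> \<partial>M) + P n"
      by (simp add: distrib_right ac_simps)
    also have "1 + ennreal c = ennreal \<gamma>" using c by (simp add: c_def flip: ennreal_1 ennreal_plus)
    finally show ?thesis using \<gamma> by (simp add: e_def distrib_left ennreal_mult mult_ac)
  qed
  have tele: "(\<Sum>i<n. ennreal (\<gamma> ^ i) * P i) + e n = e 0" for n
  proof (induction n)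
    case (Suc n)
    then show ?case using step[of n] by (simp add: ac_simps)
  qed simp
  have e0: "e 0 \<le> 1"
  proof -
    have "V 0 \<omega> \<le> 1" if "\<omega> \<in> space M" for \<omega>
      using that jump_at_eq[OF that, of 0] jtime_0[OF that] A_path(1)[OF that] by (simp add: V_def expA_def)
    then have "(\<integral>\<^sup>+\<omega>. V 0 \<omega> \<partial>M) \<le> (\<integral>\<^sup>+\<omega>. 1 \<partial>M)" by (intro nn_integral_mono)
    then show ?thesis by (simp add: e_def emeasure_space_1)
  qed
  have "terminal_norm \<gamma> (- c) (\<lambda>_. 1) = (\<Sum>n. ennreal (\<gamma> ^ n) * P n)"
    unfolding P_def using \<gamma> by (intro sum_end_value[symmetric]) auto
  also have "\<dots> \<le> 1"
    unfolding suminf_eq_SUP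
  proof (rule SUP_least)
    fix n
    have "(\<Sum>i<n. ennreal (\<gamma> ^ i) * P i) \<le> (\<Sum>i<n. ennreal (\<gamma> ^ i) * P i) + e n" by simp
    also have "\<dots> \<le> 1" unfolding tele by (rule e0)
    finally show "(\<Sum>i<n. ennreal (\<gamma> ^ i) * P i) \<le> 1" .
  qed
  finally show ?thesis by (simp add: c_def)
qed

lemma jump_moment_finite:
  assumes \<gamma>: "1 \<le> \<gamma>" and C: "AE \<omega> in M. A \<omega> T \<le> C"
  shows "(\<integral>\<^sup>+\<omega>. ennreal (\<gamma> ^ njumps \<omega>) \<partial>M) < \<infinity>"
proof -
  have "(\<integral>\<^sup>+\<omega>. ennreal (\<gamma> ^ njumps \<omega>) \<partial>M)
    \<le> (\<integral>\<^sup>+\<omega>. ennreal (exp ((\<gamma> - 1) * C)) * ennreal (\<gamma> ^ njumps \<omega> * exp (- (\<gamma> - 1) * A \<omega> T) * \<bar>1\<bar>) \<partial>M)"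
  proof (rule nn_integral_mono_AE)
    show "AE \<omega> in M. ennreal (\<gamma> ^ njumps \<omega>)
      \<le> ennreal (exp ((\<gamma> - 1) * C)) * ennreal (\<gamma> ^ njumps \<omega> * exp (- (\<gamma> - 1) * A \<omega> T) * \<bar>1\<bar>)"
      using C
    proof eventually_elim
      case (elim \<omega>)
      have "1 \<le> exp ((\<gamma> - 1) * C - (\<gamma> - 1) * A \<omega> T)" using elim \<gamma> by (simp add: mult_left_mono)
      also have "\<dots> = exp ((\<gamma> - 1) * C) * exp (- (\<gamma> - 1) * A \<omega> T)" by (subst exp_add[symmetric]) (simp add: algebra_simps)
      finally have "\<gamma> ^ njumps \<omega> * 1 \<le> \<gamma> ^ njumps \<omega> * (exp ((\<gamma> - 1) * C) * exp (- (\<gamma> - 1) * A \<omega> T))"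
        using \<gamma> by (intro mult_left_mono) auto
      then show ?case using \<gamma> by (subst ennreal_mult[symmetric]) (auto intro!: ennreal_leI simp: mult_ac)
    qed
  qed
  also have "\<dots> = ennreal (exp ((\<gamma> - 1) * C)) * terminal_norm \<gamma> (- (\<gamma> - 1)) (\<lambda>_. 1)"
  proof -
    have [measurable]: "(\<lambda>\<omega>. A \<omega> T) \<in> borel_measurable M" using T_pos by (intro measurable_F_M[OF A_adapted]) auto
    have [measurable]: "(\<lambda>\<omega>. \<gamma> ^ njumps \<omega>) \<in> borel_measurable M" by (rule measurable_compose[OF njumps_measurable]) simp
    show ?thesis unfolding terminal_norm_def by (rule nn_integral_cmult) measurable
  qed
  also have "\<dots> \<le> ennreal (exp ((\<gamma> - 1) * C)) * 1" by (intro mult_left_mono exponential_moment \<gamma>) simp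
  finally show ?thesis by (simp add: le_less_trans)
qed

text \<open>
  Young's inequality separates the two factors; the one with the number of jumps has moments of
  all orders.
\<close>

lemma weighted_jump_moment_finite:
  fixes V :: "'w \<Rightarrow> real"
  assumes a: "1 \<le> a" and C: "AE \<omega> in M. A \<omega> T \<le> C" and \<epsilon>: "0 < \<epsilon>" and V[measurable]: "V \<in> borel_measurable M"
    and int: "(\<integral>\<^sup>+\<omega>. ennreal (\<bar>V \<omega>\<bar> powr (1 + \<epsilon>)) \<partial>M) < \<infinity>"
  shows "(\<integral>\<^sup>+\<omega>. ennreal (a ^ njumps \<omega> * \<bar>V \<omega>\<bar>) \<partial>M) < \<infinity>"
proof -
  define \<gamma> where "\<gamma> = a powr (1 + 1 / \<epsilon>)"
  have \<gamma>: "1 \<le> \<gamma>" using a \<epsilon> by (simp add: \<gamma>_def ge_one_powr_ge_zero)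
  have pw: "(a ^ n) powr (1 + 1 / \<epsilon>) = \<gamma> ^ n" for n
    using a by (simp add: \<gamma>_def powr_realpow[symmetric] powr_powr mult.commute)
  have [measurable]: "(\<lambda>\<omega>. \<gamma> ^ njumps \<omega>) \<in> borel_measurable M" by (rule measurable_compose[OF njumps_measurable]) simp
  have "(\<integral>\<^sup>+\<omega>. ennreal (a ^ njumps \<omega> * \<bar>V \<omega>\<bar>) \<partial>M) \<le> (\<integral>\<^sup>+\<omega>. ennreal (\<gamma> ^ njumps \<omega>) + ennreal (\<bar>V \<omega>\<bar> powr (1 + \<epsilon>)) \<partial>M)"
  proof (rule nn_integral_mono)
    fix \<omega>
    have "a ^ njumps \<omega> * \<bar>V \<omega>\<bar> \<le> \<gamma> ^ njumps \<omega> + \<bar>V \<omega>\<bar> powr (1 + \<epsilon>)"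
      using mult_le_powr_add_powr[of "a ^ njumps \<omega>" "\<bar>V \<omega>\<bar>" \<epsilon>] a \<epsilon> by (simp add: pw)
    then show "ennreal (a ^ njumps \<omega> * \<bar>V \<omega>\<bar>) \<le> ennreal (\<gamma> ^ njumps \<omega>) + ennreal (\<bar>V \<omega>\<bar> powr (1 + \<epsilon>))"
      using \<gamma> by (simp add: ennreal_leI flip: ennreal_plus)
  qed
  also have "\<dots> = (\<integral>\<^sup>+\<omega>. ennreal (\<gamma> ^ njumps \<omega>) \<partial>M) + (\<integral>\<^sup>+\<omega>. ennreal (\<bar>V \<omega>\<bar> powr (1 + \<epsilon>)) \<partial>M)"
    by (intro nn_integral_add) measurable
  also have "\<dots> < \<infinity>" using jump_moment_finite[OF \<gamma> C] int by (simp add: less_top[symmetric])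
  finally show ?thesis .
qed

text \<open>
  For nonnegative \<open>\<beta>\<close> the factor \<open>exp (\<beta> * A)\<close> lies between \<open>1\<close> and \<open>exp (\<beta> * C)\<close>, so only \<open>\<alpha>\<close>
  matters.
\<close>

lemma weight_bounded_compensator:
  assumes C: "AE \<omega> in M. A \<omega> T \<le> C" and \<alpha>: "0 < \<alpha>'" "\<alpha>' \<le> \<alpha>" and \<beta>: "0 \<le> \<beta>" "0 \<le> \<beta>'"
    and h[measurable]: "h \<in> borel_measurable PE" and fin: "wnorm \<alpha> \<beta> h < \<infinity>"
  shows "wnorm \<alpha>' \<beta>' h < \<infinity>"
proof -
  have \<alpha>0: "0 < \<alpha>" using \<alpha> by simp
  have "wnorm \<alpha>' \<beta>' h = (\<integral>\<^sup>+\<omega>. comp_int (\<lambda>p. ennreal (weight \<alpha>' \<beta>' (fst p) * \<bar>h p\<bar>)) \<omega> \<partial>M)" by (rule nn_integral_Q) measurable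
  also have "\<dots> \<le> (\<integral>\<^sup>+\<omega>. ennreal (exp (\<beta>' * C)) * comp_int (\<lambda>p. ennreal (weight \<alpha> \<beta> (fst p) * \<bar>h p\<bar>)) \<omega> \<partial>M)"
  proof (rule nn_integral_mono_AE)
    show "AE \<omega> in M. comp_int (\<lambda>p. ennreal (weight \<alpha>' \<beta>' (fst p) * \<bar>h p\<bar>)) \<omega>
      \<le> ennreal (exp (\<beta>' * C)) * comp_int (\<lambda>p. ennreal (weight \<alpha> \<beta> (fst p) * \<bar>h p\<bar>)) \<omega>"
      using C AE_space
    proof eventually_elim
      case (elim \<omega>)
      note \<omega> = elim(2)
      have "comp_int (\<lambda>p. ennreal (weight \<alpha>' \<beta>' (fst p) * \<bar>h p\<bar>)) \<omega>
        \<le> comp_int (\<lambda>p. ennreal (exp (\<beta>' * C)) * ennreal (weight \<alpha> \<beta> (fst p) * \<bar>h p\<bar>)) \<omega>"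
      proof (rule comp_int_mono[OF \<omega>])
        fix t x assume t: "0 < t" "t \<le> T"
        have "A \<omega> t \<le> C" using A_mono[OF \<omega>, of t T] t elim(1) by simp
        then have 1: "expA \<beta>' (\<omega>, t) \<le> exp (\<beta>' * C)" using \<beta> by (simp add: expA_def mult_left_mono)
        have 2: "1 \<le> expA \<beta> (\<omega>, t)" using A_nonneg[OF \<omega>, of t] t \<beta> by (simp add: expA_def)
        have 3: "\<alpha>' ^ jump_index (\<omega>, t) \<le> \<alpha> ^ jump_index (\<omega>, t)" using \<alpha> by (intro power_mono) auto
        have "\<alpha>' ^ jump_index (\<omega>, t) * expA \<beta>' (\<omega>, t) \<le> (\<alpha> ^ jump_index (\<omega>, t) * expA \<beta> (\<omega>, t)) * exp (\<beta>' * C)"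
        proof (rule mult_mono[OF _ 1])
          show "\<alpha>' ^ jump_index (\<omega>, t) \<le> \<alpha> ^ jump_index (\<omega>, t) * expA \<beta> (\<omega>, t)"
            using mult_mono[OF 3 2] \<alpha>0 by simp
        qed (use \<alpha>0 expA_pos[of \<beta>' "(\<omega>, t)"] expA_pos[of \<beta> "(\<omega>, t)"] in auto)
        then have "weight \<alpha>' \<beta>' (\<omega>, t) * \<bar>h ((\<omega>, t), x)\<bar> \<le> (exp (\<beta>' * C) * weight \<alpha> \<beta> (\<omega>, t)) * \<bar>h ((\<omega>, t), x)\<bar>"
          by (intro mult_right_mono) (simp_all add: weight_def mult_ac)
        then show "ennreal (weight \<alpha>' \<beta>' (fst ((\<omega>, t), x)) * \<bar>h ((\<omega>, t), x)\<bar>)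
          \<le> ennreal (exp (\<beta>' * C)) * ennreal (weight \<alpha> \<beta> (fst ((\<omega>, t), x)) * \<bar>h ((\<omega>, t), x)\<bar>)"
          using weight_pos[OF \<alpha>0, of \<beta> "(\<omega>, t)"] by (simp add: ennreal_mult[symmetric] ennreal_leI mult.assoc)
      qed
      also have "\<dots> = ennreal (exp (\<beta>' * C)) * comp_int (\<lambda>p. ennreal (weight \<alpha> \<beta> (fst p) * \<bar>h p\<bar>)) \<omega>"
        by (intro comp_int_cmult \<omega>) measurable
      finally show ?case .
    qed
  qed
  also have "\<dots> = ennreal (exp (\<beta>' * C)) * (\<integral>\<^sup>+\<omega>. comp_int (\<lambda>p. ennreal (weight \<alpha> \<beta> (fst p) * \<bar>h p\<bar>)) \<omega> \<partial>M)"
    by (rule nn_integral_cmult) measurable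
  also have "(\<integral>\<^sup>+\<omega>. comp_int (\<lambda>p. ennreal (weight \<alpha> \<beta> (fst p) * \<bar>h p\<bar>)) \<omega> \<partial>M) = wnorm \<alpha> \<beta> h" by (rule nn_integral_Q[symmetric]) measurable
  finally show ?thesis using fin by (auto simp: ennreal_mult_less_top intro: le_less_trans)
qed

end

section \<open>Bounded compensators\<close>

context bsde
begin

lemma weighted_data_iff:
  assumes \<alpha>: "0 < \<alpha>"
  shows "weighted_integrable_data M T \<nu> A (counting_process T S X) \<xi> f \<alpha> \<beta>
    \<longleftrightarrow> terminal_norm \<alpha> \<beta> \<xi> < \<infinity> \<and> wnorm \<alpha> \<beta> f0 < \<infinity>"
proof -
  have 1: "(\<integral>\<^sup>+\<omega>. ennreal (exp (\<beta> * A \<omega> T) * \<alpha> powr counting_process T S X \<omega> T * \<bar>\<xi> \<omega>\<bar>) \<partial>M) = terminal_norm \<alpha> \<beta> \<xi>"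
    unfolding terminal_norm_def
  proof (rule nn_integral_cong)
    fix \<omega> assume \<omega>: "\<omega> \<in> space M"
    have "counting_process T S X \<omega> T = real (njumps \<omega>)"
      using T_pos jtime[OF \<omega>, of "njumps \<omega>"] by (intro counting_process_eq[OF \<omega>]) auto
    then show "ennreal (exp (\<beta> * A \<omega> T) * \<alpha> powr counting_process T S X \<omega> T * \<bar>\<xi> \<omega>\<bar>) = ennreal (\<alpha> ^ njumps \<omega> * exp (\<beta> * A \<omega> T) * \<bar>\<xi> \<omega>\<bar>)"
      using \<alpha> by (simp add: powr_realpow mult_ac)
  qed
  have "(\<integral>\<^sup>+\<omega>. nn_integral_upto T (\<nu> \<omega>) (\<lambda>s x. ennreal (\<alpha> powr counting_process T S X \<omega> s * exp (\<beta> * A \<omega> s) * \<bar>f \<omega> s x 0 (\<lambda>_. 0)\<bar>)) \<partial>M)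
    = (\<integral>\<^sup>+\<omega>. comp_int (\<lambda>p. ennreal (weight \<alpha> \<beta> (fst p) * \<bar>f0 p\<bar>)) \<omega> \<partial>M)"
  proof (rule nn_integral_cong_AE)
    show "AE \<omega> in M. nn_integral_upto T (\<nu> \<omega>) (\<lambda>s x. ennreal (\<alpha> powr counting_process T S X \<omega> s * exp (\<beta> * A \<omega> s) * \<bar>f \<omega> s x 0 (\<lambda>_. 0)\<bar>))
      = comp_int (\<lambda>p. ennreal (weight \<alpha> \<beta> (fst p) * \<bar>f0 p\<bar>)) \<omega>"
      using AE_off_jumps AE_space
    proof eventually_elim
      case (elim \<omega>)
      note \<omega> = elim(2)
      show ?case
        unfolding nn_integral_upto_def comp_int_def
      proof (intro nn_integral_cong_AE, use elim(1) in eventually_elim)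
        case (elim z)
        then have t: "0 < fst z" "fst z \<le> T" and nj: "\<And>n. fst z \<noteq> jtime n \<omega>" by auto
        obtain n where n: "jump_index (\<omega>, fst z) = n" "counting_process T S X \<omega> (fst z) = real n"
          by (rule off_jumps[OF \<omega> t nj])
        have ap: "at_path \<omega> z = ((\<omega>, fst z), snd z)" using t by (simp add: at_path_def)
        have "\<alpha> powr counting_process T S X \<omega> (fst z) * exp (\<beta> * A \<omega> (fst z)) = weight \<alpha> \<beta> (\<omega>, fst z)"
          using n \<alpha> by (simp add: weight_def expA_def powr_realpow)
        then show ?case using t by (simp add: ap indicator_def mem_Times_iff f0_eq)
      qed
    qed
  qed
  also have "\<dots> = wnorm \<alpha> \<beta> f0" by (rule nn_integral_Q[symmetric]) measurable
  finally show ?thesis unfolding weighted_integrable_data_def 1 by simp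
qed

theorem existence_uniqueness:
  assumes \<alpha>: "L < \<alpha>" and \<beta>: "1 + \<alpha> + L' < \<beta>"
    and data: "weighted_integrable_data M T \<nu> A (counting_process T S X) \<xi> f \<alpha> \<beta>"
  shows "exists_unique_up_to_null M T \<nu> (sols \<inter> L1 \<alpha> \<beta>)"
proof -
  have "0 < \<alpha>" using \<alpha> L_nonneg by simp
  then have "sols \<inter> L1 \<alpha> \<beta> \<noteq> {}" using data weighted_data_iff[of \<alpha> \<beta>] existence[OF \<alpha> \<beta>] by simp
  then show ?thesis
    unfolding exists_unique_up_to_null_def using uniqueness[OF \<alpha> \<beta>] by (auto simp del: Int_iff)
qed

lemma f0_integral:
  "AE \<omega> in M. integral_Ioc 0 T (\<nu> \<omega>) (\<lambda>s x. \<bar>f \<omega> s x 0 (\<lambda>_. 0)\<bar>) = enn2real (comp_int (\<lambda>p. ennreal \<bar>f0 p\<bar>) \<omega>)"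
  using f0_path_integrable AE_space
proof eventually_elim
  case (elim \<omega>)
  note \<omega> = elim(2)
  have m: "(\<lambda>p. \<bar>f0 p\<bar>) \<in> borel_measurable PE" by measurable
  have i: "path_integrable (\<lambda>p. \<bar>f0 p\<bar>) \<omega>" using elim(1) by (simp add: path_integrable_def)
  have "integral_Ioc 0 T (\<nu> \<omega>) (\<lambda>s x. \<bar>f \<omega> s x 0 (\<lambda>_. 0)\<bar>) = path_int (\<lambda>p. \<bar>f0 p\<bar>) \<omega> T - path_int (\<lambda>p. \<bar>f0 p\<bar>) \<omega> 0"
    by (rule integral_\<nu>_Ioc[OF \<omega> m i]) (use T_pos in \<open>auto simp: f0_eq\<close>)
  also have "\<dots> = (\<integral>z. \<bar>f0 (at_path \<omega> z)\<bar> \<partial>\<nu> \<omega>)"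
    unfolding path_int_0 diff_0_right unfolding path_int_def
  proof (rule integral_cong_AE)
    show "AE z in \<nu> \<omega>. indicator ({0<..T} \<times> UNIV) z *\<^sub>R \<bar>f0 (at_path \<omega> z)\<bar> = \<bar>f0 (at_path \<omega> z)\<bar>"
      using AE_\<nu>_Ioc[OF \<omega>] by eventually_elim (simp add: indicator_def mem_Times_iff)
  qed (use path_integrableD[OF \<omega> m i] Ioc_times_sets[OF \<omega>, of "{0<..T}"] in \<open>auto intro: borel_measurable_integrable\<close>)
  also have "\<dots> = enn2real (comp_int (\<lambda>p. ennreal \<bar>f0 p\<bar>) \<omega>)"
    unfolding comp_int_def using path_integrableD(1)[OF \<omega> m i]
    by (intro integral_eq_nn_integral) (auto intro: borel_measurable_integrable)
  finally show ?case .
qed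

lemma bounded_compensator_data:
  assumes C: "AE \<omega> in M. A \<omega> T \<le> C" and \<epsilon>: "0 < \<epsilon>"
    and int\<xi>: "(\<integral>\<^sup>+\<omega>. ennreal (\<bar>\<xi> \<omega>\<bar> powr (1 + \<epsilon>)) \<partial>M) < \<infinity>"
    and intf: "(\<integral>\<^sup>+\<omega>. ennreal (integral_Ioc 0 T (\<nu> \<omega>) (\<lambda>s x. \<bar>f \<omega> s x 0 (\<lambda>_. 0)\<bar>) powr (1 + \<epsilon>)) \<partial>M) < \<infinity>"
    and \<alpha>: "0 < \<alpha>" and \<beta>: "0 \<le> \<beta>"
  shows "weighted_integrable_data M T \<nu> A (counting_process T S X) \<xi> f \<alpha> \<beta>"
proof -
  define a where "a = max 1 \<alpha>"
  have a: "1 \<le> a" "\<alpha> \<le> a" by (simp_all add: a_def)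
  have [measurable]: "(\<lambda>\<omega>. a ^ njumps \<omega>) \<in> borel_measurable M" by (rule measurable_compose[OF njumps_measurable]) simp
  have tn: "terminal_norm \<alpha> \<beta> \<xi> < \<infinity>"
  proof -
    have "terminal_norm \<alpha> \<beta> \<xi> \<le> (\<integral>\<^sup>+\<omega>. ennreal (exp (\<beta> * C)) * ennreal (a ^ njumps \<omega> * \<bar>\<xi> \<omega>\<bar>) \<partial>M)"
      unfolding terminal_norm_def
    proof (rule nn_integral_mono_AE)
      show "AE \<omega> in M. ennreal (\<alpha> ^ njumps \<omega> * exp (\<beta> * A \<omega> T) * \<bar>\<xi> \<omega>\<bar>) \<le> ennreal (exp (\<beta> * C)) * ennreal (a ^ njumps \<omega> * \<bar>\<xi> \<omega>\<bar>)"
        using C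
      proof eventually_elim
        case (elim \<omega>)
        have "\<alpha> ^ njumps \<omega> * exp (\<beta> * A \<omega> T) \<le> a ^ njumps \<omega> * exp (\<beta> * C)"
          using a \<alpha> \<beta> elim by (intro mult_mono power_mono) (auto simp: mult_left_mono)
        then have "\<alpha> ^ njumps \<omega> * exp (\<beta> * A \<omega> T) * \<bar>\<xi> \<omega>\<bar> \<le> a ^ njumps \<omega> * exp (\<beta> * C) * \<bar>\<xi> \<omega>\<bar>" by (rule mult_right_mono) simp
        then show ?case using a by (simp add: ennreal_mult[symmetric] ennreal_leI mult_ac)
      qed
    qed
    also have "\<dots> = ennreal (exp (\<beta> * C)) * (\<integral>\<^sup>+\<omega>. ennreal (a ^ njumps \<omega> * \<bar>\<xi> \<omega>\<bar>) \<partial>M)" by (rule nn_integral_cmult) measurable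
    also have "\<dots> < \<infinity>" using weighted_jump_moment_finite[OF a(1) C \<epsilon> \<xi>_measurable int\<xi>] by (simp add: ennreal_mult_less_top)
    finally show ?thesis .
  qed
  define V where "V \<omega> = enn2real (comp_int (\<lambda>p. ennreal \<bar>f0 p\<bar>) \<omega>)" for \<omega>
  have V[measurable]: "V \<in> borel_measurable M" unfolding V_def by measurable
  have "(\<integral>\<^sup>+\<omega>. ennreal (\<bar>V \<omega>\<bar> powr (1 + \<epsilon>)) \<partial>M)
    = (\<integral>\<^sup>+\<omega>. ennreal (integral_Ioc 0 T (\<nu> \<omega>) (\<lambda>s x. \<bar>f \<omega> s x 0 (\<lambda>_. 0)\<bar>) powr (1 + \<epsilon>)) \<partial>M)"
    using f0_integral by (intro nn_integral_cong_AE) (auto elim!: eventually_mono simp: V_def)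
  then have VI: "(\<integral>\<^sup>+\<omega>. ennreal (\<bar>V \<omega>\<bar> powr (1 + \<epsilon>)) \<partial>M) < \<infinity>" using intf by simp
  have fn: "wnorm \<alpha> \<beta> f0 < \<infinity>"
  proof -
    have "wnorm \<alpha> \<beta> f0 = (\<integral>\<^sup>+\<omega>. comp_int (\<lambda>p. ennreal (weight \<alpha> \<beta> (fst p) * \<bar>f0 p\<bar>)) \<omega> \<partial>M)" by (rule nn_integral_Q) measurable
    also have "\<dots> \<le> (\<integral>\<^sup>+\<omega>. ennreal (exp (\<beta> * C)) * ennreal (a ^ njumps \<omega> * \<bar>V \<omega>\<bar>) \<partial>M)"
    proof (rule nn_integral_mono_AE)
      show "AE \<omega> in M. comp_int (\<lambda>p. ennreal (weight \<alpha> \<beta> (fst p) * \<bar>f0 p\<bar>)) \<omega> \<le> ennreal (exp (\<beta> * C)) * ennreal (a ^ njumps \<omega> * \<bar>V \<omega>\<bar>)"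
        using C f0_path_integrable AE_space
      proof eventually_elim
        case (elim \<omega>)
        note \<omega> = elim(3)
        let ?k = "exp (\<beta> * C) * a ^ njumps \<omega>"
        have "comp_int (\<lambda>p. ennreal (weight \<alpha> \<beta> (fst p) * \<bar>f0 p\<bar>)) \<omega> \<le> comp_int (\<lambda>p. ennreal ?k * ennreal \<bar>f0 p\<bar>) \<omega>"
        proof (rule comp_int_mono[OF \<omega>])
          fix t x assume t: "0 < t" "t \<le> T"
          have "A \<omega> t \<le> C" using A_mono[OF \<omega>, of t T] t elim(1) by simp
          then have 1: "expA \<beta> (\<omega>, t) \<le> exp (\<beta> * C)" using \<beta> by (simp add: expA_def mult_left_mono)
          have "\<alpha> ^ jump_index (\<omega>, t) \<le> a ^ jump_index (\<omega>, t)" using \<alpha> a by (intro power_mono) auto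
          also have "\<dots> \<le> a ^ njumps \<omega>" using a jump_index_le[OF \<omega> t] by (intro power_increasing) auto
          finally have "weight \<alpha> \<beta> (\<omega>, t) \<le> ?k"
            unfolding weight_def using mult_mono[OF _ 1, of "\<alpha> ^ jump_index (\<omega>, t)" "a ^ njumps \<omega>"] a expA_pos[of \<beta> "(\<omega>, t)"]
            by (simp add: mult.commute)
          then have "weight \<alpha> \<beta> (\<omega>, t) * \<bar>f0 ((\<omega>, t), x)\<bar> \<le> ?k * \<bar>f0 ((\<omega>, t), x)\<bar>" by (rule mult_right_mono) simp
          then show "ennreal (weight \<alpha> \<beta> (fst ((\<omega>, t), x)) * \<bar>f0 ((\<omega>, t), x)\<bar>) \<le> ennreal ?k * ennreal \<bar>f0 ((\<omega>, t), x)\<bar>"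
            using a by (simp add: ennreal_mult[symmetric] ennreal_leI)
        qed
        also have "\<dots> = ennreal ?k * comp_int (\<lambda>p. ennreal \<bar>f0 p\<bar>) \<omega>" by (intro comp_int_cmult \<omega>) measurable
        also have "comp_int (\<lambda>p. ennreal \<bar>f0 p\<bar>) \<omega> = ennreal \<bar>V \<omega>\<bar>"
          using elim(2) by (simp add: V_def path_integrable_def)
        also have "ennreal ?k * ennreal \<bar>V \<omega>\<bar> = ennreal (exp (\<beta> * C)) * ennreal (a ^ njumps \<omega> * \<bar>V \<omega>\<bar>)"
          using a by (simp add: ennreal_mult[symmetric] mult.assoc)
        finally show ?case .
      qed
    qed
    also have "\<dots> = ennreal (exp (\<beta> * C)) * (\<integral>\<^sup>+\<omega>. ennreal (a ^ njumps \<omega> * \<bar>V \<omega>\<bar>) \<partial>M)" by (rule nn_integral_cmult) measurable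
    also have "\<dots> < \<infinity>" using weighted_jump_moment_finite[OF a(1) C \<epsilon> V VI] by (simp add: ennreal_mult_less_top)
    finally show ?thesis .
  qed
  show ?thesis using tn fn weighted_data_iff[OF \<alpha>] by simp
qed

lemma L1_antimono:
  assumes C: "AE \<omega> in M. A \<omega> T \<le> C" and \<alpha>: "0 < \<alpha>'" "\<alpha>' \<le> \<alpha>" and \<beta>: "0 \<le> \<beta>" "0 \<le> \<beta>'"
    and p: "p \<in> sols" "p \<in> L1 \<alpha> \<beta>"
  shows "p \<in> L1 \<alpha>' \<beta>'"
proof -
  obtain Y Z where YZ: "p = (Y, Z)" by (cases p)
  have s: "linear_solution \<xi> (driver Y Z) Y Z" using p YZ bsde_solution_iff by simp
  note [measurable] = linear_solutionD(2,4)[OF s]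
  have fin: "wnorm \<alpha> \<beta> (\<lambda>p. left_lim Y (fst p)) < \<infinity>" "wnorm \<alpha> \<beta> (uncurried Z) < \<infinity>"
    using p YZ L1_iff[of \<alpha> Y Z \<beta>] \<alpha> by auto
  have "wnorm \<alpha>' \<beta>' (\<lambda>p. left_lim Y (fst p)) < \<infinity>"
    by (rule weight_bounded_compensator[OF C \<alpha> \<beta> _ fin(1)]) measurable
  moreover have "wnorm \<alpha>' \<beta>' (uncurried Z) < \<infinity>"
    by (rule weight_bounded_compensator[OF C \<alpha> \<beta> _ fin(2)]) measurable
  ultimately show ?thesis using p YZ L1_iff[of \<alpha>' Y Z \<beta>'] \<alpha> by simp
qed

lemma L1_same_up_to_null:
  assumes same: "same_up_to_null M T \<nu> p q" and p: "p \<in> sols" and q: "q \<in> L1 \<alpha> \<beta>"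
  shows "p \<in> L1 \<alpha> \<beta>"
proof -
  obtain Y Z Y' Z' where pq: "p = (Y, Z)" "q = (Y', Z')" by (cases p; cases q) auto
  let ?N = "counting_process T S X"
  let ?h = "\<lambda>Y Z \<omega> t x. ennreal ((\<bar>Y \<omega> t\<bar> + \<bar>Z \<omega> t x\<bar>) * exp (\<beta> * A \<omega> t) * \<alpha> powr ?N \<omega> t)"
  have "(\<integral>\<^sup>+\<omega>. nn_integral_upto T (\<nu> \<omega>) (?h Y Z \<omega>) \<partial>M) = (\<integral>\<^sup>+\<omega>. nn_integral_upto T (\<nu> \<omega>) (?h Y' Z' \<omega>) \<partial>M)"
  proof (rule nn_integral_cong_AE)
    have "AE \<omega> in M. \<forall>t\<in>{0..T}. Y \<omega> t = Y' \<omega> t" "AE \<omega> in M. AE z in \<nu> \<omega>. Z \<omega> (fst z) (snd z) = Z' \<omega> (fst z) (snd z)"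
      using same by (simp_all add: same_up_to_null_def pq)
    then show "AE \<omega> in M. nn_integral_upto T (\<nu> \<omega>) (?h Y Z \<omega>) = nn_integral_upto T (\<nu> \<omega>) (?h Y' Z' \<omega>)"
    proof eventually_elim
      case (elim \<omega>)
      show ?case unfolding nn_integral_upto_def
      proof (intro nn_integral_cong_AE, use elim(2) in eventually_elim)
        case (elim z)
        then show ?case using \<open>\<forall>t\<in>{0..T}. Y \<omega> t = Y' \<omega> t\<close> by (auto simp: indicator_def)
      qed
    qed
  qed
  moreover have "adapted_cadlag M T F Y" "predictable M T F borel Z"
    using p pq by (simp_all add: bsde_solution_def)
  ultimately show ?thesis using q by (simp add: L1_space_def pq)
qed

definition integrable_sols :: "(('w \<Rightarrow> real \<Rightarrow> real) \<times> ('w \<Rightarrow> real \<Rightarrow> 'e \<Rightarrow> real)) set" where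
  "integrable_sols = sols \<inter> (\<Union>(\<alpha>, \<beta>) \<in> {(\<alpha>, \<beta>). \<alpha> > L \<and> \<beta> > 1 + \<alpha> + L'}. L1 \<alpha> \<beta>)"

text \<open>
  Both solutions belong to the space for the smaller of the two values of \<open>\<alpha>\<close>, and there
  uniqueness is known.
\<close>

lemma bounded_compensator_uniqueness:
  assumes C: "AE \<omega> in M. A \<omega> T \<le> C" and p: "p \<in> integrable_sols" and q: "q \<in> integrable_sols"
  shows "same_up_to_null M T \<nu> p q"
proof -
  obtain \<alpha>1 \<beta>1 where p1: "p \<in> sols" "p \<in> L1 \<alpha>1 \<beta>1" "L < \<alpha>1" "1 + \<alpha>1 + L' < \<beta>1" using p by (auto simp: integrable_sols_def)
  obtain \<alpha>2 \<beta>2 where q1: "q \<in> sols" "q \<in> L1 \<alpha>2 \<beta>2" "L < \<alpha>2" "1 + \<alpha>2 + L' < \<beta>2" using q by (auto simp: integrable_sols_def)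
  define m where "m = min \<alpha>1 \<alpha>2"
  have m: "L < m" "0 < m" using p1 q1 L_nonneg by (auto simp: m_def)
  have "p \<in> L1 m (2 + m + L')"
    by (rule L1_antimono[OF C m(2) _ _ _ p1(1,2)]) (use p1 m L_nonneg in \<open>auto simp: m_def\<close>)
  moreover have "q \<in> L1 m (2 + m + L')"
    by (rule L1_antimono[OF C m(2) _ _ _ q1(1,2)]) (use q1 m L_nonneg in \<open>auto simp: m_def\<close>)
  moreover obtain Y Z Y' Z' where "p = (Y, Z)" "q = (Y', Z')" by (cases p; cases q) auto
  ultimately show ?thesis using uniqueness[OF m(1), of "2 + m + L'"] p1(1) q1(1) by auto
qed

text \<open>
  For every \<open>a > L\<close> there is a solution in the space for \<open>a\<close>, and uniqueness identifies it with
  any given one. As \<open>a\<close> is arbitrarily large, the given solution belongs to all the spaces.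
\<close>

theorem bounded_compensator_existence_uniqueness:
  assumes C: "AE \<omega> in M. A \<omega> T \<le> C"
    and data: "\<And>\<alpha> \<beta>. 0 < \<alpha> \<Longrightarrow> 0 \<le> \<beta> \<Longrightarrow> weighted_integrable_data M T \<nu> A (counting_process T S X) \<xi> f \<alpha> \<beta>"
  shows "exists_unique_up_to_null M T \<nu> integrable_sols"
    and "0 < \<alpha> \<Longrightarrow> 0 \<le> \<beta> \<Longrightarrow> integrable_sols \<subseteq> L1 \<alpha> \<beta>"
proof -
  have ex: "\<exists>r. r \<in> sols \<and> r \<in> L1 a (2 + a + L')" if "L < a" for a
  proof -
    have "exists_unique_up_to_null M T \<nu> (sols \<inter> L1 a (2 + a + L'))"
      using that L_nonneg by (intro existence_uniqueness data) auto
    then show ?thesis by (auto simp: exists_unique_up_to_null_def)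
  qed
  have mem: "r \<in> integrable_sols" if "r \<in> sols" "r \<in> L1 a (2 + a + L')" "L < a" for r a
    unfolding integrable_sols_def using that by (intro IntI UN_I[of "(a, 2 + a + L')"]) auto
  obtain r where "r \<in> sols" "r \<in> L1 (L + 1) (2 + (L + 1) + L')" using ex[of "L + 1"] by auto
  then have "integrable_sols \<noteq> {}" using mem[of r "L + 1"] by auto
  then show "exists_unique_up_to_null M T \<nu> integrable_sols"
    unfolding exists_unique_up_to_null_def using bounded_compensator_uniqueness[OF C] by blast
  assume \<alpha>: "0 < \<alpha>" and \<beta>: "0 \<le> \<beta>"
  show "integrable_sols \<subseteq> L1 \<alpha> \<beta>"
  proof
    fix p assume p: "p \<in> integrable_sols"
    then have ps: "p \<in> sols" by (simp add: integrable_sols_def)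
    define a where "a = max \<alpha> (L + 1)"
    have a: "L < a" "\<alpha> \<le> a" "0 < a" using \<alpha> L_nonneg by (auto simp: a_def)
    obtain r where r: "r \<in> sols" "r \<in> L1 a (2 + a + L')" using ex[OF a(1)] by auto
    have "same_up_to_null M T \<nu> p r" by (rule bounded_compensator_uniqueness[OF C p mem[OF r a(1)]])
    then have "p \<in> L1 a (2 + a + L')" using ps r(2) by (rule L1_same_up_to_null)
    then show "p \<in> L1 \<alpha> \<beta>"
      using L1_antimono[OF C \<alpha> a(2) _ \<beta> ps, of "2 + a + L'"] a L_nonneg by simp
  qed
qed

end

theorem theorem3:
  fixes M :: "'w measure" and T L L' :: real and \<Delta> :: "'e::t2_space"
    and S :: "nat \<Rightarrow> 'w \<Rightarrow> ennreal" and X :: "nat \<Rightarrow> 'w \<Rightarrow> 'e"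
    and F :: "ennreal \<Rightarrow> 'w measure"
    and A :: "'w \<Rightarrow> real \<Rightarrow> real" and \<phi> :: "'w \<Rightarrow> real \<Rightarrow> 'e measure"
    and \<xi> :: "'w \<Rightarrow> real"
    and f :: "'w \<Rightarrow> real \<Rightarrow> 'e \<Rightarrow> real \<Rightarrow> ('e \<Rightarrow> real) \<Rightarrow> real"
  defines "\<mu> \<equiv> jump_measure T S X"
    and "N \<equiv> counting_process T S X"
    and "\<nu> \<equiv> disintegrated_measure T A \<phi>"
  assumes "prob_space M" and "0 < T" and "lusin_space TYPE('e)"
    and "multivariate_point_process M T \<Delta> S X"
    and "generated_filtration M S X F"
    and "compensator M T F \<mu> A \<phi>"
    and A1: "continuous_compensator M T A"
    and A2: "no_more_jumps_possible M T S F"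
    and "\<xi> \<in> borel_measurable (F (ennreal T))"
    and "bsde_generator M T F A \<phi> f L L'"
  shows
    "(\<forall>\<alpha> \<beta>. \<alpha> > L \<and> \<beta> > 1 + \<alpha> + L' \<and> weighted_integrable_data M T \<nu> A N \<xi> f \<alpha> \<beta> \<longrightarrow>
        exists_unique_up_to_null M T \<nu>
          (bsde_solution M T F \<mu> \<nu> \<xi> f \<inter> L1_space M T F \<nu> A N \<alpha> \<beta>)) \<and>
     (\<forall>\<epsilon>>0. (\<exists>C. AE \<omega> in M. A \<omega> T \<le> C) \<and>
        (\<integral>\<^sup>+\<omega>. ennreal (\<bar>\<xi> \<omega>\<bar> powr (1 + \<epsilon>)) \<partial>M) < \<infinity> \<and>
        (\<integral>\<^sup>+\<omega>. ennreal (integral_Ioc 0 T (\<nu> \<omega>) (\<lambda>s x. \<bar>f \<omega> s x 0 (\<lambda>_. 0)\<bar>) powr (1 + \<epsilon>)) \<partial>M) < \<infinity>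
        \<longrightarrow>
        (\<forall>\<alpha> \<beta>. \<alpha> > 0 \<and> \<beta> \<ge> 0 \<longrightarrow> weighted_integrable_data M T \<nu> A N \<xi> f \<alpha> \<beta>) \<and>
        (let sols = bsde_solution M T F \<mu> \<nu> \<xi> f \<inter>
               (\<Union>(\<alpha>, \<beta>) \<in> {(\<alpha>, \<beta>). \<alpha> > L \<and> \<beta> > 1 + \<alpha> + L'}. L1_space M T F \<nu> A N \<alpha> \<beta>)
         in exists_unique_up_to_null M T \<nu> sols \<and>
            sols \<subseteq> (\<Inter>(\<alpha>, \<beta>) \<in> {(\<alpha>, \<beta>). \<alpha> > 0 \<and> \<beta> \<ge> 0}. L1_space M T F \<nu> A N \<alpha> \<beta>)))"
proof -
  interpret bsde M T \<Delta> S X F A \<phi> \<xi> f L L'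
    using assms(4-) unfolding \<mu>_def
    by (intro bsde.intro marked_point_process.intro bsde_axioms.intro)
  show ?thesis
    unfolding \<mu>_def N_def \<nu>_def Let_def integrable_sols_def[symmetric]
  proof (intro conjI allI impI)
    fix \<alpha> \<beta> assume "L < \<alpha> \<and> 1 + \<alpha> + L' < \<beta> \<and>
      weighted_integrable_data M T (disintegrated_measure T A \<phi>) A (counting_process T S X) \<xi> f \<alpha> \<beta>"
    then show "exists_unique_up_to_null M T (disintegrated_measure T A \<phi>) (sols \<inter> L1 \<alpha> \<beta>)"
      using existence_uniqueness by blast
  next
    fix \<epsilon> :: real assume \<epsilon>: "0 < \<epsilon>"
    assume "(\<exists>C. AE \<omega> in M. A \<omega> T \<le> C) \<and> (\<integral>\<^sup>+\<omega>. ennreal (\<bar>\<xi> \<omega>\<bar> powr (1 + \<epsilon>)) \<partial>M) < \<infinity> \<and>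
      (\<integral>\<^sup>+\<omega>. ennreal (integral_Ioc 0 T (disintegrated_measure T A \<phi> \<omega>) (\<lambda>s x. \<bar>f \<omega> s x 0 (\<lambda>_. 0)\<bar>) powr (1 + \<epsilon>)) \<partial>M) < \<infinity>"
    then obtain C where C: "AE \<omega> in M. A \<omega> T \<le> C" and i: "(\<integral>\<^sup>+\<omega>. ennreal (\<bar>\<xi> \<omega>\<bar> powr (1 + \<epsilon>)) \<partial>M) < \<infinity>"
      "(\<integral>\<^sup>+\<omega>. ennreal (integral_Ioc 0 T (disintegrated_measure T A \<phi> \<omega>) (\<lambda>s x. \<bar>f \<omega> s x 0 (\<lambda>_. 0)\<bar>) powr (1 + \<epsilon>)) \<partial>M) < \<infinity>"
      by blast
    note data = bounded_compensator_data[OF C \<epsilon> i]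
    show "weighted_integrable_data M T (disintegrated_measure T A \<phi>) A (counting_process T S X) \<xi> f \<alpha> \<beta>" if "0 < \<alpha> \<and> 0 \<le> \<beta>" for \<alpha> \<beta>
      using that data by blast
    show "exists_unique_up_to_null M T (disintegrated_measure T A \<phi>) integrable_sols"
      by (rule bounded_compensator_existence_uniqueness(1)[OF C data])
    show "integrable_sols \<subseteq> (\<Inter>(\<alpha>, \<beta>) \<in> {(\<alpha>, \<beta>). \<alpha> > 0 \<and> \<beta> \<ge> 0}. L1 \<alpha> \<beta>)"
      using bounded_compensator_existence_uniqueness(2)[OF C data] by blast
  qed
qed

end
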